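(* For $m=1$, $N > 1$ and $\mathrm{char}\,\mathbb{K} = 2$, the Hochschild cohomology ring $\mathrm{HH}^*(\Lambda_N)$ is finitely generated as a $\mathbb{K}$-algebra with generators: - $1,\ a\bar a + \bar a a,\ (a\bar a)^{N-1}a,\ (\bar a a)^{N-1}\bar a,\ (a\bar a)^N$ in degree $0$; - $\chi_{1,0},\ \chi_{1,1},\ \varphi_{1,0},\ \psi_{1,1}$ in degree $1$; - $\chi_{2,1},\ \psi_{2,2}$ in degree $2$.
   Context: Let $\mathbb{K}$ be a field. For $m=1$, $\Lambda_N$ is the quotient of the path algebra of the quiver with one vertex and two loops $a,\bar a$ (i.e. the free algebra $\mathbb{K}\langle a,\bar a\rangle$) by the ideal generated by $a^2$, $\bar a^2$ and $(a\bar a)^N-(\bar aa)^N$. $\mathrm{HH}^*(\Lambda_N)=\mathrm{Ext}^*_{\Lambda_N^e}(\Lambda_N,\Lambda_N)$ with the Yoneda product; $\mathrm{HH}^0(\Lambda_N)$ is identified with the centre $Z(\Lambda_N)$. Write $\otimes=\otimes_{\mathbb{K}}$. A minimal projective bimodule resolution of $\Lambda_N$ is $(P^*,\partial^* )$ with $P^n=\bigoplus_{r=0}^n\Lambda_N\otimes\Lambda_N$; write $1\otimes_r1$ for the generator of the $r$-th summand of $P^n$ (in $P^{n-1}$, set $1\otimes_{-1}1=0=1\otimes_n1$). $\partial^0$ is multiplication, and for $n\geq1$, $\partial^n(1\otimes_r1)$ is: if $n-2r>0$: $1\otimes_r a+(-1)^{n+r}a\otimes_r1+(-1)^{n+r}\bar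 a(a\bar a)^{N-1}\otimes_{r-1}1+(-1)^n1\otimes_{r-1}\bar a(a\bar a)^{N-1}$; if $n-2r<0$: $1\otimes_r a(\bar aa)^{N-1}+(-1)^{n+r}a(\bar aa)^{N-1}\otimes_r1+(-1)^{n+r}\bar a\otimes_{r-1}1+(-1)^n1\otimes_{r-1}\bar a$; if $n=2r$: $\sum_{k=0}^{N-1}\big((\bar aa)^k[1\otimes_ra+(-1)^r\bar a\otimes_{r-1}1](\bar aa)^{N-k-1}+(a\bar a)^k[(-1)^ra\otimes_r1+1\otimes_{r-1}\bar a](a\bar a)^{N-k-1}\big)$. Classes in $\mathrm{HH}^n(\Lambda_N)$ are represented by cocycles in $\mathrm{Hom}_{\Lambda_N^e}(P^n,\Lambda_N)$; only the non-zero images of generators are listed. The first subscript of each symbol is its cohomological degree: $\chi_{1,0}$: $1\otimes_01\mapsto1$; $\chi_{1,1}$: $1\otimes_11\mapsto1$; $\varphi_{1,0}$: $1\otimes_01\mapsto a$; $\psi_{1,1}$: $1\otimes_11\mapsto\bar a$; $\chi_{2,1}$: $1\otimes_11\mapsto1$; $\psi_{2,2}$: $1\otimes_21\mapsto\bar a$. *)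

theory Defs
  imports
    "HOL-Algebra.QuotRing"
    "HOL-Algebra.Generated_Rings"
    "HOL-Algebra.Free_Abelian_Groups"
    "HOL-Algebra.Product_Groups"
    "HOL-Library.Poly_Mapping"
begin

section \<open>The algebra \<open>\<Lambda>\<^sub>N\<close>\<close>

datatype arrow = Arr_a | Arr_abar

datatype path = Path "arrow list"

instantiation path :: monoid_add
begin

definition zero_path :: path where
  "zero_path = Path []"

fun plus_path :: "path \<Rightarrow> path \<Rightarrow> path" where
  "plus_path (Path u) (Path v) = Path (u @ v)"

instance
proof
  fix p q r :: path
  show "p + q + r = p + (q + r)"
    by (cases p; cases q; cases r) simp
  show "0 + p = p"
    by (cases p) (simp add: zero_path_def)
  show "p + 0 = p"
    by (cases p) (simp add: zero_path_def)
qed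

end

text \<open>
  The monoid algebra of the free monoid on \<open>a\<close>, \<open>\<bar>a\<close>, i.e. the free algebra on these
  two letters. Multiplication on \<open>path \<Rightarrow>\<^sub>0 'k\<close> is convolution.
\<close>

type_synonym 'k free_alg = "path \<Rightarrow>\<^sub>0 'k"

definition free_algebra :: "'k::field free_alg ring" where
  "free_algebra = \<lparr>carrier = UNIV, monoid.mult = (*), one = 1, ring.zero = 0, add = (+)\<rparr>"

definition free_arrow :: "arrow \<Rightarrow> 'k::field free_alg" where
  "free_arrow x = Poly_Mapping.single (Path [x]) 1"

definition Lambda_ideal :: "nat \<Rightarrow> 'k::field free_alg set" where
  "Lambda_ideal N =
     (let a = free_arrow Arr_a; b = free_arrow Arr_abar
      in Idl\<^bsub>free_algebra\<^esub> {a * a, b * b, (a * b) ^ N - (b * a) ^ N})"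

type_synonym 'k lam = "'k free_alg set"

definition Lambda :: "nat \<Rightarrow> 'k::field lam ring" where
  "Lambda N = free_algebra Quot Lambda_ideal N"

definition Lambda_arrow :: "nat \<Rightarrow> arrow \<Rightarrow> 'k::field lam" where
  "Lambda_arrow N x = Lambda_ideal N +>\<^bsub>free_algebra\<^esub> free_arrow x"

definition Lambda_scalar :: "nat \<Rightarrow> 'k::field \<Rightarrow> 'k lam" where
  "Lambda_scalar N c = Lambda_ideal N +>\<^bsub>free_algebra\<^esub> Poly_Mapping.single 0 c"


section \<open>Bimodules and the tensor square of an algebra\<close>

text \<open>
  A module over the enveloping algebra \<open>A\<^sup>e\<close> is handled as an \<open>A\<close>-\<open>A\<close>-bimodule on which
  the ground field acts centrally. As for HOL-Algebra's modules, the ring multiplication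
  and unit inherited by the record are irrelevant.
\<close>

record ('a, 'm) bimodule = "('a, 'm) module" +
  rsmult :: "'m \<Rightarrow> 'a \<Rightarrow> 'm"

definition regular_bimodule :: "'a ring \<Rightarrow> ('a, 'a) bimodule" where
  "regular_bimodule A =
     \<lparr>carrier = carrier A, monoid.mult = monoid.mult A, one = \<one>\<^bsub>A\<^esub>,
      ring.zero = \<zero>\<^bsub>A\<^esub>, add = add A,
      smult = monoid.mult A, rsmult = monoid.mult A\<rparr>"

text \<open>
  Homomorphisms are extensional functions, so that equal maps are equal as functions.
  Linearity over the ground field follows from compatibility with the left action.
\<close>

definition bimod_hom ::
  "'a ring \<Rightarrow> ('a, 'm) bimodule \<Rightarrow> ('a, 'n) bimodule \<Rightarrow> ('m \<Rightarrow> 'n) set" where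
  "bimod_hom A M L =
     {f \<in> carrier M \<rightarrow>\<^sub>E carrier L.
        (\<forall>x\<in>carrier M. \<forall>y\<in>carrier M. f (x \<oplus>\<^bsub>M\<^esub> y) = f x \<oplus>\<^bsub>L\<^esub> f y) \<and>
        (\<forall>u\<in>carrier A. \<forall>x\<in>carrier M. f (u \<odot>\<^bsub>M\<^esub> x) = u \<odot>\<^bsub>L\<^esub> f x) \<and>
        (\<forall>u\<in>carrier A. \<forall>x\<in>carrier M. f (rsmult M x u) = rsmult L (f x) u)}"

definition hom_group ::
  "'a ring \<Rightarrow> ('a, 'm) bimodule \<Rightarrow> ('a, 'n) bimodule \<Rightarrow> ('m \<Rightarrow> 'n) monoid" where
  "hom_group A M L =
     \<lparr>carrier = bimod_hom A M L,
      monoid.mult = (\<lambda>f g. \<lambda>x\<in>carrier M. f x \<oplus>\<^bsub>L\<^esub> g x),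
      one = (\<lambda>x\<in>carrier M. \<zero>\<^bsub>L\<^esub>)\<rparr>"

text \<open>
  The tensor product \<open>A \<otimes> A\<close> over the ground field, whose embedding into \<open>A\<close> is
  \<open>\<kappa>\<close>: the free abelian group on pairs modulo biadditivity and balancing.
\<close>

type_synonym 'a tensor = "('a \<times> 'a \<Rightarrow>\<^sub>0 int) set"

definition tensor_rels :: "('k \<Rightarrow> 'a) \<Rightarrow> 'a ring \<Rightarrow> ('a \<times> 'a \<Rightarrow>\<^sub>0 int) set" where
  "tensor_rels \<kappa> A =
     {frag_of (x \<oplus>\<^bsub>A\<^esub> x', y) - frag_of (x, y) - frag_of (x', y) | x x' y.
        x \<in> carrier A \<and> x' \<in> carrier A \<and> y \<in> carrier A} \<union>
     {frag_of (x, y \<oplus>\<^bsub>A\<^esub> y') - frag_of (x, y) - frag_of (x, y') | x y y'.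
        x \<in> carrier A \<and> y \<in> carrier A \<and> y' \<in> carrier A} \<union>
     {frag_of (x \<otimes>\<^bsub>A\<^esub> \<kappa> c, y) - frag_of (x, \<kappa> c \<otimes>\<^bsub>A\<^esub> y) | x y c.
        x \<in> carrier A \<and> y \<in> carrier A}"

definition tensor_rel_group :: "('k \<Rightarrow> 'a) \<Rightarrow> 'a ring \<Rightarrow> ('a \<times> 'a \<Rightarrow>\<^sub>0 int) set" where
  "tensor_rel_group \<kappa> A =
     generate (free_Abelian_group (carrier A \<times> carrier A)) (tensor_rels \<kappa> A)"

definition tensor_group :: "('k \<Rightarrow> 'a) \<Rightarrow> 'a ring \<Rightarrow> 'a tensor monoid" where
  "tensor_group \<kappa> A =
     free_Abelian_group (carrier A \<times> carrier A) Mod tensor_rel_group \<kappa> A"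

definition tensor_class ::
  "('k \<Rightarrow> 'a) \<Rightarrow> 'a ring \<Rightarrow> ('a \<times> 'a \<Rightarrow>\<^sub>0 int) \<Rightarrow> 'a tensor" where
  "tensor_class \<kappa> A p =
     tensor_rel_group \<kappa> A #>\<^bsub>free_Abelian_group (carrier A \<times> carrier A)\<^esub> p"

text \<open>
  The two-sided action \<open>u (x \<otimes> y) v = u x \<otimes> y v\<close> on cosets; the union is over all
  representatives, as in \<^const>\<open>rcoset_mult\<close>.
\<close>

definition tensor_act ::
  "('k \<Rightarrow> 'a) \<Rightarrow> 'a ring \<Rightarrow> 'a \<Rightarrow> 'a tensor \<Rightarrow> 'a \<Rightarrow> 'a tensor" where
  "tensor_act \<kappa> A u T v =
     (\<Union>p\<in>T. tensor_class \<kappa> A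
        (frag_extend (\<lambda>(x, y). frag_of (u \<otimes>\<^bsub>A\<^esub> x, y \<otimes>\<^bsub>A\<^esub> v)) p))"

text \<open>The direct sum of \<open>n + 1\<close> copies of \<open>A \<otimes> A\<close>, indexed by \<open>0, \<dots>, n\<close>.\<close>

definition free_bimodule ::
  "('k \<Rightarrow> 'a) \<Rightarrow> 'a ring \<Rightarrow> nat \<Rightarrow> ('a, nat \<Rightarrow> 'a tensor) bimodule" where
  "free_bimodule \<kappa> A n =
     (let G = sum_group {..n} (\<lambda>_. tensor_group \<kappa> A)
      in \<lparr>carrier = carrier G, monoid.mult = undefined, one = undefined,
          ring.zero = \<one>\<^bsub>G\<^esub>, add = monoid.mult G,
          smult = (\<lambda>u x. \<lambda>r\<in>{..n}. tensor_act \<kappa> A u (x r) \<one>\<^bsub>A\<^esub>),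
          rsmult = (\<lambda>x u. \<lambda>r\<in>{..n}. tensor_act \<kappa> A \<one>\<^bsub>A\<^esub> (x r) u)\<rparr>)"

text \<open>
  The element \<open>x \<otimes>\<^sub>r y\<close>. The index is an integer, and the element is zero for
  \<open>r = -1\<close> and \<open>r = n + 1\<close>.
\<close>

definition free_tensor ::
  "('k \<Rightarrow> 'a) \<Rightarrow> 'a ring \<Rightarrow> nat \<Rightarrow> int \<Rightarrow> 'a \<Rightarrow> 'a \<Rightarrow> nat \<Rightarrow> 'a tensor" where
  "free_tensor \<kappa> A n r x y =
     (\<lambda>i\<in>{..n}. if int i = r then tensor_class \<kappa> A (frag_of (x, y))
                 else \<one>\<^bsub>tensor_group \<kappa> A\<^esub>)"

text \<open>The unique bimodule map out of the free bimodule with \<open>1 \<otimes>\<^sub>r 1 \<mapsto> v r\<close>.\<close>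

definition free_bimod_map ::
  "('k \<Rightarrow> 'a) \<Rightarrow> 'a ring \<Rightarrow> nat \<Rightarrow> ('a, 'm) bimodule \<Rightarrow> (nat \<Rightarrow> 'm)
     \<Rightarrow> (nat \<Rightarrow> 'a tensor) \<Rightarrow> 'm" where
  "free_bimod_map \<kappa> A n M v =
     (THE f. f \<in> bimod_hom A (free_bimodule \<kappa> A n) M \<and>
        (\<forall>r\<le>n. f (free_tensor \<kappa> A n (int r) \<one>\<^bsub>A\<^esub> \<one>\<^bsub>A\<^esub>) = v r))"


section \<open>The Ext ring computed from a projective resolution\<close>

text \<open>
  Below, \<open>P\<close> with differentials \<open>d n : P n \<rightarrow> P (n - 1)\<close> for \<open>n \<ge> 1\<close> and
  augmentation \<open>\<epsilon> : P 0 \<rightarrow> M\<close> is a projective resolution of the bimodule \<open>M\<close>.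
\<close>

definition ext_cocycles ::
  "'a ring \<Rightarrow> (nat \<Rightarrow> ('a, 'm) bimodule) \<Rightarrow> (nat \<Rightarrow> 'm \<Rightarrow> 'm) \<Rightarrow> ('a, 'n) bimodule
     \<Rightarrow> nat \<Rightarrow> ('m \<Rightarrow> 'n) set" where
  "ext_cocycles A P d M n =
     {f \<in> bimod_hom A (P n) M. \<forall>x\<in>carrier (P (Suc n)). f (d (Suc n) x) = \<zero>\<^bsub>M\<^esub>}"

fun ext_coboundaries ::
  "'a ring \<Rightarrow> (nat \<Rightarrow> ('a, 'm) bimodule) \<Rightarrow> (nat \<Rightarrow> 'm \<Rightarrow> 'm) \<Rightarrow> ('a, 'n) bimodule
     \<Rightarrow> nat \<Rightarrow> ('m \<Rightarrow> 'n) set" where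
  "ext_coboundaries A P d M 0 = {\<one>\<^bsub>hom_group A (P 0) M\<^esub>}"
| "ext_coboundaries A P d M (Suc n) =
     {compose (carrier (P (Suc n))) h (d (Suc n)) | h. h \<in> bimod_hom A (P n) M}"

definition ext_group ::
  "'a ring \<Rightarrow> (nat \<Rightarrow> ('a, 'm) bimodule) \<Rightarrow> (nat \<Rightarrow> 'm \<Rightarrow> 'm) \<Rightarrow> ('a, 'n) bimodule
     \<Rightarrow> nat \<Rightarrow> ('m \<Rightarrow> 'n) set monoid" where
  "ext_group A P d M n =
     (hom_group A (P n) M)\<lparr>carrier := ext_cocycles A P d M n\<rparr>
       Mod ext_coboundaries A P d M n"

definition ext_class ::
  "'a ring \<Rightarrow> (nat \<Rightarrow> ('a, 'm) bimodule) \<Rightarrow> (nat \<Rightarrow> 'm \<Rightarrow> 'm) \<Rightarrow> ('a, 'n) bimodule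
     \<Rightarrow> nat \<Rightarrow> ('m \<Rightarrow> 'n) \<Rightarrow> ('m \<Rightarrow> 'n) set" where
  "ext_class A P d M n f = ext_coboundaries A P d M n #>\<^bsub>hom_group A (P n) M\<^esub> f"

text \<open>\<open>F\<close> is a chain map \<open>P (n + *) \<rightarrow> P *\<close> lifting the cocycle \<open>f : P n \<rightarrow> M\<close>.\<close>

definition chain_lift ::
  "'a ring \<Rightarrow> (nat \<Rightarrow> ('a, 'm) bimodule) \<Rightarrow> (nat \<Rightarrow> 'm \<Rightarrow> 'm) \<Rightarrow> ('m \<Rightarrow> 'n)
     \<Rightarrow> nat \<Rightarrow> ('m \<Rightarrow> 'n) \<Rightarrow> (nat \<Rightarrow> 'm \<Rightarrow> 'm) \<Rightarrow> bool" where
  "chain_lift A P d \<epsilon> n f F \<longleftrightarrow>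
     (\<forall>i. F i \<in> bimod_hom A (P (n + i)) (P i)) \<and>
     (\<forall>x\<in>carrier (P n). \<epsilon> (F 0 x) = f x) \<and>
     (\<forall>i. \<forall>x\<in>carrier (P (n + Suc i)). d (Suc i) (F (Suc i) x) = F i (d (n + Suc i) x))"

text \<open>
  The Yoneda product of \<open>Y\<close> in degree \<open>m\<close> and \<open>X\<close> in degree \<open>n\<close>: the class of \<open>g \<circ> F m\<close>
  for \<open>g \<in> Y\<close> and a lift \<open>F\<close> of some \<open>f \<in> X\<close>. This class does not depend on the
  choices, so the union over all choices is that class.
\<close>

definition yoneda ::
  "'a ring \<Rightarrow> (nat \<Rightarrow> ('a, 'm) bimodule) \<Rightarrow> (nat \<Rightarrow> 'm \<Rightarrow> 'm) \<Rightarrow> ('m \<Rightarrow> 'n)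
     \<Rightarrow> ('a, 'n) bimodule \<Rightarrow> nat \<Rightarrow> nat \<Rightarrow> ('m \<Rightarrow> 'n) set \<Rightarrow> ('m \<Rightarrow> 'n) set
     \<Rightarrow> ('m \<Rightarrow> 'n) set" where
  "yoneda A P d \<epsilon> M m n Y X =
     \<Union>{ext_class A P d M (n + m) (compose (carrier (P (n + m))) g (F m)) | g f F.
          g \<in> Y \<and> f \<in> X \<and> chain_lift A P d \<epsilon> n f F}"

definition ext_ring ::
  "'a ring \<Rightarrow> (nat \<Rightarrow> ('a, 'm) bimodule) \<Rightarrow> (nat \<Rightarrow> 'm \<Rightarrow> 'm) \<Rightarrow> ('m \<Rightarrow> 'n)
     \<Rightarrow> ('a, 'n) bimodule \<Rightarrow> (nat \<Rightarrow> ('m \<Rightarrow> 'n) set) ring" where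
  "ext_ring A P d \<epsilon> M =
     (let E = ext_group A P d M; G = sum_group UNIV E
      in \<lparr>carrier = carrier G,
          monoid.mult = (\<lambda>y x n. finprod (E n)
                    (\<lambda>m. yoneda A P d \<epsilon> M m (n - m) (y m) (x (n - m))) {..n}),
          one = (\<lambda>n. if n = 0 then ext_class A P d M 0 \<epsilon> else \<one>\<^bsub>E n\<^esub>),
          ring.zero = \<one>\<^bsub>G\<^esub>, add = monoid.mult G\<rparr>)"

text \<open>The class of a cocycle of degree \<open>n\<close> as a homogeneous element of the Ext ring.\<close>

definition ext_homogeneous ::
  "'a ring \<Rightarrow> (nat \<Rightarrow> ('a, 'm) bimodule) \<Rightarrow> (nat \<Rightarrow> 'm \<Rightarrow> 'm) \<Rightarrow> ('a, 'n) bimodule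
     \<Rightarrow> nat \<Rightarrow> ('m \<Rightarrow> 'n) \<Rightarrow> nat \<Rightarrow> ('m \<Rightarrow> 'n) set" where
  "ext_homogeneous A P d M n f =
     (\<lambda>k. if k = n then ext_class A P d M n f else \<one>\<^bsub>ext_group A P d M k\<^esub>)"


section \<open>The minimal bimodule resolution and the Hochschild cohomology ring\<close>

type_synonym 'k res_elem = "nat \<Rightarrow> 'k lam tensor"
type_synonym 'k hh_elem = "nat \<Rightarrow> ('k res_elem \<Rightarrow> 'k lam) set"

definition res_module :: "nat \<Rightarrow> nat \<Rightarrow> ('k::field lam, 'k res_elem) bimodule" where
  "res_module N n = free_bimodule (Lambda_scalar N) (Lambda N) n"

definition res_tensor ::
  "nat \<Rightarrow> nat \<Rightarrow> int \<Rightarrow> 'k::field lam \<Rightarrow> 'k lam \<Rightarrow> 'k res_elem" where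
  "res_tensor N n r x y = free_tensor (Lambda_scalar N) (Lambda N) n r x y"

text \<open>
  The image of \<open>1 \<otimes>\<^sub>r 1\<close> under the differential \<open>P n \<rightarrow> P (n - 1)\<close>, for \<open>n \<ge> 1\<close>;
  \<open>\<sigma> k\<close> is multiplication by \<open>(-1)\<^sup>k\<close>.
\<close>

definition res_diff_gen :: "nat \<Rightarrow> nat \<Rightarrow> nat \<Rightarrow> 'k::field res_elem" where
  "res_diff_gen N n r =
     (let A = Lambda N;
          P = res_module N (n - 1);
          t = (\<lambda>i. res_tensor N (n - 1) i);
          s = int r;
          \<sigma> = (\<lambda>k x. if even (k :: nat) then x else \<ominus>\<^bsub>P\<^esub> x);
          e = \<one>\<^bsub>A\<^esub>;
          a = Lambda_arrow N Arr_a;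
          b = Lambda_arrow N Arr_abar;
          ab = a \<otimes>\<^bsub>A\<^esub> b;
          ba = b \<otimes>\<^bsub>A\<^esub> a;
          bab = b \<otimes>\<^bsub>A\<^esub> (ab [^]\<^bsub>A\<^esub> (N - 1));
          aba = a \<otimes>\<^bsub>A\<^esub> (ba [^]\<^bsub>A\<^esub> (N - 1))
      in if 2 * r < n then
           t s e a \<oplus>\<^bsub>P\<^esub> \<sigma> (n + r) (t s a e)
             \<oplus>\<^bsub>P\<^esub> \<sigma> (n + r) (t (s - 1) bab e) \<oplus>\<^bsub>P\<^esub> \<sigma> n (t (s - 1) e bab)
         else if n < 2 * r then
           t s e aba \<oplus>\<^bsub>P\<^esub> \<sigma> (n + r) (t s aba e)
             \<oplus>\<^bsub>P\<^esub> \<sigma> (n + r) (t (s - 1) b e) \<oplus>\<^bsub>P\<^esub> \<sigma> n (t (s - 1) e b)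
         else
           (\<Oplus>\<^bsub>P\<^esub>k\<in>{..<N}.
              rsmult P
                ((ba [^]\<^bsub>A\<^esub> k) \<odot>\<^bsub>P\<^esub> (t s e a \<oplus>\<^bsub>P\<^esub> \<sigma> r (t (s - 1) b e)))
                (ba [^]\<^bsub>A\<^esub> (N - k - 1))
              \<oplus>\<^bsub>P\<^esub>
              rsmult P
                ((ab [^]\<^bsub>A\<^esub> k) \<odot>\<^bsub>P\<^esub> (\<sigma> r (t s a e) \<oplus>\<^bsub>P\<^esub> t (s - 1) e b))
                (ab [^]\<^bsub>A\<^esub> (N - k - 1))))"

definition res_diff :: "nat \<Rightarrow> nat \<Rightarrow> 'k::field res_elem \<Rightarrow> 'k res_elem" where
  "res_diff N n =
     free_bimod_map (Lambda_scalar N) (Lambda N) n (res_module N (n - 1)) (res_diff_gen N n)"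

text \<open>The augmentation is the multiplication map \<open>x \<otimes> y \<mapsto> x y\<close>.\<close>

definition res_aug :: "nat \<Rightarrow> 'k::field res_elem \<Rightarrow> 'k lam" where
  "res_aug N =
     (THE f. f \<in> bimod_hom (Lambda N) (res_module N 0) (regular_bimodule (Lambda N)) \<and>
        (\<forall>x\<in>carrier (Lambda N). \<forall>y\<in>carrier (Lambda N).
           f (res_tensor N 0 0 x y) = x \<otimes>\<^bsub>Lambda N\<^esub> y))"

definition HH :: "nat \<Rightarrow> 'k::field hh_elem ring" where
  "HH N =
     ext_ring (Lambda N) (res_module N) (res_diff N) (res_aug N) (regular_bimodule (Lambda N))"

text \<open>
  The class in degree \<open>n\<close> of the cochain sending \<open>1 \<otimes>\<^sub>r 1\<close> to \<open>x\<close> and the other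
  generators of \<open>P n\<close> to \<open>0\<close>. For \<open>n = r = 0\<close> this is the identification of the centre
  of \<open>\<Lambda>\<^sub>N\<close> with the degree \<open>0\<close> part.
\<close>

definition HH_class :: "nat \<Rightarrow> nat \<Rightarrow> nat \<Rightarrow> 'k::field lam \<Rightarrow> 'k hh_elem" where
  "HH_class N n r x =
     ext_homogeneous (Lambda N) (res_module N) (res_diff N) (regular_bimodule (Lambda N)) n
       (free_bimod_map (Lambda_scalar N) (Lambda N) n (regular_bimodule (Lambda N))
          (\<lambda>i. if i = r then x else \<zero>\<^bsub>Lambda N\<^esub>))"

text \<open>The structure map of \<open>HH N\<close> as an algebra over the ground field.\<close>

definition HH_scalar :: "nat \<Rightarrow> 'k::field \<Rightarrow> 'k hh_elem" where
  "HH_scalar N c = HH_class N 0 0 (Lambda_scalar N c)"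

text \<open>
  The subalgebra generated by \<open>S\<close> over the ground field: the subring generated by \<open>S\<close>
  together with the image of the field.
\<close>

definition HH_subalgebra :: "nat \<Rightarrow> 'k::field hh_elem set \<Rightarrow> 'k hh_elem set" where
  "HH_subalgebra N S = generate_ring (HH N) (range (HH_scalar N) \<union> S)"

end

theory Submission
  imports Defs
begin

text \<open>
  In characteristic two all signs disappear, and the differential becomes a matrix of commutators
  with \<open>a\<close>, \<open>\<bar>a\<close>, \<open>a(\<bar>aa)\<^sup>N\<^sup>-\<^sup>1\<close>, \<open>\<bar>a(a\<bar>a)\<^sup>N\<^sup>-\<^sup>1\<close> and, for \<open>n = 2r\<close>, of the sums
  \<open>norm_sum\<close>. The resolution is filtered by the length of the right tensor factor. The leading
  part of the differential is the one-sided complex obtained by letting \<open>a\<close> and \<open>\<bar>a\<close> act by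
  zero on the right, and its exactness is a computation in the basis of alternating words.

  The long commutators and the sums vanish identically on \<open>\<Lambda>\<^sub>N\<close>. So a cochain is a cocycle if and
  only if its value at \<open>1 \<otimes>\<^sub>r 1\<close> commutes with \<open>a\<close> when \<open>2r \<le> n\<close> and with \<open>\<bar>a\<close> when \<open>2r \<ge> n\<close>,
  and no knowledge of the coboundaries is needed to generate all classes. Since the chain map
  lifting \<open>\<chi>\<close> in degree \<open>2\<close> is a shift of the resolution, a value at an interior index
  \<open>0 < r < n\<close> comes from degree \<open>n - 2\<close>. The centraliser of \<open>a\<close> is \<open>Z + Za\<close> for the centre \<open>Z\<close>,
  which leaves the values \<open>1\<close> and \<open>a\<close> at \<open>r = 0\<close>; up to an interior term these are products of
  \<open>\<chi>\<^bsub>1,0\<^esub>\<close> and \<open>\<phi>\<^bsub>1,0\<^esub>\<close> with a class of degree \<open>n - 1\<close>. The index \<open>r = n\<close> is symmetric.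
\<close>

section \<open>The tensor square\<close>

text \<open>A product in \<open>HH\<close> is by definition a union over all representatives and all
  chain lifts. Nothing can be multiplied before lifts are known to exist and the class to be
  independent of them, so exactness of the resolution has to be proved, and it serves only as a
  source of lifts. No contracting homotopy of the bimodule complex is written down: the filtration
  replaces it by a leading-term argument, which stops because no basis word is longer than
  \<open>2 * N\<close>. The modules are quotients of free abelian groups on pairs, so even the
  coordinates of a tensor must be produced from the universal property. Generator indices are
  integers, with value zero out of range; this makes one formula for the differential valid at both
  ends and lets a shift of indices be a chain map. In a product it is the right factor that is
  lifted, which decides the order: central classes stand on the left, where only the component
  \<open>F 0\<close> of a lift is seen, and the class of degree two stands on the right, where its
  lift is explicit.\<close>

locale central_ring = ring A for A :: "'a ring" (structure) +
  fixes \<kappa> :: "'k \<Rightarrow> 'a"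
  assumes kappa_closed [simp, intro]: "\<kappa> c \<in> carrier A"
    and kappa_central: "x \<in> carrier A \<Longrightarrow> \<kappa> c \<otimes> x = x \<otimes> \<kappa> c"
begin

abbreviation FG :: "('a \<times> 'a \<Rightarrow>\<^sub>0 int) monoid" where
  "FG \<equiv> free_Abelian_group (carrier A \<times> carrier A)"

abbreviation T :: "'a tensor monoid" where
  "T \<equiv> tensor_group \<kappa> A"

abbreviation tcl :: "('a \<times> 'a \<Rightarrow>\<^sub>0 int) \<Rightarrow> 'a tensor" where
  "tcl \<equiv> tensor_class \<kappa> A"

definition tens :: "'a \<Rightarrow> 'a \<Rightarrow> 'a tensor" where
  "tens x y = tcl (frag_of (x, y))"

lemma tensor_rels_subset: "tensor_rels \<kappa> A \<subseteq> carrier FG"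
proof -
  have d: "p - q \<in> carrier FG" if "p \<in> carrier FG" "q \<in> carrier FG" for p q
    using that keys_diff[of p q] by auto
  show ?thesis
    unfolding tensor_rels_def by (auto intro!: d simp del: carrier_free_Abelian_group_iff)
qed

lemma tensor_rel_subgroup: "subgroup (tensor_rel_group \<kappa> A) FG"
  unfolding tensor_rel_group_def
  by (rule group.generate_is_subgroup[OF group_free_Abelian_group tensor_rels_subset])

lemma tensor_rel_normal: "tensor_rel_group \<kappa> A \<lhd> FG"
  by (simp add: comm_group.subgroup_imp_normal[OF abelian_free_Abelian_group] tensor_rel_subgroup)

lemma T_comm_group: "comm_group T"
  unfolding tensor_group_def
  by (rule comm_group.abelian_FactGroup[OF abelian_free_Abelian_group tensor_rel_subgroup])

lemma T_group: "group T"
  using T_comm_group by (simp add: comm_group_def)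

lemma tcl_hom: "tcl \<in> hom FG T"
  unfolding tensor_group_def tensor_class_def
  by (rule normal.r_coset_hom_Mod[OF tensor_rel_normal])

lemma tcl_group_hom: "group_hom FG T tcl"
  by (simp add: group_hom_def group_hom_axioms_def T_group tcl_hom)

lemma tcl_surj: "t \<in> carrier T \<Longrightarrow> \<exists>p\<in>carrier FG. t = tcl p"
  unfolding tensor_group_def tensor_class_def FactGroup_def RCOSETS_def by auto

lemma tcl_one_iff:
  assumes "p \<in> carrier FG"
  shows "tcl p = \<one>\<^bsub>T\<^esub> \<longleftrightarrow> p \<in> tensor_rel_group \<kappa> A"
  using group.coset_join1[OF group_free_Abelian_group _ assms tensor_rel_subgroup]
    group.coset_join2[OF group_free_Abelian_group assms tensor_rel_subgroup]
  by (auto simp: tensor_group_def tensor_class_def FactGroup_def)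

lemma tcl_eq_iff:
  assumes "p \<in> carrier FG" "q \<in> carrier FG"
  shows "tcl p = tcl q \<longleftrightarrow> p - q \<in> tensor_rel_group \<kappa> A"
proof -
  interpret h: group_hom FG T tcl by (rule tcl_group_hom)
  interpret T: comm_group T by (rule T_comm_group)
  have pq: "p - q \<in> carrier FG" using assms keys_diff[of p q] by auto
  have "tcl p = tcl (p - q) \<otimes>\<^bsub>T\<^esub> tcl q"
    using h.hom_mult[OF pq assms(2)] by simp
  then have "tcl p = tcl q \<longleftrightarrow> tcl (p - q) = \<one>\<^bsub>T\<^esub>"
    using h.hom_closed[OF pq] h.hom_closed[OF assms(2)] by simp
  then show ?thesis by (simp only: tcl_one_iff[OF pq])
qed

lemma tens_closed [simp, intro]: "x \<in> carrier A \<Longrightarrow> y \<in> carrier A \<Longrightarrow> tens x y \<in> carrier T"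
  unfolding tens_def by (rule hom_in_carrier[OF tcl_hom]) simp

lemma tcl_add: "p \<in> carrier FG \<Longrightarrow> q \<in> carrier FG \<Longrightarrow> tcl (p + q) = tcl p \<otimes>\<^bsub>T\<^esub> tcl q"
  using hom_mult[OF tcl_hom] by simp

lemma tcl_rel: "p \<in> tensor_rels \<kappa> A \<Longrightarrow> tcl p = \<one>\<^bsub>T\<^esub>"
  using tcl_one_iff tensor_rels_subset generate.incl[of p "tensor_rels \<kappa> A" FG]
  unfolding tensor_rel_group_def by blast

lemma tcl_rel_add:
  assumes "p - q - r \<in> tensor_rels \<kappa> A" "q \<in> carrier FG" "r \<in> carrier FG"
  shows "tcl p = tcl q \<otimes>\<^bsub>T\<^esub> tcl r"
proof -
  interpret T: comm_group T by (rule T_comm_group)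
  have c: "p - q - r \<in> carrier FG" "q + r \<in> carrier FG"
    using assms tensor_rels_subset keys_add[of q r] by (blast, auto)
  have "tcl p = tcl ((p - q - r) + (q + r))" by simp
  also have "\<dots> = tcl (q + r)"
    using tcl_add[OF c] tcl_rel[OF assms(1)] hom_in_carrier[OF tcl_hom c(2)] by simp
  finally show ?thesis using tcl_add[OF assms(2,3)] by simp
qed

lemma tens_add_left:
  "x \<in> carrier A \<Longrightarrow> x' \<in> carrier A \<Longrightarrow> y \<in> carrier A \<Longrightarrow>
    tens (x \<oplus> x') y = tens x y \<otimes>\<^bsub>T\<^esub> tens x' y"
  unfolding tens_def by (rule tcl_rel_add, unfold tensor_rels_def, blast) auto

lemma tens_add_right:
  "x \<in> carrier A \<Longrightarrow> y' \<in> carrier A \<Longrightarrow> y \<in> carrier A \<Longrightarrow>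
    tens x (y \<oplus> y') = tens x y \<otimes>\<^bsub>T\<^esub> tens x y'"
  unfolding tens_def by (rule tcl_rel_add, unfold tensor_rels_def, blast) auto

lemma tens_balanced:
  assumes "x \<in> carrier A" "y \<in> carrier A"
  shows "tens (x \<otimes> \<kappa> c) y = tens x (\<kappa> c \<otimes> y)"
proof -
  have "frag_of (x \<otimes> \<kappa> c, y) - frag_of (x, \<kappa> c \<otimes> y) \<in> tensor_rels \<kappa> A"
    using assms unfolding tensor_rels_def by blast
  then have "frag_of (x \<otimes> \<kappa> c, y) - frag_of (x, \<kappa> c \<otimes> y) \<in> tensor_rel_group \<kappa> A"
    unfolding tensor_rel_group_def by (rule generate.incl)
  then show ?thesis
    unfolding tens_def using assms by (subst tcl_eq_iff) auto
qed

lemma tens_zero_left [simp]: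
  assumes y: "y \<in> carrier A" shows "tens \<zero> y = \<one>\<^bsub>T\<^esub>"
proof -
  interpret T: comm_group T by (rule T_comm_group)
  show ?thesis
    using tens_add_left[of \<zero> \<zero> y] y T.r_cancel_one[of "tens \<zero> y" "tens \<zero> y"] by auto
qed

section \<open>Induction on tensors and the universal property\<close>

lemma inv_tens:
  assumes x: "x \<in> carrier A" and y: "y \<in> carrier A"
  shows "inv\<^bsub>T\<^esub> (tens x y) = tens (\<ominus> x) y"
proof -
  interpret T: comm_group T by (rule T_comm_group)
  have "tens (\<ominus> x) y \<otimes>\<^bsub>T\<^esub> tens x y = \<one>\<^bsub>T\<^esub>"
    using tens_add_left[of "\<ominus> x" x y] x y by (simp add: l_neg)
  then show ?thesis using x y T.inv_equality by auto
qed

text \<open>The inverse of a pure tensor is a pure tensor, so pure tensors generate the group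
  already as a monoid, and the cases of the unit, pure tensors and products suffice.\<close>

lemma T_induct [consumes 1, case_names one tens mult]:
  assumes t: "t \<in> carrier T"
    and one: "Q \<one>\<^bsub>T\<^esub>"
    and tens: "\<And>x y. x \<in> carrier A \<Longrightarrow> y \<in> carrier A \<Longrightarrow> Q (tens x y)"
    and mult: "\<And>s t. s \<in> carrier T \<Longrightarrow> t \<in> carrier T \<Longrightarrow> Q s \<Longrightarrow> Q t \<Longrightarrow> Q (s \<otimes>\<^bsub>T\<^esub> t)"
  shows "Q t"
proof -
  interpret T: comm_group T by (rule T_comm_group)
  interpret h: group_hom FG T tcl by (rule tcl_group_hom)
  obtain p where p: "p \<in> carrier FG" and t: "t = tcl p" using tcl_surj[OF t] by blast
  \<comment> \<open>Induction on the free abelian group proceeds by differences, hence the claim for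
    inverses is carried along.\<close>
  have "Q (tcl p) \<and> Q (inv\<^bsub>T\<^esub> (tcl p))"
  proof (rule free_Abelian_group_induct[of p "carrier A \<times> carrier A"])
    show "Poly_Mapping.keys p \<subseteq> carrier A \<times> carrier A" using p by simp
    show "Q (tcl 0) \<and> Q (inv\<^bsub>T\<^esub> (tcl 0))" using h.hom_one one by simp
  next
    fix x y assume xy: "Poly_Mapping.keys x \<subseteq> carrier A \<times> carrier A" "Poly_Mapping.keys y \<subseteq> carrier A \<times> carrier A"
      "Q (tcl x) \<and> Q (inv\<^bsub>T\<^esub> (tcl x))" "Q (tcl y) \<and> Q (inv\<^bsub>T\<^esub> (tcl y))"
    have c: "tcl x \<in> carrier T" "tcl y \<in> carrier T" using xy by auto
    have "tcl (x - y) = tcl x \<otimes>\<^bsub>T\<^esub> inv\<^bsub>T\<^esub> (tcl y)"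
      using h.hom_mult[of x "-y"] h.hom_inv[of y] xy(1,2) by simp
    then show "Q (tcl (x - y)) \<and> Q (inv\<^bsub>T\<^esub> (tcl (x - y)))"
      using xy c by (auto intro!: mult simp: T.inv_mult)
  next
    fix a assume a: "a \<in> carrier A \<times> carrier A"
    then obtain x y where a: "a = (x, y)" and xy: "x \<in> carrier A" "y \<in> carrier A" by auto
    then show "Q (tcl (frag_of a)) \<and> Q (inv\<^bsub>T\<^esub> (tcl (frag_of a)))"
      using tens[OF xy] tens[of "\<ominus> x" y] inv_tens[OF xy] by (simp add: tens_def)
  qed
  then show ?thesis using t by simp
qed

text \<open>A homomorphism that kills the defining relations kills the subgroup they generate, since
  its kernel is a subgroup; the factor map is then evaluated at an arbitrary representative.\<close>

lemma T_factor:
  assumes H: "group H" and \<phi>: "\<phi> \<in> hom FG H"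
    and rel: "\<And>p. p \<in> tensor_rels \<kappa> A \<Longrightarrow> \<phi> p = \<one>\<^bsub>H\<^esub>"
  shows "\<exists>\<psi>\<in>hom T H. \<forall>p\<in>carrier FG. \<psi> (tcl p) = \<phi> p"
proof -
  interpret h: group_hom FG T tcl by (rule tcl_group_hom)
  interpret \<phi>: group_hom FG H \<phi>
    using H \<phi> by (simp add: group_hom_def group_hom_axioms_def)
  have ker: "\<phi> p = \<one>\<^bsub>H\<^esub>" if "p \<in> tensor_rel_group \<kappa> A" for p
  proof -
    have "tensor_rel_group \<kappa> A \<subseteq> kernel FG H \<phi>"
      unfolding tensor_rel_group_def
      by (rule group.generate_subgroup_incl[OF group_free_Abelian_group _ \<phi>.subgroup_kernel])
        (use rel tensor_rels_subset in \<open>auto simp: kernel_def simp del: carrier_free_Abelian_group_iff\<close>)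
    then show ?thesis using that by (auto simp: kernel_def)
  qed
  have wd: "\<phi> p = \<phi> q" if "p \<in> carrier FG" "q \<in> carrier FG" "tcl p = tcl q" for p q
  proof -
    have d: "p - q \<in> carrier FG" using that keys_diff[of p q] by auto
    have "\<phi> (p - q) = \<one>\<^bsub>H\<^esub>" using that by (intro ker) (simp add: tcl_eq_iff[symmetric])
    then show ?thesis using \<phi>.hom_mult[OF d that(2)] \<phi>.hom_closed[OF that(2)] by simp
  qed
  define \<psi> where "\<psi> t = \<phi> (SOME p. p \<in> carrier FG \<and> tcl p = t)" for t
  have \<psi>: "\<psi> (tcl p) = \<phi> p" if p: "p \<in> carrier FG" for p
  proof -
    have "(SOME q. q \<in> carrier FG \<and> tcl q = tcl p) \<in> carrier FG \<and>
        tcl (SOME q. q \<in> carrier FG \<and> tcl q = tcl p) = tcl p"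
      by (rule someI_ex) (use p in blast)
    then show ?thesis unfolding \<psi>_def using wd p by blast
  qed
  have "\<psi> \<in> hom T H"
  proof (rule homI)
    fix s assume "s \<in> carrier T"
    then show "\<psi> s \<in> carrier H" using tcl_surj \<psi> by (metis \<phi>.hom_closed)
  next
    fix s t assume "s \<in> carrier T" "t \<in> carrier T"
    then obtain p q where pq: "p \<in> carrier FG" "q \<in> carrier FG" "s = tcl p" "t = tcl q"
      using tcl_surj by metis
    then have "s \<otimes>\<^bsub>T\<^esub> t = tcl (p \<otimes>\<^bsub>FG\<^esub> q)" using h.hom_mult by simp
    then show "\<psi> (s \<otimes>\<^bsub>T\<^esub> t) = \<psi> s \<otimes>\<^bsub>H\<^esub> \<psi> t"
      using pq \<psi> \<phi>.hom_mult monoid.m_closed[OF group.is_monoid[OF group_free_Abelian_group]] by metis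
  qed
  then show ?thesis using \<psi> by blast
qed

text \<open>Universal property of the balanced tensor product. The target is a multiplicative group,
  as \<open>hom\<close> requires; modules enter through \<open>add_monoid\<close>.\<close>

lemma T_universal:
  assumes H: "comm_group H"
    and cl: "\<And>x y. x \<in> carrier A \<Longrightarrow> y \<in> carrier A \<Longrightarrow> \<beta> x y \<in> carrier H"
    and addl: "\<And>x x' y. x \<in> carrier A \<Longrightarrow> x' \<in> carrier A \<Longrightarrow> y \<in> carrier A \<Longrightarrow>
       \<beta> (x \<oplus> x') y = \<beta> x y \<otimes>\<^bsub>H\<^esub> \<beta> x' y"
    and addr: "\<And>x y y'. x \<in> carrier A \<Longrightarrow> y \<in> carrier A \<Longrightarrow> y' \<in> carrier A \<Longrightarrow>
       \<beta> x (y \<oplus> y') = \<beta> x y \<otimes>\<^bsub>H\<^esub> \<beta> x y'"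
    and bal: "\<And>x y c. x \<in> carrier A \<Longrightarrow> y \<in> carrier A \<Longrightarrow> \<beta> (x \<otimes> \<kappa> c) y = \<beta> x (\<kappa> c \<otimes> y)"
  shows "\<exists>\<psi>\<in>hom T H. \<forall>x\<in>carrier A. \<forall>y\<in>carrier A. \<psi> (tens x y) = \<beta> x y"
proof -
  interpret H: comm_group H by (rule H)
  obtain \<phi> where \<phi>: "\<phi> \<in> hom FG H"
    and of: "\<And>a. a \<in> carrier A \<times> carrier A \<Longrightarrow> \<phi> (frag_of a) = (\<lambda>(x, y). \<beta> x y) a"
    by (rule H.free_Abelian_group_universal[of "\<lambda>(x, y). \<beta> x y" "carrier A \<times> carrier A"])
      (use cl in auto)
  interpret \<phi>: group_hom FG H \<phi>
    using \<phi> H.group_axioms by (simp add: group_hom_def group_hom_axioms_def)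
  have diff: "\<phi> (p - q) = \<phi> p \<otimes>\<^bsub>H\<^esub> inv\<^bsub>H\<^esub> \<phi> q" if "p \<in> carrier FG" "q \<in> carrier FG" for p q
    using \<phi>.hom_mult[of p "-q"] \<phi>.hom_inv[of q] that by simp
  have dc: "p - q \<in> carrier FG" if "p \<in> carrier FG" "q \<in> carrier FG" for p q
    using that keys_diff[of p q] by auto
  have diff3: "\<phi> (p - q - r) = \<one>\<^bsub>H\<^esub>"
    if "p \<in> carrier FG" "q \<in> carrier FG" "r \<in> carrier FG" "\<phi> p = \<phi> q \<otimes>\<^bsub>H\<^esub> \<phi> r" for p q r
  proof -
    have c: "\<phi> q \<in> carrier H" "\<phi> r \<in> carrier H" using that \<phi>.hom_closed by blast+
    have "\<phi> (p - q - r) = \<phi> q \<otimes>\<^bsub>H\<^esub> \<phi> r \<otimes>\<^bsub>H\<^esub> inv\<^bsub>H\<^esub> \<phi> q \<otimes>\<^bsub>H\<^esub> inv\<^bsub>H\<^esub> \<phi> r"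
      using diff[OF dc[OF that(1,2)] that(3)] diff[OF that(1,2)] that(4) by simp
    also have "\<dots> = \<phi> q \<otimes>\<^bsub>H\<^esub> inv\<^bsub>H\<^esub> \<phi> q \<otimes>\<^bsub>H\<^esub> (\<phi> r \<otimes>\<^bsub>H\<^esub> inv\<^bsub>H\<^esub> \<phi> r)"
      using c by (simp only: H.m_ac H.m_closed H.inv_closed)
    finally show ?thesis using c by simp
  qed
  have fr: "frag_of (x, y) \<in> carrier FG" if "x \<in> carrier A" "y \<in> carrier A" for x y
    using that by simp
  have of': "\<phi> (frag_of (x, y)) = \<beta> x y" if "x \<in> carrier A" "y \<in> carrier A" for x y
    using of that by simp
  have "\<phi> p = \<one>\<^bsub>H\<^esub>" if "p \<in> tensor_rels \<kappa> A" for p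
    using that unfolding tensor_rels_def Un_iff
  proof (elim disjE)
    assume "p \<in> {frag_of (x \<oplus> x', y) - frag_of (x, y) - frag_of (x', y) | x x' y.
        x \<in> carrier A \<and> x' \<in> carrier A \<and> y \<in> carrier A}"
    then show ?thesis by (clarsimp) (rule diff3; simp add: fr of' addl del: carrier_free_Abelian_group_iff)
  next
    assume "p \<in> {frag_of (x, y \<oplus> y') - frag_of (x, y) - frag_of (x, y') | x y y'.
        x \<in> carrier A \<and> y \<in> carrier A \<and> y' \<in> carrier A}"
    then show ?thesis by (clarsimp) (rule diff3; simp add: fr of' addr del: carrier_free_Abelian_group_iff)
  next
    assume "p \<in> {frag_of (x \<otimes> \<kappa> c, y) - frag_of (x, \<kappa> c \<otimes> y) | x y c.
        x \<in> carrier A \<and> y \<in> carrier A}"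
    then show ?thesis
      by (clarsimp) (subst diff; simp add: fr of' bal cl del: carrier_free_Abelian_group_iff)
  qed
  then obtain \<psi> where "\<psi> \<in> hom T H" "\<forall>p\<in>carrier FG. \<psi> (tcl p) = \<phi> p"
    using T_factor[OF H.group_axioms \<phi>] by blast
  then show ?thesis using of by (intro bexI[of _ \<psi>]) (auto simp: tens_def)
qed

end

section \<open>Bimodules and homomorphisms out of a free bimodule\<close>

text \<open>The last axiom makes the ground field act centrally. This is what lets the two-sided
  action on a fixed element be balanced, so that it factors through the tensor product.\<close>

locale bimod = central_ring A \<kappa> + M: abelian_group M
  for A :: "'a ring" (structure) and \<kappa> :: "'k \<Rightarrow> 'a" and M :: "('a, 'm) bimodule" +
  assumes smult_closed [simp, intro]: "u \<in> carrier A \<Longrightarrow> x \<in> carrier M \<Longrightarrow> u \<odot>\<^bsub>M\<^esub> x \<in> carrier M"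
    and rsmult_closed [simp, intro]: "u \<in> carrier A \<Longrightarrow> x \<in> carrier M \<Longrightarrow> rsmult M x u \<in> carrier M"
    and smult_l_distr: "u \<in> carrier A \<Longrightarrow> v \<in> carrier A \<Longrightarrow> x \<in> carrier M \<Longrightarrow>
      (u \<oplus> v) \<odot>\<^bsub>M\<^esub> x = u \<odot>\<^bsub>M\<^esub> x \<oplus>\<^bsub>M\<^esub> v \<odot>\<^bsub>M\<^esub> x"
    and smult_r_distr: "u \<in> carrier A \<Longrightarrow> x \<in> carrier M \<Longrightarrow> y \<in> carrier M \<Longrightarrow>
      u \<odot>\<^bsub>M\<^esub> (x \<oplus>\<^bsub>M\<^esub> y) = u \<odot>\<^bsub>M\<^esub> x \<oplus>\<^bsub>M\<^esub> u \<odot>\<^bsub>M\<^esub> y"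
    and smult_assoc1: "u \<in> carrier A \<Longrightarrow> v \<in> carrier A \<Longrightarrow> x \<in> carrier M \<Longrightarrow>
      (u \<otimes> v) \<odot>\<^bsub>M\<^esub> x = u \<odot>\<^bsub>M\<^esub> (v \<odot>\<^bsub>M\<^esub> x)"
    and smult_one [simp]: "x \<in> carrier M \<Longrightarrow> \<one> \<odot>\<^bsub>M\<^esub> x = x"
    and rsmult_r_distr: "u \<in> carrier A \<Longrightarrow> v \<in> carrier A \<Longrightarrow> x \<in> carrier M \<Longrightarrow>
      rsmult M x (u \<oplus> v) = rsmult M x u \<oplus>\<^bsub>M\<^esub> rsmult M x v"
    and rsmult_l_distr: "u \<in> carrier A \<Longrightarrow> x \<in> carrier M \<Longrightarrow> y \<in> carrier M \<Longrightarrow>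
      rsmult M (x \<oplus>\<^bsub>M\<^esub> y) u = rsmult M x u \<oplus>\<^bsub>M\<^esub> rsmult M y u"
    and rsmult_assoc: "u \<in> carrier A \<Longrightarrow> v \<in> carrier A \<Longrightarrow> x \<in> carrier M \<Longrightarrow>
      rsmult M x (u \<otimes> v) = rsmult M (rsmult M x u) v"
    and rsmult_one [simp]: "x \<in> carrier M \<Longrightarrow> rsmult M x \<one> = x"
    and smult_rsmult: "u \<in> carrier A \<Longrightarrow> v \<in> carrier A \<Longrightarrow> x \<in> carrier M \<Longrightarrow>
      rsmult M (u \<odot>\<^bsub>M\<^esub> x) v = u \<odot>\<^bsub>M\<^esub> rsmult M x v"
    and kappa_smult: "x \<in> carrier M \<Longrightarrow> \<kappa> c \<odot>\<^bsub>M\<^esub> x = rsmult M x (\<kappa> c)"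

definition bact :: "('a, 'm) bimodule \<Rightarrow> 'a \<Rightarrow> 'm \<Rightarrow> 'a \<Rightarrow> 'm" where
  "bact M u x v = rsmult M (u \<odot>\<^bsub>M\<^esub> x) v"

section \<open>The two-sided action on tensors and the free bimodules\<close>

context central_ring
begin

lemma act_frag_hom:
  assumes "u \<in> carrier A" "v \<in> carrier A" "p \<in> carrier FG"
  shows "frag_extend (\<lambda>(x, y). frag_of (u \<otimes> x, y \<otimes> v)) p \<in> carrier FG"
proof -
  have "Poly_Mapping.keys p \<subseteq> carrier A \<times> carrier A" using assms by simp
  then have "frag_extend (\<lambda>(x, y). frag_of (u \<otimes> x, y \<otimes> v)) p \<in> carrier FG"
  proof (rule free_Abelian_group_induct)
    fix x y
    assume "frag_extend (\<lambda>(x, y). frag_of (u \<otimes> x, y \<otimes> v)) x \<in> carrier FG"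
      "frag_extend (\<lambda>(x, y). frag_of (u \<otimes> x, y \<otimes> v)) y \<in> carrier FG"
    then show "frag_extend (\<lambda>(x, y). frag_of (u \<otimes> x, y \<otimes> v)) (x - y) \<in> carrier FG"
      using keys_diff[of "frag_extend (\<lambda>(x, y). frag_of (u \<otimes> x, y \<otimes> v)) x"
          "frag_extend (\<lambda>(x, y). frag_of (u \<otimes> x, y \<otimes> v)) y"]
      by (auto simp: frag_extend_diff)
  qed (use assms in auto)
  then show ?thesis .
qed

lemma tensor_relsI:
  "x \<in> carrier A \<Longrightarrow> x' \<in> carrier A \<Longrightarrow> y \<in> carrier A \<Longrightarrow>
    p = frag_of (x \<oplus> x', y) - frag_of (x, y) - frag_of (x', y) \<Longrightarrow> p \<in> tensor_rels \<kappa> A"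
  "x \<in> carrier A \<Longrightarrow> y \<in> carrier A \<Longrightarrow> y' \<in> carrier A \<Longrightarrow>
    p = frag_of (x, y \<oplus> y') - frag_of (x, y) - frag_of (x, y') \<Longrightarrow> p \<in> tensor_rels \<kappa> A"
  "x \<in> carrier A \<Longrightarrow> y \<in> carrier A \<Longrightarrow>
    p = frag_of (x \<otimes> \<kappa> c, y) - frag_of (x, \<kappa> c \<otimes> y) \<Longrightarrow> p \<in> tensor_rels \<kappa> A"
  unfolding tensor_rels_def by blast+

lemma tensor_rels_cases:
  assumes "p \<in> tensor_rels \<kappa> A"
  obtains (add_left) x x' y where "x \<in> carrier A" "x' \<in> carrier A" "y \<in> carrier A"
      "p = frag_of (x \<oplus> x', y) - frag_of (x, y) - frag_of (x', y)"
  | (add_right) x y y' where "x \<in> carrier A" "y \<in> carrier A" "y' \<in> carrier A"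
      "p = frag_of (x, y \<oplus> y') - frag_of (x, y) - frag_of (x, y')"
  | (balanced) x y c where "x \<in> carrier A" "y \<in> carrier A"
      "p = frag_of (x \<otimes> \<kappa> c, y) - frag_of (x, \<kappa> c \<otimes> y)"
  using assms unfolding tensor_rels_def
  apply (elim UnE CollectE exE conjE)
  subgoal by (rule that(1))
  subgoal by (rule that(2))
  subgoal by (rule that(3))
  done

text \<open>\<open>tensor_act\<close> is a union over the representatives of a coset. Acting on both
  entries sends each defining relation to a defining relation, so all representatives give one and
  the same coset, and the union is that coset.\<close>

lemma tensor_act_ex:
  assumes u: "u \<in> carrier A" and v: "v \<in> carrier A"
  shows "\<exists>\<psi>\<in>hom T T. (\<forall>t\<in>carrier T. tensor_act \<kappa> A u t v = \<psi> t) \<and>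
    (\<forall>x\<in>carrier A. \<forall>y\<in>carrier A. \<psi> (tens x y) = tens (u \<otimes> x) (y \<otimes> v))"
proof -
  let ?F = "frag_extend (\<lambda>(x, y). frag_of (u \<otimes> x, y \<otimes> v))"
  interpret h: group_hom FG T tcl by (rule tcl_group_hom)
  have hom: "(\<lambda>p. tcl (?F p)) \<in> hom FG T"
    by (rule homI) (use act_frag_hom[OF u v] in
      \<open>auto simp: frag_extend_add tcl_add simp del: carrier_free_Abelian_group_iff intro: hom_in_carrier[OF tcl_hom]\<close>)
  have rel: "tcl (?F p) = \<one>\<^bsub>T\<^esub>" if p: "p \<in> tensor_rels \<kappa> A" for p
  proof -
    from p have "?F p \<in> tensor_rels \<kappa> A"
    proof (cases rule: tensor_rels_cases)
      case (add_left x x' y)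
      then show ?thesis using u v
        by (intro tensor_relsI(1)[of "u \<otimes> x" "u \<otimes> x'" "y \<otimes> v"]) (auto simp: frag_extend_diff r_distr)
    next
      case (add_right x y y')
      then show ?thesis using u v
        by (intro tensor_relsI(2)[of "u \<otimes> x" "y \<otimes> v" "y' \<otimes> v"]) (auto simp: frag_extend_diff l_distr)
    next
      case (balanced x y c)
      then show ?thesis using u v
        by (intro tensor_relsI(3)[of "u \<otimes> x" "y \<otimes> v" _ c]) (auto simp: frag_extend_diff m_assoc)
    qed
    then show ?thesis by (rule tcl_rel)
  qed
  obtain \<psi> where \<psi>: "\<psi> \<in> hom T T" and \<psi>2: "\<And>p. p \<in> carrier FG \<Longrightarrow> \<psi> (tcl p) = tcl (?F p)"
    using T_factor[OF T_group hom rel] by blast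
  have "tensor_act \<kappa> A u t v = \<psi> t" if t: "t \<in> carrier T" for t
  proof -
    obtain q where q: "q \<in> carrier FG" "t = tcl q" using tcl_surj[OF t] by blast
    have sub: "subgroup (tensor_rel_group \<kappa> A) FG" by (rule tensor_rel_subgroup)
    have q_in: "q \<in> t" unfolding q(2) tensor_class_def
      by (rule group.rcos_self[OF group_free_Abelian_group q(1) sub])
    have *: "tcl (?F p) = \<psi> t" if "p \<in> t" for p
    proof -
      have pc: "p \<in> carrier FG"
        using that subgroup.rcosets_carrier[OF sub group_free_Abelian_group] q
        unfolding tensor_class_def RCOSETS_def by blast
      have "tcl p = t" using group.repr_independence[OF group_free_Abelian_group _ q(1) sub, of p] that
        unfolding q(2) tensor_class_def by simp
      then show ?thesis using \<psi>2[OF pc] by simp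
    qed
    show ?thesis unfolding tensor_act_def using q_in * by blast
  qed
  moreover have "\<psi> (tens x y) = tens (u \<otimes> x) (y \<otimes> v)" if "x \<in> carrier A" "y \<in> carrier A" for x y
    using \<psi>2[of "frag_of (x, y)"] that by (simp add: tens_def)
  ultimately show ?thesis using \<psi> by blast
qed

abbreviation tact :: "'a \<Rightarrow> 'a tensor \<Rightarrow> 'a \<Rightarrow> 'a tensor" where
  "tact \<equiv> tensor_act \<kappa> A"

lemma tact_closed [simp, intro]:
  "u \<in> carrier A \<Longrightarrow> v \<in> carrier A \<Longrightarrow> t \<in> carrier T \<Longrightarrow> tact u t v \<in> carrier T"
  using tensor_act_ex[of u v] hom_in_carrier by metis

lemma tact_hom:
  assumes "u \<in> carrier A" "v \<in> carrier A"
  shows "(\<lambda>t. tact u t v) \<in> hom T T"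
proof -
  interpret T: comm_group T by (rule T_comm_group)
  obtain \<psi> where \<psi>: "\<psi> \<in> hom T T" "\<And>t. t \<in> carrier T \<Longrightarrow> tact u t v = \<psi> t"
    using tensor_act_ex[OF assms] by blast
  show ?thesis by (rule homI) (simp_all add: \<psi>(2) hom_in_carrier[OF \<psi>(1)] hom_mult[OF \<psi>(1)])
qed

lemma tact_mult:
  assumes "u \<in> carrier A" "v \<in> carrier A" "s \<in> carrier T" "t \<in> carrier T"
  shows "tact u (s \<otimes>\<^bsub>T\<^esub> t) v = tact u s v \<otimes>\<^bsub>T\<^esub> tact u t v"
  using hom_mult[OF tact_hom[OF assms(1,2)] assms(3,4)] .

lemma tact_one [simp]:
  assumes "u \<in> carrier A" "v \<in> carrier A"
  shows "tact u \<one>\<^bsub>T\<^esub> v = \<one>\<^bsub>T\<^esub>"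
  using hom_one[OF tact_hom[OF assms] T_group T_group] .

lemma tact_tens [simp]:
  "u \<in> carrier A \<Longrightarrow> v \<in> carrier A \<Longrightarrow> x \<in> carrier A \<Longrightarrow> y \<in> carrier A \<Longrightarrow>
    tact u (tens x y) v = tens (u \<otimes> x) (y \<otimes> v)"
  using tensor_act_ex[of u v] tens_closed by metis

lemma T_hom_eq:
  assumes "f \<in> hom T H" "g \<in> hom T H" "group H"
    and "\<And>x y. x \<in> carrier A \<Longrightarrow> y \<in> carrier A \<Longrightarrow> f (tens x y) = g (tens x y)"
    and "t \<in> carrier T"
  shows "f t = g t"
  using assms(5)
proof (induction rule: T_induct)
  case one
  then show ?case using hom_one[OF assms(1) T_group assms(3)] hom_one[OF assms(2) T_group assms(3)] by simp
next
  case (tens x y) then show ?case using assms(4) by simp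
next
  case (mult s t) then show ?case by (simp add: hom_mult[OF assms(1)] hom_mult[OF assms(2)])
qed

text \<open>Makes the right-hand sides of the additivity laws of the action into homomorphisms, so
  that these laws can be checked on pure tensors.\<close>

lemma T_hom_mult:
  assumes "comm_group H" "f \<in> hom T H" "g \<in> hom T H"
  shows "(\<lambda>t. f t \<otimes>\<^bsub>H\<^esub> g t) \<in> hom T H"
proof -
  interpret H: comm_group H by (rule assms(1))
  have c: "f t \<in> carrier H" "g t \<in> carrier H" if "t \<in> carrier T" for t
    using hom_in_carrier[OF assms(2) that] hom_in_carrier[OF assms(3) that] .
  show ?thesis
    by (rule homI) (simp_all add: c hom_mult[OF assms(2)] hom_mult[OF assms(3)] H.m_ac)
qed

lemma tact_add_left:
  assumes "u \<in> carrier A" "u' \<in> carrier A" "v \<in> carrier A" "t \<in> carrier T"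
  shows "tact (u \<oplus> u') t v = tact u t v \<otimes>\<^bsub>T\<^esub> tact u' t v"
  by (rule T_hom_eq[OF _ T_hom_mult[OF T_comm_group] T_group])
    (use assms in \<open>auto intro!: tact_hom simp: tens_add_left l_distr\<close>)

lemma tact_add_right:
  assumes "u \<in> carrier A" "v \<in> carrier A" "v' \<in> carrier A" "t \<in> carrier T"
  shows "tact u t (v \<oplus> v') = tact u t v \<otimes>\<^bsub>T\<^esub> tact u t v'"
  by (rule T_hom_eq[OF _ T_hom_mult[OF T_comm_group] T_group])
    (use assms in \<open>auto intro!: tact_hom simp: tens_add_right r_distr\<close>)

lemma tact_tact:
  assumes "u \<in> carrier A" "v \<in> carrier A" "u' \<in> carrier A" "v' \<in> carrier A" "t \<in> carrier T"
  shows "tact u (tact u' t v') v = tact (u \<otimes> u') t (v' \<otimes> v)"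
proof -
  have "(\<lambda>t. tact u (tact u' t v') v) \<in> hom T T"
    using hom_compose[OF tact_hom[OF assms(3,4)] tact_hom[OF assms(1,2)]] by (simp add: o_def)
  then show ?thesis
    by (rule T_hom_eq[OF _ tact_hom T_group]) (use assms in \<open>auto simp: m_assoc\<close>)
qed

lemma tact_one_one [simp]: "t \<in> carrier T \<Longrightarrow> tact \<one> t \<one> = t"
  by (rule T_hom_eq[of "\<lambda>t. tact \<one> t \<one>" T "\<lambda>t. t"]) (simp_all add: tact_hom T_group, simp add: hom_def)

lemma tact_kappa:
  assumes "t \<in> carrier T"
  shows "tact (\<kappa> c) t \<one> = tact \<one> t (\<kappa> c)"
proof (rule T_hom_eq[OF tact_hom tact_hom T_group _ assms])
  fix x y assume xy: "x \<in> carrier A" "y \<in> carrier A"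
  have "tens (\<kappa> c \<otimes> x) y = tens x (\<kappa> c \<otimes> y)"
    by (simp only: kappa_central[OF xy(1)] tens_balanced[OF xy])
  then show "tact (\<kappa> c) (tens x y) \<one> = tact \<one> (tens x y) (\<kappa> c)"
    using xy by (simp only: kappa_central[OF xy(2)] tact_tens kappa_closed one_closed l_one r_one)
qed auto

abbreviation F :: "nat \<Rightarrow> ('a, nat \<Rightarrow> 'a tensor) bimodule" where
  "F \<equiv> free_bimodule \<kappa> A"

lemma F_simps [simp]:
  "add (F n) = (\<lambda>x y. \<lambda>i\<in>{..n}. x i \<otimes>\<^bsub>T\<^esub> y i)"
  "\<zero>\<^bsub>F n\<^esub> = (\<lambda>i\<in>{..n}. \<one>\<^bsub>T\<^esub>)"
  "smult (F n) = (\<lambda>u x. \<lambda>r\<in>{..n}. tact u (x r) \<one>)"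
  "rsmult (F n) = (\<lambda>x u. \<lambda>r\<in>{..n}. tact \<one> (x r) u)"
  by (simp_all add: free_bimodule_def Let_def)

lemma F_carrier: "carrier (F n) = (\<Pi>\<^sub>E i\<in>{..n}. carrier T)"
  by (auto simp add: free_bimodule_def Let_def carrier_sum_group T_group)

lemma F_abelian_group: "abelian_group (F n)"
proof -
  interpret T: comm_group T by (rule T_comm_group)
  show ?thesis
  proof (rule abelian_groupI)
    fix x assume "x \<in> carrier (F n)"
    then show "\<exists>y\<in>carrier (F n). y \<oplus>\<^bsub>F n\<^esub> x = \<zero>\<^bsub>F n\<^esub>"
      by (intro bexI[of _ "\<lambda>i\<in>{..n}. inv\<^bsub>T\<^esub> x i"]) (auto simp: F_carrier PiE_iff intro!: restrict_ext)
  next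
    fix x assume "x \<in> carrier (F n)"
    then show "\<zero>\<^bsub>F n\<^esub> \<oplus>\<^bsub>F n\<^esub> x = x"
      by (intro extensionalityI[of _ "{..n}"]) (auto simp: F_carrier PiE_iff)
  qed (auto simp: F_carrier PiE_iff T.m_ac intro!: restrict_ext)
qed

lemma F_ext:
  assumes "x \<in> carrier (F n)" "y \<in> carrier (F n)" "\<And>i. i \<le> n \<Longrightarrow> x i = y i"
  shows "x = y"
  by (rule extensionalityI[of x "{..n}" y]) (use assms in \<open>auto simp: F_carrier PiE_iff\<close>)

lemma F_mem: "x \<in> carrier (F n) \<Longrightarrow> i \<le> n \<Longrightarrow> x i \<in> carrier T"
  by (auto simp: F_carrier)

lemma F_bimod: "bimod A \<kappa> (F n)"
proof -
  interpret F: abelian_group "F n" by (rule F_abelian_group)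
  interpret T: comm_group T by (rule T_comm_group)
  note mem = F_carrier PiE_iff
  show ?thesis
    apply (intro bimod.intro bimod_axioms.intro central_ring_axioms F_abelian_group)
               apply (simp add: mem)
              apply (simp add: mem)
             apply (rule F_ext[where n=n]; simp add: mem tact_add_left)
            apply (rule F_ext[where n=n]; simp add: mem tact_mult)
           apply (rule F_ext[where n=n]; simp add: mem tact_tact)
          apply (rule F_ext[where n=n]; simp add: mem)
         apply (rule F_ext[where n=n]; simp add: mem tact_add_right)
        apply (rule F_ext[where n=n]; simp add: mem tact_mult)
       apply (rule F_ext[where n=n]; simp add: mem tact_tact)
      apply (rule F_ext[where n=n]; simp add: mem)
     apply (rule F_ext[where n=n]; simp add: mem tact_tact)
    apply (rule F_ext[where n=n]; simp add: mem)
    apply (rule tact_kappa; simp add: mem)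
    done
qed

lemma free_tensor_closed [simp, intro]:
  "x \<in> carrier A \<Longrightarrow> y \<in> carrier A \<Longrightarrow> free_tensor \<kappa> A n r x y \<in> carrier (F n)"
proof -
  interpret T: comm_group T by (rule T_comm_group)
  show "x \<in> carrier A \<Longrightarrow> y \<in> carrier A \<Longrightarrow> free_tensor \<kappa> A n r x y \<in> carrier (F n)"
    by (auto simp: F_carrier free_tensor_def tens_def[symmetric])
qed

lemma free_tensor_apply:
  "i \<le> n \<Longrightarrow> free_tensor \<kappa> A n r x y i = (if int i = r then tens x y else \<one>\<^bsub>T\<^esub>)"
  by (simp add: free_tensor_def tens_def)

lemma free_tensor_zero:
  "r < 0 \<or> int n < r \<Longrightarrow> free_tensor \<kappa> A n r x y = \<zero>\<^bsub>F n\<^esub>"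
  by (auto simp: free_tensor_def intro!: restrict_ext)

text \<open>An element is the sum of its components and each component is a sum of pure tensors, so
  pure tensors sitting in one component generate.\<close>

lemma F_induct [consumes 1, case_names zero tensor add]:
  assumes x: "x \<in> carrier (F n)"
    and zero: "Q \<zero>\<^bsub>F n\<^esub>"
    and tensor: "\<And>r x y. r \<le> n \<Longrightarrow> x \<in> carrier A \<Longrightarrow> y \<in> carrier A \<Longrightarrow>
      Q (free_tensor \<kappa> A n (int r) x y)"
    and add: "\<And>x y. x \<in> carrier (F n) \<Longrightarrow> y \<in> carrier (F n) \<Longrightarrow> Q x \<Longrightarrow> Q y \<Longrightarrow> Q (x \<oplus>\<^bsub>F n\<^esub> y)"
  shows "Q x"
proof -
  interpret T: comm_group T by (rule T_comm_group)
  let ?s = "\<lambda>r t. \<lambda>i\<in>{..n}. if i = r then t else \<one>\<^bsub>T\<^esub>"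
  have s: "?s r t \<in> carrier (F n)" if "t \<in> carrier T" for r t
    using that by (auto simp: F_carrier)
  have single: "Q (?s r t)" if r: "r \<le> n" and t: "t \<in> carrier T" for r t
    using t
  proof (induction rule: T_induct)
    case one
    have e: "?s r \<one>\<^bsub>T\<^esub> = \<zero>\<^bsub>F n\<^esub>" by (auto intro!: restrict_ext)
    show ?case unfolding e by (rule zero)
  next
    case (tens x y)
    have "?s r (tens x y) = free_tensor \<kappa> A n (int r) x y"
      by (auto simp: free_tensor_def tens_def intro!: restrict_ext)
    then show ?case using tensor[OF r tens] by simp
  next
    case (mult t u)
    have e: "?s r (t \<otimes>\<^bsub>T\<^esub> u) = ?s r t \<oplus>\<^bsub>F n\<^esub> ?s r u"
      by (auto intro!: restrict_ext)
    show ?case unfolding e by (rule add[OF s[OF mult(1)] s[OF mult(2)] mult(3,4)])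
  qed
  \<comment> \<open>The truncation of \<open>x\<close> to the indices below \<open>k\<close>; at
    \<open>k = Suc n\<close> nothing is cut off.\<close>
  let ?p = "\<lambda>k. \<lambda>i\<in>{..n}. if i < k then x i else \<one>\<^bsub>T\<^esub>"
  have p: "?p k \<in> carrier (F n)" for k
    using x by (auto simp: F_carrier)
  have all: "k \<le> Suc n \<Longrightarrow> Q (?p k)" for k
  proof (induction k)
    case 0
    have e: "?p 0 = \<zero>\<^bsub>F n\<^esub>" by (auto intro!: restrict_ext)
    show ?case unfolding e by (rule zero)
  next
    case (Suc k)
    have xk: "x k \<in> carrier T" using x Suc by (auto simp: F_carrier)
    have e: "?p (Suc k) = ?p k \<oplus>\<^bsub>F n\<^esub> ?s k (x k)"
      using x by (auto simp: F_carrier PiE_iff less_Suc_eq intro!: restrict_ext)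
    show ?case unfolding e by (rule add[OF p s[OF xk] Suc.IH single[OF _ xk]]) (use Suc.prems in simp_all)
  qed
  have e: "?p (Suc n) = x"
    using x by (intro extensionalityI[of _ "{..n}"]) (auto simp: F_carrier PiE_iff)
  show ?thesis using all[OF order_refl] unfolding e .
qed

end

lemma finsum_additive:
  fixes M (structure) and L (structure)
  assumes M: "abelian_group M" and L: "abelian_group L"
    and f: "\<And>x. x \<in> carrier M \<Longrightarrow> f x \<in> carrier L"
    and add: "\<And>x y. x \<in> carrier M \<Longrightarrow> y \<in> carrier M \<Longrightarrow> f (x \<oplus>\<^bsub>M\<^esub> y) = f x \<oplus>\<^bsub>L\<^esub> f y"
    and g: "g \<in> I \<rightarrow> carrier M"
  shows "f (finsum M g I) = finsum L (\<lambda>i. f (g i)) I"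
proof -
  interpret M: abelian_group M by (rule M)
  interpret L: abelian_group L by (rule L)
  have zero: "f \<zero>\<^bsub>M\<^esub> = \<zero>\<^bsub>L\<^esub>"
    using add[of "\<zero>\<^bsub>M\<^esub>" "\<zero>\<^bsub>M\<^esub>"] f[of "\<zero>\<^bsub>M\<^esub>"] L.add.r_cancel_one' by auto
  show ?thesis using g
  proof (induction I rule: infinite_finite_induct)
    case (insert i I)
    then have c: "g i \<in> carrier M" "g \<in> I \<rightarrow> carrier M" "(\<lambda>i. f (g i)) \<in> I \<rightarrow> carrier L"
      using f by auto
    show ?case using insert c by (simp add: add f)
  qed (auto simp: zero)
qed

lemma bimod_homD:
  assumes "f \<in> bimod_hom A M L"
  shows "x \<in> carrier M \<Longrightarrow> f x \<in> carrier L"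
    and "x \<in> carrier M \<Longrightarrow> y \<in> carrier M \<Longrightarrow> f (x \<oplus>\<^bsub>M\<^esub> y) = f x \<oplus>\<^bsub>L\<^esub> f y"
    and "u \<in> carrier A \<Longrightarrow> x \<in> carrier M \<Longrightarrow> f (u \<odot>\<^bsub>M\<^esub> x) = u \<odot>\<^bsub>L\<^esub> f x"
    and "u \<in> carrier A \<Longrightarrow> x \<in> carrier M \<Longrightarrow> f (rsmult M x u) = rsmult L (f x) u"
    and "f \<in> extensional (carrier M)"
  using assms by (auto simp: bimod_hom_def PiE_def)

lemma bimod_homI:
  assumes "\<And>x. x \<in> carrier M \<Longrightarrow> f x \<in> carrier L"
    and "\<And>x y. x \<in> carrier M \<Longrightarrow> y \<in> carrier M \<Longrightarrow> f (x \<oplus>\<^bsub>M\<^esub> y) = f x \<oplus>\<^bsub>L\<^esub> f y"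
    and "\<And>u x. u \<in> carrier A \<Longrightarrow> x \<in> carrier M \<Longrightarrow> f (u \<odot>\<^bsub>M\<^esub> x) = u \<odot>\<^bsub>L\<^esub> f x"
    and "\<And>u x. u \<in> carrier A \<Longrightarrow> x \<in> carrier M \<Longrightarrow> f (rsmult M x u) = rsmult L (f x) u"
    and "f \<in> extensional (carrier M)"
  shows "f \<in> bimod_hom A M L"
  using assms by (auto simp: bimod_hom_def PiE_def)

section \<open>Freeness: maps out of a free bimodule\<close>

context bimod
begin

lemma bact_closed [simp, intro]:
  "u \<in> carrier A \<Longrightarrow> v \<in> carrier A \<Longrightarrow> x \<in> carrier M \<Longrightarrow> bact M u x v \<in> carrier M"
  by (simp add: bact_def)

lemma smult_zero [simp]: "u \<in> carrier A \<Longrightarrow> u \<odot>\<^bsub>M\<^esub> \<zero>\<^bsub>M\<^esub> = \<zero>\<^bsub>M\<^esub>"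
  using smult_r_distr[of u "\<zero>\<^bsub>M\<^esub>" "\<zero>\<^bsub>M\<^esub>"] M.add.r_cancel_one'[of "u \<odot>\<^bsub>M\<^esub> \<zero>\<^bsub>M\<^esub>" "u \<odot>\<^bsub>M\<^esub> \<zero>\<^bsub>M\<^esub>"] by auto

lemma rsmult_zero [simp]: "u \<in> carrier A \<Longrightarrow> rsmult M \<zero>\<^bsub>M\<^esub> u = \<zero>\<^bsub>M\<^esub>"
  using rsmult_l_distr[of u "\<zero>\<^bsub>M\<^esub>" "\<zero>\<^bsub>M\<^esub>"] M.add.r_cancel_one'[of "rsmult M \<zero>\<^bsub>M\<^esub> u" "rsmult M \<zero>\<^bsub>M\<^esub> u"] by auto

lemma zero_smult [simp]: "x \<in> carrier M \<Longrightarrow> \<zero> \<odot>\<^bsub>M\<^esub> x = \<zero>\<^bsub>M\<^esub>"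
  using smult_l_distr[of \<zero> \<zero> x] M.add.r_cancel_one'[of "\<zero> \<odot>\<^bsub>M\<^esub> x" "\<zero> \<odot>\<^bsub>M\<^esub> x"] by auto

lemma rsmult_zero_right [simp]: "x \<in> carrier M \<Longrightarrow> rsmult M x \<zero> = \<zero>\<^bsub>M\<^esub>"
  using rsmult_r_distr[of \<zero> \<zero> x] M.add.r_cancel_one'[of "rsmult M x \<zero>" "rsmult M x \<zero>"] by auto

lemma T_bact_hom:
  assumes m: "m \<in> carrier M"
  shows "\<exists>\<psi>\<in>hom T (add_monoid M). \<forall>x\<in>carrier A. \<forall>y\<in>carrier A. \<psi> (tens x y) = bact M x m y"
proof (rule T_universal)
  fix x y c assume xy: "x \<in> carrier A" "y \<in> carrier A"
  have "(x \<otimes> \<kappa> c) \<odot>\<^bsub>M\<^esub> m = rsmult M (x \<odot>\<^bsub>M\<^esub> m) (\<kappa> c)"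
    using xy m by (simp add: smult_assoc1 kappa_smult smult_rsmult)
  then show "bact M (x \<otimes> \<kappa> c) m y = bact M x m (\<kappa> c \<otimes> y)"
    using xy m by (simp add: bact_def rsmult_assoc)
qed (use m in \<open>auto simp: bact_def smult_l_distr rsmult_l_distr rsmult_r_distr M.a_comm_group\<close>)

text \<open>Component \<open>r\<close> contributes the additive map induced by x \<otimes> y
  \<mapsto> x (v r) y; the sum of these maps over the components respects both actions because each
  of them does so on pure tensors.\<close>

lemma F_hom_ex:
  assumes v: "\<And>r. r \<le> n \<Longrightarrow> v r \<in> carrier M"
  shows "\<exists>f\<in>bimod_hom A (F n) M. \<forall>r\<le>n. \<forall>x\<in>carrier A. \<forall>y\<in>carrier A.
    f (free_tensor \<kappa> A n (int r) x y) = bact M x (v r) y"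
proof -
  have grp: "group (add_monoid M)" by (simp add: M.a_comm_group comm_group.axioms)
  have "\<forall>r\<in>{..n}. \<exists>\<psi>. \<psi> \<in> hom T (add_monoid M) \<and>
    (\<forall>x\<in>carrier A. \<forall>y\<in>carrier A. \<psi> (tens x y) = bact M x (v r) y)"
    using T_bact_hom v by blast
  then obtain \<psi> where \<psi>: "\<And>r. r \<le> n \<Longrightarrow> \<psi> r \<in> hom T (add_monoid M)"
    and \<psi>t: "\<And>r x y. r \<le> n \<Longrightarrow> x \<in> carrier A \<Longrightarrow> y \<in> carrier A \<Longrightarrow> \<psi> r (tens x y) = bact M x (v r) y"
    unfolding bchoice_iff by auto
  have \<psi>c: "\<psi> r t \<in> carrier M" if "r \<le> n" "t \<in> carrier T" for r t
    using hom_in_carrier[OF \<psi>[OF that(1)] that(2)] by simp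
  have \<psi>m: "\<psi> r (s \<otimes>\<^bsub>T\<^esub> t) = \<psi> r s \<oplus>\<^bsub>M\<^esub> \<psi> r t" if "r \<le> n" "s \<in> carrier T" "t \<in> carrier T" for r s t
    using hom_mult[OF \<psi>[OF that(1)] that(2,3)] by simp
  have \<psi>1: "\<psi> r \<one>\<^bsub>T\<^esub> = \<zero>\<^bsub>M\<^esub>" if "r \<le> n" for r
    using hom_one[OF \<psi>[OF that] T_group grp] by simp
  have \<psi>s: "\<psi> r (tact u t \<one>) = u \<odot>\<^bsub>M\<^esub> \<psi> r t" if "r \<le> n" "t \<in> carrier T" "u \<in> carrier A" for r t u
    using that(2)
  proof (induction rule: T_induct)
    case (tens x y)
    then show ?case using that v by (simp add: \<psi>t bact_def smult_assoc1 smult_rsmult)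
  qed (use that in \<open>auto simp: \<psi>1 \<psi>m \<psi>c tact_mult smult_r_distr\<close>)
  have \<psi>r: "\<psi> r (tact \<one> t u) = rsmult M (\<psi> r t) u" if "r \<le> n" "t \<in> carrier T" "u \<in> carrier A" for r t u
    using that(2)
  proof (induction rule: T_induct)
    case (tens x y)
    then show ?case using that v by (simp add: \<psi>t bact_def rsmult_assoc)
  qed (use that in \<open>auto simp: \<psi>1 \<psi>m \<psi>c tact_mult rsmult_l_distr\<close>)
  interpret FF: bimod A \<kappa> "F n" by (rule F_bimod)
  define f where "f = (\<lambda>x\<in>carrier (F n). finsum M (\<lambda>r. \<psi> r (x r)) {..n})"
  have xc: "\<psi> r (x r) \<in> carrier M" if "r \<le> n" "x \<in> carrier (F n)" for r x
    using that \<psi>c F_mem by blast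
  have "f \<in> bimod_hom A (F n) M"
  proof (rule bimod_homI)
    fix x assume x: "x \<in> carrier (F n)"
    then show "f x \<in> carrier M" by (auto simp: f_def xc intro!: M.finsum_closed)
  next
    fix x y assume x: "x \<in> carrier (F n)" and y: "y \<in> carrier (F n)"
    have "finsum M (\<lambda>r. \<psi> r ((x \<oplus>\<^bsub>F n\<^esub> y) r)) {..n} = finsum M (\<lambda>r. \<psi> r (x r) \<oplus>\<^bsub>M\<^esub> \<psi> r (y r)) {..n}"
      by (rule M.finsum_cong') (use x y in \<open>auto simp: xc \<psi>m F_mem\<close>)
    also have "\<dots> = finsum M (\<lambda>r. \<psi> r (x r)) {..n} \<oplus>\<^bsub>M\<^esub> finsum M (\<lambda>r. \<psi> r (y r)) {..n}"
      by (rule M.finsum_addf) (use x y in \<open>auto simp: xc\<close>)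
    finally show "f (x \<oplus>\<^bsub>F n\<^esub> y) = f x \<oplus>\<^bsub>M\<^esub> f y"
      using x y FF.M.a_closed[OF x y] by (simp only: f_def restrict_apply' if_True)
  next
    fix u x assume u: "u \<in> carrier A" and x: "x \<in> carrier (F n)"
    have "finsum M (\<lambda>r. \<psi> r ((u \<odot>\<^bsub>F n\<^esub> x) r)) {..n} = finsum M (\<lambda>r. u \<odot>\<^bsub>M\<^esub> \<psi> r (x r)) {..n}"
      by (rule M.finsum_cong') (use x u in \<open>auto simp: xc \<psi>s F_mem\<close>)
    also have "\<dots> = u \<odot>\<^bsub>M\<^esub> finsum M (\<lambda>r. \<psi> r (x r)) {..n}"
      by (rule finsum_additive[symmetric, OF M.abelian_group_axioms M.abelian_group_axioms])
        (use x u in \<open>auto simp: xc smult_r_distr\<close>)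
    finally show "f (u \<odot>\<^bsub>F n\<^esub> x) = u \<odot>\<^bsub>M\<^esub> f x"
      using x u FF.smult_closed[OF u x] by (simp only: f_def restrict_apply' if_True)
    have "finsum M (\<lambda>r. \<psi> r ((rsmult (F n) x u) r)) {..n} = finsum M (\<lambda>r. rsmult M (\<psi> r (x r)) u) {..n}"
      by (rule M.finsum_cong') (use x u in \<open>auto simp: xc \<psi>r F_mem\<close>)
    also have "\<dots> = rsmult M (finsum M (\<lambda>r. \<psi> r (x r)) {..n}) u"
      by (rule finsum_additive[symmetric, OF M.abelian_group_axioms M.abelian_group_axioms])
        (use x u in \<open>auto simp: xc rsmult_l_distr\<close>)
    finally show "f (rsmult (F n) x u) = rsmult M (f x) u"
      using x u FF.rsmult_closed[OF u x] by (simp only: f_def restrict_apply' if_True)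
  qed (simp add: f_def)
  moreover have "f (free_tensor \<kappa> A n (int r) x y) = bact M x (v r) y"
    if "r \<le> n" "x \<in> carrier A" "y \<in> carrier A" for r x y
  proof -
    have "f (free_tensor \<kappa> A n (int r) x y) =
        finsum M (\<lambda>i. if r = i then bact M x (v i) y else \<zero>\<^bsub>M\<^esub>) {..n}"
      unfolding f_def using that v
      by (simp add: free_tensor_closed) (rule M.finsum_cong', auto simp: free_tensor_apply \<psi>t \<psi>1)
    also have "\<dots> = bact M x (v r) y"
      using that v by (intro M.finsum_singleton) auto
    finally show ?thesis .
  qed
  ultimately show ?thesis by blast
qed

lemma F_hom_tensor:
  assumes f: "f \<in> bimod_hom A (F n) M" and xy: "x \<in> carrier A" "y \<in> carrier A"
  shows "f (free_tensor \<kappa> A n r x y) = bact M x (f (free_tensor \<kappa> A n r \<one> \<one>)) y"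
proof -
  interpret FF: bimod A \<kappa> "F n" by (rule F_bimod)
  have e: "free_tensor \<kappa> A n r \<one> \<one> \<in> carrier (F n)" by auto
  have "free_tensor \<kappa> A n r x y = bact (F n) x (free_tensor \<kappa> A n r \<one> \<one>) y"
    by (rule F_ext) (use xy FF.bact_closed[OF xy e] in \<open>auto simp: bact_def free_tensor_apply\<close>)
  then show ?thesis
    using xy e FF.smult_closed[OF xy(1) e] by (simp only: bact_def bimod_homD[OF f])
qed

lemma F_hom_eqI:
  assumes f: "f \<in> bimod_hom A (F n) M" and g: "g \<in> bimod_hom A (F n) M"
    and eq: "\<And>r. r \<le> n \<Longrightarrow> f (free_tensor \<kappa> A n (int r) \<one> \<one>) = g (free_tensor \<kappa> A n (int r) \<one> \<one>)"
  shows "f = g"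
proof (rule extensionalityI[OF bimod_homD(5)[OF f] bimod_homD(5)[OF g]])
  interpret FF: bimod A \<kappa> "F n" by (rule F_bimod)
  have hz: "h \<zero>\<^bsub>F n\<^esub> = \<zero>\<^bsub>M\<^esub>" if h: "h \<in> bimod_hom A (F n) M" for h
  proof -
    have "h (\<zero>\<^bsub>F n\<^esub> \<oplus>\<^bsub>F n\<^esub> \<zero>\<^bsub>F n\<^esub>) = h \<zero>\<^bsub>F n\<^esub> \<oplus>\<^bsub>M\<^esub> h \<zero>\<^bsub>F n\<^esub>"
      by (rule bimod_homD(2)[OF h FF.M.zero_closed FF.M.zero_closed])
    then have "h \<zero>\<^bsub>F n\<^esub> = h \<zero>\<^bsub>F n\<^esub> \<oplus>\<^bsub>M\<^esub> h \<zero>\<^bsub>F n\<^esub>"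
      by (simp only: FF.M.l_zero[OF FF.M.zero_closed])
    then show ?thesis
      using M.add.r_cancel_one'[OF bimod_homD(1)[OF h FF.M.zero_closed] bimod_homD(1)[OF h FF.M.zero_closed]] by blast
  qed
  fix x assume "x \<in> carrier (F n)"
  then show "f x = g x"
  proof (induction rule: F_induct)
    case zero
    show ?case by (simp only: hz[OF f] hz[OF g])
  next
    case (tensor r x y)
    show ?case
      unfolding F_hom_tensor[OF f tensor(2,3)] F_hom_tensor[OF g tensor(2,3)] eq[OF tensor(1)] ..
  next
    case (add x y)
    then show ?case by (simp only: bimod_homD(2)[OF f] bimod_homD(2)[OF g])
  qed
qed

text \<open>Existence and uniqueness on generators make the definite description in
  \<open>free_bimod_map\<close> denote.\<close>

lemma free_bimod_map:
  assumes v: "\<And>r. r \<le> n \<Longrightarrow> v r \<in> carrier M"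
  shows "free_bimod_map \<kappa> A n M v \<in> bimod_hom A (F n) M"
    and "r \<le> n \<Longrightarrow> free_bimod_map \<kappa> A n M v (free_tensor \<kappa> A n (int r) \<one> \<one>) = v r"
proof -
  let ?P = "\<lambda>f. f \<in> bimod_hom A (F n) M \<and>
        (\<forall>r\<le>n. f (free_tensor \<kappa> A n (int r) \<one> \<one>) = v r)"
  obtain f where f: "f \<in> bimod_hom A (F n) M"
    "\<And>r x y. r \<le> n \<Longrightarrow> x \<in> carrier A \<Longrightarrow> y \<in> carrier A \<Longrightarrow>
      f (free_tensor \<kappa> A n (int r) x y) = bact M x (v r) y"
    using F_hom_ex[of n v] v by blast
  have "?P f" using f v by (simp add: bact_def)
  moreover have "g = f" if "?P g" for g
    using that \<open>?P f\<close> by (intro F_hom_eqI[of _ n]) simp_all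
  ultimately have "\<exists>!f. ?P f" by blast
  then have "?P (free_bimod_map \<kappa> A n M v)"
    unfolding free_bimod_map_def by (rule theI')
  then show "free_bimod_map \<kappa> A n M v \<in> bimod_hom A (F n) M"
    and "r \<le> n \<Longrightarrow> free_bimod_map \<kappa> A n M v (free_tensor \<kappa> A n (int r) \<one> \<one>) = v r" by auto
qed

end

section \<open>The Ext ring of a resolution\<close>

lemma bimod_hom_compose:
  assumes f: "f \<in> bimod_hom A M L" and g: "g \<in> bimod_hom A L K"
    and sm: "\<And>u x. u \<in> carrier A \<Longrightarrow> x \<in> carrier M \<Longrightarrow> u \<odot>\<^bsub>M\<^esub> x \<in> carrier M \<and> rsmult M x u \<in> carrier M"
    and M: "abelian_group M"
  shows "compose (carrier M) g f \<in> bimod_hom A M K"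
proof -
  interpret M: abelian_group M by (rule M)
  show ?thesis
    by (rule bimod_homI)
      (simp_all add: compose_def bimod_homD[OF f] bimod_homD[OF g] sm)
qed

locale bimod2 = X: bimod A \<kappa> X + Y: bimod A \<kappa> Y
  for A :: "'a ring" (structure) and \<kappa> :: "'k \<Rightarrow> 'a"
    and X :: "('a, 'm) bimodule" and Y :: "('a, 'n) bimodule"
begin

lemma hom_add_closed:
  assumes f: "f \<in> bimod_hom A X Y" and g: "g \<in> bimod_hom A X Y"
  shows "(\<lambda>x\<in>carrier X. f x \<oplus>\<^bsub>Y\<^esub> g x) \<in> bimod_hom A X Y"
  by (rule bimod_homI)
    (simp_all add: bimod_homD[OF f] bimod_homD[OF g] Y.smult_r_distr Y.rsmult_l_distr Y.M.a_ac)

lemma smult_minus: "u \<in> carrier A \<Longrightarrow> y \<in> carrier Y \<Longrightarrow> u \<odot>\<^bsub>Y\<^esub> (\<ominus>\<^bsub>Y\<^esub> y) = \<ominus>\<^bsub>Y\<^esub> (u \<odot>\<^bsub>Y\<^esub> y)"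
  by (rule Y.M.minus_equality[symmetric]) (simp_all flip: Y.smult_r_distr add: Y.M.l_neg)

lemma rsmult_minus: "u \<in> carrier A \<Longrightarrow> y \<in> carrier Y \<Longrightarrow> rsmult Y (\<ominus>\<^bsub>Y\<^esub> y) u = \<ominus>\<^bsub>Y\<^esub> (rsmult Y y u)"
  by (rule Y.M.minus_equality[symmetric]) (simp_all flip: Y.rsmult_l_distr add: Y.M.l_neg)

lemma hom_minus_closed:
  assumes f: "f \<in> bimod_hom A X Y"
  shows "(\<lambda>x\<in>carrier X. \<ominus>\<^bsub>Y\<^esub> f x) \<in> bimod_hom A X Y"
  by (rule bimod_homI)
    (simp_all add: bimod_homD[OF f] smult_minus rsmult_minus Y.M.minus_add Y.M.a_comm)

lemma hom_zero_closed: "(\<lambda>x\<in>carrier X. \<zero>\<^bsub>Y\<^esub>) \<in> bimod_hom A X Y"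
  by (rule bimod_homI) simp_all

lemma hom_group_simps [simp]:
  "carrier (hom_group A X Y) = bimod_hom A X Y"
  "mult (hom_group A X Y) = (\<lambda>f g. \<lambda>x\<in>carrier X. f x \<oplus>\<^bsub>Y\<^esub> g x)"
  "one (hom_group A X Y) = (\<lambda>x\<in>carrier X. \<zero>\<^bsub>Y\<^esub>)"
  by (simp_all add: hom_group_def)

lemma hom_group_comm_group: "comm_group (hom_group A X Y)"
proof (rule comm_groupI)
  fix f assume f: "f \<in> carrier (hom_group A X Y)"
  then have f': "f \<in> bimod_hom A X Y" by simp
  show "\<one>\<^bsub>hom_group A X Y\<^esub> \<otimes>\<^bsub>hom_group A X Y\<^esub> f = f"
    by (rule extensionalityI[OF _ bimod_homD(5)[OF f']]) (simp_all add: bimod_homD[OF f'])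
  show "\<exists>g\<in>carrier (hom_group A X Y). g \<otimes>\<^bsub>hom_group A X Y\<^esub> f = \<one>\<^bsub>hom_group A X Y\<^esub>"
    by (rule bexI[of _ "\<lambda>x\<in>carrier X. \<ominus>\<^bsub>Y\<^esub> f x"])
      (simp_all add: hom_minus_closed[OF f'] bimod_homD[OF f'] Y.M.l_neg cong: restrict_cong)
next
  fix f g assume "f \<in> carrier (hom_group A X Y)" "g \<in> carrier (hom_group A X Y)"
  then have f: "f \<in> bimod_hom A X Y" and g: "g \<in> bimod_hom A X Y" by simp_all
  show "f \<otimes>\<^bsub>hom_group A X Y\<^esub> g \<in> carrier (hom_group A X Y)"
    using hom_add_closed[OF f g] by simp
  show "f \<otimes>\<^bsub>hom_group A X Y\<^esub> g = g \<otimes>\<^bsub>hom_group A X Y\<^esub> f"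
    by (simp add: bimod_homD[OF f] bimod_homD[OF g] Y.M.a_comm cong: restrict_cong)
  fix h assume "h \<in> carrier (hom_group A X Y)"
  then have h: "h \<in> bimod_hom A X Y" by simp
  show "f \<otimes>\<^bsub>hom_group A X Y\<^esub> g \<otimes>\<^bsub>hom_group A X Y\<^esub> h = f \<otimes>\<^bsub>hom_group A X Y\<^esub> (g \<otimes>\<^bsub>hom_group A X Y\<^esub> h)"
    by (simp add: bimod_homD[OF f] bimod_homD[OF g] bimod_homD[OF h] Y.M.a_assoc cong: restrict_cong)
qed (simp add: hom_zero_closed)

lemma hom_zero:
  assumes f: "f \<in> bimod_hom A X Y" shows "f \<zero>\<^bsub>X\<^esub> = \<zero>\<^bsub>Y\<^esub>"
proof -
  have z: "f \<zero>\<^bsub>X\<^esub> \<in> carrier Y" by (simp add: bimod_homD[OF f])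
  have "f \<zero>\<^bsub>X\<^esub> = f \<zero>\<^bsub>X\<^esub> \<oplus>\<^bsub>Y\<^esub> f \<zero>\<^bsub>X\<^esub>"
    using bimod_homD(2)[OF f X.M.zero_closed X.M.zero_closed] by simp
  then show ?thesis using Y.M.add.r_cancel_one'[OF z z] by blast
qed

lemma hom_neg:
  assumes f: "f \<in> bimod_hom A X Y" and x: "x \<in> carrier X" shows "f (\<ominus>\<^bsub>X\<^esub> x) = \<ominus>\<^bsub>Y\<^esub> f x"
proof (rule Y.M.minus_equality[symmetric])
  have "f (\<ominus>\<^bsub>X\<^esub> x) \<oplus>\<^bsub>Y\<^esub> f x = f (\<ominus>\<^bsub>X\<^esub> x \<oplus>\<^bsub>X\<^esub> x)"
    by (rule bimod_homD(2)[OF f, symmetric]) (simp_all add: x)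
  then show "f (\<ominus>\<^bsub>X\<^esub> x) \<oplus>\<^bsub>Y\<^esub> f x = \<zero>\<^bsub>Y\<^esub>"
    by (simp add: X.M.l_neg x hom_zero[OF f])
qed (simp_all add: bimod_homD[OF f] x)

end

text \<open>Projectivity and exactness are assumed jointly, in the form in which they act: a map out
  of some \<open>P n\<close> whose composite with the next map of the resolution vanishes factors
  through the preceding differential. \<open>lift_eps\<close> plays the same role for surjectivity
  of the augmentation.\<close>

locale ext_res =
  fixes A :: "'a ring" (structure) and \<kappa> :: "'k \<Rightarrow> 'a" and P :: "nat \<Rightarrow> ('a, 'm) bimodule"
    and d :: "nat \<Rightarrow> 'm \<Rightarrow> 'm" and \<epsilon> :: "'m \<Rightarrow> 'n" and M :: "('a, 'n) bimodule"
  assumes P_bimod: "bimod A \<kappa> (P n)" and M_bimod: "bimod A \<kappa> M"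
    and d_hom: "d (Suc n) \<in> bimod_hom A (P (Suc n)) (P n)"
    and eps_hom: "\<epsilon> \<in> bimod_hom A (P 0) M"
    and dd: "x \<in> carrier (P (Suc (Suc n))) \<Longrightarrow> d (Suc n) (d (Suc (Suc n)) x) = \<zero>\<^bsub>P n\<^esub>"
    and eps_d: "x \<in> carrier (P (Suc 0)) \<Longrightarrow> \<epsilon> (d (Suc 0) x) = \<zero>\<^bsub>M\<^esub>"
    and lift_d: "\<phi> \<in> bimod_hom A (P n) (P (Suc i)) \<Longrightarrow>
      (\<And>x. x \<in> carrier (P n) \<Longrightarrow> d (Suc i) (\<phi> x) = \<zero>\<^bsub>P i\<^esub>) \<Longrightarrow>
      \<exists>\<psi>\<in>bimod_hom A (P n) (P (Suc (Suc i))). \<forall>x\<in>carrier (P n). d (Suc (Suc i)) (\<psi> x) = \<phi> x"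
    and lift_eps_d: "\<phi> \<in> bimod_hom A (P n) (P 0) \<Longrightarrow>
      (\<And>x. x \<in> carrier (P n) \<Longrightarrow> \<epsilon> (\<phi> x) = \<zero>\<^bsub>M\<^esub>) \<Longrightarrow>
      \<exists>\<psi>\<in>bimod_hom A (P n) (P (Suc 0)). \<forall>x\<in>carrier (P n). d (Suc 0) (\<psi> x) = \<phi> x"
    and lift_eps: "f \<in> bimod_hom A (P n) M \<Longrightarrow>
      \<exists>\<psi>\<in>bimod_hom A (P n) (P 0). \<forall>x\<in>carrier (P n). \<epsilon> (\<psi> x) = f x"
begin

sublocale P: bimod A \<kappa> "P n" for n by (rule P_bimod)
sublocale M: bimod A \<kappa> M by (rule M_bimod)

lemma PM: "bimod2 A \<kappa> (P n) M"
  by (simp add: bimod2_def P_bimod M_bimod)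

lemma PP: "bimod2 A \<kappa> (P n) (P i)"
  by (simp add: bimod2_def P_bimod)

lemma comp_PP:
  assumes f: "f \<in> bimod_hom A (P n) (P i)" and g: "g \<in> bimod_hom A (P i) L"
  shows "compose (carrier (P n)) g f \<in> bimod_hom A (P n) L"
  by (rule bimod_hom_compose[OF f g]) (auto intro: P.M.abelian_group_axioms)

section \<open>Cocycles, coboundaries and their quotient\<close>

abbreviation "hg n \<equiv> hom_group A (P n) M"
abbreviation "Z n \<equiv> ext_cocycles A P d M n"
abbreviation "Bd n \<equiv> ext_coboundaries A P d M n"
abbreviation "EG n \<equiv> ext_group A P d M n"
abbreviation "cls n f \<equiv> ext_class A P d M n f"
abbreviation "hadd n f g \<equiv> (\<lambda>x\<in>carrier (P n). f x \<oplus>\<^bsub>M\<^esub> g x)"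

lemma hg_comm_group: "comm_group (hg n)"
  by (rule bimod2.hom_group_comm_group[OF PM])

lemma hg_simps [simp]:
  "carrier (hg n) = bimod_hom A (P n) M"
  "mult (hg n) = hadd n"
  "one (hg n) = (\<lambda>x\<in>carrier (P n). \<zero>\<^bsub>M\<^esub>)"
  by (simp_all add: hom_group_def)

lemma inv_hg:
  assumes f: "f \<in> bimod_hom A (P n) M"
  shows "inv\<^bsub>hg n\<^esub> f = (\<lambda>x\<in>carrier (P n). \<ominus>\<^bsub>M\<^esub> f x)"
proof (rule group.inv_equality)
  show "group (hg n)" using hg_comm_group by (rule comm_group.axioms)
  show "(\<lambda>x\<in>carrier (P n). \<ominus>\<^bsub>M\<^esub> f x) \<in> carrier (hg n)"
    using bimod2.hom_minus_closed[OF PM f] by simp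
qed (use f in \<open>auto simp: bimod_homD[OF f] M.M.l_neg intro!: restrict_ext\<close>)

lemma Z_hom: "f \<in> Z n \<Longrightarrow> f \<in> bimod_hom A (P n) M"
  by (simp add: ext_cocycles_def)

lemma Z_d: "f \<in> Z n \<Longrightarrow> x \<in> carrier (P (Suc n)) \<Longrightarrow> f (d (Suc n) x) = \<zero>\<^bsub>M\<^esub>"
  by (simp add: ext_cocycles_def)

lemma ZI: "f \<in> bimod_hom A (P n) M \<Longrightarrow> (\<And>x. x \<in> carrier (P (Suc n)) \<Longrightarrow> f (d (Suc n) x) = \<zero>\<^bsub>M\<^esub>) \<Longrightarrow> f \<in> Z n"
  by (simp add: ext_cocycles_def)

lemma d_closed [simp, intro]: "x \<in> carrier (P (Suc n)) \<Longrightarrow> d (Suc n) x \<in> carrier (P n)"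
  by (rule bimod_homD(1)[OF d_hom])

lemma Z_add: "f \<in> Z n \<Longrightarrow> g \<in> Z n \<Longrightarrow> hadd n f g \<in> Z n"
  by (rule ZI) (simp_all add: bimod2.hom_add_closed[OF PM] Z_hom Z_d)

lemma Z_subgroup: "subgroup (Z n) (hg n)"
proof (rule subgroup.intro)
  show "Z n \<subseteq> carrier (hg n)" using Z_hom by auto
  show "\<one>\<^bsub>hg n\<^esub> \<in> Z n"
    by (rule ZI) (simp_all add: bimod2.hom_zero_closed[OF PM])
next
  fix f assume f: "f \<in> Z n"
  then show "inv\<^bsub>hg n\<^esub> f \<in> Z n"
    by (intro ZI) (simp_all add: inv_hg Z_hom bimod2.hom_minus_closed[OF PM] Z_d)
qed (simp add: Z_add)

lemma cobd_Z:
  assumes h: "h \<in> bimod_hom A (P n) M"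
  shows "compose (carrier (P (Suc n))) h (d (Suc n)) \<in> Z (Suc n)"
proof (rule ZI)
  show "compose (carrier (P (Suc n))) h (d (Suc n)) \<in> bimod_hom A (P (Suc n)) M"
    by (rule comp_PP[OF d_hom h])
  fix x assume "x \<in> carrier (P (Suc (Suc n)))"
  then show "compose (carrier (P (Suc n))) h (d (Suc n)) (d (Suc (Suc n)) x) = \<zero>\<^bsub>M\<^esub>"
    by (simp add: compose_def dd bimod2.hom_zero[OF PM h])
qed

lemma Bd_subgroup: "subgroup (Bd n) (hg n)"
proof (cases n)
  case 0
  then show ?thesis
    using group.triv_subgroup[OF comm_group.axioms(2)[OF hg_comm_group[of 0]]] by simp
next
  case (Suc k)
  let ?c = "\<lambda>h. compose (carrier (P (Suc k))) h (d (Suc k))"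
  have "subgroup (Bd (Suc k)) (hg (Suc k))"
  proof (rule subgroup.intro)
    show "Bd (Suc k) \<subseteq> carrier (hg (Suc k))" using cobd_Z Z_hom by auto
    have "\<one>\<^bsub>hg (Suc k)\<^esub> = ?c (\<lambda>x\<in>carrier (P k). \<zero>\<^bsub>M\<^esub>)"
      by (auto simp: compose_def intro!: restrict_ext)
    then show "\<one>\<^bsub>hg (Suc k)\<^esub> \<in> Bd (Suc k)"
      unfolding ext_coboundaries.simps mem_Collect_eq using bimod2.hom_zero_closed[OF PM[of k]] by blast
  next
    fix f g assume "f \<in> Bd (Suc k)" "g \<in> Bd (Suc k)"
    then obtain h h' where h: "h \<in> bimod_hom A (P k) M" "h' \<in> bimod_hom A (P k) M" "f = ?c h" "g = ?c h'"
      by auto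
    have "f \<otimes>\<^bsub>hg (Suc k)\<^esub> g = ?c (hadd k h h')"
      by (auto simp: h compose_def intro!: restrict_ext)
    then show "f \<otimes>\<^bsub>hg (Suc k)\<^esub> g \<in> Bd (Suc k)"
      using bimod2.hom_add_closed[OF PM h(1,2)] by auto
  next
    fix f assume "f \<in> Bd (Suc k)"
    then obtain h where h: "h \<in> bimod_hom A (P k) M" "f = ?c h" by auto
    have "inv\<^bsub>hg (Suc k)\<^esub> f = ?c (\<lambda>x\<in>carrier (P k). \<ominus>\<^bsub>M\<^esub> h x)"
      using inv_hg[OF Z_hom[OF cobd_Z[OF h(1)]]] by (auto simp: h compose_def intro!: restrict_ext)
    then show "inv\<^bsub>hg (Suc k)\<^esub> f \<in> Bd (Suc k)"
      using bimod2.hom_minus_closed[OF PM h(1)] by auto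
  qed
  then show ?thesis using Suc by simp
qed

lemma Bd_Z: "Bd n \<subseteq> Z n"
proof (cases n)
  case 0
  then show ?thesis using subgroup.one_closed[OF Z_subgroup[of 0]] by simp
next
  case (Suc k)
  then show ?thesis using cobd_Z by auto
qed

abbreviation "zg n \<equiv> (hg n)\<lparr>carrier := Z n\<rparr>"

lemma zg_comm_group: "comm_group (zg n)"
proof (rule group.group_comm_groupI)
  show "group (zg n)"
    by (rule subgroup.subgroup_is_group[OF Z_subgroup comm_group.axioms(2)[OF hg_comm_group]])
  fix f g assume "f \<in> carrier (zg n)" "g \<in> carrier (zg n)"
  then show "f \<otimes>\<^bsub>zg n\<^esub> g = g \<otimes>\<^bsub>zg n\<^esub> f"
    by (auto simp: M.M.a_comm bimod_homD(1)[OF Z_hom] intro!: restrict_ext)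
qed

lemma Bd_subgroup_zg: "subgroup (Bd n) (zg n)"
  by (rule group.subgroup_incl[OF comm_group.axioms(2)[OF hg_comm_group] Bd_subgroup Z_subgroup Bd_Z])

lemma EG_comm_group: "comm_group (EG n)"
  unfolding ext_group_def by (rule comm_group.abelian_FactGroup[OF zg_comm_group Bd_subgroup_zg])

text \<open>\<open>ext_class\<close> forms cosets in the group of all cochains,
  \<open>ext_group\<close> in the group of cocycles; the two groups share their multiplication, and
  a coset sees nothing else.\<close>

lemma cls_eq: "cls n f = Bd n #>\<^bsub>zg n\<^esub> f"
  by (simp add: ext_class_def r_coset_def)

lemma zg_group: "group (zg n)"
  using zg_comm_group by (rule comm_group.axioms)

lemma cls_hom: "(\<lambda>f. cls n f) \<in> hom (zg n) (EG n)"
  unfolding ext_group_def cls_eq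
  by (rule normal.r_coset_hom_Mod)
    (rule comm_group.subgroup_imp_normal[OF zg_comm_group Bd_subgroup_zg])

lemma cls_closed [simp, intro]: "f \<in> Z n \<Longrightarrow> cls n f \<in> carrier (EG n)"
  using hom_in_carrier[OF cls_hom, of f n] by simp

lemma cls_add: "f \<in> Z n \<Longrightarrow> g \<in> Z n \<Longrightarrow> cls n (hadd n f g) = cls n f \<otimes>\<^bsub>EG n\<^esub> cls n g"
  using hom_mult[OF cls_hom, of f n g] by simp

lemma one_EG: "\<one>\<^bsub>EG n\<^esub> = Bd n"
  by (simp add: ext_group_def FactGroup_def)

lemma cls_zero: "f \<in> Bd n \<Longrightarrow> cls n f = \<one>\<^bsub>EG n\<^esub>"
  unfolding one_EG cls_eq
  using group.coset_join2[OF zg_group _ Bd_subgroup_zg, of f] Bd_Z by auto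

lemma EG_cases:
  assumes "X \<in> carrier (EG n)" obtains f where "f \<in> Z n" "X = cls n f"
  using assms unfolding ext_group_def FactGroup_def RCOSETS_def cls_eq by auto

lemma cls_mem:
  assumes f: "f \<in> Z n" and g: "g \<in> cls n f"
  shows "g \<in> Z n" "\<exists>b\<in>Bd n. g = hadd n b f"
proof -
  show "\<exists>b\<in>Bd n. g = hadd n b f"
    using g unfolding ext_class_def r_coset_def by auto
  then show "g \<in> Z n" using Z_add f Bd_Z by blast
qed

lemma cls_self: "f \<in> Z n \<Longrightarrow> f \<in> cls n f"
  unfolding cls_eq using group.rcos_self[OF zg_group _ Bd_subgroup_zg, of f] by simp

lemma cls_eqI:
  assumes f: "f \<in> Z n" and b: "b \<in> Bd n" and g: "g = hadd n b f"
  shows "cls n g = cls n f"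
proof -
  interpret E: comm_group "EG n" by (rule EG_comm_group)
  show ?thesis unfolding g using cls_add[of b n f] cls_zero[OF b] f b Bd_Z by auto
qed

section \<open>Chain lifts and independence of choices\<close>

abbreviation "lifts n f F \<equiv> chain_lift A P d \<epsilon> n f F"

lemma liftsD:
  assumes "lifts n f F"
  shows "F i \<in> bimod_hom A (P (n + i)) (P i)"
    and "x \<in> carrier (P n) \<Longrightarrow> \<epsilon> (F 0 x) = f x"
    and "x \<in> carrier (P (n + Suc i)) \<Longrightarrow> d (Suc i) (F (Suc i) x) = F i (d (n + Suc i) x)"
  using assms by (auto simp: chain_lift_def)

text \<open>The components are chosen one after another by \<open>lift_d\<close>. Two of them are
  prescribed instead of one, so that a product with a class of degree one can be computed from a
  chosen \<open>F1\<close>.\<close>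

lemma lifts_extend:
  assumes F0: "F0 \<in> bimod_hom A (P n) (P 0)" and F1: "F1 \<in> bimod_hom A (P (Suc n)) (P (Suc 0))"
    and e: "\<And>x. x \<in> carrier (P n) \<Longrightarrow> \<epsilon> (F0 x) = f x"
    and c: "\<And>x. x \<in> carrier (P (Suc n)) \<Longrightarrow> d (Suc 0) (F1 x) = F0 (d (Suc n) x)"
  shows "\<exists>F. lifts n f F \<and> F 0 = F0 \<and> F (Suc 0) = F1"
proof -
  \<comment> \<open>What makes the next choice possible: \<open>G\<close> after the following
    differential takes values in the kernel of \<open>d (Suc i)\<close>.\<close>
  let ?Q = "\<lambda>i G. G \<in> bimod_hom A (P (n + Suc i)) (P (Suc i)) \<and> (i = 0 \<longrightarrow> G = F1) \<and>
    (\<forall>x\<in>carrier (P (Suc (n + Suc i))). d (Suc i) (G (d (Suc (n + Suc i)) x)) = \<zero>\<^bsub>P i\<^esub>)"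
  let ?R = "\<lambda>i G G'. \<forall>x\<in>carrier (P (Suc (n + Suc i))). d (Suc (Suc i)) (G' x) = G (d (Suc (n + Suc i)) x)"
  have "\<exists>G. \<forall>i. ?Q i (G i) \<and> ?R i (G i) (G (Suc i))"
  proof (rule dependent_nat_choice)
    show "\<exists>G. ?Q 0 G"
      using F1 by (intro exI[of _ F1]) (simp add: c dd bimod2.hom_zero[OF PP F0])
  next
    fix G i assume Q: "?Q i G"
    then have G: "G \<in> bimod_hom A (P (n + Suc i)) (P (Suc i))" by simp
    have "\<exists>G'\<in>bimod_hom A (P (Suc (n + Suc i))) (P (Suc (Suc i))). \<forall>x\<in>carrier (P (Suc (n + Suc i))).
      d (Suc (Suc i)) (G' x) = compose (carrier (P (Suc (n + Suc i)))) G (d (Suc (n + Suc i))) x"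
      by (rule lift_d[OF comp_PP[OF d_hom G]]) (use Q in \<open>simp add: compose_def\<close>)
    then obtain G' where G': "G' \<in> bimod_hom A (P (Suc (n + Suc i))) (P (Suc (Suc i)))"
      and eq: "\<And>x. x \<in> carrier (P (Suc (n + Suc i))) \<Longrightarrow> d (Suc (Suc i)) (G' x) = G (d (Suc (n + Suc i)) x)"
      by (auto simp: compose_def)
    have "d (Suc (Suc i)) (G' (d (Suc (Suc (n + Suc i))) x)) = \<zero>\<^bsub>P (Suc i)\<^esub>"
      if x: "x \<in> carrier (P (Suc (Suc (n + Suc i))))" for x
      using eq[OF d_closed[OF x]] dd[OF x] bimod2.hom_zero[OF PP G] by simp
    then show "\<exists>G'. ?Q (Suc i) G' \<and> ?R i G G'"
      using G' eq by (intro exI[of _ G']) simp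
  qed
  then obtain G where G: "\<And>i. ?Q i (G i)" "\<And>i. ?R i (G i) (G (Suc i))" by blast
  \<comment> \<open>\<open>G i\<close> is the component in degree \<open>Suc i\<close>.\<close>
  define F where "F = case_nat F0 G"
  have "lifts n f F"
    unfolding chain_lift_def
  proof (intro conjI allI ballI)
    fix i show "F i \<in> bimod_hom A (P (n + i)) (P i)"
      using F0 G(1) by (cases i) (auto simp: F_def)
  next
    fix x assume "x \<in> carrier (P n)"
    then show "\<epsilon> (F 0 x) = f x" by (simp add: F_def e)
  next
    fix i x assume x: "x \<in> carrier (P (n + Suc i))"
    show "d (Suc i) (F (Suc i) x) = F i (d (n + Suc i) x)"
    proof (cases i)
      case 0
      then show ?thesis using G(1)[of 0] c x by (simp add: F_def)
    next
      case (Suc k)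
      then show ?thesis using G(2)[of k] x by (simp add: F_def)
    qed
  qed
  then show ?thesis using G(1)[of 0] by (auto simp: F_def)
qed

lemma lifts_ex1:
  assumes f: "f \<in> Z n" and F0: "F0 \<in> bimod_hom A (P n) (P 0)"
    and e: "\<And>x. x \<in> carrier (P n) \<Longrightarrow> \<epsilon> (F0 x) = f x"
  shows "\<exists>F. lifts n f F \<and> F 0 = F0"
proof -
  have "\<exists>F1\<in>bimod_hom A (P (Suc n)) (P (Suc 0)). \<forall>x\<in>carrier (P (Suc n)).
    d (Suc 0) (F1 x) = compose (carrier (P (Suc n))) F0 (d (Suc n)) x"
    by (rule lift_eps_d[OF comp_PP[OF d_hom F0]]) (simp add: compose_def e Z_d[OF f])
  then obtain F1 where "F1 \<in> bimod_hom A (P (Suc n)) (P (Suc 0))"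
    "\<And>x. x \<in> carrier (P (Suc n)) \<Longrightarrow> d (Suc 0) (F1 x) = F0 (d (Suc n) x)"
    by (auto simp: compose_def)
  then show ?thesis using lifts_extend[OF F0 _ e] by blast
qed

lemma lifts_ex: "f \<in> Z n \<Longrightarrow> \<exists>F. lifts n f F"
  using lifts_ex1 lift_eps[OF Z_hom] by metis

lemma comp_lift_Z:
  assumes g: "g \<in> Z m" and F: "lifts n f F"
  shows "compose (carrier (P (n + m))) g (F m) \<in> Z (n + m)"
proof (rule ZI)
  show "compose (carrier (P (n + m))) g (F m) \<in> bimod_hom A (P (n + m)) M"
    by (rule comp_PP[OF liftsD(1)[OF F] Z_hom[OF g]])
  fix x assume x: "x \<in> carrier (P (Suc (n + m)))"
  have Fx: "F (Suc m) x \<in> carrier (P (Suc m))"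
    using bimod_homD(1)[OF liftsD(1)[OF F, of "Suc m"]] x by simp
  have "g (F m (d (Suc (n + m)) x)) = g (d (Suc m) (F (Suc m) x))"
    using liftsD(3)[OF F, of x m] x by simp
  also have "\<dots> = \<zero>\<^bsub>M\<^esub>" by (rule Z_d[OF g Fx])
  finally show "compose (carrier (P (n + m))) g (F m) (d (Suc (n + m)) x) = \<zero>\<^bsub>M\<^esub>"
    using x by (simp add: compose_def)
qed

text \<open>A chain map lifting zero is null-homotopic. The maps \<open>s\<close> and
  \<open>t\<close> are provided for each degree separately and are not tied into one family, because
  a single degree is enough to recognise a coboundary.\<close>

lemma homotopy:
  assumes G: "\<And>i. G i \<in> bimod_hom A (P (n + i)) (P i)"
    and e: "\<And>x. x \<in> carrier (P n) \<Longrightarrow> \<epsilon> (G 0 x) = \<zero>\<^bsub>M\<^esub>"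
    and c: "\<And>i x. x \<in> carrier (P (n + Suc i)) \<Longrightarrow> d (Suc i) (G (Suc i) x) = G i (d (n + Suc i) x)"
  shows "\<exists>s\<in>bimod_hom A (P n) (P (Suc 0)). \<forall>x\<in>carrier (P n). d (Suc 0) (s x) = G 0 x"
    and "\<exists>s\<in>bimod_hom A (P (n + m)) (P (Suc m)). \<exists>t\<in>bimod_hom A (P (n + Suc m)) (P (Suc (Suc m))).
      \<forall>x\<in>carrier (P (n + Suc m)). G (Suc m) x = d (Suc (Suc m)) (t x) \<oplus>\<^bsub>P (Suc m)\<^esub> s (d (n + Suc m) x)"
proof -
  show base: "\<exists>s\<in>bimod_hom A (P n) (P (Suc 0)). \<forall>x\<in>carrier (P n). d (Suc 0) (s x) = G 0 x"
    using lift_eps_d[of "G 0" n] G[of 0] e by simp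
  have step: "\<exists>t\<in>bimod_hom A (P (n + Suc m)) (P (Suc (Suc m))).
      \<forall>x\<in>carrier (P (n + Suc m)). G (Suc m) x = d (Suc (Suc m)) (t x) \<oplus>\<^bsub>P (Suc m)\<^esub> s (d (n + Suc m) x)"
    if s: "s \<in> bimod_hom A (P (n + m)) (P (Suc m))"
      and ds: "\<And>x. x \<in> carrier (P (n + Suc m)) \<Longrightarrow> d (Suc m) (s (d (n + Suc m) x)) = G m (d (n + Suc m) x)" for s m
  proof -
    have sd: "compose (carrier (P (n + Suc m))) s (d (n + Suc m)) \<in> bimod_hom A (P (n + Suc m)) (P (Suc m))"
      using comp_PP[OF d_hom s] by simp
    \<comment> \<open>\<open>G (Suc m)\<close> minus \<open>s\<close> after \<open>d\<close>: its
      values are cycles, and a lift of it is the next homotopy map.\<close>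
    let ?\<phi> = "\<lambda>x\<in>carrier (P (n + Suc m)). G (Suc m) x \<oplus>\<^bsub>P (Suc m)\<^esub>
      (\<lambda>x\<in>carrier (P (n + Suc m)). \<ominus>\<^bsub>P (Suc m)\<^esub> compose (carrier (P (n + Suc m))) s (d (n + Suc m)) x) x"
    have \<phi>: "?\<phi> \<in> bimod_hom A (P (n + Suc m)) (P (Suc m))"
      by (rule bimod2.hom_add_closed[OF PP G bimod2.hom_minus_closed[OF PP sd]])
    have cl: "G (Suc m) x \<in> carrier (P (Suc m))" "s (d (n + Suc m) x) \<in> carrier (P (Suc m))"
      if "x \<in> carrier (P (n + Suc m))" for x
      using bimod_homD(1)[OF G that] bimod_homD(1)[OF sd that] that by (auto simp: compose_def)
    have "\<exists>t\<in>bimod_hom A (P (n + Suc m)) (P (Suc (Suc m))).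
      \<forall>x\<in>carrier (P (n + Suc m)). d (Suc (Suc m)) (t x) = ?\<phi> x"
    proof (rule lift_d[OF \<phi>])
      fix x assume x: "x \<in> carrier (P (n + Suc m))"
      have "d (Suc m) (G (Suc m) x) \<in> carrier (P m)" using cl(1)[OF x] by simp
      then have Gc: "G m (d (n + Suc m) x) \<in> carrier (P m)" by (simp only: c[OF x])
      have "d (Suc m) (?\<phi> x) = d (Suc m) (G (Suc m) x) \<oplus>\<^bsub>P m\<^esub> (\<ominus>\<^bsub>P m\<^esub> d (Suc m) (s (d (n + Suc m) x)))"
        using x cl[OF x] by (simp add: compose_def bimod_homD(2)[OF d_hom] bimod2.hom_neg[OF PP d_hom])
      also have "\<dots> = \<zero>\<^bsub>P m\<^esub>"
        unfolding ds[OF x] c[OF x] using Gc by (rule P.M.r_neg)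
      finally show "d (Suc m) (?\<phi> x) = \<zero>\<^bsub>P m\<^esub>" .
    qed
    then obtain t where t: "t \<in> bimod_hom A (P (n + Suc m)) (P (Suc (Suc m)))"
      and dt: "\<And>x. x \<in> carrier (P (n + Suc m)) \<Longrightarrow> d (Suc (Suc m)) (t x) = ?\<phi> x" by blast
    have "G (Suc m) x = d (Suc (Suc m)) (t x) \<oplus>\<^bsub>P (Suc m)\<^esub> s (d (n + Suc m) x)"
      if x: "x \<in> carrier (P (n + Suc m))" for x
      unfolding dt[OF x] using x cl[OF x] by (simp add: compose_def P.M.a_assoc P.M.l_neg)
    then show ?thesis using t by blast
  qed
  show "\<exists>s\<in>bimod_hom A (P (n + m)) (P (Suc m)). \<exists>t\<in>bimod_hom A (P (n + Suc m)) (P (Suc (Suc m))).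
      \<forall>x\<in>carrier (P (n + Suc m)). G (Suc m) x = d (Suc (Suc m)) (t x) \<oplus>\<^bsub>P (Suc m)\<^esub> s (d (n + Suc m) x)"
  proof (induction m)
    case 0
    obtain s where s: "s \<in> bimod_hom A (P n) (P (Suc 0))" "\<And>x. x \<in> carrier (P n) \<Longrightarrow> d (Suc 0) (s x) = G 0 x"
      using base by blast
    have "s \<in> bimod_hom A (P (n + 0)) (P (Suc 0))"
      "\<And>x. x \<in> carrier (P (n + Suc 0)) \<Longrightarrow> d (Suc 0) (s (d (n + Suc 0) x)) = G 0 (d (n + Suc 0) x)"
      using s by simp_all
    from step[OF this] this(1) show ?case by blast
  next
    case (Suc m)
    then obtain s t where s: "s \<in> bimod_hom A (P (n + m)) (P (Suc m))"
      and t: "t \<in> bimod_hom A (P (n + Suc m)) (P (Suc (Suc m)))"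
      and strip: "\<And>x. x \<in> carrier (P (n + Suc m)) \<Longrightarrow>
        G (Suc m) x = d (Suc (Suc m)) (t x) \<oplus>\<^bsub>P (Suc m)\<^esub> s (d (n + Suc m) x)" by blast
    have "d (Suc (Suc m)) (t (d (n + Suc (Suc m)) x)) = G (Suc m) (d (n + Suc (Suc m)) x)"
      if x: "x \<in> carrier (P (n + Suc (Suc m)))" for x
    proof -
      have dx: "d (n + Suc (Suc m)) x \<in> carrier (P (n + Suc m))" using d_closed[of x "n + Suc m"] x by simp
      have "s (d (n + Suc m) (d (n + Suc (Suc m)) x)) = \<zero>\<^bsub>P (Suc m)\<^esub>"
        using dd[of x "n + m"] x bimod2.hom_zero[OF PP s] by simp
      moreover have "d (Suc (Suc m)) (t (d (n + Suc (Suc m)) x)) \<in> carrier (P (Suc m))"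
        by (rule d_closed[OF bimod_homD(1)[OF t dx]])
      ultimately show ?thesis unfolding strip[OF dx] by simp
    qed
    from step[OF t this] t show ?case by blast
  qed
qed

text \<open>Two lifts differ by a map of the form d t + s d. The cocycle \<open>g\<close> kills the
  first term and turns the second into the coboundary of g s. For \<open>m = 0\<close> only the term
  killed by \<open>g\<close> is present.\<close>

lemma comp_lift_indep:
  assumes g: "g \<in> Z m" and F: "lifts n f F" and F': "lifts n f F'"
  shows "cls (n + m) (compose (carrier (P (n + m))) g (F m)) = cls (n + m) (compose (carrier (P (n + m))) g (F' m))"
proof -
  define G where "G i = (\<lambda>x\<in>carrier (P (n + i)). F i x \<oplus>\<^bsub>P i\<^esub>
    (\<lambda>x\<in>carrier (P (n + i)). \<ominus>\<^bsub>P i\<^esub> F' i x) x)" for i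
  note FH = liftsD(1)[OF F] and FH' = liftsD(1)[OF F']
  have G: "G i \<in> bimod_hom A (P (n + i)) (P i)" for i
    unfolding G_def by (rule bimod2.hom_add_closed[OF PP FH bimod2.hom_minus_closed[OF PP FH']])
  have Gx: "G i x = F i x \<oplus>\<^bsub>P i\<^esub> (\<ominus>\<^bsub>P i\<^esub> F' i x)" if "x \<in> carrier (P (n + i))" for i x
    using that by (simp add: G_def)
  have FG: "F i x = G i x \<oplus>\<^bsub>P i\<^esub> F' i x" if "x \<in> carrier (P (n + i))" for i x
    using bimod_homD(1)[OF FH that] bimod_homD(1)[OF FH' that]
    by (simp add: Gx[OF that] P.M.a_assoc P.M.l_neg)
  have e: "\<epsilon> (G 0 x) = \<zero>\<^bsub>M\<^esub>" if x: "x \<in> carrier (P n)" for x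
  proof -
    have x0: "x \<in> carrier (P (n + 0))" using x by simp
    have c: "F 0 x \<in> carrier (P 0)" "F' 0 x \<in> carrier (P 0)"
      using bimod_homD(1)[OF FH x0] bimod_homD(1)[OF FH' x0] by auto
    have "\<epsilon> (F' 0 x) \<in> carrier M" using bimod_homD(1)[OF eps_hom c(2)] .
    then show ?thesis
      unfolding Gx[OF x0] using c
      by (simp add: bimod_homD(2)[OF eps_hom] bimod2.hom_neg[OF PM eps_hom] liftsD(2)[OF F x] liftsD(2)[OF F' x] M.M.r_neg)
  qed
  have c: "d (Suc i) (G (Suc i) x) = G i (d (n + Suc i) x)" if x: "x \<in> carrier (P (n + Suc i))" for i x
  proof -
    have dx: "d (n + Suc i) x \<in> carrier (P (n + i))" using d_closed[of x "n + i"] x by simp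
    have c: "F (Suc i) x \<in> carrier (P (Suc i))" "F' (Suc i) x \<in> carrier (P (Suc i))"
      using bimod_homD(1)[OF FH x] bimod_homD(1)[OF FH' x] by auto
    show ?thesis
      unfolding Gx[OF x] Gx[OF dx] using c
      by (simp only: bimod_homD(2)[OF d_hom] bimod2.hom_neg[OF PP d_hom] liftsD(3)[OF F x] liftsD(3)[OF F' x] P.M.a_inv_closed)
  qed
  note hom = homotopy[OF G e c]
  define b where "b = compose (carrier (P (n + m))) g (G m)"
  have gc: "compose (carrier (P (n + m))) g (F m) = hadd (n + m) b (compose (carrier (P (n + m))) g (F' m))"
    unfolding b_def
    using FG bimod_homD(1)[OF G] bimod_homD(1)[OF FH']
    by (auto simp: compose_def bimod_homD(2)[OF Z_hom[OF g]] intro!: restrict_ext)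
  have "b \<in> Bd (n + m)"
  proof (cases m)
    case 0
    obtain s where s: "s \<in> bimod_hom A (P n) (P (Suc 0))" "\<And>x. x \<in> carrier (P n) \<Longrightarrow> d (Suc 0) (s x) = G 0 x"
      using hom(1) by blast
    have "g (G 0 x) = \<zero>\<^bsub>M\<^esub>" if "x \<in> carrier (P n)" for x
      using Z_d[OF g[unfolded 0] bimod_homD(1)[OF s(1) that]] s(2)[OF that] by simp
    then have "b = \<one>\<^bsub>hg (n + m)\<^esub>"
      by (auto simp: b_def compose_def 0 intro!: restrict_ext)
    then show ?thesis using subgroup.one_closed[OF Bd_subgroup] by metis
  next
    case (Suc k)
    obtain s t where s: "s \<in> bimod_hom A (P (n + k)) (P (Suc k))"
      and t: "t \<in> bimod_hom A (P (n + Suc k)) (P (Suc (Suc k)))"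
      and strip: "\<And>x. x \<in> carrier (P (n + Suc k)) \<Longrightarrow>
        G (Suc k) x = d (Suc (Suc k)) (t x) \<oplus>\<^bsub>P (Suc k)\<^esub> s (d (n + Suc k) x)"
      using hom(2) by blast
    have gH: "g \<in> bimod_hom A (P (Suc k)) M" using Z_hom[OF g] Suc by simp
    have "g (G (Suc k) x) = g (s (d (n + Suc k) x))" if x: "x \<in> carrier (P (n + Suc k))" for x
    proof -
      have tx: "t x \<in> carrier (P (Suc (Suc k)))" by (rule bimod_homD(1)[OF t x])
      have sx: "s (d (n + Suc k) x) \<in> carrier (P (Suc k))"
        using bimod_homD(1)[OF s, of "d (n + Suc k) x"] d_closed[of x "n + k"] x by simp
      show ?thesis
        unfolding strip[OF x] bimod_homD(2)[OF gH d_closed[OF tx] sx]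
        using Z_d[OF g[unfolded Suc] tx] bimod_homD(1)[OF gH sx] by simp
    qed
    then have "b = compose (carrier (P (Suc (n + k)))) (compose (carrier (P (n + k))) g s) (d (Suc (n + k)))"
      by (auto simp: b_def compose_def Suc intro!: restrict_ext)
    moreover have "compose (carrier (P (n + k))) g s \<in> bimod_hom A (P (n + k)) M"
      by (rule comp_PP[OF s gH])
    ultimately show ?thesis unfolding Suc add_Suc_right ext_coboundaries.simps by blast
  qed
  then show ?thesis by (rule cls_eqI[OF comp_lift_Z[OF g F'] _ gc])
qed

text \<open>Changing \<open>g\<close> by h d changes the composite by h F' d, a coboundary since a
  lift commutes with the differentials. Changing \<open>f\<close> by h d is matched by a change of
  its lift in component zero, which affects the composite for \<open>m = 0\<close> alone and there
  by a coboundary.\<close>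

lemma comp_lift_cls:
  assumes f: "f \<in> Z n" and g: "g \<in> Z m" and F: "lifts n f F"
    and f': "f' \<in> cls n f" and g': "g' \<in> cls m g" and F': "lifts n f' F'"
  shows "cls (n + m) (compose (carrier (P (n + m))) g' (F' m)) = cls (n + m) (compose (carrier (P (n + m))) g (F m))"
proof -
  let ?c = "\<lambda>g F. compose (carrier (P (n + m))) g (F m)"
  obtain b where b: "b \<in> Bd m" "g' = hadd m b g" using cls_mem(2)[OF g g'] by blast
  have bZ: "b \<in> Z m" using b Bd_Z by blast
  have FmH: "F m \<in> bimod_hom A (P (n + m)) (P m)" by (rule liftsD(1)[OF F])
  have Fm': "F' m \<in> bimod_hom A (P (n + m)) (P m)" by (rule liftsD(1)[OF F'])
  have 1: "cls (n + m) (?c g' F') = cls (n + m) (?c g F')"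
  proof (rule cls_eqI[OF comp_lift_Z[OF g F']])
    show "?c g' F' = hadd (n + m) (?c b F') (?c g F')"
      by (auto simp: b compose_def bimod_homD(1)[OF Fm'] intro!: restrict_ext)
    show "?c b F' \<in> Bd (n + m)"
    proof (cases m)
      case 0
      then have "?c b F' = \<one>\<^bsub>hg (n + m)\<^esub>"
        using b bimod_homD(1)[OF Fm'] by (auto simp: compose_def intro!: restrict_ext)
      then show ?thesis using subgroup.one_closed[OF Bd_subgroup] by metis
    next
      case (Suc k)
      then obtain h where h: "h \<in> bimod_hom A (P k) M" "b = compose (carrier (P (Suc k))) h (d (Suc k))"
        using b by auto
      have "?c b F' = compose (carrier (P (Suc (n + k)))) (compose (carrier (P (n + k))) h (F' k)) (d (Suc (n + k)))"
      proof -
        have "?c b F' x = compose (carrier (P (Suc (n + k)))) (compose (carrier (P (n + k))) h (F' k)) (d (Suc (n + k))) x"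
          if x: "x \<in> carrier (P (n + Suc k))" for x
          using x bimod_homD(1)[OF liftsD(1)[OF F', of "Suc k"] x] liftsD(3)[OF F' x]
          by (simp add: compose_def Suc h)
        then show ?thesis by (intro extensionalityI[of _ "carrier (P (n + Suc k))"]) (auto simp: Suc compose_def)
      qed
      moreover have "compose (carrier (P (n + k))) h (F' k) \<in> bimod_hom A (P (n + k)) M"
        by (rule comp_PP[OF liftsD(1)[OF F'] h(1)])
      ultimately show ?thesis unfolding Suc add_Suc_right ext_coboundaries.simps by blast
    qed
  qed
  have "\<exists>F''. lifts n f' F'' \<and> cls (n + m) (?c g F'') = cls (n + m) (?c g F)"
  proof (cases n)
    case 0
    obtain c where c: "c \<in> Bd n" "f' = hadd n c f" using cls_mem(2)[OF f f'] by blast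
    have "f' x = f x" if "x \<in> carrier (P n)" for x
      using c 0 that bimod_homD(1)[OF Z_hom[OF f] that] by simp
    then have "lifts n f' F" using F by (simp add: chain_lift_def)
    then show ?thesis by blast
  next
    case (Suc k)
    then obtain h where h: "h \<in> bimod_hom A (P k) M" "f' = hadd n (compose (carrier (P (Suc k))) h (d (Suc k))) f"
      using cls_mem(2)[OF f f'] by auto
    obtain s where s: "s \<in> bimod_hom A (P k) (P 0)" "\<And>x. x \<in> carrier (P k) \<Longrightarrow> \<epsilon> (s x) = h x"
      using lift_eps[OF h(1)] by blast
    let ?sd = "compose (carrier (P (Suc k))) s (d (Suc k))"
    have sd: "?sd \<in> bimod_hom A (P (Suc k)) (P 0)" by (rule comp_PP[OF d_hom s(1)])
    have F0: "F 0 \<in> bimod_hom A (P (Suc k)) (P 0)" using liftsD(1)[OF F, of 0] Suc by simp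
    let ?F0 = "\<lambda>x\<in>carrier (P (Suc k)). ?sd x \<oplus>\<^bsub>P 0\<^esub> F 0 x"
    have F0': "?F0 \<in> bimod_hom A (P (Suc k)) (P 0)"
      by (rule bimod2.hom_add_closed[OF PP sd F0])
    \<comment> \<open>Adding s d to component zero lifts the added coboundary; the higher components
      may stay, because s d d is zero.\<close>
    define F'' where "F'' = F(0 := ?F0)"
    have "lifts n f' F''"
      unfolding chain_lift_def
    proof (intro conjI allI ballI)
      fix i show "F'' i \<in> bimod_hom A (P (n + i)) (P i)"
        using F0' liftsD(1)[OF F, of i] Suc by (cases "i = 0") (auto simp: F''_def)
    next
      fix x assume x: "x \<in> carrier (P n)"
      then have x': "x \<in> carrier (P (Suc k))" using Suc by simp
      show "\<epsilon> (F'' 0 x) = f' x"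
        using x' bimod_homD(1)[OF sd x'] bimod_homD(1)[OF F0 x'] liftsD(2)[OF F x] s(2)[OF d_closed[OF x']]
        by (simp add: F''_def h Suc bimod_homD(2)[OF eps_hom] compose_def)
    next
      fix i x assume x: "x \<in> carrier (P (n + Suc i))"
      show "d (Suc i) (F'' (Suc i) x) = F'' i (d (n + Suc i) x)"
      proof (cases i)
        case 0
        have x': "x \<in> carrier (P (Suc (Suc k)))" using x Suc 0 by simp
        have "F 0 (d (Suc (Suc k)) x) \<in> carrier (P 0)" by (rule bimod_homD(1)[OF F0 d_closed[OF x']])
        then show ?thesis
          using liftsD(3)[OF F x] x' d_closed[OF x'] dd[OF x']
          by (simp add: F''_def 0 Suc compose_def bimod2.hom_zero[OF PP s(1)])
      next
        case (Suc j)
        then show ?thesis using liftsD(3)[OF F x] by (simp add: F''_def)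
      qed
    qed
    moreover have "cls (n + m) (?c g F'') = cls (n + m) (?c g F)"
    proof (cases m)
      case 0
      have gH: "g \<in> bimod_hom A (P 0) M" using Z_hom[OF g] 0 by simp
      show ?thesis
      proof (rule cls_eqI[OF comp_lift_Z[OF g F]])
        have "compose (carrier (P k)) g s \<in> bimod_hom A (P k) M" by (rule comp_PP[OF s(1) gH])
        then show "compose (carrier (P (Suc k))) (compose (carrier (P k)) g s) (d (Suc k)) \<in> Bd (n + m)"
          unfolding 0 Suc add_0_right ext_coboundaries.simps by blast
        show "?c g F'' = hadd (n + m) (compose (carrier (P (Suc k))) (compose (carrier (P k)) g s) (d (Suc k))) (?c g F)"
          using bimod_homD(1)[OF sd] bimod_homD(1)[OF F0]
          by (auto simp: 0 Suc F''_def compose_def bimod_homD(2)[OF gH] intro!: restrict_ext)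
      qed
    qed (simp add: F''_def)
    ultimately show ?thesis by blast
  qed
  then obtain F'' where "lifts n f' F''" "cls (n + m) (?c g F'') = cls (n + m) (?c g F)" by blast
  then show ?thesis using 1 comp_lift_indep[OF g F'] by metis
qed

text \<open>All choices lead to one class, so the union in \<open>yoneda\<close> is taken over a
  singleton.\<close>

lemma yoneda_cls:
  assumes f: "f \<in> Z n" and g: "g \<in> Z m" and F: "lifts n f F"
  shows "yoneda A P d \<epsilon> M m n (cls m g) (cls n f) = cls (n + m) (compose (carrier (P (n + m))) g (F m))"
proof -
  have "{cls (n + m) (compose (carrier (P (n + m))) g' (F' m)) | g' f' F'.
      g' \<in> cls m g \<and> f' \<in> cls n f \<and> lifts n f' F'} = {cls (n + m) (compose (carrier (P (n + m))) g (F m))}"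
    using comp_lift_cls[OF f g F] cls_self[OF f] cls_self[OF g] F by blast
  then show ?thesis by (simp add: yoneda_def)
qed

section \<open>Ring operations on finitely supported families of classes\<close>

abbreviation "ER \<equiv> ext_ring A P d \<epsilon> M"
abbreviation "hm n f \<equiv> ext_homogeneous A P d M n f"

lemma EG_group: "group (EG n)"
  using EG_comm_group by (rule comm_group.axioms)

lemma EG_one_closed [simp]: "\<one>\<^bsub>EG n\<^esub> \<in> carrier (EG n)"
  by (rule monoid.one_closed[OF group.is_monoid[OF EG_group]])

lemma ER_carrier: "x \<in> carrier ER \<longleftrightarrow> (\<forall>n. x n \<in> carrier (EG n)) \<and> finite {n. x n \<noteq> \<one>\<^bsub>EG n\<^esub>}"
  by (simp add: ext_ring_def Let_def carrier_sum_group EG_group PiE_iff)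

lemma ER_add: "add ER = (\<lambda>x y n. x n \<otimes>\<^bsub>EG n\<^esub> y n)"
  by (simp add: ext_ring_def Let_def restrict_def)

lemma ER_mult: "mult ER = (\<lambda>y x n. finprod (EG n)
    (\<lambda>m. yoneda A P d \<epsilon> M m (n - m) (y m) (x (n - m))) {..n})"
  by (simp add: ext_ring_def Let_def)

lemma ER_add_monoid: "add_monoid ER = sum_group UNIV EG"
  by (rule monoid.equality) (simp_all add: ext_ring_def Let_def)

lemma ER_add_closed: "x \<in> carrier ER \<Longrightarrow> y \<in> carrier ER \<Longrightarrow> x \<oplus>\<^bsub>ER\<^esub> y \<in> carrier ER"
  using monoid.m_closed[OF group.is_monoid[OF sum_group[of UNIV EG, OF EG_group]], of x y]
  unfolding ER_add_monoid[symmetric] by simp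

lemma ER_a_inv_closed: "x \<in> carrier ER \<Longrightarrow> \<ominus>\<^bsub>ER\<^esub> x \<in> carrier ER"
  using group.inv_closed[OF sum_group[of UNIV EG, OF EG_group], of x]
  unfolding ER_add_monoid[symmetric] a_inv_def by simp

lemma hm_closed: "f \<in> Z n \<Longrightarrow> hm n f \<in> carrier ER"
  unfolding ER_carrier ext_homogeneous_def
  by (auto intro!: finite_subset[of _ "{n}"] split: if_splits)

lemma hm_add: "f \<in> Z n \<Longrightarrow> g \<in> Z n \<Longrightarrow> hm n f \<oplus>\<^bsub>ER\<^esub> hm n g = hm n (hadd n f g)"
  using monoid.l_one[OF group.is_monoid[OF EG_group] EG_one_closed]
  by (auto simp: ER_add ext_homogeneous_def cls_add intro!: ext)

lemma eps_Z: "\<epsilon> \<in> Z 0"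
  by (rule ZI[OF eps_hom eps_d])

lemma ER_one: "\<one>\<^bsub>ER\<^esub> = hm 0 \<epsilon>"
  by (auto simp: ext_ring_def Let_def ext_homogeneous_def)

lemma yoneda_closed:
  assumes "Y \<in> carrier (EG m)" "X \<in> carrier (EG n)"
  shows "yoneda A P d \<epsilon> M m n Y X \<in> carrier (EG (n + m))"
proof -
  obtain f g F where "f \<in> Z n" "X = cls n f" "g \<in> Z m" "Y = cls m g" "lifts n f F"
    using assms EG_cases lifts_ex by metis
  then show ?thesis using yoneda_cls comp_lift_Z by (metis cls_closed)
qed

lemma zero_Z: "(\<lambda>x\<in>carrier (P n). \<zero>\<^bsub>M\<^esub>) \<in> Z n"
  using subgroup.one_closed[OF Z_subgroup] by simp

lemma cls_zero_map: "cls n (\<lambda>x\<in>carrier (P n). \<zero>\<^bsub>M\<^esub>) = \<one>\<^bsub>EG n\<^esub>"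
  using cls_zero[OF subgroup.one_closed[OF Bd_subgroup]] by simp

lemma yoneda_one_left:
  assumes "X \<in> carrier (EG n)"
  shows "yoneda A P d \<epsilon> M m n \<one>\<^bsub>EG m\<^esub> X = \<one>\<^bsub>EG (n + m)\<^esub>"
proof -
  obtain f F where f: "f \<in> Z n" "X = cls n f" and F: "lifts n f F"
    using assms EG_cases lifts_ex by metis
  have "compose (carrier (P (n + m))) (\<lambda>x\<in>carrier (P m). \<zero>\<^bsub>M\<^esub>) (F m) = (\<lambda>x\<in>carrier (P (n + m)). \<zero>\<^bsub>M\<^esub>)"
    using bimod_homD(1)[OF liftsD(1)[OF F]] by (auto simp: compose_def intro!: restrict_ext)
  then show ?thesis
    using yoneda_cls[OF f(1) zero_Z F] by (simp add: cls_zero_map f(2))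
qed

lemma yoneda_one_right:
  assumes "Y \<in> carrier (EG m)"
  shows "yoneda A P d \<epsilon> M m n Y \<one>\<^bsub>EG n\<^esub> = \<one>\<^bsub>EG (n + m)\<^esub>"
proof -
  obtain g where g: "g \<in> Z m" "Y = cls m g"
    using assms EG_cases by metis
  have F: "lifts n (\<lambda>x\<in>carrier (P n). \<zero>\<^bsub>M\<^esub>) (\<lambda>i. \<lambda>x\<in>carrier (P (n + i)). \<zero>\<^bsub>P i\<^esub>)"
    using d_closed[of _ "n + i" for i]
    by (auto simp: chain_lift_def bimod2.hom_zero_closed[OF PP] bimod2.hom_zero[OF PM eps_hom] bimod2.hom_zero[OF PP d_hom])
  have "compose (carrier (P (n + m))) g (\<lambda>x\<in>carrier (P (n + m)). \<zero>\<^bsub>P m\<^esub>) = (\<lambda>x\<in>carrier (P (n + m)). \<zero>\<^bsub>M\<^esub>)"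
    by (auto simp: compose_def bimod2.hom_zero[OF PM Z_hom[OF g(1)]] intro!: restrict_ext)
  then show ?thesis
    using yoneda_cls[OF zero_Z g(1) F] by (simp add: cls_zero_map g(2))
qed

text \<open>A term of the convolution is trivial as soon as one of its factors is, so the support of
  the product lies in the sumset of the two supports.\<close>

lemma ER_mult_closed:
  assumes y: "y \<in> carrier ER" and x: "x \<in> carrier ER"
  shows "y \<otimes>\<^bsub>ER\<^esub> x \<in> carrier ER"
  unfolding ER_carrier
proof (intro conjI allI)
  have yc: "y j \<in> carrier (EG j)" and xc: "x j \<in> carrier (EG j)" for j
    using x y by (auto simp: ER_carrier)
  let ?t = "\<lambda>n m. yoneda A P d \<epsilon> M m (n - m) (y m) (x (n - m))"
  have t: "?t n m \<in> carrier (EG n)" if "m \<le> n" for n m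
    using yoneda_closed[OF yc[of m] xc[of "n - m"]] that by simp
  show "(y \<otimes>\<^bsub>ER\<^esub> x) n \<in> carrier (EG n)" for n
    unfolding ER_mult using t by (intro comm_monoid.finprod_closed[OF comm_group.axioms(1)[OF EG_comm_group]]) auto
  let ?S = "(\<lambda>(m, k). m + k) ` ({m. y m \<noteq> \<one>\<^bsub>EG m\<^esub>} \<times> {k. x k \<noteq> \<one>\<^bsub>EG k\<^esub>})"
  have "{n. (y \<otimes>\<^bsub>ER\<^esub> x) n \<noteq> \<one>\<^bsub>EG n\<^esub>} \<subseteq> ?S"
  proof
    fix n assume n: "n \<in> {n. (y \<otimes>\<^bsub>ER\<^esub> x) n \<noteq> \<one>\<^bsub>EG n\<^esub>}"
    show "n \<in> ?S"
    proof (rule ccontr)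
      assume nS: "n \<notin> ?S"
      have t1: "?t n m = \<one>\<^bsub>EG n\<^esub>" if m: "m \<le> n" for m
      proof (cases "y m = \<one>\<^bsub>EG m\<^esub>")
        case True
        then show ?thesis using yoneda_one_left[OF xc[of "n - m"], of m] m by simp
      next
        case False
        have "n = m + (n - m)" using m by simp
        then have "x (n - m) = \<one>\<^bsub>EG (n - m)\<^esub>" using nS False by (auto simp: image_iff)
        then show ?thesis using yoneda_one_right[OF yc[of m], of "n - m"] m by simp
      qed
      have "(y \<otimes>\<^bsub>ER\<^esub> x) n = \<one>\<^bsub>EG n\<^esub>"
        unfolding ER_mult
        by (rule comm_monoid.finprod_one_eqI[OF comm_group.axioms(1)[OF EG_comm_group]]) (use t1 in auto)
      then show False using n by simp
    qed
  qed
  moreover have "finite ?S" using x y by (auto simp: ER_carrier)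
  ultimately show "finite {n. (y \<otimes>\<^bsub>ER\<^esub> x) n \<noteq> \<one>\<^bsub>EG n\<^esub>}" by (rule finite_subset)
qed

lemma hm_mult:
  assumes f: "f \<in> Z n" and g: "g \<in> Z m" and F: "lifts n f F"
  shows "hm m g \<otimes>\<^bsub>ER\<^esub> hm n f = hm (n + m) (compose (carrier (P (n + m))) g (F m))"
proof
  fix k
  let ?c = "cls (n + m) (compose (carrier (P (n + m))) g (F m))"
  let ?t = "\<lambda>j. yoneda A P d \<epsilon> M j (k - j) (hm m g j) (hm n f (k - j))"
  interpret Ek: comm_group "EG k" by (rule EG_comm_group)
  have hc: "hm m g j \<in> carrier (EG j)" "hm n f j \<in> carrier (EG j)" for j
    using hm_closed[OF f] hm_closed[OF g] by (auto simp: ER_carrier)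
  have t1: "?t j = (if j = m \<and> k = n + m then ?c else \<one>\<^bsub>EG k\<^esub>)" if j: "j \<le> k" for j
  proof (cases "j = m")
    case False
    then have "hm m g j = \<one>\<^bsub>EG j\<^esub>" by (simp add: ext_homogeneous_def)
    then show ?thesis using yoneda_one_left[OF hc(2)[of "k - j"], of j] j False by simp
  next
    case True
    show ?thesis
    proof (cases "k = n + m")
      case k: True
      then show ?thesis using True yoneda_cls[OF f g F] by (simp add: ext_homogeneous_def)
    next
      case k: False
      then have "hm n f (k - j) = \<one>\<^bsub>EG (k - j)\<^esub>" using j True by (auto simp: ext_homogeneous_def)
      then show ?thesis using yoneda_one_right[OF hc(1)[of j], of "k - j"] j k by simp
    qed
  qed
  show "(hm m g \<otimes>\<^bsub>ER\<^esub> hm n f) k = hm (n + m) (compose (carrier (P (n + m))) g (F m)) k"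
  proof (cases "k = n + m")
    case True
    have c: "?c \<in> carrier (EG k)" using comp_lift_Z[OF g F] True by auto
    have "(hm m g \<otimes>\<^bsub>ER\<^esub> hm n f) k = finprod (EG k) (\<lambda>j. if m = j then ?c else \<one>\<^bsub>EG k\<^esub>) {..k}"
      unfolding ER_mult by (rule Ek.finprod_cong') (use c t1 True in auto)
    also have "\<dots> = ?c"
      using Ek.finprod_singleton[of m "{..k}" "\<lambda>_. ?c"] c True by simp
    finally show ?thesis using True by (simp add: ext_homogeneous_def)
  next
    case False
    have "(hm m g \<otimes>\<^bsub>ER\<^esub> hm n f) k = \<one>\<^bsub>EG k\<^esub>"
      unfolding ER_mult by (rule Ek.finprod_one_eqI) (use t1 False in auto)
    then show ?thesis using False by (simp add: ext_homogeneous_def)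
  qed
qed

lemma generate_ER_subset:
  assumes "S \<subseteq> carrier ER" shows "generate_ring ER S \<subseteq> carrier ER"
proof
  fix x assume "x \<in> generate_ring ER S"
  then show "x \<in> carrier ER"
  proof (induction rule: generate_ring.induct)
    case one
    show ?case unfolding ER_one by (rule hm_closed[OF eps_Z])
  qed (use assms in \<open>auto intro: ER_a_inv_closed ER_add_closed ER_mult_closed\<close>)
qed

text \<open>Supports are finite, so an element is exhausted by splitting off one homogeneous
  component at a time.\<close>

lemma ER_subset:
  assumes hmS: "\<And>n f. f \<in> Z n \<Longrightarrow> hm n f \<in> S"
    and add: "\<And>x y. x \<in> S \<Longrightarrow> y \<in> S \<Longrightarrow> x \<oplus>\<^bsub>ER\<^esub> y \<in> S"
  shows "carrier ER \<subseteq> S"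
proof
  fix x assume x: "x \<in> carrier ER"
  have "finite D \<Longrightarrow> x \<in> carrier ER \<Longrightarrow> {n. x n \<noteq> \<one>\<^bsub>EG n\<^esub>} \<subseteq> D \<Longrightarrow> x \<in> S" for D x
  proof (induction D arbitrary: x rule: finite_induct)
    case empty
    then have "x k = hm 0 (\<lambda>x\<in>carrier (P 0). \<zero>\<^bsub>M\<^esub>) k" for k
      by (simp add: ext_homogeneous_def cls_zero_map)
    then have "x = hm 0 (\<lambda>x\<in>carrier (P 0). \<zero>\<^bsub>M\<^esub>)" by blast
    then show ?case using hmS[OF zero_Z[of 0]] by simp
  next
    case (insert n D)
    obtain f where f: "f \<in> Z n" "x n = cls n f"
      using insert.prems(1) EG_cases by (metis ER_carrier)
    let ?y = "x(n := \<one>\<^bsub>EG n\<^esub>)"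
    have xc: "x k \<in> carrier (EG k)" for k using insert.prems(1) by (simp add: ER_carrier)
    have "?y \<in> carrier ER"
      unfolding ER_carrier using xc insert.hyps(1) insert.prems(2)
      by (auto intro!: finite_subset[of _ D])
    then have "?y \<in> S" by (rule insert.IH) (use insert.prems(2) in auto)
    moreover have "x = hm n f \<oplus>\<^bsub>ER\<^esub> ?y"
      using xc monoid.l_one[OF group.is_monoid[OF EG_group]] monoid.r_one[OF group.is_monoid[OF EG_group]]
      by (intro ext) (auto simp: ER_add ext_homogeneous_def f(2)[symmetric])
    ultimately show ?case using add[OF hmS[OF f(1)], of ?y] by simp
  qed
  then show "x \<in> S" using x by (auto simp: ER_carrier)
qed

end

section \<open>The algebra in coordinates\<close>

abbreviation lk :: "'k::field free_alg \<Rightarrow> arrow list \<Rightarrow> 'k" where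
  "lk p w \<equiv> poly_mapping.lookup p (Path w)"

definition sg :: "arrow list \<Rightarrow> 'k::field free_alg" where
  "sg w = Poly_Mapping.single (Path w) 1"

definition cst :: "'k::field \<Rightarrow> 'k free_alg" where
  "cst c = Poly_Mapping.single (Path []) c"

section \<open>Alternating words and convolution in the free algebra\<close>

fun flip :: "arrow \<Rightarrow> arrow" where
  "flip Arr_a = Arr_abar"
| "flip Arr_abar = Arr_a"

primrec altw :: "arrow \<Rightarrow> nat \<Rightarrow> arrow list" where
  "altw s 0 = []"
| "altw s (Suc n) = s # altw (flip s) n"

lemma flip_flip [simp]: "flip (flip s) = s"
  by (cases s) auto

lemma flip_neq [simp]: "flip s \<noteq> s" "s \<noteq> flip s"
  by (cases s; simp)+

lemma neq_iff_flip: "x \<noteq> s \<longleftrightarrow> x = flip s"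
  by (cases s; cases x; simp)

lemma length_altw [simp]: "length (altw s n) = n"
  by (induction n arbitrary: s) auto

lemma hd_altw: "0 < n \<Longrightarrow> hd (altw s n) = s"
  by (cases n) auto

lemma distinct_adj_altw [simp]: "distinct_adj (altw s n)"
proof (induction n arbitrary: s)
  case (Suc n)
  then show ?case using Suc[of "flip s"] by (cases n) simp_all
qed simp

lemma distinct_adj_eq_altw: "distinct_adj w \<Longrightarrow> w = altw (hd w) (length w)"
proof (induction w)
  case (Cons x w)
  show ?case
  proof (cases w)
    case (Cons y v)
    then have "y = flip x" using Cons.prems neq_iff_flip[of y x] by auto
    then show ?thesis using Cons Cons.IH Cons.prems distinct_adj_ConsD by fastforce
  qed simp
qed simp

lemma distinct_adj_cases: "distinct_adj w \<Longrightarrow> w = altw Arr_a (length w) \<or> w = altw Arr_abar (length w)"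
  using distinct_adj_eq_altw[of w] by (cases "hd w") auto

lemma altw_inj: "altw s n = altw t m \<longleftrightarrow> n = m \<and> (n = 0 \<or> s = t)"
  by (metis altw.simps(1) hd_altw length_altw neq0_conv)

lemma altw_add: "altw s (m + n) = altw s m @ altw (if even m then s else flip s) n"
  by (induction m arbitrary: s) auto

lemma altw_Suc: "altw s (Suc n) = altw s n @ [if even n then s else flip s]"
  using altw_add[of s n 1] by simp

lemma nonalt_split: "\<not> distinct_adj w \<Longrightarrow> \<exists>u x v. w = u @ [x, x] @ v"
proof (induction w)
  case (Cons y w)
  show ?case
  proof (cases "distinct_adj w")
    case True
    then have "w \<noteq> []" "hd w = y" using Cons.prems by (auto simp: distinct_adj_Cons)
    then have "y # w = [] @ [y, y] @ tl w" by (cases w) auto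
    then show ?thesis by blast
  next
    case False
    then obtain u x v where "w = u @ [x, x] @ v" using Cons.IH by blast
    then have "y # w = (y # u) @ [x, x] @ v" by simp
    then show ?thesis by blast
  qed
qed simp

text \<open>A word factors only into a prefix and the remaining suffix, so the convolution over all
  pairs of paths collapses to a sum over the cutting point.\<close>

lemma lookup_path_mult:
  fixes p q :: "'k::field free_alg"
  shows "lk (p * q) w = (\<Sum>i\<le>length w. lk p (take i w) * lk q (drop i w))"
proof -
  have inner: "(\<Sum>r. poly_mapping.lookup q r when Path w = Path u + r) = (if take (length u) w = u then lk q (drop (length u) w) else 0)" for u
  proof (cases "take (length u) w = u")
    case True
    have "(Path w = Path u + r) = (r = Path (drop (length u) w))" for r
      using True by (cases r) (metis append_eq_conv_conj path.inject plus_path.simps)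
    then show ?thesis using True by simp
  next
    case False
    have "Path w \<noteq> Path u + r" for r
      using False by (cases r) auto
    then show ?thesis using False by simp
  qed
  have "lk (p * q) w = (\<Sum>l. poly_mapping.lookup p l * (\<Sum>r. poly_mapping.lookup q r when Path w = l + r))"
    by (rule lookup_mult)
  also have "\<dots> = (\<Sum>l\<in>(\<lambda>i. Path (take i w)) ` {..length w}. poly_mapping.lookup p l * (\<Sum>r. poly_mapping.lookup q r when Path w = l + r))"
  proof (rule Sum_any.expand_superset)
    show "{l. poly_mapping.lookup p l * (\<Sum>r. poly_mapping.lookup q r when Path w = l + r) \<noteq> 0} \<subseteq> (\<lambda>i. Path (take i w)) ` {..length w}"
    proof
      fix l assume l: "l \<in> {l. poly_mapping.lookup p l * (\<Sum>r. poly_mapping.lookup q r when Path w = l + r) \<noteq> 0}"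
      obtain u where u: "l = Path u" by (cases l)
      then have t: "take (length u) w = u" using l by (auto simp: inner split: if_splits)
      then have "length u \<le> length w" by (metis length_take min.cobounded1)
      then show "l \<in> (\<lambda>i. Path (take i w)) ` {..length w}" using u t by (auto intro!: image_eqI[of _ _ "length u"])
    qed
  qed simp
  also have "\<dots> = (\<Sum>i\<le>length w. lk p (take i w) * (\<Sum>r. poly_mapping.lookup q r when Path w = Path (take i w) + r))"
  proof (subst sum.reindex)
    show "inj_on (\<lambda>i. Path (take i w)) {..length w}"
      by (rule inj_onI) (metis atMost_iff length_take min.absorb2 path.inject)
  qed simp
  also have "\<dots> = (\<Sum>i\<le>length w. lk p (take i w) * lk q (drop i w))"
    by (intro sum.cong) (auto simp: inner min_absorb2)
  finally show ?thesis .
qed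

lemma lk_sg: "lk (sg u) w = (if w = u then 1 else 0)"
  by (auto simp: sg_def lookup_single when_def)

lemma lk_cst: "lk (cst c) w = (if w = [] then c else 0)"
  by (auto simp: cst_def lookup_single when_def)

lemma lk_sg_left: "lk (sg u * p) w = (if take (length u) w = u then lk p (drop (length u) w) else 0)"
proof -
  have "lk (sg u * p) w = (\<Sum>i\<le>length w. if i = length u then (if take (length u) w = u then lk p (drop (length u) w) else 0) else 0)"
    unfolding lookup_path_mult by (intro sum.cong) (auto simp: lk_sg)
  also have "\<dots> = (if take (length u) w = u then lk p (drop (length u) w) else 0)"
  proof -
    have "take (length u) w = u \<Longrightarrow> length u \<le> length w" by (metis length_take min.cobounded1)
    then show ?thesis by simp
  qed
  finally show ?thesis .
qed

lemma lk_sg_right: "lk (p * sg u) (v @ u) = lk p v"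
proof -
  have "lk (p * sg u) (v @ u) = (\<Sum>i\<le>length (v @ u). if i = length v then lk p v else 0)"
    unfolding lookup_path_mult
  proof (intro sum.cong refl)
    fix i assume i: "i \<in> {..length (v @ u)}"
    show "lk p (take i (v @ u)) * lk (sg u) (drop i (v @ u)) = (if i = length v then lk p v else 0)"
    proof (cases "i = length v")
      case False
      then have "length (drop i (v @ u)) \<noteq> length u" using i by auto
      then have "drop i (v @ u) \<noteq> u" by metis
      then show ?thesis using False by (simp add: lk_sg)
    qed (simp add: lk_sg)
  qed
  then show ?thesis by simp
qed

lemma lk_sg_right_zero: "(\<And>v. w \<noteq> v @ u) \<Longrightarrow> lk (p * sg u) w = 0"
  unfolding lookup_path_mult
  by (intro sum.neutral) (auto simp: lk_sg, metis append_take_drop_id)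

lemma lk_cst_left [simp]: "lk (cst c * p) w = c * lk p w"
proof -
  have "lk (cst c * p) w = (\<Sum>i\<le>length w. if i = 0 then c * lk p w else 0)"
    unfolding lookup_path_mult by (intro sum.cong) (auto simp: lk_cst)
  then show ?thesis by simp
qed

lemma lk_cst_right [simp]: "lk (p * cst c) w = lk p w * c"
proof -
  have "lk (p * cst c) w = (\<Sum>i\<le>length w. if i = length w then lk p w * c else 0)"
    unfolding lookup_path_mult by (intro sum.cong) (auto simp: lk_cst)
  then show ?thesis by simp
qed

lemma free_alg_eqI: "(\<And>w. lk p w = lk q w) \<Longrightarrow> p = q"
  by (rule poly_mapping_eqI) (metis path.exhaust)

lemma cst_comm: "cst c * p = p * cst c"
  by (rule free_alg_eqI) (simp add: mult.commute)

lemma sg_mult: "sg u * sg v = sg (u @ v)"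
  by (simp add: sg_def mult_single)

lemma sg_Nil [simp]: "sg [] = 1"
  unfolding sg_def zero_path_def[symmetric] by (rule single_one)

lemma cst_simps: "cst 0 = 0" "cst 1 = 1" "cst (c + d) = cst c + cst d" "cst (c * d) = cst c * cst d"
  by (rule free_alg_eqI; simp add: lk_cst lookup_add sg_Nil[symmetric] lk_sg del: sg_Nil)+

lemma sg_alt_power: "(sg [s] * sg [flip s]) ^ n = sg (altw s (2 * n))"
  by (induction n) (auto simp: sg_mult)

lemma free_alg_expand: "p = (\<Sum>k\<in>Poly_Mapping.keys p. cst (poly_mapping.lookup p k) * Poly_Mapping.single k 1)"
proof -
  have "p = (\<Sum>k\<in>Poly_Mapping.keys p. Poly_Mapping.single k (poly_mapping.lookup p k))"
    by (rule poly_mapping_eqI) (auto simp: lookup_sum lookup_single when_def in_keys_iff)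
  also have "\<dots> = (\<Sum>k\<in>Poly_Mapping.keys p. cst (poly_mapping.lookup p k) * Poly_Mapping.single k 1)"
    by (simp add: cst_def mult_single zero_path_def[symmetric])
  finally show ?thesis .
qed

lemma free_algebra_simps [simp]:
  "carrier free_algebra = UNIV" "mult free_algebra = (*)" "one free_algebra = 1"
  "ring.zero free_algebra = 0" "add free_algebra = (+)"
  by (simp_all add: free_algebra_def)

lemma free_algebra_ring: "ring (free_algebra :: 'k::field free_alg ring)"
proof (rule ringI)
  show "abelian_group (free_algebra :: 'k free_alg ring)"
    by (rule abelian_groupI) (auto simp: algebra_simps intro: exI[of _ "- x" for x])
  show "Group.monoid (free_algebra :: 'k free_alg ring)"
    by (rule monoidI) (auto simp: algebra_simps)
qed (auto simp: algebra_simps)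

lemma free_algebra_a_inv [simp]: "\<ominus>\<^bsub>free_algebra\<^esub> x = - x"
proof -
  interpret ring free_algebra by (rule free_algebra_ring)
  show ?thesis by (rule minus_equality) auto
qed

text \<open>The parameter \<open>K\<close> only fixes the type of the ground field.\<close>

locale Lam =
  fixes N :: nat and K :: "'k::field itself"
  assumes N1: "1 < N" and char2: "CHAR('k) = 2"
begin

lemma two_zero [simp]: "(x::'k) + x = 0"
proof -
  have "(2::'k) = 0" using of_nat_CHAR[where 'a='k] char2 by simp
  then show ?thesis by (simp flip: mult_2)
qed

lemma uminus_k [simp]: "- (x::'k) = x"
  using two_zero[of x] by (simp add: eq_neg_iff_add_eq_0 neg_eq_iff_add_eq_0)

lemma two_zero_alg [simp]: "(p::'k free_alg) + p = 0"
  by (rule free_alg_eqI) (simp add: lookup_add)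

lemma uminus_alg [simp]: "- (p::'k free_alg) = p"
  by (rule free_alg_eqI) simp

lemma minus_alg [simp]: "(p::'k free_alg) - q = p + q"
  using diff_conv_add_uminus[of p q] by simp

section \<open>Membership in the ideal of relations\<close>

definition wa where "wa = altw Arr_a (2 * N)"
definition wb where "wb = altw Arr_abar (2 * N)"

definition I :: "'k free_alg set" where "I = Lambda_ideal N"

text \<open>Linear conditions that turn out to describe the ideal: short alternating words stay
  independent, the two alternating words of length \<open>2 * N\<close> are identified, and all
  other words are unrestricted. In characteristic two a combination of \<open>wa\<close> and
  \<open>wb\<close> is a multiple of their difference exactly if the two coefficients agree.\<close>

definition small :: "'k free_alg \<Rightarrow> bool" where
  "small p \<longleftrightarrow> (\<forall>w. distinct_adj w \<longrightarrow> length w < 2 * N \<longrightarrow> lk p w = 0) \<and> lk p wa = lk p wb"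

lemma len_w [simp]: "length wa = 2 * N" "length wb = 2 * N"
  by (simp_all add: wa_def wb_def)

lemma alt_w [simp]: "distinct_adj wa" "distinct_adj wb"
  by (simp_all add: wa_def wb_def)

lemma w_neq [simp]: "wa \<noteq> wb" "wb \<noteq> wa"
  using N1 by (auto simp: wa_def wb_def altw_inj)

lemma smallI: "(\<And>w. distinct_adj w \<Longrightarrow> length w < 2 * N \<Longrightarrow> lk p w = 0) \<Longrightarrow> lk p wa = lk p wb \<Longrightarrow> small p"
  by (simp add: small_def)

lemma smallD: "small p \<Longrightarrow> distinct_adj w \<Longrightarrow> length w < 2 * N \<Longrightarrow> lk p w = 0"
  "small p \<Longrightarrow> lk p wa = lk p wb"
  by (simp_all add: small_def)

lemma alt_take: "distinct_adj w \<Longrightarrow> distinct_adj (take i w)" and alt_drop: "distinct_adj w \<Longrightarrow> distinct_adj (drop i w)"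
  by (metis append_take_drop_id distinct_adj_appendD1, metis append_take_drop_id distinct_adj_appendD2)

text \<open>Suffixes of an alternating word alternate. Those of a short word are short, and of a
  word of length \<open>2 * N\<close> every proper suffix is short, so there only the constant
  coefficient of \<open>x\<close> takes part.\<close>

lemma small_mult_left:
  assumes p: "small p" shows "small (x * p)"
proof (rule smallI)
  fix w :: "arrow list" assume "distinct_adj w" "length w < 2 * N"
  then show "lk (x * p) w = 0"
    unfolding lookup_path_mult by (intro sum.neutral) (auto intro!: smallD(1)[OF p] alt_drop)
next
  have *: "lk (x * p) w = lk x [] * lk p w" if "distinct_adj w" "length w = 2 * N" for w
  proof -
    have "lk (x * p) w = (\<Sum>i\<le>length w. if i = 0 then lk x [] * lk p w else 0)"
      unfolding lookup_path_mult
      by (intro sum.cong refl) (use that N1 in \<open>auto intro!: smallD(1)[OF p] alt_drop\<close>)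
    then show ?thesis by simp
  qed
  show "lk (x * p) wa = lk (x * p) wb" using smallD(2)[OF p] by (simp add: *)
qed

lemma small_mult_right:
  assumes p: "small p" shows "small (p * x)"
proof (rule smallI)
  fix w :: "arrow list" assume "distinct_adj w" "length w < 2 * N"
  then show "lk (p * x) w = 0"
    unfolding lookup_path_mult by (intro sum.neutral) (auto intro!: smallD(1)[OF p] alt_take)
next
  have *: "lk (p * x) w = lk p w * lk x []" if "distinct_adj w" "length w = 2 * N" for w
  proof -
    have "lk (p * x) w = (\<Sum>i\<le>length w. if i = length w then lk p w * lk x [] else 0)"
      unfolding lookup_path_mult
      by (intro sum.cong refl) (use that N1 in \<open>auto intro!: smallD(1)[OF p] alt_take\<close>)
    then show ?thesis by simp
  qed
  show "lk (p * x) wa = lk (p * x) wb" using smallD(2)[OF p] by (simp add: *)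
qed

lemma small_add: "small p \<Longrightarrow> small q \<Longrightarrow> small (p + q)"
  by (simp add: small_def lookup_add)

lemma small_zero [simp]: "small 0"
  by (simp add: small_def)

lemma small_ideal: "ideal (Collect small) (free_algebra :: 'k free_alg ring)"
proof -
  interpret ring "free_algebra :: 'k free_alg ring" by (rule free_algebra_ring)
  have "subgroup (Collect small) (add_monoid (free_algebra :: 'k free_alg ring))"
  proof (rule subgroup.intro)
    fix x assume "x \<in> Collect small"
    moreover have "inv\<^bsub>add_monoid free_algebra\<^esub> x = x"
      using free_algebra_a_inv[of x] by (simp add: a_inv_def)
    ultimately show "inv\<^bsub>add_monoid free_algebra\<^esub> x \<in> Collect small" by simp
  qed (auto simp: small_add)
  then show ?thesis
    by (intro idealI free_algebra_ring) (auto simp: small_mult_left small_mult_right)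
qed

lemma gens_eq: "{free_arrow Arr_a * free_arrow Arr_a, free_arrow Arr_abar * free_arrow Arr_abar,
    (free_arrow Arr_a * free_arrow Arr_abar) ^ N - (free_arrow Arr_abar * free_arrow Arr_a) ^ N}
   = {sg [Arr_a, Arr_a], sg [Arr_abar, Arr_abar], sg wa + sg wb :: 'k free_alg}"
  using sg_alt_power[where 'a='k and s=Arr_a and n=N] sg_alt_power[where 'a='k and s=Arr_abar and n=N]
  by (simp add: free_arrow_def sg_def[symmetric] sg_mult wa_def wb_def)

lemma I_eq: "I = Idl\<^bsub>free_algebra\<^esub> {sg [Arr_a, Arr_a], sg [Arr_abar, Arr_abar], sg wa + sg wb}"
  unfolding I_def Lambda_ideal_def Let_def gens_eq ..

lemma I_ideal: "ideal I free_algebra"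
  unfolding I_eq by (rule ring.genideal_ideal[OF free_algebra_ring]) simp

lemma I_gens: "sg [x, x] \<in> I" "sg wa + sg wb \<in> I"
  using ring.genideal_self[OF free_algebra_ring, of "{sg [Arr_a, Arr_a], sg [Arr_abar, Arr_abar], sg wa + sg wb}"]
  by (cases x; auto simp: I_eq)+

lemma I_add: "p \<in> I \<Longrightarrow> q \<in> I \<Longrightarrow> p + q \<in> I"
  using additive_subgroup.a_closed[OF ideal.axioms(1)[OF I_ideal]] by simp

lemma I_mult: "p \<in> I \<Longrightarrow> x * p * y \<in> I"
  using ideal.I_l_closed[OF I_ideal, of p x] ideal.I_r_closed[OF I_ideal, of "x * p" y] by simp

lemma I_zero: "0 \<in> I"
  using additive_subgroup.zero_closed[OF ideal.axioms(1)[OF I_ideal]] by simp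

lemma I_sum: "(\<And>k. k \<in> A \<Longrightarrow> f k \<in> I) \<Longrightarrow> sum f A \<in> I"
  by (induction A rule: infinite_finite_induct) (auto simp: I_zero I_add)

lemma I_sg_nonalt:
  assumes "\<not> distinct_adj w" shows "sg w \<in> I"
proof -
  obtain u x v where "w = u @ [x, x] @ v" using nonalt_split[OF assms] by blast
  then have "(sg w :: 'k free_alg) = sg u * sg [x, x] * sg v" by (simp add: sg_mult)
  then show ?thesis using I_mult[OF I_gens(1)[of x]] by (simp only:)
qed

text \<open>Exchange the first \<open>2 * N\<close> letters of an alternating word for the other
  alternating word of that length: it ends in the letter with which the rest begins, so a square of
  an arrow appears.\<close>

lemma I_sg_long:
  assumes "2 * N < length w" shows "sg w \<in> I"
proof (cases "distinct_adj w")
  case True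
  let ?s = "hd w"
  obtain m where m: "length w = 2 * N + Suc m" using assms less_iff_Suc_add by auto
  have w: "w = altw ?s (2 * N) @ altw ?s (Suc m)"
    using distinct_adj_eq_altw[OF True] altw_add[of ?s "2 * N" "Suc m"] m by simp
  have s: "sg (altw ?s (2 * N)) + sg (altw (flip ?s) (2 * N)) \<in> I"
    using I_gens(2) by (cases ?s) (auto simp: wa_def wb_def add.commute)
  have 1: "sg w + sg (altw (flip ?s) (2 * N) @ altw ?s (Suc m)) \<in> I"
    using I_mult[OF s, of 1 "sg (altw ?s (Suc m))"] w by (simp add: sg_mult distrib_right)
  have "altw (flip ?s) (2 * N) = altw (flip ?s) (2 * N - 1) @ [?s]"
    using altw_Suc[of "flip ?s" "2 * N - 1"] N1 by simp
  then have "\<not> distinct_adj (altw (flip ?s) (2 * N) @ altw ?s (Suc m))"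
    by (auto simp: distinct_adj_append_iff)
  then have 2: "sg (altw (flip ?s) (2 * N) @ altw ?s (Suc m)) \<in> I" by (rule I_sg_nonalt)
  show ?thesis using I_add[OF 1 2] by (simp add: add.assoc)
qed (rule I_sg_nonalt)

text \<open>One direction is minimality of the generated ideal. For the other, adding a multiple of
  \<open>sg wa + sg wb\<close> clears both long words, and every word then left over has a repeated
  letter or is longer than \<open>2 * N\<close>.\<close>

lemma I_iff_small: "p \<in> I \<longleftrightarrow> small p"
proof
  interpret ring "free_algebra :: 'k free_alg ring" by (rule free_algebra_ring)
  have "small (sg [x, x])" for x
    using N1 by (auto simp: small_def lk_sg wa_def wb_def dest!: arg_cong[of _ _ length])
  moreover have "small (sg wa + sg wb)"
    by (auto simp: small_def lk_sg lookup_add)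
  ultimately have "I \<subseteq> Collect small"
    unfolding I_eq by (intro genideal_minimal small_ideal) auto
  then show "p \<in> I \<Longrightarrow> small p" by auto
next
  assume p: "small p"
  let ?q = "p + cst (lk p wa) * (sg wa + sg wb)"
  have q: "lk ?q wa = 0" "lk ?q wb = 0"
    using smallD(2)[OF p] by (simp_all add: lookup_add lk_sg)
  have q0: "lk ?q w = 0" if "distinct_adj w" "length w \<le> 2 * N" for w
  proof (cases "length w = 2 * N")
    case True
    then have "w = wa \<or> w = wb" using distinct_adj_cases[OF that(1)] by (simp add: wa_def wb_def)
    then show ?thesis using q by auto
  next
    case False
    then have "w \<noteq> wa" "w \<noteq> wb" by auto
    then show ?thesis using False that smallD(1)[OF p that(1)] by (simp add: lookup_add lk_sg)
  qed
  have "(\<Sum>k\<in>Poly_Mapping.keys ?q. cst (poly_mapping.lookup ?q k) * Poly_Mapping.single k 1) \<in> I"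
  proof (rule I_sum)
    fix k assume k: "k \<in> Poly_Mapping.keys ?q"
    obtain w where w: "k = Path w" by (cases k)
    then have "\<not> (distinct_adj w \<and> length w \<le> 2 * N)" using k q0 by (auto simp: in_keys_iff)
    then have "sg w \<in> I" using I_sg_nonalt I_sg_long by force
    then show "cst (poly_mapping.lookup ?q k) * Poly_Mapping.single k 1 \<in> I"
      using I_mult[of "sg w" "cst (poly_mapping.lookup ?q k)" 1] by (simp add: sg_def w)
  qed
  then have "?q \<in> I" using free_alg_expand[of ?q] by simp
  moreover have "cst (lk p wa) * (sg wa + sg wb) \<in> I"
    using I_mult[OF I_gens(2), of "cst (lk p wa)" 1] by simp
  ultimately show "p \<in> I" using I_add by (fastforce simp: add.assoc)
qed

section \<open>The quotient algebra and its coordinates\<close>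

abbreviation L :: "'k lam ring" where "L \<equiv> Lambda N"
abbreviation \<kappa> :: "'k \<Rightarrow> 'k lam" where "\<kappa> \<equiv> Lambda_scalar N"

definition pr :: "'k free_alg \<Rightarrow> 'k lam" where "pr p = I +>\<^bsub>free_algebra\<^esub> p"

lemma L_eq: "L = free_algebra Quot I"
  by (simp add: Lambda_def I_def)

lemma L_ring: "ring L"
  unfolding L_eq by (rule ideal.quotient_is_ring[OF I_ideal])

sublocale L: ring L by (rule L_ring)

lemma pr_hom: "ring_hom_ring free_algebra L pr"
proof -
  have "pr = (+>\<^bsub>free_algebra\<^esub>) I" by (simp add: fun_eq_iff pr_def)
  then show ?thesis unfolding L_eq using ideal.rcos_ring_hom_ring[OF I_ideal] by simp
qed

lemma pr_closed [simp, intro]: "pr p \<in> carrier L"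
  using ring_hom_ring.axioms(3)[OF pr_hom] ring_hom_closed[of pr free_algebra L p]
  by (simp add: ring_hom_ring_axioms_def)

lemma pr_mem: "pr \<in> ring_hom free_algebra L"
  using ring_hom_ring.axioms(3)[OF pr_hom] by (simp add: ring_hom_ring_axioms_def)

lemma pr_add [simp]: "pr p \<oplus>\<^bsub>L\<^esub> pr q = pr (p + q)"
  using ring_hom_add[OF pr_mem, of p q] by simp

lemma pr_mult [simp]: "pr p \<otimes>\<^bsub>L\<^esub> pr q = pr (p * q)"
  using ring_hom_mult[OF pr_mem, of p q] by simp

lemma pr_one [simp]: "\<one>\<^bsub>L\<^esub> = pr 1"
  using ring_hom_one[OF pr_mem] by simp

lemma pr_zero [simp]: "\<zero>\<^bsub>L\<^esub> = pr 0"
  using ring_hom_zero[OF pr_mem free_algebra_ring L_ring] by simp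

lemma pr_pow [simp]: "pr p [^]\<^bsub>L\<^esub> (n::nat) = pr (p ^ n)"
  by (induction n) (simp_all add: power_Suc2 del: power_Suc)

lemma pr_sum: "finite J \<Longrightarrow> finsum L (\<lambda>i. pr (f i)) J = pr (sum f J)"
  by (induction J rule: finite_induct) auto

lemma pr_surj: "x \<in> carrier L \<Longrightarrow> \<exists>p. x = pr p"
  unfolding L_eq FactRing_def A_RCOSETS_def' pr_def by auto

lemma pr_eq_zero_iff: "pr p = pr 0 \<longleftrightarrow> p \<in> I"
proof -
  interpret FA: ring "free_algebra :: 'k free_alg ring" by (rule free_algebra_ring)
  interpret I: ideal I free_algebra by (rule I_ideal)
  have "pr 0 = I" using pr_zero unfolding L_eq FactRing_def by simp
  then show ?thesis
    using FA.a_coset_join1[of I p] FA.a_coset_join2[of p I] I.a_subgroup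
    unfolding pr_def by auto
qed

lemma pr_eq_iff: "pr p = pr q \<longleftrightarrow> small (p + q)"
proof -
  have "pr p = pr q \<longleftrightarrow> pr (p + q) = pr 0"
  proof
    assume "pr p = pr q"
    then have "pr (p + q) = pr q \<oplus>\<^bsub>L\<^esub> pr q" by (simp flip: pr_add)
    then show "pr (p + q) = pr 0" by simp
  next
    assume "pr (p + q) = pr 0"
    then have "pr (p + q) \<oplus>\<^bsub>L\<^esub> pr q = pr 0 \<oplus>\<^bsub>L\<^esub> pr q" by (rule arg_cong)
    then show "pr p = pr q" by (simp add: add.assoc)
  qed
  then show ?thesis by (simp only: pr_eq_zero_iff I_iff_small)
qed

lemma arrow_pr: "Lambda_arrow N x = pr (sg [x])"
  by (simp add: Lambda_arrow_def pr_def I_def free_arrow_def sg_def)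

lemma scalar_pr: "\<kappa> c = pr (cst c)"
  by (simp add: Lambda_scalar_def pr_def I_def cst_def zero_path_def)

lemma central_L: "central_ring L \<kappa>"
proof (intro central_ring.intro central_ring_axioms.intro L_ring)
  show "\<kappa> c \<in> carrier L" for c by (simp add: scalar_pr)
  show "x \<in> carrier L \<Longrightarrow> \<kappa> c \<otimes>\<^bsub>L\<^esub> x = x \<otimes>\<^bsub>L\<^esub> \<kappa> c" for x c
  proof -
    assume "x \<in> carrier L"
    then obtain p where "x = pr p" using pr_surj by blast
    then show ?thesis using cst_comm[of c p] by (simp add: scalar_pr)
  qed
qed

sublocale L: central_ring L \<kappa> by (rule central_L)

text \<open>Coordinates on \<open>\<Lambda>\<^sub>N\<close>. The two words of length \<open>2N\<close> become equal, so \<open>wa\<close> represents both and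
  its coordinate is the sum of the two coefficients.\<close>

definition basis_words :: "arrow list set" where
  "basis_words = insert wa {w. distinct_adj w \<and> length w < 2 * N}"

definition cf :: "'k free_alg \<Rightarrow> arrow list \<Rightarrow> 'k" where
  "cf p w = (if w = wa then lk p wa + lk p wb else lk p w)"

definition coef :: "'k lam \<Rightarrow> arrow list \<Rightarrow> 'k" where
  "coef x = cf (SOME p. x = pr p)"

lemma finite_basis_words: "finite basis_words"
proof -
  have "basis_words \<subseteq> (\<lambda>(s, n). altw s n) ` ({Arr_a, Arr_abar} \<times> {..2 * N})"
  proof
    fix w assume w: "w \<in> basis_words"
    then have "distinct_adj w" "length w \<le> 2 * N" by (auto simp: basis_words_def)
    then show "w \<in> (\<lambda>(s, n). altw s n) ` ({Arr_a, Arr_abar} \<times> {..2 * N})"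
      using distinct_adj_cases[of w] by force
  qed
  then show ?thesis by (rule finite_subset) simp
qed

lemma basis_words_props: "w \<in> basis_words \<Longrightarrow> distinct_adj w" "w \<in> basis_words \<Longrightarrow> length w \<le> 2 * N"
  by (auto simp: basis_words_def)

lemma basis_words_Nil [simp]: "[] \<in> basis_words"
  using N1 by (simp add: basis_words_def)

lemma wb_notin_basis_words [simp]: "wb \<notin> basis_words"
  by (simp add: basis_words_def)

lemma small_iff_cf: "small p \<longleftrightarrow> (\<forall>w\<in>basis_words. cf p w = 0)"
proof -
  have "w \<noteq> wa" if "length w < 2 * N" for w using that by auto
  moreover have "lk p wa = lk p wb \<longleftrightarrow> lk p wa + lk p wb = 0"
    by (simp add: eq_neg_iff_add_eq_0[symmetric])
  ultimately show ?thesis unfolding small_def basis_words_def cf_def by auto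
qed

lemma cf_add: "cf (p + q) w = cf p w + cf q w"
  by (simp add: cf_def lookup_add)

text \<open>Two representatives differ by a \<open>small\<close> element, and \<open>cf\<close> of
  such an element vanishes on the basis words; so the chosen representative does not matter
  there.\<close>

lemma coef_pr: "w \<in> basis_words \<Longrightarrow> coef (pr p) w = cf p w"
proof -
  assume w: "w \<in> basis_words"
  have "pr p = pr (SOME q. pr p = pr q)" by (rule someI) (rule refl)
  then have "cf (p + (SOME q. pr p = pr q)) w = 0" using w by (simp add: pr_eq_iff small_iff_cf)
  then have "cf p w = cf (SOME q. pr p = pr q) w" by (simp add: cf_add eq_neg_iff_add_eq_0[symmetric])
  then show ?thesis by (simp add: coef_def)
qed

lemma coef_add: "x \<in> carrier L \<Longrightarrow> y \<in> carrier L \<Longrightarrow> w \<in> basis_words \<Longrightarrow> coef (x \<oplus>\<^bsub>L\<^esub> y) w = coef x w + coef y w"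
  using pr_surj[of x] pr_surj[of y] by (auto simp: coef_pr cf_add)

lemma coef_kappa: "x \<in> carrier L \<Longrightarrow> w \<in> basis_words \<Longrightarrow> coef (\<kappa> c \<otimes>\<^bsub>L\<^esub> x) w = c * coef x w"
  using pr_surj[of x] by (auto simp: coef_pr scalar_pr cf_def distrib_left)

lemma coef_eqI:
  assumes "x \<in> carrier L" "y \<in> carrier L" "\<And>w. w \<in> basis_words \<Longrightarrow> coef x w = coef y w" shows "x = y"
proof -
  obtain p q where "x = pr p" "y = pr q" using pr_surj assms by metis
  moreover have "small (p + q)"
    unfolding small_iff_cf using assms(3) calculation by (auto simp: cf_add coef_pr)
  ultimately show ?thesis by (simp add: pr_eq_iff)
qed

definition lw :: "arrow list \<Rightarrow> 'k lam" where "lw w = pr (sg w)"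

lemma lw_closed [simp, intro]: "lw w \<in> carrier L"
  by (simp add: lw_def)

lemma cf_sg: "w \<in> basis_words \<Longrightarrow> v \<in> basis_words \<Longrightarrow> cf (sg v) w = (if w = v then 1 else 0)"
  by (auto simp: cf_def lk_sg)

lemma cf_sum: "cf (sum f J) w = (\<Sum>j\<in>J. cf (f j) w)"
  by (simp add: cf_def lookup_sum sum.distrib)

lemma cf_cst: "cf (cst c * p) w = c * cf p w"
  by (simp add: cf_def distrib_left)

lemma L_expand:
  assumes "x \<in> carrier L"
  shows "x = finsum L (\<lambda>w. \<kappa> (coef x w) \<otimes>\<^bsub>L\<^esub> lw w) basis_words"
proof -
  obtain p where p: "x = pr p" using pr_surj assms by blast
  have A: "finsum L (\<lambda>w. \<kappa> (coef x w) \<otimes>\<^bsub>L\<^esub> lw w) basis_words = pr (\<Sum>w\<in>basis_words. cst (coef x w) * sg w)"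
    by (simp add: lw_def scalar_pr pr_sum finite_basis_words)
  have B: "pr p = pr (\<Sum>w\<in>basis_words. cst (coef x w) * sg w)"
    unfolding pr_eq_iff small_iff_cf
  proof
    fix v assume v: "v \<in> basis_words"
    have "(\<Sum>w\<in>basis_words. coef x w * cf (sg w) v) = (\<Sum>w\<in>basis_words. if w = v then coef x v else 0)"
      by (intro sum.cong) (auto simp: cf_sg v)
    also have "\<dots> = cf p v" using v finite_basis_words by (simp add: p coef_pr)
    finally show "cf (p + (\<Sum>w\<in>basis_words. cst (coef x w) * sg w)) v = 0"
      by (simp add: cf_add cf_sum cf_cst)
  qed
  show ?thesis by (rule trans[OF p trans[OF B A[symmetric]]])
qed

text \<open>A word no longer than \<open>v\<close> ends in \<open>v\<close> only if it equals
  \<open>v\<close>. At \<open>wa\<close> this is applied to both words of length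
  \<open>2 * N\<close>, whose coefficients \<open>cf\<close> adds. It is the reason why the length
  of the right factor gives a filtration.\<close>

lemma coef_mult_lw:
  assumes x: "x \<in> carrier L" and w: "w \<in> basis_words" and v: "v \<in> basis_words" and le: "length w \<le> length v"
  shows "coef (x \<otimes>\<^bsub>L\<^esub> lw v) w = (if w = v then coef x [] else 0)"
proof -
  obtain p where p: "x = pr p" using pr_surj x by blast
  have nil: "cf p [] = lk p []" using N1 by (auto simp: cf_def dest!: arg_cong[of _ _ length])
  have lk: "lk (p * sg v) u = (if u = v then lk p [] else 0)" if "length u \<le> length v" for u
  proof (cases "u = v")
    case True
    then show ?thesis using lk_sg_right[of p v "[]"] by simp
  next
    case False
    have "u \<noteq> t @ v" for t using that False by auto
    then show ?thesis using False by (simp add: lk_sg_right_zero)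
  qed
  have "cf (p * sg v) w = (if w = v then lk p [] else 0)"
  proof (cases "w = wa")
    case True
    then have "v = wa" using le v by (auto simp: basis_words_def)
    then show ?thesis using True lk[of wa] lk[of wb] by (simp add: cf_def)
  next
    case False
    then show ?thesis using lk[OF le] by (simp add: cf_def)
  qed
  then show ?thesis using w by (simp add: p lw_def coef_pr nil)
qed

end

section \<open>The differential\<close>

context Lam
begin

lemma lw_mult [simp]: "lw u \<otimes>\<^bsub>L\<^esub> lw v = lw (u @ v)"
  by (simp add: lw_def sg_mult)

lemma lw_Nil [simp]: "lw [] = \<one>\<^bsub>L\<^esub>"
  by (simp add: lw_def)

lemma lw_nonalt [simp]: "\<not> distinct_adj w \<Longrightarrow> lw w = \<zero>\<^bsub>L\<^esub>"
  using I_sg_nonalt[of w] by (simp add: lw_def pr_eq_zero_iff)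

lemma lw_long: "2 * N < length w \<Longrightarrow> lw w = \<zero>\<^bsub>L\<^esub>"
  using I_sg_long[of w] by (simp add: lw_def pr_eq_zero_iff)

lemma lw_top: "lw (altw (flip s) (2 * N)) = lw (altw s (2 * N))"
  using I_gens(2) by (cases s) (auto simp: lw_def pr_eq_iff I_iff_small wa_def wb_def add.commute)

lemma lw_pow: "(lw [s] \<otimes>\<^bsub>L\<^esub> lw [flip s]) [^]\<^bsub>L\<^esub> (n::nat) = lw (altw s (2 * n))"
  using sg_alt_power[where 'a='k and s=s and n=n] by (simp add: lw_def sg_mult)

end

text \<open>The identities behind the differential are proved in an arbitrary bimodule, as they are
  applied in the modules of the resolution, in the algebra itself and in the twisted module
  \<open>Le\<close>.\<close>

locale LamM = Lam N K + M: bimod "Lambda N" "Lambda_scalar N" M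
  for N :: nat and K :: "'k::field itself" and M :: "('k lam, 'm) bimodule"
begin

definition W :: "arrow list \<Rightarrow> 'm \<Rightarrow> arrow list \<Rightarrow> 'm" where
  "W u x v = bact M (lw u) x (lw v)"

lemma M_double [simp]: "x \<in> carrier M \<Longrightarrow> x \<oplus>\<^bsub>M\<^esub> x = \<zero>\<^bsub>M\<^esub>"
proof -
  assume x: "x \<in> carrier M"
  have "x \<oplus>\<^bsub>M\<^esub> x = (\<one>\<^bsub>L\<^esub> \<oplus>\<^bsub>L\<^esub> \<one>\<^bsub>L\<^esub>) \<odot>\<^bsub>M\<^esub> x"
    by (simp only: M.smult_l_distr[OF L.one_closed L.one_closed x] M.smult_one[OF x])
  also have "\<one>\<^bsub>L\<^esub> \<oplus>\<^bsub>L\<^esub> \<one>\<^bsub>L\<^esub> = \<zero>\<^bsub>L\<^esub>" by simp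
  finally show ?thesis using M.zero_smult[OF x] by simp
qed

lemma M_double2 [simp]: "x \<in> carrier M \<Longrightarrow> y \<in> carrier M \<Longrightarrow> x \<oplus>\<^bsub>M\<^esub> (x \<oplus>\<^bsub>M\<^esub> y) = y"
  by (simp flip: M.M.a_assoc)

lemma M_neg [simp]: "x \<in> carrier M \<Longrightarrow> \<ominus>\<^bsub>M\<^esub> x = x"
  by (rule M.M.minus_equality) auto

lemma W_closed [simp, intro]: "x \<in> carrier M \<Longrightarrow> W u x v \<in> carrier M"
  by (simp add: W_def)

lemma W_W [simp]: "x \<in> carrier M \<Longrightarrow> W u (W u' x v') v = W (u @ u') x (v' @ v)"
  by (simp add: W_def bact_def M.smult_assoc1 M.rsmult_assoc M.smult_rsmult flip: lw_mult)

lemma W_add [simp]: "x \<in> carrier M \<Longrightarrow> y \<in> carrier M \<Longrightarrow> W u (x \<oplus>\<^bsub>M\<^esub> y) v = W u x v \<oplus>\<^bsub>M\<^esub> W u y v"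
  by (simp add: W_def bact_def M.smult_r_distr M.rsmult_l_distr)

lemma W_zero [simp]: "W u \<zero>\<^bsub>M\<^esub> v = \<zero>\<^bsub>M\<^esub>"
  by (simp add: W_def bact_def)

lemma W_left_zero: "lw u = \<zero>\<^bsub>L\<^esub> \<Longrightarrow> x \<in> carrier M \<Longrightarrow> W u x v = \<zero>\<^bsub>M\<^esub>"
  by (simp add: W_def bact_def del: pr_zero)

lemma W_right_zero: "lw v = \<zero>\<^bsub>L\<^esub> \<Longrightarrow> x \<in> carrier M \<Longrightarrow> W u x v = \<zero>\<^bsub>M\<^esub>"
  by (simp add: W_def bact_def del: pr_zero)

lemma W_nonalt:
  "\<not> distinct_adj u \<Longrightarrow> x \<in> carrier M \<Longrightarrow> W u x v = \<zero>\<^bsub>M\<^esub>"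
  "\<not> distinct_adj v \<Longrightarrow> x \<in> carrier M \<Longrightarrow> W u x v = \<zero>\<^bsub>M\<^esub>"
  using W_left_zero W_right_zero lw_nonalt by blast+

lemma W_top: "W (altw (flip s) (2 * N)) x v = W (altw s (2 * N)) x v"
  "W u x (altw (flip s) (2 * N)) = W u x (altw s (2 * N))"
  by (simp_all only: W_def lw_top)

lemma W_finsum:
  assumes "\<And>i. i \<in> J \<Longrightarrow> f i \<in> carrier M"
  shows "W u (finsum M f J) v = finsum M (\<lambda>i. W u (f i) v) J"
  by (rule finsum_additive[OF M.M.abelian_group_axioms M.M.abelian_group_axioms]) (use assms in auto)

section \<open>Commutators, norm sums and the identities between them\<close>

definition commut :: "arrow list \<Rightarrow> 'm \<Rightarrow> 'm" where
  "commut w x = W w x [] \<oplus>\<^bsub>M\<^esub> W [] x w"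

text \<open>A noncommutative derivative of the relation of length \<open>2 * N\<close>: each
  occurrence of \<open>flip s\<close> in the two alternating words of that length is in turn
  replaced by \<open>x\<close>, and the results are added.\<close>

definition norm_sum :: "arrow \<Rightarrow> 'm \<Rightarrow> 'm" where
  "norm_sum s x = finsum M (\<lambda>k. W (altw (flip s) (2 * k)) x (altw s (Suc (2 * (N - 1 - k))))
      \<oplus>\<^bsub>M\<^esub> W (altw s (Suc (2 * k))) x (altw s (2 * (N - 1 - k)))) {..<N}"

lemma commut_closed [simp, intro]: "x \<in> carrier M \<Longrightarrow> commut w x \<in> carrier M"
  by (simp add: commut_def)

lemma norm_sum_closed [simp, intro]: "x \<in> carrier M \<Longrightarrow> norm_sum s x \<in> carrier M"
  unfolding norm_sum_def by (intro M.M.finsum_closed) auto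

lemma commut_add [simp]: "x \<in> carrier M \<Longrightarrow> y \<in> carrier M \<Longrightarrow> commut w (x \<oplus>\<^bsub>M\<^esub> y) = commut w x \<oplus>\<^bsub>M\<^esub> commut w y"
  by (simp add: commut_def M.M.a_ac)

lemma commut_zero [simp]: "commut w \<zero>\<^bsub>M\<^esub> = \<zero>\<^bsub>M\<^esub>"
  by (simp add: commut_def)

lemma norm_sum_add [simp]:
  assumes "x \<in> carrier M" "y \<in> carrier M"
  shows "norm_sum s (x \<oplus>\<^bsub>M\<^esub> y) = norm_sum s x \<oplus>\<^bsub>M\<^esub> norm_sum s y"
  unfolding norm_sum_def using assms
  by (subst M.M.finsum_addf[symmetric]) (auto intro!: M.M.finsum_cong' simp: M.M.a_ac)

lemma norm_sum_zero [simp]: "norm_sum s \<zero>\<^bsub>M\<^esub> = \<zero>\<^bsub>M\<^esub>"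
  unfolding norm_sum_def by (simp add: M.M.finsum_zero)

lemma telescope:
  assumes "\<And>k. p k \<in> carrier M"
  shows "finsum M (\<lambda>k. p (Suc k) \<oplus>\<^bsub>M\<^esub> p k) {..<n} = p n \<oplus>\<^bsub>M\<^esub> p 0"
proof (induction n)
  case 0
  then show ?case using assms by simp
next
  case (Suc n)
  have "finsum M (\<lambda>k. p (Suc k) \<oplus>\<^bsub>M\<^esub> p k) {..<Suc n} = (p (Suc n) \<oplus>\<^bsub>M\<^esub> p n) \<oplus>\<^bsub>M\<^esub> (p n \<oplus>\<^bsub>M\<^esub> p 0)"
    unfolding lessThan_Suc using assms Suc by (subst M.M.finsum_insert) auto
  then show ?case using assms by (simp add: M.M.a_ac)
qed

lemma telescope_sum:
  assumes "\<And>k. p k \<in> carrier M"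
  shows "finsum M (\<lambda>k. p (Suc k)) {..<n} \<oplus>\<^bsub>M\<^esub> finsum M p {..<n} = p n \<oplus>\<^bsub>M\<^esub> p 0"
proof -
  have "finsum M (\<lambda>k. p (Suc k)) {..<n} \<oplus>\<^bsub>M\<^esub> finsum M p {..<n} = finsum M (\<lambda>k. p (Suc k) \<oplus>\<^bsub>M\<^esub> p k) {..<n}"
    by (rule M.M.finsum_addf[symmetric]) (use assms in auto)
  then show ?thesis using telescope[of p n] assms by simp
qed

lemma alt_append_same:
  assumes "0 < m" "0 < n" "(if even m then flip s else s) = t"
  shows "\<not> distinct_adj (altw s m @ altw t n)"
proof -
  obtain k l where kl: "m = Suc k" "n = Suc l" using assms gr0_implies_Suc by metis
  have "altw s m = altw s k @ [t]" using assms(3) by (auto simp: kl(1) altw_Suc simp del: altw.simps(2))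
  then have "altw s m @ altw t n = altw s k @ t # t # altw (flip t) l" by (simp add: kl(2))
  then show ?thesis by (simp add: distinct_adj_append_iff)
qed

lemma commut_commut_same: "x \<in> carrier M \<Longrightarrow> \<not> distinct_adj (w @ w) \<Longrightarrow> commut w (commut w x) = \<zero>\<^bsub>M\<^esub>"
  by (simp add: commut_def W_nonalt)

lemma top_left: "[s] @ altw (flip s) (2 * N - 1) = altw s (2 * N)"
  using N1 by (cases "2 * N") auto

lemma top_right: "altw (flip s) (2 * N - 1) @ [s] = altw (flip s) (2 * N)"
  using altw_Suc[of "flip s" "2 * N - 1"] N1 by simp

text \<open>The letter and the long word multiply, in the two orders, to the two alternating words
  of length \<open>2 * N\<close>, which agree in the algebra; the mixed terms are the same on both
  sides.\<close>

lemma commut_commut_comm: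
  assumes x: "x \<in> carrier M"
  shows "commut [s] (commut (altw (flip s) (2 * N - 1)) x) = commut (altw (flip s) (2 * N - 1)) (commut [s] x)"
  using x unfolding commut_def
  by (simp add: top_left[simplified] top_right[simplified] W_top M.M.a_ac)

lemma finsum_at:
  assumes "c \<in> carrier M" "i < N" "\<And>k. k < N \<Longrightarrow> f k = (if k = i then c else \<zero>\<^bsub>M\<^esub>)"
  shows "finsum M f {..<N} = c"
proof -
  have "finsum M f {..<N} = finsum M (\<lambda>k. if i = k then c else \<zero>\<^bsub>M\<^esub>) {..<N}"
    by (rule M.M.finsum_cong') (use assms in auto)
  then show ?thesis using M.M.finsum_singleton[of i "{..<N}" "\<lambda>_. c"] assms by simp
qed

text \<open>Multiplying by \<open>s\<close> on the left or on the right kills one half of the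
  summands and turns the other half into one and the same sum, with words of odd length on both
  sides of \<open>x\<close>.\<close>

lemma commut_norm_sum_same:
  assumes x: "x \<in> carrier M" shows "commut [s] (norm_sum s x) = \<zero>\<^bsub>M\<^esub>"
proof -
  let ?j = "\<lambda>k. N - 1 - k"
  have L: "W [s] (norm_sum s x) [] = finsum M (\<lambda>k. W (altw s (Suc (2 * k))) x (altw s (Suc (2 * ?j k)))) {..<N}"
    unfolding norm_sum_def using x
    by (subst W_finsum) (auto intro!: M.M.finsum_cong' simp: W_nonalt)
  have na: "\<not> distinct_adj (s # altw (flip s) (2 * k) @ [s])" for k
    using alt_append_same[of "Suc (2 * k)" 1 s s] by simp
  have al: "altw s (2 * k) @ [s] = altw s (Suc (2 * k))" for k
    by (simp add: altw_Suc del: altw.simps(2))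
  have R: "W [] (norm_sum s x) [s] = finsum M (\<lambda>k. W (altw s (Suc (2 * k))) x (altw s (Suc (2 * ?j k)))) {..<N}"
    unfolding norm_sum_def using x
    by (subst W_finsum) (auto intro!: M.M.finsum_cong' simp: W_nonalt na al)
  show ?thesis unfolding commut_def L R by (rule M_double) (use x in \<open>auto intro!: M.M.finsum_closed\<close>)
qed

text \<open>Multiplication by \<open>s\<close> from the two sides produces the same summands with
  \<open>k\<close> shifted by one, so they telescope; apart from these only a term at
  \<open>k = 0\<close> and a term at \<open>k = N - 1\<close> survive. The four terms left are those
  of the iterated commutator.\<close>

lemma commut_norm_sum_flip:
  assumes x: "x \<in> carrier M"
  shows "commut [s] (norm_sum (flip s) x) = commut (altw (flip s) (2 * N - 1)) (commut [s] x)"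
proof -
  let ?j = "\<lambda>k. N - 1 - k"
  \<comment> \<open>\<open>?p\<close> is the telescoping summand; \<open>?l\<close> and
    \<open>?r\<close> below are the two isolated ones.\<close>
  let ?p = "\<lambda>k. W (altw s (2 * k)) x (altw (flip s) (2 * (N - k)))"
  let ?B = "altw (flip s) (2 * N - 1)"
  let ?l = "\<lambda>k. if k = 0 then W [s] x ?B else \<zero>\<^bsub>M\<^esub>"
  let ?r = "\<lambda>k. if k = N - 1 then W ?B x [s] else \<zero>\<^bsub>M\<^esub>"
  have L: "W [s] (norm_sum (flip s) x) [] = finsum M (\<lambda>k. ?l k \<oplus>\<^bsub>M\<^esub> ?p (Suc k)) {..<N}"
    unfolding norm_sum_def
  proof (subst W_finsum, use x in force, rule M.M.finsum_cong')
    fix k assume k: "k \<in> {..<N}"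
    have 1: "W ([s] @ altw s (2 * k)) x (altw (flip s) (Suc (2 * ?j k))) = ?l k"
    proof (cases k)
      case 0
      have "2 * N - 1 = Suc (2 * ?j 0)" using N1 by simp
      then show ?thesis using 0 by simp
    qed (use x in \<open>simp add: W_nonalt\<close>)
    have 2: "W ([s] @ altw (flip s) (Suc (2 * k))) x (altw (flip s) (2 * ?j k)) = ?p (Suc k)"
      by simp
    show "W [s] (W (altw (flip (flip s)) (2 * k)) x (altw (flip s) (Suc (2 * ?j k))) \<oplus>\<^bsub>M\<^esub>
        W (altw (flip s) (Suc (2 * k))) x (altw (flip s) (2 * ?j k))) [] = ?l k \<oplus>\<^bsub>M\<^esub> ?p (Suc k)"
      unfolding 1[symmetric] 2[symmetric] using x by simp
  qed (use x in auto)
  have R: "W [] (norm_sum (flip s) x) [s] = finsum M (\<lambda>k. ?p k \<oplus>\<^bsub>M\<^esub> ?r k) {..<N}"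
    unfolding norm_sum_def
  proof (subst W_finsum, use x in force, rule M.M.finsum_cong')
    fix k assume k: "k \<in> {..<N}"
    have "altw (flip s) (Suc (2 * ?j k)) @ [s] = altw (flip s) (2 * (N - k))"
    proof -
      have "2 * (N - k) = Suc (Suc (2 * ?j k))" using k by auto
      then show ?thesis using altw_Suc[of "flip s" "Suc (2 * ?j k)"] by simp
    qed
    then have 1: "W (altw s (2 * k)) x (altw (flip s) (Suc (2 * ?j k)) @ [s]) = ?p k" by simp
    have 2: "W (altw (flip s) (Suc (2 * k))) x (altw (flip s) (2 * ?j k) @ [s]) = ?r k"
    proof (cases "k = N - 1")
      case True
      have "2 * N - 1 = Suc (2 * (N - 1))" using N1 by simp
      then show ?thesis using True by simp
    next
      case False
      then have "0 < 2 * ?j k" using k by auto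
      then have "\<not> distinct_adj (altw (flip s) (2 * ?j k) @ altw s 1)" by (intro alt_append_same) auto
      then show ?thesis using False x by (simp add: W_nonalt)
    qed
    show "W [] (W (altw (flip (flip s)) (2 * k)) x (altw (flip s) (Suc (2 * ?j k))) \<oplus>\<^bsub>M\<^esub>
        W (altw (flip s) (Suc (2 * k))) x (altw (flip s) (2 * ?j k))) [s] = ?p k \<oplus>\<^bsub>M\<^esub> ?r k"
      unfolding 1[symmetric] 2[symmetric] using x by simp
  qed (use x in auto)
  have l: "finsum M ?l {..<N} = W [s] x ?B" by (rule finsum_at) (use x N1 in auto)
  have r: "finsum M ?r {..<N} = W ?B x [s]" by (rule finsum_at) (use x N1 in auto)
  have "commut [s] (norm_sum (flip s) x) =
      (finsum M ?l {..<N} \<oplus>\<^bsub>M\<^esub> finsum M (\<lambda>k. ?p (Suc k)) {..<N}) \<oplus>\<^bsub>M\<^esub>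
      (finsum M ?p {..<N} \<oplus>\<^bsub>M\<^esub> finsum M ?r {..<N})"
    unfolding commut_def L R using x by (subst (1 2) M.M.finsum_addf) auto
  also have "\<dots> = (finsum M ?l {..<N} \<oplus>\<^bsub>M\<^esub> finsum M ?r {..<N}) \<oplus>\<^bsub>M\<^esub>
      (finsum M (\<lambda>k. ?p (Suc k)) {..<N} \<oplus>\<^bsub>M\<^esub> finsum M ?p {..<N})"
    by (rule M.M.add.m_assoc[THEN trans]) (use x in \<open>auto simp: M.M.a_ac intro!: M.M.finsum_closed\<close>)
  also have "finsum M (\<lambda>k. ?p (Suc k)) {..<N} \<oplus>\<^bsub>M\<^esub> finsum M ?p {..<N} = ?p N \<oplus>\<^bsub>M\<^esub> ?p 0"
    by (rule telescope_sum) (use x in auto)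
  finally show ?thesis
    unfolding l r using x unfolding commut_def
    by (simp add: top_left[simplified] top_right[simplified] W_top M.M.a_ac)
qed

text \<open>Next to the long word every further factor creates a repeated letter or a word longer
  than \<open>2 * N\<close>. What remains is \<open>x\<close> between two copies of the long word,
  once from \<open>k = 0\<close> and once from \<open>k = N - 1\<close>.\<close>

lemma norm_sum_commut_top:
  assumes x: "x \<in> carrier M" shows "norm_sum s (commut (altw s (2 * N - 1)) x) = \<zero>\<^bsub>M\<^esub>"
proof -
  let ?j = "\<lambda>k. N - 1 - k"
  let ?A = "altw s (2 * N - 1)"
  let ?l = "\<lambda>k. if k = 0 then W ?A x ?A else \<zero>\<^bsub>M\<^esub>"
  let ?r = "\<lambda>k. if k = N - 1 then W ?A x ?A else \<zero>\<^bsub>M\<^esub>"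
  have "norm_sum s (commut ?A x) = finsum M (\<lambda>k. ?l k \<oplus>\<^bsub>M\<^esub> ?r k) {..<N}"
    unfolding norm_sum_def
  proof (rule M.M.finsum_cong')
    fix k assume k: "k \<in> {..<N}"
    have A: "?A = altw s (Suc (2 * (N - 1)))" 
    proof -
      have "2 * N - 1 = Suc (2 * (N - 1))" using N1 by simp
      then show ?thesis by (simp only:)
    qed
    have 1: "W (altw (flip s) (2 * k) @ ?A) x (altw s (Suc (2 * ?j k))) = ?l k"
    proof (cases k)
      case 0
      have e: "altw s (Suc (2 * ?j 0)) = ?A" unfolding A by (simp only: diff_zero)
      show ?thesis unfolding 0 e by simp
    next
      case (Suc i)
      then have "lw (altw (flip s) (2 * k) @ ?A) = \<zero>\<^bsub>L\<^esub>" by (intro lw_long) auto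
      then show ?thesis using Suc x by (simp add: W_left_zero)
    qed
    have 2: "W (altw (flip s) (2 * k)) x (?A @ altw s (Suc (2 * ?j k))) = \<zero>\<^bsub>M\<^esub>"
      by (rule W_nonalt(2)[OF _ x], unfold A) (rule alt_append_same, auto)
    have 3: "W (altw s (Suc (2 * k)) @ ?A) x (altw s (2 * ?j k)) = \<zero>\<^bsub>M\<^esub>"
      by (rule W_nonalt(1)[OF _ x], unfold A) (rule alt_append_same, auto)
    have 4: "W (altw s (Suc (2 * k))) x (?A @ altw s (2 * ?j k)) = ?r k"
    proof (cases "k = N - 1")
      case True
      show ?thesis unfolding True A[symmetric] by simp
    next
      case False
      then have "0 < 2 * ?j k" using k by auto
      then have "\<not> distinct_adj (?A @ altw s (2 * ?j k))" unfolding A by (intro alt_append_same) auto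
      then show ?thesis using False x by (simp add: W_nonalt)
    qed
    show "W (altw (flip s) (2 * k)) (commut ?A x) (altw s (Suc (2 * ?j k))) \<oplus>\<^bsub>M\<^esub>
        W (altw s (Suc (2 * k))) (commut ?A x) (altw s (2 * ?j k)) = ?l k \<oplus>\<^bsub>M\<^esub> ?r k"
      using x 1 2 3 4 by (simp add: commut_def del: altw.simps(2))
  qed (use x in auto)
  also have "\<dots> = finsum M ?l {..<N} \<oplus>\<^bsub>M\<^esub> finsum M ?r {..<N}"
    by (rule M.M.finsum_addf) (use x in auto)
  also have "\<dots> = \<zero>\<^bsub>M\<^esub>"
    using finsum_at[of "W ?A x ?A" 0 ?l] finsum_at[of "W ?A x ?A" "N - 1" ?r] x N1 by simp
  finally show ?thesis .
qed

text \<open>Summands with words of odd length on both sides are exchanged by \<open>flip\<close>.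
  Those with words of even length telescope to boundary terms that involve only the two words of
  length \<open>2 * N\<close>, which are equal in the algebra.\<close>

lemma norm_sum_commut_flip:
  assumes x: "x \<in> carrier M" shows "norm_sum s (commut [flip s] x) = norm_sum (flip s) (commut [s] x)"
proof -
  let ?j = "\<lambda>k. N - 1 - k"
  let ?c = "\<lambda>s k. W (altw (flip s) (Suc (2 * k))) x (altw s (Suc (2 * ?j k)))"
  let ?p = "\<lambda>s k. W (altw s (2 * k)) x (altw s (2 * (N - k)))"
  have S0: "norm_sum s (commut [flip s] x) = finsum M (\<lambda>k. (?c s k \<oplus>\<^bsub>M\<^esub> ?c (flip s) k) \<oplus>\<^bsub>M\<^esub> (?p s (Suc k) \<oplus>\<^bsub>M\<^esub> ?p (flip s) k)) {..<N}" for s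
    unfolding norm_sum_def
  proof (rule M.M.finsum_cong')
    fix k assume k: "k \<in> {..<N}"
    have 1: "altw (flip s) (2 * k) @ [flip s] = altw (flip s) (Suc (2 * k))"
      by (simp add: altw_Suc del: altw.simps(2))
    have 2: "flip s # altw s (Suc (2 * ?j k)) = altw (flip s) (2 * (N - k))"
    proof -
      have "2 * (N - k) = Suc (Suc (2 * ?j k))" using k by auto
      then show ?thesis by simp
    qed
    have 3: "altw s (Suc (2 * k)) @ [flip s] = altw s (2 * Suc k)"
      using altw_Suc[of s "Suc (2 * k)"] by simp
    have 4: "flip s # altw s (2 * ?j k) = altw (flip s) (Suc (2 * ?j k))" by simp
    show "W (altw (flip s) (2 * k)) (commut [flip s] x) (altw s (Suc (2 * ?j k))) \<oplus>\<^bsub>M\<^esub>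
        W (altw s (Suc (2 * k))) (commut [flip s] x) (altw s (2 * ?j k)) =
        (?c s k \<oplus>\<^bsub>M\<^esub> ?c (flip s) k) \<oplus>\<^bsub>M\<^esub> (?p s (Suc k) \<oplus>\<^bsub>M\<^esub> ?p (flip s) k)"
      unfolding commut_def using x
      by (simp only: W_add W_W W_closed append_Cons append_Nil 1 2 3 4 append_Nil2 M.M.a_ac M.M.a_closed flip_flip)
        (simp add: M.M.a_ac del: altw.simps(2))
  qed (use x in auto)
  have T: "finsum M (\<lambda>k. ?p s (Suc k) \<oplus>\<^bsub>M\<^esub> ?p (flip s) k) {..<N} = finsum M (\<lambda>k. ?p (flip s) (Suc k) \<oplus>\<^bsub>M\<^esub> ?p s k) {..<N}"
  proof -
    have t: "finsum M (\<lambda>k. ?p t (Suc k)) {..<N} \<oplus>\<^bsub>M\<^esub> finsum M (?p t) {..<N} =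
        W (altw s (2 * N)) x [] \<oplus>\<^bsub>M\<^esub> W [] x (altw s (2 * N))" for t
    proof -
      have "finsum M (\<lambda>k. ?p t (Suc k)) {..<N} \<oplus>\<^bsub>M\<^esub> finsum M (?p t) {..<N} = ?p t N \<oplus>\<^bsub>M\<^esub> ?p t 0"
        by (rule telescope_sum) (use x in auto)
      also have "\<dots> = W (altw s (2 * N)) x [] \<oplus>\<^bsub>M\<^esub> W [] x (altw s (2 * N))"
        using neq_iff_flip[of t s] by (cases "t = s") (auto simp: W_top)
      finally show ?thesis .
    qed
    \<comment> \<open>Summands may change sides of an equation, since every element is its own
      negative.\<close>
    have g: "A \<oplus>\<^bsub>M\<^esub> B = C \<oplus>\<^bsub>M\<^esub> D"
      if "A \<oplus>\<^bsub>M\<^esub> D = C \<oplus>\<^bsub>M\<^esub> B" "A \<in> carrier M" "B \<in> carrier M" "C \<in> carrier M" "D \<in> carrier M" for A B C D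
    proof -
      have "A \<oplus>\<^bsub>M\<^esub> B = (A \<oplus>\<^bsub>M\<^esub> D) \<oplus>\<^bsub>M\<^esub> (B \<oplus>\<^bsub>M\<^esub> D)" using that(2-5) by (simp add: M.M.a_ac)
      also have "\<dots> = C \<oplus>\<^bsub>M\<^esub> D" unfolding that(1) using that(2-5) by (simp add: M.M.a_ac)
      finally show ?thesis .
    qed
    have "finsum M (\<lambda>k. ?p s (Suc k)) {..<N} \<oplus>\<^bsub>M\<^esub> finsum M (?p (flip s)) {..<N} =
        finsum M (\<lambda>k. ?p (flip s) (Suc k)) {..<N} \<oplus>\<^bsub>M\<^esub> finsum M (?p s) {..<N}"
      by (rule g[OF trans[OF t t[symmetric]]]) (use x in \<open>auto intro!: M.M.finsum_closed\<close>)
    then show ?thesis by (subst (1 2) M.M.finsum_addf) (use x in auto)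
  qed
  have S: "norm_sum s (commut [flip s] x) = finsum M (\<lambda>k. ?c s k \<oplus>\<^bsub>M\<^esub> ?c (flip s) k) {..<N}
      \<oplus>\<^bsub>M\<^esub> finsum M (\<lambda>k. ?p s (Suc k) \<oplus>\<^bsub>M\<^esub> ?p (flip s) k) {..<N}" for s
    unfolding S0 by (rule M.M.finsum_addf) (use x in auto)
  have C: "finsum M (\<lambda>k. ?c (flip s) k \<oplus>\<^bsub>M\<^esub> ?c (flip (flip s)) k) {..<N} =
      finsum M (\<lambda>k. ?c s k \<oplus>\<^bsub>M\<^esub> ?c (flip s) k) {..<N}"
    unfolding flip_flip by (rule M.M.finsum_cong') (use x in \<open>auto intro: M.M.a_comm\<close>)
  show ?thesis
    using S[of s] S[of "flip s", unfolded C] T by (simp only: flip_flip)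
qed

abbreviation "wA \<equiv> altw Arr_a (2 * N - 1)"
abbreviation "wB \<equiv> altw Arr_abar (2 * N - 1)"

text \<open>The image of \<open>1 \<otimes>\<^sub>r 1\<close> under the differential from degree \<open>n\<close>, with \<open>v s\<close> substituted for
  \<open>1 \<otimes>\<^sub>s 1\<close>; this makes sense in every bimodule.\<close>

definition diff_val :: "nat \<Rightarrow> int \<Rightarrow> (int \<Rightarrow> 'm) \<Rightarrow> 'm" where
  "diff_val n r v =
    (if 2 * r < int n then commut [Arr_a] (v r) \<oplus>\<^bsub>M\<^esub> commut wB (v (r - 1))
     else if int n < 2 * r then commut wA (v r) \<oplus>\<^bsub>M\<^esub> commut [Arr_abar] (v (r - 1))
     else norm_sum Arr_a (v r) \<oplus>\<^bsub>M\<^esub> norm_sum Arr_abar (v (r - 1)))"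

lemma diff_val_closed [simp, intro]: "(\<And>s. v s \<in> carrier M) \<Longrightarrow> diff_val n r v \<in> carrier M"
  by (simp add: diff_val_def)

lemma w_nonalt: "\<not> distinct_adj (wA @ wA)" "\<not> distinct_adj (wB @ wB)"
  using N1 by (intro alt_append_same; simp)+

text \<open>The type of an entry depends on the position of \<open>2 * r\<close> and
  \<open>2 * r - 2\<close> relative to the middle of the degree. This leaves five regimes, in each
  of which the preceding identities for commutators and norm sums make the terms cancel.\<close>

lemma diff_val_diff_val:
  assumes v: "\<And>s. v s \<in> carrier M"
  shows "diff_val (Suc n) r (\<lambda>s. diff_val n s v) = \<zero>\<^bsub>M\<^esub>"
proof -
  note comm_a = commut_commut_comm[of _ Arr_a, simplified] and comm_b = commut_commut_comm[of _ Arr_abar, simplified]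
  note flip_a = commut_norm_sum_flip[of _ Arr_a, simplified] and flip_b = commut_norm_sum_flip[of _ Arr_abar, simplified]
  note same = commut_commut_same commut_norm_sum_same w_nonalt w_nonalt[simplified]
  consider "2 * r < int n" | "2 * r = int n" | "2 * r = int n + 1" | "2 * r = int n + 2" | "int n + 2 < 2 * r"
    by linarith
  then show ?thesis
  proof cases
    case 1
    then have "diff_val (Suc n) r (\<lambda>s. diff_val n s v) =
        commut [Arr_a] (commut [Arr_a] (v r) \<oplus>\<^bsub>M\<^esub> commut wB (v (r - 1))) \<oplus>\<^bsub>M\<^esub> commut wB (commut [Arr_a] (v (r - 1)) \<oplus>\<^bsub>M\<^esub> commut wB (v (r - 2)))"
      by (simp add: diff_val_def)
    then show ?thesis using v by (simp add: same comm_a M.M.a_ac)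
  next
    case 2
    then have "diff_val (Suc n) r (\<lambda>s. diff_val n s v) =
        commut [Arr_a] (norm_sum Arr_a (v r) \<oplus>\<^bsub>M\<^esub> norm_sum Arr_abar (v (r - 1))) \<oplus>\<^bsub>M\<^esub> commut wB (commut [Arr_a] (v (r - 1)) \<oplus>\<^bsub>M\<^esub> commut wB (v (r - 2)))"
      by (simp add: diff_val_def)
    then show ?thesis using v by (simp add: same flip_a M.M.a_ac)
  next
    case 3
    then have "diff_val (Suc n) r (\<lambda>s. diff_val n s v) =
        norm_sum Arr_a (commut wA (v r) \<oplus>\<^bsub>M\<^esub> commut [Arr_abar] (v (r - 1))) \<oplus>\<^bsub>M\<^esub> norm_sum Arr_abar (commut [Arr_a] (v (r - 1)) \<oplus>\<^bsub>M\<^esub> commut wB (v (r - 2)))"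
      by (simp add: diff_val_def)
    then show ?thesis using v norm_sum_commut_flip[OF v[of "r - 1"], of Arr_a] by (simp add: norm_sum_commut_top norm_sum_commut_top[simplified] M.M.a_ac)
  next
    case 4
    then have "diff_val (Suc n) r (\<lambda>s. diff_val n s v) =
        commut wA (commut wA (v r) \<oplus>\<^bsub>M\<^esub> commut [Arr_abar] (v (r - 1))) \<oplus>\<^bsub>M\<^esub> commut [Arr_abar] (norm_sum Arr_a (v (r - 1)) \<oplus>\<^bsub>M\<^esub> norm_sum Arr_abar (v (r - 2)))"
      by (simp add: diff_val_def)
    then show ?thesis using v by (simp add: same flip_b M.M.a_ac)
  next
    case 5
    then have "diff_val (Suc n) r (\<lambda>s. diff_val n s v) =
        commut wA (commut wA (v r) \<oplus>\<^bsub>M\<^esub> commut [Arr_abar] (v (r - 1))) \<oplus>\<^bsub>M\<^esub> commut [Arr_abar] (commut wA (v (r - 1)) \<oplus>\<^bsub>M\<^esub> commut [Arr_abar] (v (r - 2)))"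
      by (simp add: diff_val_def)
    then show ?thesis using v by (simp add: same comm_b M.M.a_ac)
  qed
qed

end

section \<open>Exactness of the one-sided complex\<close>

context Lam
begin

text \<open>The long word that \<open>t\<close> completes to length \<open>2 * N\<close> from either
  side; it begins and ends with \<open>flip t\<close>.\<close>

definition topw :: "arrow \<Rightarrow> arrow list" where
  "topw t = altw (flip t) (2 * N - 1)"

definition mk :: "(arrow list \<Rightarrow> 'k) \<Rightarrow> 'k lam" where
  "mk f = pr (\<Sum>w\<in>basis_words. cst (f w) * sg w)"

lemma mk_closed [simp, intro]: "mk f \<in> carrier L"
  by (simp add: mk_def)

lemma coef_mk: "v \<in> basis_words \<Longrightarrow> coef (mk f) v = f v"
proof -
  assume v: "v \<in> basis_words"
  have "(\<Sum>w\<in>basis_words. f w * cf (sg w) v) = (\<Sum>w\<in>basis_words. if w = v then f v else 0)"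
    by (intro sum.cong) (auto simp: cf_sg v)
  then show ?thesis using v finite_basis_words by (simp add: mk_def coef_pr cf_sum cf_cst)
qed

lemma topw_props [simp]: "distinct_adj (topw t)" "length (topw t) = 2 * N - 1" "topw t \<in> basis_words" "topw t \<noteq> wa" "topw t \<noteq> []"
proof -
  show l: "length (topw t) = 2 * N - 1" and "distinct_adj (topw t)" by (simp_all add: topw_def)
  then show "topw t \<in> basis_words" using N1 by (simp add: basis_words_def)
  show "topw t \<noteq> wa" "topw t \<noteq> []" using l N1 by (auto dest!: arg_cong[of _ _ length])
qed

lemma top_words:
  "topw t @ [t] = altw (flip t) (2 * N)" "[t] @ topw t = altw t (2 * N)"
proof -
  have 2: "2 * N = Suc (2 * N - 1)" using N1 by simp
  show "topw t @ [t] = altw (flip t) (2 * N)"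
    using altw_Suc[of "flip t" "2 * N - 1"] N1 by (simp add: topw_def)
  show "[t] @ topw t = altw t (2 * N)"
    by (subst 2) (simp add: topw_def)
qed

lemma cf_wa: "cf p wa = lk p (altw t (2 * N)) + lk p (altw (flip t) (2 * N))"
  by (cases t) (auto simp: cf_def wa_def wb_def add.commute)

lemma last_altw: "0 < n \<Longrightarrow> last (altw s n) = (if even n then flip s else s)"
  by (cases n) (auto simp: altw_Suc simp del: altw.simps(2))

lemma alt_len_cases: "distinct_adj w \<Longrightarrow> length w = n \<Longrightarrow> w = altw t n \<or> w = altw (flip t) n"
  using distinct_adj_cases[of w] by (cases t) auto

lemma cf_not_wa: "w \<noteq> wa \<Longrightarrow> cf p w = lk p w"
  by (simp add: cf_def)

text \<open>\<open>wa\<close> stands for two words, one of which ends in \<open>t\<close> whatever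
  \<open>t\<close> is. Its coefficient therefore comes from \<open>topw t\<close>, not from
  \<open>butlast w\<close>.\<close>

lemma coef_mult_letter:
  assumes y: "y \<in> carrier L" and w: "w \<in> basis_words"
  shows "coef (y \<otimes>\<^bsub>L\<^esub> lw [t]) w =
    (if w = wa then coef y (topw t) else if w \<noteq> [] \<and> last w = t then coef y (butlast w) else 0)"
proof -
  obtain p where p: "y = pr p" using pr_surj y by blast
  have "cf (p * sg [t]) w = (if w = wa then cf p (topw t) else if w \<noteq> [] \<and> last w = t then cf p (butlast w) else 0)"
  proof (cases "w = wa")
    case True
    have "lk (p * sg [t]) (altw (flip t) (2 * N)) = lk p (topw t)"
      unfolding top_words(1)[of t, symmetric] by (rule lk_sg_right)
    moreover have "lk (p * sg [t]) (altw t (2 * N)) = 0"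
    proof (rule lk_sg_right_zero)
      fix v show "altw t (2 * N) \<noteq> v @ [t]"
        using last_altw[of "2 * N" t] N1 by (metis even_mult_iff even_numeral flip_neq(1) last_snoc mult_pos_pos zero_less_numeral less_trans zero_less_one)
    qed
    ultimately show ?thesis unfolding True cf_wa[of _ t] by (simp add: cf_not_wa)
  next
    case False
    show ?thesis
    proof (cases "w \<noteq> [] \<and> last w = t")
      case True
      then have e: "w = butlast w @ [t]" by (metis append_butlast_last_id)
      have "length (butlast w) < 2 * N" using basis_words_props(2)[OF w] True by (cases w) auto
      then have "butlast w \<noteq> wa" by (metis len_w(1) less_irrefl)
      moreover have "lk (p * sg [t]) (butlast w @ [t]) = lk p (butlast w)" by (rule lk_sg_right)
      then have "lk (p * sg [t]) w = lk p (butlast w)" unfolding e[symmetric] .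
      ultimately show ?thesis using False True by (simp add: cf_not_wa)
    next
      case F: False
      then have "w \<noteq> v @ [t]" for v by auto
      then show ?thesis using False F by (auto simp add: cf_not_wa lk_sg_right_zero)
    qed
  qed
  moreover have "w \<noteq> [] \<Longrightarrow> w \<noteq> wa \<Longrightarrow> butlast w \<in> basis_words"
    using w by (auto simp: basis_words_def butlast_conv_take intro!: alt_take)
  ultimately show ?thesis using w by (simp add: p lw_def coef_pr)
qed

text \<open>Only the empty word and \<open>[t]\<close> count as left factors: any other one produces
  a repeated letter or a word longer than \<open>2 * N\<close>.\<close>

lemma coef_mult_topw:
  assumes y: "y \<in> carrier L" and w: "w \<in> basis_words"
  shows "coef (y \<otimes>\<^bsub>L\<^esub> lw (topw t)) w = (if w = wa then coef y [t] else if w = topw t then coef y [] else 0)"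
proof -
  obtain p where p: "y = pr p" using pr_surj y by blast
  have single: "[t] \<in> basis_words" "[t] \<noteq> wa" using N1 by (auto simp: basis_words_def dest!: arg_cong[of _ _ length])
  have nil: "[] \<noteq> wa" using N1 by (auto dest!: arg_cong[of _ _ length])
  have "cf (p * sg (topw t)) w = (if w = wa then lk p [t] else if w = topw t then lk p [] else 0)"
  proof (cases "w = wa")
    case True
    have "lk (p * sg (topw t)) (altw t (2 * N)) = lk p [t]"
      unfolding top_words(2)[of t, symmetric] by (rule lk_sg_right)
    moreover have "lk (p * sg (topw t)) (altw (flip t) (2 * N)) = 0"
    proof (rule lk_sg_right_zero)
      fix v show "altw (flip t) (2 * N) \<noteq> v @ topw t"
      proof
        assume "altw (flip t) (2 * N) = v @ topw t"
        then have "last (altw (flip t) (2 * N)) = last (topw t)" by simp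
        then show False using N1 by (simp add: last_altw topw_def)
      qed
    qed
    ultimately show ?thesis unfolding True cf_wa[of _ t] by simp
  next
    case False
    show ?thesis
    proof (cases "w = topw t")
      case True
      have "lk (p * sg (topw t)) ([] @ topw t) = lk p []" by (rule lk_sg_right)
      then show ?thesis using True False by (simp add: cf_not_wa del: topw_props(4))
    next
      case F: False
      have "w \<noteq> v @ topw t" for v
      proof
        assume e: "w = v @ topw t"
        then have "v \<noteq> []" using F by auto
        then have "2 * N \<le> length w" using e by (cases v) auto
        then show False using w False by (auto simp: basis_words_def)
      qed
      then show ?thesis using False F by (simp add: cf_not_wa lk_sg_right_zero)
    qed
  qed
  then show ?thesis using w single nil by (simp add: p lw_def coef_pr cf_not_wa)
qed

text \<open>The words of \<open>x\<close> ending in \<open>t\<close>, with that letter removed; \<open>b\<close> says whether \<open>wa\<close> counts as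
  ending in \<open>t\<close>.\<close>

definition strip :: "arrow \<Rightarrow> bool \<Rightarrow> 'k lam \<Rightarrow> 'k lam" where
  "strip t b x = mk (\<lambda>u. if distinct_adj (u @ [t]) \<and> length u < 2 * N then
     (if length u = 2 * N - 1 then (if b then coef x wa else 0) else coef x (u @ [t])) else 0)"

lemma strip_closed [simp, intro]: "strip t b x \<in> carrier L"
  by (simp add: strip_def)

lemma coef_strip:
  assumes "u \<in> basis_words"
  shows "coef (strip t b x) u = (if distinct_adj (u @ [t]) \<and> length u < 2 * N then
     (if length u = 2 * N - 1 then (if b then coef x wa else 0) else coef x (u @ [t])) else 0)"
  unfolding strip_def by (rule coef_mk[OF assms])

lemma coef_strip_letter:
  assumes w: "w \<in> basis_words"
  shows "coef (strip t b x \<otimes>\<^bsub>L\<^esub> lw [t]) w =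
    (if w = wa then (if b then coef x wa else 0) else if w \<noteq> [] \<and> last w = t then coef x w else 0)"
proof -
  have top: "coef (strip t b x) (topw t) = (if b then coef x wa else 0)"
    using N1 by (simp add: coef_strip top_words)
  have "coef (strip t b x) (butlast w) = coef x w" if "w \<noteq> wa" "w \<noteq> []" "last w = t"
  proof -
    have e: "w = butlast w @ [t]" using that by (metis append_butlast_last_id)
    have d: "distinct_adj w" and l: "length w < 2 * N" using w that by (auto simp: basis_words_def)
    have b: "butlast w \<in> basis_words" using d l by (auto simp: basis_words_def butlast_conv_take intro!: alt_take)
    have "0 < length w" using that by simp
    then have "length (butlast w) < 2 * N - 1" using l by (cases w) auto
    then have "length (butlast w) < 2 * N" "length (butlast w) \<noteq> 2 * N - 1" by linarith+
    then show ?thesis using coef_strip[OF b, of t b x] d unfolding e[symmetric] by (simp del: length_butlast)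
  qed
  then show ?thesis using w by (simp add: coef_mult_letter top)
qed

text \<open>\<open>strip\<close> recovers \<open>wa\<close> and all words ending in
  \<open>t\<close>. Among the words not ending in \<open>t\<close>, \<open>x0\<close> leaves only
  \<open>topw t\<close>, and this one is supplied by the constant coefficient of \<open>y\<close>.
  The condition \<open>y1\<close> keeps the second product from disturbing
  \<open>wa\<close>.\<close>

lemma divide_letter:
  assumes x: "x \<in> carrier L" and y: "y \<in> carrier L"
    and x0: "\<And>u. distinct_adj (u @ [t]) \<Longrightarrow> length u < 2 * N - 1 \<Longrightarrow> coef x u = 0"
    and y1: "coef y [t] = 0" and y0: "coef y [] = coef x (topw t)"
  shows "x = strip t True x \<otimes>\<^bsub>L\<^esub> lw [t] \<oplus>\<^bsub>L\<^esub> y \<otimes>\<^bsub>L\<^esub> lw (topw t)"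
proof (rule coef_eqI)
  fix w assume w: "w \<in> basis_words"
  have "coef x w = coef (strip t True x \<otimes>\<^bsub>L\<^esub> lw [t]) w + coef (y \<otimes>\<^bsub>L\<^esub> lw (topw t)) w"
  proof (cases "w = wa")
    case True
    then show ?thesis using w y by (simp add: coef_strip_letter coef_mult_topw y1)
  next
    case False
    show ?thesis
    proof (cases "w = topw t")
      case True
      have "last (topw t) = flip t" using N1 by (simp add: topw_def last_altw)
      then show ?thesis using True y by (simp add: coef_strip_letter coef_mult_topw y0)
    next
      case F: False
      show ?thesis
      proof (cases "w \<noteq> [] \<and> last w = t")
        case True
        then show ?thesis using w y F False by (simp add: coef_strip_letter coef_mult_topw)
      next
        case G: False
        have d: "distinct_adj w" and l: "length w < 2 * N" using w False by (auto simp: basis_words_def)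
        have dt: "distinct_adj (w @ [t])" using d G by (auto simp: distinct_adj_append_iff)
        have "length w \<noteq> 2 * N - 1"
        proof
          assume lw: "length w = 2 * N - 1"
          then have "w = altw t (2 * N - 1) \<or> w = topw t"
            using alt_len_cases[OF d lw, of t] by (simp add: topw_def)
          then have "last w = t" using F last_altw[of "2 * N - 1" t] N1 by auto
          moreover have "w \<noteq> []" using lw N1 by auto
          ultimately show False using G by simp
        qed
        then have "coef x w = 0" using x0[OF dt] l by simp
        then show ?thesis using w y F False G by (simp add: coef_strip_letter coef_mult_topw)
      qed
    qed
  qed
  then show "coef x w = coef (strip t True x \<otimes>\<^bsub>L\<^esub> lw [t] \<oplus>\<^bsub>L\<^esub> y \<otimes>\<^bsub>L\<^esub> lw (topw t)) w"
    using w y by (simp add: coef_add)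
qed (use x y in auto)

lemma coef_zero_elem: "w \<in> basis_words \<Longrightarrow> coef \<zero>\<^bsub>L\<^esub> w = 0"
  by (simp add: coef_pr cf_def)

lemma k_add_eq_0: "(x::'k) + y = 0 \<longleftrightarrow> x = y"
  by (simp add: eq_neg_iff_add_eq_0[symmetric])

lemma snoc_basis_words:
  assumes "distinct_adj (u @ [t])" "length u < 2 * N - 1"
  shows "u @ [t] \<in> basis_words" "u @ [t] \<noteq> wa" "u @ [t] \<noteq> topw t"
proof -
  show "u @ [t] \<in> basis_words" "u @ [t] \<noteq> wa" using assms by (auto simp: basis_words_def dest!: arg_cong[of _ _ length])
  show "u @ [t] \<noteq> topw t"
  proof
    assume "u @ [t] = topw t"
    then have "last (topw t) = t" by (metis last_snoc)
    then show False using N1 by (simp add: topw_def last_altw)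
  qed
qed

text \<open>The coefficients of the equation at \<open>u @ [t]\<close>, at \<open>topw t\<close> and
  at \<open>wa\<close>; of these only \<open>wa\<close> receives contributions from both
  products.\<close>

lemma cond_top:
  assumes x: "x \<in> carrier L" and y: "y \<in> carrier L"
    and eq: "x \<otimes>\<^bsub>L\<^esub> lw [t] \<oplus>\<^bsub>L\<^esub> y \<otimes>\<^bsub>L\<^esub> lw (topw t) = \<zero>\<^bsub>L\<^esub>"
  shows "distinct_adj (u @ [t]) \<Longrightarrow> length u < 2 * N - 1 \<Longrightarrow> coef x u = 0"
    and "coef y [] = 0" and "coef y [t] = coef x (topw t)"
proof -
  have e: "coef (x \<otimes>\<^bsub>L\<^esub> lw [t]) w = coef (y \<otimes>\<^bsub>L\<^esub> lw (topw t)) w" if w: "w \<in> basis_words" for w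
    using arg_cong[OF eq, of "\<lambda>z. coef z w"] w x y by (simp add: coef_add coef_zero_elem k_add_eq_0 del: pr_zero)
  have last: "last (topw t) \<noteq> t" using N1 by (simp add: topw_def last_altw)
  show "distinct_adj (u @ [t]) \<Longrightarrow> length u < 2 * N - 1 \<Longrightarrow> coef x u = 0"
    using e[of "u @ [t]"] snoc_basis_words[of u t] x y by (simp add: coef_mult_letter coef_mult_topw)
  show "coef y [] = 0" using e[of "topw t"] x y last by (simp add: coef_mult_letter coef_mult_topw)
  have "wa \<in> basis_words" by (simp add: basis_words_def)
  then show "coef y [t] = coef x (topw t)" using e[of wa] x y by (simp add: coef_mult_letter coef_mult_topw)
qed

lemma cond_mid:
  assumes x: "x \<in> carrier L" and y: "y \<in> carrier L"
    and eq: "x \<otimes>\<^bsub>L\<^esub> lw [t] \<oplus>\<^bsub>L\<^esub> y \<otimes>\<^bsub>L\<^esub> lw [flip t] = \<zero>\<^bsub>L\<^esub>"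
  shows "distinct_adj (u @ [t]) \<Longrightarrow> length u < 2 * N - 1 \<Longrightarrow> coef x u = 0"
    and "distinct_adj (u @ [flip t]) \<Longrightarrow> length u < 2 * N - 1 \<Longrightarrow> coef y u = 0"
    and "coef y (topw (flip t)) = coef x (topw t)"
proof -
  have e: "coef (x \<otimes>\<^bsub>L\<^esub> lw [t]) w = coef (y \<otimes>\<^bsub>L\<^esub> lw [flip t]) w" if w: "w \<in> basis_words" for w
    using arg_cong[OF eq, of "\<lambda>z. coef z w"] w x y by (simp add: coef_add coef_zero_elem k_add_eq_0 del: pr_zero)
  show "distinct_adj (u @ [t]) \<Longrightarrow> length u < 2 * N - 1 \<Longrightarrow> coef x u = 0"
    using e[of "u @ [t]"] snoc_basis_words[of u t] x y by (simp add: coef_mult_letter)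
  show "distinct_adj (u @ [flip t]) \<Longrightarrow> length u < 2 * N - 1 \<Longrightarrow> coef y u = 0"
    using e[of "u @ [flip t]"] snoc_basis_words[of u "flip t"] x y by (simp add: coef_mult_letter)
  have "wa \<in> basis_words" by (simp add: basis_words_def)
  then show "coef y (topw (flip t)) = coef x (topw t)" using e[of wa] x y by (simp add: coef_mult_letter)
qed

text \<open>\<open>wa\<close> can be read as ending in either letter. It is assigned to
  \<open>Arr_a\<close> alone, hence the two different flags.\<close>

lemma split_letters:
  assumes x: "x \<in> carrier L" and x0: "coef x [] = 0"
  shows "x = strip Arr_a True x \<otimes>\<^bsub>L\<^esub> lw [Arr_a] \<oplus>\<^bsub>L\<^esub> strip Arr_abar False x \<otimes>\<^bsub>L\<^esub> lw [Arr_abar]"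
proof (rule coef_eqI)
  fix w assume w: "w \<in> basis_words"
  have "coef x w = coef (strip Arr_a True x \<otimes>\<^bsub>L\<^esub> lw [Arr_a]) w + coef (strip Arr_abar False x \<otimes>\<^bsub>L\<^esub> lw [Arr_abar]) w"
    using w x0 by (cases "w = []"; cases "last w") (auto simp: coef_strip_letter)
  then show "coef x w = coef (strip Arr_a True x \<otimes>\<^bsub>L\<^esub> lw [Arr_a] \<oplus>\<^bsub>L\<^esub> strip Arr_abar False x \<otimes>\<^bsub>L\<^esub> lw [Arr_abar]) w"
    using w by (simp add: coef_add)
qed (use x in auto)

text \<open>The entries of the one-sided differential of degree \<open>m\<close> into the component \<open>s\<close>, from the
  components \<open>s\<close> and \<open>s + 1\<close>.\<close>

definition wl :: "nat \<Rightarrow> nat \<Rightarrow> arrow list" where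
  "wl m s = (if 2 * s < m then [Arr_a] else topw Arr_abar)"

definition wr :: "nat \<Rightarrow> nat \<Rightarrow> arrow list" where
  "wr m s = (if 2 * s + 2 \<le> m then topw Arr_a else [Arr_abar])"

text \<open>The preimage is explicit: below the middle divide by \<open>Arr_a\<close>, above it by
  \<open>Arr_abar\<close>, and let the remainder at the long word come from a neighbouring
  component. The cycle conditions make these divisions possible; for \<open>m = 0\<close>, where
  there is no cycle condition, the hypothesis on the constant coefficient takes their place.\<close>

lemma Q_exact:
  assumes q: "\<And>s. s \<le> m \<Longrightarrow> q s \<in> carrier L"
    and q0: "m = 0 \<Longrightarrow> coef (q 0) [] = 0"
    and cyc: "\<And>s. s < m \<Longrightarrow> q s \<otimes>\<^bsub>L\<^esub> lw (wl m s) \<oplus>\<^bsub>L\<^esub> q (Suc s) \<otimes>\<^bsub>L\<^esub> lw (wr m s) = \<zero>\<^bsub>L\<^esub>"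
  shows "\<exists>y. (\<forall>s. y s \<in> carrier L) \<and>
    (\<forall>s\<le>m. q s = y s \<otimes>\<^bsub>L\<^esub> lw (wl (Suc m) s) \<oplus>\<^bsub>L\<^esub> y (Suc s) \<otimes>\<^bsub>L\<^esub> lw (wr (Suc m) s))"
proof -
  \<comment> \<open>At \<open>2 * s = m + 1\<close> the component has to supply the coefficients of
    the long words on both sides of the middle, so it is a scalar. The flag omits \<open>wa\<close>
    at \<open>2 * (s - 1) = m\<close>, where the division by \<open>Arr_a\<close> has already taken
    it.\<close>
  define y where "y s = (if 2 * s \<le> m then strip Arr_a True (q s)
    else if 2 * s = m + 1 then \<kappa> (coef (q (s - 1)) (topw Arr_a))
    else strip Arr_abar (2 * (s - 1) \<noteq> m) (q (s - 1)))" for s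
  have N1': "1 < 2 * N - 1" using N1 by simp
  have letter: "[t] \<in> basis_words" for t using N1 by (auto simp: basis_words_def)
  have kn: "coef (\<kappa> c) [] = c" "coef (\<kappa> c) [t] = 0" for c t
    using letter[of t] N1 by (auto simp: scalar_pr coef_pr cf_def lk_cst dest!: arg_cong[of _ _ length])
  have stn: "coef (strip t b x) [] = coef x [t]" "coef (strip t b x) [t] = 0" for t b x
    using letter[of t] N1' by (auto simp: coef_strip)
  have "q s = y s \<otimes>\<^bsub>L\<^esub> lw (wl (Suc m) s) \<oplus>\<^bsub>L\<^esub> y (Suc s) \<otimes>\<^bsub>L\<^esub> lw (wr (Suc m) s)" if s: "s \<le> m" for s
  proof -
    consider "2 * s + 2 \<le> m" | "2 * s + 1 = m" | "2 * s = m" | "2 * s = m + 1" | "m + 1 < 2 * s" by linarith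
    then show ?thesis
    proof cases
      case 1
      have "q s = strip Arr_a True (q s) \<otimes>\<^bsub>L\<^esub> lw [Arr_a] \<oplus>\<^bsub>L\<^esub> y (Suc s) \<otimes>\<^bsub>L\<^esub> lw (topw Arr_a)"
      proof (rule divide_letter)
        show "coef (q s) u = 0" if "distinct_adj (u @ [Arr_a])" "length u < 2 * N - 1" for u
          by (rule cond_top(1)[of _ "q (Suc s)"]) (use that q 1 cyc[of s] in \<open>auto simp: wl_def wr_def\<close>)
        have "coef (q (Suc s)) [Arr_a] = coef (q s) (topw Arr_a)"
          by (rule cond_top(3)) (use q 1 cyc[of s] in \<open>auto simp: wl_def wr_def\<close>)
        then show "coef (y (Suc s)) [] = coef (q s) (topw Arr_a)" using 1 by (simp add: y_def stn)
        show "coef (y (Suc s)) [Arr_a] = 0" using 1 by (simp add: y_def stn)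
      qed (use q s 1 in \<open>auto simp: y_def\<close>)
      then show ?thesis using 1 by (simp add: y_def wl_def wr_def)
    next
      case 2
      have "q s = strip Arr_a True (q s) \<otimes>\<^bsub>L\<^esub> lw [Arr_a] \<oplus>\<^bsub>L\<^esub> y (Suc s) \<otimes>\<^bsub>L\<^esub> lw (topw Arr_a)"
      proof (rule divide_letter)
        show "coef (q s) u = 0" if "distinct_adj (u @ [Arr_a])" "length u < 2 * N - 1" for u
          by (rule cond_mid(1)[of _ "q (Suc s)"]) (use that q 2 cyc[of s] in \<open>auto simp: wl_def wr_def\<close>)
        show "coef (y (Suc s)) [] = coef (q s) (topw Arr_a)" using 2 by (simp add: y_def kn)
        show "coef (y (Suc s)) [Arr_a] = 0" using 2 by (simp add: y_def kn)
      qed (use q s 2 in \<open>auto simp: y_def\<close>)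
      then show ?thesis using 2 by (simp add: y_def wl_def wr_def)
    next
      case 3
      have "coef (q s) [] = 0"
      proof (cases s)
        case 0
        then show ?thesis using 3 q0 by simp
      next
        case (Suc k)
        show ?thesis
          by (rule cond_top(2)[of "q k" _ Arr_a]) (use q 3 Suc cyc[of k] in \<open>auto simp: wl_def wr_def\<close>)
      qed
      from split_letters[OF q[OF s] this] show ?thesis using 3 by (simp add: y_def wl_def wr_def)
    next
      case 4
      then obtain k where k: "s = Suc k" by (cases s) auto
      have "q s = strip Arr_abar True (q s) \<otimes>\<^bsub>L\<^esub> lw [Arr_abar] \<oplus>\<^bsub>L\<^esub> y s \<otimes>\<^bsub>L\<^esub> lw (topw Arr_abar)"
      proof (rule divide_letter)
        show "coef (q s) u = 0" if "distinct_adj (u @ [Arr_abar])" "length u < 2 * N - 1" for u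
          using cond_mid(2)[of "q k" "q s" Arr_a u] that q 4 s k cyc[of k] by (auto simp: wl_def wr_def)
        \<comment> \<open>By the cycle condition the scalar chosen for component \<open>k\<close> is
          also the right one for component \<open>s\<close>.\<close>
        have "coef (q s) (topw Arr_abar) = coef (q k) (topw Arr_a)"
          using cond_mid(3)[of "q k" "q s" Arr_a] q 4 s k cyc[of k] by (auto simp: wl_def wr_def)
        then show "coef (y s) [] = coef (q s) (topw Arr_abar)" using 4 k by (simp add: y_def kn)
        show "coef (y s) [Arr_abar] = 0" using 4 by (simp add: y_def kn)
      qed (use q s 4 in \<open>auto simp: y_def\<close>)
      then show ?thesis using 4 k by (simp add: y_def wl_def wr_def L.a_comm)
    next
      case 5
      then obtain k where k: "s = Suc k" by (cases s) auto
      have eq: "q s \<otimes>\<^bsub>L\<^esub> lw [Arr_abar] \<oplus>\<^bsub>L\<^esub> q k \<otimes>\<^bsub>L\<^esub> lw (topw Arr_abar) = \<zero>\<^bsub>L\<^esub>"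
        using cyc[of k] q[of k] q[of s] 5 s k by (auto simp: wl_def wr_def L.a_comm simp del: pr_zero)
      have "q s = strip Arr_abar True (q s) \<otimes>\<^bsub>L\<^esub> lw [Arr_abar] \<oplus>\<^bsub>L\<^esub> y s \<otimes>\<^bsub>L\<^esub> lw (topw Arr_abar)"
      proof (rule divide_letter)
        show "coef (q s) u = 0" if "distinct_adj (u @ [Arr_abar])" "length u < 2 * N - 1" for u
          using cond_top(1)[OF _ _ eq that] q s k by auto
        have "coef (q k) [Arr_abar] = coef (q s) (topw Arr_abar)"
          using cond_top(3)[OF _ _ eq] q s k by auto
        then show "coef (y s) [] = coef (q s) (topw Arr_abar)" using 5 k by (simp add: y_def stn)
        show "coef (y s) [Arr_abar] = 0" using 5 k by (simp add: y_def stn)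
      qed (use q s 5 in \<open>auto simp: y_def\<close>)
      then show ?thesis using 5 k by (simp add: y_def wl_def wr_def L.a_comm)
    qed
  qed
  moreover have "y s \<in> carrier L" for s by (simp add: y_def)
  ultimately show ?thesis by blast
qed

end

section \<open>Exactness of the bimodule resolution\<close>

text \<open>The formula is built from sums and the two actions, so bimodule maps pass through it.
  All composites with the differential are computed on generators in this way.\<close>

lemma (in Lam) hom_diff_val:
  fixes M :: "('k lam, 'm) bimodule" and M' :: "('k lam, 'n) bimodule"
  assumes M1: "LamM N M" and M2: "LamM N M'" and f: "f \<in> bimod_hom L M M'"
    and v: "\<And>s. v s \<in> carrier M"
  shows "f (LamM.diff_val N M n r v) = LamM.diff_val N M' n r (\<lambda>s. f (v s))"
proof -
  interpret A: LamM N K M by (rule M1)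
  interpret B: LamM N K M' by (rule M2)
  have W: "f (A.W u x w) = B.W u (f x) w" if "x \<in> carrier M" for u x w
    using that unfolding A.W_def B.W_def bact_def
    by (simp add: bimod_homD(3)[OF f] bimod_homD(4)[OF f])
  have commut: "f (A.commut w x) = B.commut w (f x)" if "x \<in> carrier M" for w x
    using that unfolding A.commut_def B.commut_def by (simp add: bimod_homD(2)[OF f] W)
  have norm_sum: "f (A.norm_sum s x) = B.norm_sum s (f x)" if x: "x \<in> carrier M" for s x
    unfolding A.norm_sum_def B.norm_sum_def
    by (subst finsum_additive[OF A.M.M.abelian_group_axioms B.M.M.abelian_group_axioms, of f])
      (use x in \<open>auto simp: bimod_homD(1)[OF f] bimod_homD(2)[OF f] W intro!: B.M.M.finsum_cong'\<close>)
  show ?thesis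
    unfolding A.diff_val_def B.diff_val_def using v by (simp add: bimod_homD(2)[OF f] commut norm_sum)
qed

context Lam
begin

lemma LamM_res: "LamM N (res_module N n :: ('k lam, 'k res_elem) bimodule)"
  by (intro LamM.intro Lam_axioms) (simp add: res_module_def L.F_bimod)

sublocale P: LamM N K "res_module N n" for n
  by (rule LamM_res)

section \<open>The differential and the augmentation on generators\<close>

abbreviation P :: "nat \<Rightarrow> ('k lam, 'k res_elem) bimodule" where "P \<equiv> res_module N"

definition gn :: "nat \<Rightarrow> int \<Rightarrow> 'k res_elem" where
  "gn n s = res_tensor N n s \<one>\<^bsub>L\<^esub> \<one>\<^bsub>L\<^esub>"

lemma gn_closed [simp, intro]: "gn n s \<in> carrier (P n)"
  unfolding gn_def res_tensor_def res_module_def by (rule L.free_tensor_closed) auto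

lemma gn_zero: "s < 0 \<or> int n < s \<Longrightarrow> gn n s = \<zero>\<^bsub>P n\<^esub>"
  unfolding gn_def res_tensor_def res_module_def by (rule L.free_tensor_zero)

lemma res_tensor_bact:
  assumes "x \<in> carrier L" "y \<in> carrier L"
  shows "res_tensor N n s x y = bact (P n) x (gn n s) y"
  unfolding res_tensor_def gn_def res_module_def
proof (rule L.F_ext[where n=n])
  interpret FF: bimod L \<kappa> "L.F n" by (rule L.F_bimod)
  show "free_tensor \<kappa> L n s x y \<in> carrier (L.F n)" using assms by auto
  show "bact (L.F n) x (free_tensor \<kappa> L n s \<one>\<^bsub>L\<^esub> \<one>\<^bsub>L\<^esub>) y \<in> carrier (L.F n)"
    by (rule FF.bact_closed[OF assms L.free_tensor_closed]) auto
  show "free_tensor \<kappa> L n s x y i = bact (L.F n) x (free_tensor \<kappa> L n s \<one>\<^bsub>L\<^esub> \<one>\<^bsub>L\<^esub>) y i" if "i \<le> n" for i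
    using that assms by (auto simp: bact_def L.free_tensor_apply simp del: pr_one)
qed

lemma lw_one: "\<one>\<^bsub>L\<^esub> = lw []"
  by (simp add: lw_def)

lemma res_tensor_W: "res_tensor N n s (lw u) (lw v) = P.W n u (gn n s) v"
  by (simp add: res_tensor_bact P.W_def)

lemma lw_pow2: "lw [Arr_a, Arr_abar] [^]\<^bsub>L\<^esub> (n::nat) = lw (altw Arr_a (2 * n))"
  "lw [Arr_abar, Arr_a] [^]\<^bsub>L\<^esub> (n::nat) = lw (altw Arr_abar (2 * n))"
  using lw_pow[of Arr_a n] lw_pow[of Arr_abar n] by simp_all

lemma arrow_lw: "Lambda_arrow N x = lw [x]"
  by (simp add: arrow_pr lw_def)

lemma wAB: "x # altw (flip x) (2 * (N - 1)) = altw x (2 * N - 1)"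
proof -
  have "2 * N - 1 = Suc (2 * (N - 1))" using N1 by simp
  then show ?thesis by (simp only: altw.simps)
qed

text \<open>Signs disappear because every element is its own negative. For
  \<open>Suc m = 2 * r\<close> the sum is regrouped according to the two generators that occur in
  it, which gives one norm sum for each.\<close>

lemma gen_eq:
  "res_diff_gen N (Suc m) r = P.diff_val m (Suc m) (int r) (gn m)"
proof -
  let ?r = "int r"
  have sig: "(if even k then x else \<ominus>\<^bsub>P m\<^esub> x) = x" if "x \<in> carrier (P m)" for k :: nat and x
    using that by simp
  have w: "Lambda_arrow N Arr_abar \<otimes>\<^bsub>L\<^esub> ((Lambda_arrow N Arr_a \<otimes>\<^bsub>L\<^esub> Lambda_arrow N Arr_abar) [^]\<^bsub>L\<^esub> (N - 1)) = lw (altw Arr_abar (2 * N - 1))"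
    "Lambda_arrow N Arr_a \<otimes>\<^bsub>L\<^esub> ((Lambda_arrow N Arr_abar \<otimes>\<^bsub>L\<^esub> Lambda_arrow N Arr_a) [^]\<^bsub>L\<^esub> (N - 1)) = lw (altw Arr_a (2 * N - 1))"
    using wAB[of Arr_abar] wAB[of Arr_a] by (simp_all add: arrow_lw lw_pow2)
  have al: "altw s (2 * k) @ [s] = altw s (Suc (2 * k))" for s k
    by (simp add: altw_Suc del: altw.simps(2))
  have mid: "res_diff_gen N (Suc m) r = P.diff_val m (Suc m) ?r (gn m)" if n: "Suc m = 2 * r"
  proof -
    have c: "\<not> 2 * r < Suc m" "\<not> Suc m < 2 * r" using n by simp_all
    have "res_diff_gen N (Suc m) r = finsum (P m) (\<lambda>k.
        (P.W m (altw Arr_abar (2 * k)) (gn m ?r) (altw Arr_a (Suc (2 * (N - 1 - k)))) \<oplus>\<^bsub>P m\<^esub>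
         P.W m (altw Arr_a (Suc (2 * k))) (gn m ?r) (altw Arr_a (2 * (N - 1 - k)))) \<oplus>\<^bsub>P m\<^esub>
        (P.W m (altw Arr_a (2 * k)) (gn m (?r - 1)) (altw Arr_abar (Suc (2 * (N - 1 - k)))) \<oplus>\<^bsub>P m\<^esub>
         P.W m (altw Arr_abar (Suc (2 * k))) (gn m (?r - 1)) (altw Arr_abar (2 * (N - 1 - k))))) {..<N}"
      unfolding res_diff_gen_def Let_def
      apply (simp only: c if_False diff_Suc_1 arrow_lw lw_mult append_Cons append_Nil lw_pow2 lw_one res_tensor_W)
      apply (rule P.M.M.finsum_cong')
        apply simp
       apply force
      subgoal for k
      proof -
        have W: "rsmult (P m) (lw u \<odot>\<^bsub>P m\<^esub> x) (lw v) = P.W m u x v" for u x v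
          by (simp add: P.W_def bact_def)
        have e: "N - k - 1 = N - 1 - k" by simp
        show ?thesis
          by (simp add: W e sig al del: altw.simps(2) P.M_neg) (simp add: P.M.M.a_ac)
      qed
      done
    also have "\<dots> = P.diff_val m (Suc m) ?r (gn m)"
      unfolding P.diff_val_def P.norm_sum_def using n by (subst P.M.M.finsum_addf[symmetric]) (auto)
    finally show ?thesis .
  qed
  consider "2 * r < Suc m" | "Suc m < 2 * r" | "Suc m = 2 * r" by linarith
  then show ?thesis
  proof cases
    case 1
    then show ?thesis
      unfolding res_diff_gen_def Let_def P.diff_val_def P.commut_def w
      by (simp only: arrow_lw lw_one res_tensor_W diff_Suc_1)
        (simp add: P.M.M.a_ac del: lw_Nil)
  next
    case 2
    then have "\<not> 2 * r < Suc m" by simp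
    then show ?thesis using 2
      unfolding res_diff_gen_def Let_def P.diff_val_def P.commut_def w
      by (simp only: arrow_lw lw_one res_tensor_W diff_Suc_1)
        (simp add: P.M.M.a_ac del: lw_Nil)
  next
    case 3
    then show ?thesis by (rule mid)
  qed
qed

lemma d_hom: "res_diff N (Suc m) \<in> bimod_hom L (P (Suc m)) (P m)"
  using bimod.free_bimod_map(1)[OF LamM.axioms(2)[OF LamM_res[of m]], of "Suc m" "res_diff_gen N (Suc m)"]
  by (simp add: res_diff_def gen_eq res_module_def[of N "Suc m"] P.diff_val_closed)

lemma diff_val_zero:
  fixes M :: "('k lam, 'm) bimodule"
  assumes M: "LamM N M" and "v r = \<zero>\<^bsub>M\<^esub>" "v (r - 1) = \<zero>\<^bsub>M\<^esub>"
  shows "LamM.diff_val N M n r v = \<zero>\<^bsub>M\<^esub>"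
proof -
  interpret A: LamM N K M by (rule M)
  show ?thesis using assms by (simp add: A.diff_val_def)
qed

lemma hom_zero_bimod:
  fixes M :: "('k lam, 'm) bimodule" and M' :: "('k lam, 'n) bimodule"
  assumes "LamM N M" "LamM N M'" "f \<in> bimod_hom L M M'" shows "f \<zero>\<^bsub>M\<^esub> = \<zero>\<^bsub>M'\<^esub>"
  using assms by (intro bimod2.hom_zero[of L \<kappa>]) (auto simp: bimod2_def LamM_def)

text \<open>Holds for every integer \<open>r\<close>: out of range the generator is zero, and so are
  both generators that \<open>diff_val\<close> then sees.\<close>

lemma d_gn: "res_diff N (Suc m) (gn (Suc m) r) = P.diff_val m (Suc m) r (gn m)"
proof (cases "0 \<le> r \<and> r \<le> int (Suc m)")
  case True
  then obtain k where k: "r = int k" "k \<le> Suc m" by (metis nonneg_int_cases of_nat_le_iff)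
  show ?thesis
    using bimod.free_bimod_map(2)[OF LamM.axioms(2)[OF LamM_res[of m]], of "Suc m" "res_diff_gen N (Suc m)" k] k
    by (simp add: res_diff_def gen_eq gn_def[of "Suc m"] res_tensor_def P.diff_val_closed del: pr_one)
next
  case False
  then have "gn (Suc m) r = \<zero>\<^bsub>P (Suc m)\<^esub>" by (intro gn_zero) auto
  moreover have "P.diff_val m (Suc m) r (gn m) = \<zero>\<^bsub>P m\<^esub>"
    using False by (intro diff_val_zero LamM_res gn_zero) auto
  ultimately show ?thesis using hom_zero_bimod[OF LamM_res LamM_res d_hom] by simp
qed

lemma P_hom_ex:
  fixes M :: "('k lam, 'm) bimodule"
  assumes M: "LamM N M" and v: "\<And>r. r \<le> n \<Longrightarrow> v r \<in> carrier M"
  shows "\<exists>f\<in>bimod_hom L (P n) M. \<forall>r\<le>n. f (gn n (int r)) = v r"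
  using bimod.free_bimod_map[OF LamM.axioms(2)[OF M], of n v] v
  unfolding gn_def res_tensor_def res_module_def by blast

lemma P_hom_eqI:
  fixes M :: "('k lam, 'm) bimodule"
  assumes M: "LamM N M" and f: "f \<in> bimod_hom L (P n) M" and g: "g \<in> bimod_hom L (P n) M"
    and eq: "\<And>r. r \<le> n \<Longrightarrow> f (gn n (int r)) = g (gn n (int r))"
  shows "f = g"
  using bimod.F_hom_eqI[OF LamM.axioms(2)[OF M], of f n g] assms(2-4)
  unfolding gn_def res_tensor_def res_module_def by blast

lemma P_comp:
  assumes "f \<in> bimod_hom L (P n) (P m)" "g \<in> bimod_hom L (P m) M"
  shows "compose (carrier (P n)) g f \<in> bimod_hom L (P n) M"
  by (rule bimod_hom_compose[OF assms]) (auto intro: P.M.M.abelian_group_axioms)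

lemma compose_apply: "x \<in> A \<Longrightarrow> compose A g f x = g (f x)"
  by (simp add: compose_def)

lemma dd:
  assumes x: "x \<in> carrier (P (Suc (Suc n)))"
  shows "res_diff N (Suc n) (res_diff N (Suc (Suc n)) x) = \<zero>\<^bsub>P n\<^esub>"
proof -
  let ?c = "compose (carrier (P (Suc (Suc n)))) (res_diff N (Suc n)) (res_diff N (Suc (Suc n)))"
  let ?z = "\<lambda>x\<in>carrier (P (Suc (Suc n))). \<zero>\<^bsub>P n\<^esub>"
  have "?c = ?z"
  proof (rule P_hom_eqI[OF LamM_res P_comp[OF d_hom d_hom]])
    show "?z \<in> bimod_hom L (P (Suc (Suc n))) (P n)"
      by (rule bimod_homI) auto
    fix r
    show "?c (gn (Suc (Suc n)) (int r)) = ?z (gn (Suc (Suc n)) (int r))"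
      by (simp add: compose_apply d_gn hom_diff_val[OF LamM_res LamM_res d_hom] P.diff_val_diff_val)
  qed
  from fun_cong[OF this, of x] show ?thesis using x by (simp add: compose_apply)
qed

abbreviation Reg :: "('k lam, 'k lam) bimodule" where "Reg \<equiv> regular_bimodule L"

lemma Reg_simps [simp]:
  "carrier Reg = carrier L" "add Reg = add L" "ring.zero Reg = pr 0"
  "smult Reg = mult L" "rsmult Reg = mult L"
  by (simp_all add: regular_bimodule_def)

lemma abelian_group_like_L:
  assumes "carrier M = carrier L" "add M = add L" "ring.zero M = ring.zero L"
  shows "abelian_group M"
  by (rule abelian_groupI) (use assms L.add.l_inv_ex in \<open>auto simp: L.a_ac\<close>)

lemma Reg_LamM: "LamM N Reg"
proof (intro LamM.intro Lam_axioms bimod.intro bimod_axioms.intro central_L)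
  show "abelian_group Reg" by (rule abelian_group_like_L) simp_all
qed (auto simp: L.l_distr L.r_distr L.m_assoc L.kappa_central simp del: pr_one)

sublocale R: LamM N K "regular_bimodule L"
  by (rule Reg_LamM)

lemma Reg_W: "R.W u x v = lw u \<otimes>\<^bsub>L\<^esub> x \<otimes>\<^bsub>L\<^esub> lw v"
  by (simp add: R.W_def bact_def)

lemma eps_ex:
  "res_aug N \<in> bimod_hom L (P 0) Reg"
  "x \<in> carrier L \<Longrightarrow> y \<in> carrier L \<Longrightarrow> res_aug N (res_tensor N 0 0 x y) = x \<otimes>\<^bsub>L\<^esub> y"
proof -
  let ?Q = "\<lambda>f. f \<in> bimod_hom L (P 0) Reg \<and>
    (\<forall>x\<in>carrier L. \<forall>y\<in>carrier L. f (res_tensor N 0 0 x y) = x \<otimes>\<^bsub>L\<^esub> y)"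
  obtain f where f: "f \<in> bimod_hom L (P 0) Reg" "\<forall>r\<le>0. f (gn 0 (int r)) = \<one>\<^bsub>L\<^esub>"
    using P_hom_ex[OF Reg_LamM, of 0 "\<lambda>_. \<one>\<^bsub>L\<^esub>"] by auto
  have "f (res_tensor N 0 0 x y) = x \<otimes>\<^bsub>L\<^esub> y" if "x \<in> carrier L" "y \<in> carrier L" for x y
    using that f(2) by (simp add: res_tensor_bact bact_def bimod_homD(3)[OF f(1)] bimod_homD(4)[OF f(1)] del: pr_one)
  then have Q: "?Q f" using f by simp
  have uniq: "g = f" if g: "?Q g" for g
  proof (rule P_hom_eqI[OF Reg_LamM])
    fix r :: nat assume "r \<le> 0"
    then show "g (gn 0 (int r)) = f (gn 0 (int r))"
      using Q g by (simp add: gn_def del: pr_one)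
  qed (use Q g in simp_all)
  have "\<exists>!f. ?Q f" by (rule ex1I[of ?Q, OF Q uniq])
  from theI'[OF this] have "?Q (res_aug N)" unfolding res_aug_def .
  then show "res_aug N \<in> bimod_hom L (P 0) Reg"
    "x \<in> carrier L \<Longrightarrow> y \<in> carrier L \<Longrightarrow> res_aug N (res_tensor N 0 0 x y) = x \<otimes>\<^bsub>L\<^esub> y" by blast+
qed

lemmas eps_hom = eps_ex(1)

lemma eps_gn: "res_aug N (gn 0 s) = (if s = 0 then \<one>\<^bsub>L\<^esub> else \<zero>\<^bsub>L\<^esub>)"
proof (cases "s = 0")
  case True
  then show ?thesis using eps_ex(2)[of "\<one>\<^bsub>L\<^esub>" "\<one>\<^bsub>L\<^esub>"] by (simp add: gn_def)
next
  case False
  then have "gn 0 s = \<zero>\<^bsub>P 0\<^esub>" by (intro gn_zero) auto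
  then show ?thesis using False hom_zero_bimod[OF LamM_res Reg_LamM eps_hom] by simp
qed

lemma Reg_commut_one: "R.commut w \<one>\<^bsub>L\<^esub> = \<zero>\<^bsub>L\<^esub>"
  by (simp add: R.commut_def Reg_W lw_def)

lemma eps_d:
  assumes x: "x \<in> carrier (P (Suc 0))"
  shows "res_aug N (res_diff N (Suc 0) x) = \<zero>\<^bsub>Reg\<^esub>"
proof -
  let ?c = "compose (carrier (P (Suc 0))) (res_aug N) (res_diff N (Suc 0))"
  let ?z = "\<lambda>x\<in>carrier (P (Suc 0)). \<zero>\<^bsub>Reg\<^esub>"
  have "?c = ?z"
  proof (rule P_hom_eqI[OF Reg_LamM P_comp[OF d_hom eps_hom]])
    show "?z \<in> bimod_hom L (P (Suc 0)) Reg"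
      using R.M.M.zero_closed R.M.M.l_zero R.M.smult_zero R.M.rsmult_zero
      by (intro bimod_homI) (auto simp del: Reg_simps(2-))
    fix r :: nat assume "r \<le> Suc 0"
    then have "r = 0 \<or> r = 1" by auto
    then show "?c (gn (Suc 0) (int r)) = ?z (gn (Suc 0) (int r))"
      using Reg_commut_one R.commut_zero
      by (auto simp: compose_apply d_gn hom_diff_val[OF LamM_res Reg_LamM eps_hom] eps_gn R.diff_val_def)
  qed
  from fun_cong[OF this, of x] show ?thesis using x by (simp add: compose_apply)
qed

subsection \<open>Coordinates on the tensor square\<close>

text \<open>The coefficient of \<open>w\<close> in the right tensor factor, as a map with values in
  the left factor. Such a map is supplied by the universal property.\<close>

definition cw :: "arrow list \<Rightarrow> 'k lam tensor \<Rightarrow> 'k lam" where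
  "cw w = (SOME \<psi>. \<psi> \<in> hom L.T (add_monoid L) \<and>
    (\<forall>x\<in>carrier L. \<forall>y\<in>carrier L. \<psi> (L.tens x y) = x \<otimes>\<^bsub>L\<^esub> \<kappa> (coef y w)))"

lemma kappa_add: "\<kappa> (c + d) = \<kappa> c \<oplus>\<^bsub>L\<^esub> \<kappa> d" and kappa_mult: "\<kappa> (c * d) = \<kappa> c \<otimes>\<^bsub>L\<^esub> \<kappa> d"
  and kappa_0: "\<kappa> 0 = \<zero>\<^bsub>L\<^esub>" and kappa_1: "\<kappa> 1 = \<one>\<^bsub>L\<^esub>"
  by (simp_all add: scalar_pr cst_simps)

lemma cw_ex:
  assumes w: "w \<in> basis_words"
  shows "cw w \<in> hom L.T (add_monoid L)"
    "x \<in> carrier L \<Longrightarrow> y \<in> carrier L \<Longrightarrow> cw w (L.tens x y) = x \<otimes>\<^bsub>L\<^esub> \<kappa> (coef y w)"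
proof -
  have "\<exists>\<psi>\<in>hom L.T (add_monoid L). \<forall>x\<in>carrier L. \<forall>y\<in>carrier L. \<psi> (L.tens x y) = x \<otimes>\<^bsub>L\<^esub> \<kappa> (coef y w)"
    by (rule L.T_universal[OF L.a_comm_group])
      (use w in \<open>auto simp: L.l_distr L.r_distr coef_add coef_kappa kappa_add kappa_mult L.m_assoc\<close>)
  then have "\<exists>\<psi>. \<psi> \<in> hom L.T (add_monoid L) \<and> (\<forall>x\<in>carrier L. \<forall>y\<in>carrier L. \<psi> (L.tens x y) = x \<otimes>\<^bsub>L\<^esub> \<kappa> (coef y w))"
    by blast
  from someI_ex[OF this] show "cw w \<in> hom L.T (add_monoid L)"
    "x \<in> carrier L \<Longrightarrow> y \<in> carrier L \<Longrightarrow> cw w (L.tens x y) = x \<otimes>\<^bsub>L\<^esub> \<kappa> (coef y w)"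
    unfolding cw_def[symmetric] by blast+
qed

definition cv :: "arrow list \<Rightarrow> nat \<Rightarrow> 'k res_elem \<Rightarrow> 'k lam" where
  "cv w s x = cw w (x s)"

lemma P_add_apply: "s \<le> n \<Longrightarrow> (x \<oplus>\<^bsub>P n\<^esub> y) s = x s \<otimes>\<^bsub>L.T\<^esub> y s"
  by (simp add: res_module_def)

lemma P_apply: "x \<in> carrier (P n) \<Longrightarrow> s \<le> n \<Longrightarrow> x s \<in> carrier L.T"
  unfolding res_module_def by (rule L.F_mem)

lemma P_induct [consumes 1, case_names zero tensor add]:
  assumes "x \<in> carrier (P n)"
    and "Q \<zero>\<^bsub>P n\<^esub>"
    and "\<And>r x y. r \<le> n \<Longrightarrow> x \<in> carrier L \<Longrightarrow> y \<in> carrier L \<Longrightarrow> Q (res_tensor N n (int r) x y)"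
    and "\<And>x y. x \<in> carrier (P n) \<Longrightarrow> y \<in> carrier (P n) \<Longrightarrow> Q x \<Longrightarrow> Q y \<Longrightarrow> Q (x \<oplus>\<^bsub>P n\<^esub> y)"
  shows "Q x"
  using assms L.F_induct[of x n Q] unfolding res_module_def res_tensor_def by blast

lemma cv_closed [simp, intro]: "w \<in> basis_words \<Longrightarrow> s \<le> n \<Longrightarrow> x \<in> carrier (P n) \<Longrightarrow> cv w s x \<in> carrier L"
  unfolding cv_def using hom_in_carrier[OF cw_ex(1) P_apply] by simp

lemma cv_add:
  "w \<in> basis_words \<Longrightarrow> s \<le> n \<Longrightarrow> x \<in> carrier (P n) \<Longrightarrow> y \<in> carrier (P n) \<Longrightarrow>
    cv w s (x \<oplus>\<^bsub>P n\<^esub> y) = cv w s x \<oplus>\<^bsub>L\<^esub> cv w s y"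
  unfolding cv_def using hom_mult[OF cw_ex(1) P_apply P_apply] by (simp add: P_add_apply)

lemma cv_zero: "w \<in> basis_words \<Longrightarrow> s \<le> n \<Longrightarrow> cv w s \<zero>\<^bsub>P n\<^esub> = \<zero>\<^bsub>L\<^esub>"
proof -
  assume a: "w \<in> basis_words" "s \<le> n"
  have c: "cv w s \<zero>\<^bsub>P n\<^esub> \<in> carrier L" using a by (intro cv_closed[of _ _ n]) auto
  have "cv w s \<zero>\<^bsub>P n\<^esub> \<oplus>\<^bsub>L\<^esub> cv w s \<zero>\<^bsub>P n\<^esub> = cv w s \<zero>\<^bsub>P n\<^esub>"
    using cv_add[OF a P.M.M.zero_closed P.M.M.zero_closed] by simp
  then show ?thesis using L.add.r_cancel_one[OF c c] by simp
qed

lemma cv_tensor: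
  assumes "w \<in> basis_words" "s \<le> n" "x \<in> carrier L" "y \<in> carrier L"
  shows "cv w s (res_tensor N n (int r) x y) = (if s = r then x \<otimes>\<^bsub>L\<^esub> \<kappa> (coef y w) else \<zero>\<^bsub>L\<^esub>)"
proof (cases "s = r")
  case True
  then show ?thesis using assms cw_ex(2)[OF assms(1)] by (simp add: cv_def res_tensor_def L.free_tensor_apply)
next
  case False
  have "group (add_monoid L)" using L.a_group .
  then have "cw w \<one>\<^bsub>L.T\<^esub> = \<zero>\<^bsub>L\<^esub>" using hom_one[OF cw_ex(1)[OF assms(1)] L.T_group] by simp
  then show ?thesis using assms False by (simp add: cv_def res_tensor_def L.free_tensor_apply)
qed

lemma res_tensor_closed [simp, intro]: "x \<in> carrier L \<Longrightarrow> y \<in> carrier L \<Longrightarrow> res_tensor N n s x y \<in> carrier (P n)"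
  by (simp add: res_tensor_bact)

lemma res_tensor_bact_bact:
  "q \<in> carrier L \<Longrightarrow> x \<in> carrier L \<Longrightarrow> y \<in> carrier L \<Longrightarrow> v \<in> carrier L \<Longrightarrow>
    bact (P n) q (res_tensor N n s x y) v = res_tensor N n s (q \<otimes>\<^bsub>L\<^esub> x) (y \<otimes>\<^bsub>L\<^esub> v)"
  by (simp add: res_tensor_bact bact_def P.M.smult_assoc1 P.M.rsmult_assoc P.M.smult_rsmult)

lemma bact_add:
  "q \<in> carrier L \<Longrightarrow> v \<in> carrier L \<Longrightarrow> x \<in> carrier (P n) \<Longrightarrow> y \<in> carrier (P n) \<Longrightarrow>
    bact (P n) q (x \<oplus>\<^bsub>P n\<^esub> y) v = bact (P n) q x v \<oplus>\<^bsub>P n\<^esub> bact (P n) q y v"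
  by (simp add: bact_def P.M.smult_r_distr P.M.rsmult_l_distr)

text \<open>On pure tensors this is \<open>coef_mult_lw\<close>: right multiplication by
  \<open>lw v\<close> moves the constant coefficient of the right factor to \<open>v\<close> and
  leaves nothing at the other words of length at most that of \<open>v\<close>.\<close>

lemma cv_bact_lw:
  assumes w: "w \<in> basis_words" and v: "v \<in> basis_words" and le: "length w \<le> length v" and s: "s \<le> n"
    and q: "q \<in> carrier L" and G: "G \<in> carrier (P n)"
  shows "cv w s (bact (P n) q G (lw v)) = (if w = v then q \<otimes>\<^bsub>L\<^esub> cv [] s G else \<zero>\<^bsub>L\<^esub>)"
  using G
proof (induction rule: P_induct)
  case zero
  have "bact (P n) q \<zero>\<^bsub>P n\<^esub> (lw v) = \<zero>\<^bsub>P n\<^esub>" using q by (simp add: bact_def)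
  then show ?case using w s q cv_zero[of w s n] cv_zero[of "[]" s n] by (simp del: pr_zero)
next
  case (tensor r x y)
  have "coef (y \<otimes>\<^bsub>L\<^esub> lw v) w = (if w = v then coef y [] else 0)"
    by (rule coef_mult_lw[OF tensor(3) w v le])
  then show ?case
    using w s q v tensor
    by (cases "w = v") (simp_all add: res_tensor_bact_bact cv_tensor kappa_0 L.m_assoc del: pr_zero)
next
  case (add x y)
  then show ?case
    using w s q by (simp add: bact_add cv_add[of _ _ n] L.r_distr del: pr_zero)
qed

lemma res_tensor_add_left:
  "x \<in> carrier L \<Longrightarrow> x' \<in> carrier L \<Longrightarrow> y \<in> carrier L \<Longrightarrow>
    res_tensor N n s (x \<oplus>\<^bsub>L\<^esub> x') y = res_tensor N n s x y \<oplus>\<^bsub>P n\<^esub> res_tensor N n s x' y"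
  by (simp add: res_tensor_bact bact_def P.M.smult_l_distr P.M.rsmult_l_distr del: pr_add)

lemma res_tensor_add_right:
  "x \<in> carrier L \<Longrightarrow> y \<in> carrier L \<Longrightarrow> y' \<in> carrier L \<Longrightarrow>
    res_tensor N n s x (y \<oplus>\<^bsub>L\<^esub> y') = res_tensor N n s x y \<oplus>\<^bsub>P n\<^esub> res_tensor N n s x y'"
  by (simp add: res_tensor_bact bact_def P.M.rsmult_r_distr del: pr_add)

lemma res_tensor_kappa:
  "x \<in> carrier L \<Longrightarrow> y \<in> carrier L \<Longrightarrow>
    res_tensor N n s (x \<otimes>\<^bsub>L\<^esub> \<kappa> c) y = res_tensor N n s x (\<kappa> c \<otimes>\<^bsub>L\<^esub> y)"
  by (simp add: res_tensor_bact bact_def P.M.smult_assoc1 P.M.kappa_smult P.M.rsmult_assoc P.M.smult_rsmult)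

lemma res_tensor_zero: "y \<in> carrier L \<Longrightarrow> res_tensor N n s \<zero>\<^bsub>L\<^esub> y = \<zero>\<^bsub>P n\<^esub>"
  by (simp add: res_tensor_bact bact_def P.M.zero_smult del: pr_zero)

text \<open>Expanding right factors in the basis words and moving the scalars to the left exhibits
  \<open>P n\<close> as a free left module with coordinates \<open>cv\<close>.\<close>

lemma P_expand:
  assumes "x \<in> carrier (P n)"
  shows "x = finsum (P n) (\<lambda>r. finsum (P n) (\<lambda>v. res_tensor N n (int r) (cv v r x) (lw v)) basis_words) {..n}"
  using assms
proof (induction rule: P_induct)
  case zero
  have "finsum (P n) (\<lambda>r. finsum (P n) (\<lambda>v. res_tensor N n (int r) (cv v r \<zero>\<^bsub>P n\<^esub>) (lw v)) basis_words) {..n} = \<zero>\<^bsub>P n\<^esub>"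
    by (intro P.M.M.add.finprod_one_eqI) (auto simp: cv_zero[of _ _ n] res_tensor_zero simp del: pr_zero intro!: P.M.M.add.finprod_one_eqI)
  then show ?case by (rule sym)
next
  case (tensor r x y)
  have "res_tensor N n (int r) x y = finsum (P n) (\<lambda>v. res_tensor N n (int r) x (\<kappa> (coef y v) \<otimes>\<^bsub>L\<^esub> lw v)) basis_words"
    by (subst L_expand[OF tensor(3)], rule finsum_additive[OF L.abelian_group_axioms P.M.M.abelian_group_axioms])
      (use tensor in \<open>auto simp: res_tensor_add_right simp del: pr_add\<close>)
  also have "\<dots> = finsum (P n) (\<lambda>v. res_tensor N n (int r) (cv v r (res_tensor N n (int r) x y)) (lw v)) basis_words"
    by (rule P.M.M.finsum_cong') (use tensor in \<open>auto simp: cv_tensor res_tensor_kappa\<close>)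
  finally have 1: "res_tensor N n (int r) x y = \<dots>" .
  have "finsum (P n) (\<lambda>q. finsum (P n) (\<lambda>v. res_tensor N n (int q) (cv v q (res_tensor N n (int r) x y)) (lw v)) basis_words) {..n} =
      finsum (P n) (\<lambda>q. if r = q then res_tensor N n (int r) x y else \<zero>\<^bsub>P n\<^esub>) {..n}"
  proof (rule P.M.M.finsum_cong')
    fix q assume q: "q \<in> {..n}"
    show "finsum (P n) (\<lambda>v. res_tensor N n (int q) (cv v q (res_tensor N n (int r) x y)) (lw v)) basis_words =
      (if r = q then res_tensor N n (int r) x y else \<zero>\<^bsub>P n\<^esub>)"
    proof (cases "r = q")
      case True
      then show ?thesis using 1 by simp
    next
      case False
      then show ?thesis using q tensor
        by (auto simp: cv_tensor res_tensor_zero simp del: pr_zero intro!: P.M.M.add.finprod_one_eqI)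
    qed
  qed (use tensor in auto)
  also have "\<dots> = res_tensor N n (int r) x y"
    using P.M.M.finsum_singleton[of r "{..n}" "\<lambda>_. res_tensor N n (int r) x y" n] tensor by simp
  finally show ?case by (rule sym)
next
  case (add x y)
  let ?i = "\<lambda>x r. finsum (P n) (\<lambda>v. res_tensor N n (int r) (cv v r x) (lw v)) basis_words"
  have ic: "?i x r \<in> carrier (P n)" if "r \<le> n" "x \<in> carrier (P n)" for x r
    using that by (intro P.M.M.finsum_closed) auto
  have "finsum (P n) (?i (x \<oplus>\<^bsub>P n\<^esub> y)) {..n} = finsum (P n) (\<lambda>r. ?i x r \<oplus>\<^bsub>P n\<^esub> ?i y r) {..n}"
  proof (rule P.M.M.finsum_cong')
    fix r assume r: "r \<in> {..n}"
    have "?i (x \<oplus>\<^bsub>P n\<^esub> y) r = finsum (P n) (\<lambda>v. res_tensor N n (int r) (cv v r x) (lw v) \<oplus>\<^bsub>P n\<^esub> res_tensor N n (int r) (cv v r y) (lw v)) basis_words"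
      by (rule P.M.M.finsum_cong') (use r add(1,2) in \<open>auto simp: cv_add[of _ _ n] res_tensor_add_left simp del: pr_add\<close>)
    also have "\<dots> = ?i x r \<oplus>\<^bsub>P n\<^esub> ?i y r"
      by (rule P.M.M.finsum_addf) (use r add(1,2) in auto)
    finally show "?i (x \<oplus>\<^bsub>P n\<^esub> y) r = ?i x r \<oplus>\<^bsub>P n\<^esub> ?i y r" .
  qed (use ic add(1,2) in auto)
  also have "\<dots> = finsum (P n) (?i x) {..n} \<oplus>\<^bsub>P n\<^esub> finsum (P n) (?i y) {..n}"
    by (rule P.M.M.finsum_addf) (use ic add(1,2) in auto)
  finally have sum: "finsum (P n) (?i (x \<oplus>\<^bsub>P n\<^esub> y)) {..n} = finsum (P n) (?i x) {..n} \<oplus>\<^bsub>P n\<^esub> finsum (P n) (?i y) {..n}" .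
  show ?case unfolding sum by (rule arg_cong2[OF add(3,4)])
qed

end

section \<open>The leading part of the differential\<close>

context Lam
begin

lemma L_double [simp]: "x \<in> carrier L \<Longrightarrow> x \<oplus>\<^bsub>L\<^esub> x = \<zero>\<^bsub>L\<^esub>"
  using pr_surj[of x] by auto

lemma coef_Nil_pr: "coef (pr p) [] = lk p []"
  using N1 by (auto simp: coef_pr cf_def dest!: arg_cong[of _ _ length])

lemma coef_Nil_mult: "u \<in> carrier L \<Longrightarrow> v \<in> carrier L \<Longrightarrow> coef (u \<otimes>\<^bsub>L\<^esub> v) [] = coef u [] * coef v []"
  using pr_surj[of u] pr_surj[of v] by (auto simp: coef_Nil_pr lookup_path_mult)

lemma coef_Nil_one: "coef \<one>\<^bsub>L\<^esub> [] = 1" "coef (\<kappa> c) [] = c"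
  by (simp_all add: coef_Nil_pr scalar_pr lk_cst flip: cst_simps(2))

text \<open>\<open>Le\<close> is the algebra with the right action twisted by the augmentation onto the ground
  field. Evaluating the differential there gives the one-sided complex.\<close>

definition Le :: "('k lam, 'k lam) bimodule" where
  "Le = \<lparr>carrier = carrier L, monoid.mult = mult L, one = one L, ring.zero = ring.zero L, add = add L,
    smult = mult L, rsmult = (\<lambda>x u. x \<otimes>\<^bsub>L\<^esub> \<kappa> (coef u []))\<rparr>"

lemma Le_simps [simp]:
  "carrier Le = carrier L" "add Le = add L" "ring.zero Le = pr 0"
  "smult Le = mult L" "rsmult Le = (\<lambda>x u. x \<otimes>\<^bsub>L\<^esub> \<kappa> (coef u []))"
  by (simp_all add: Le_def)

lemma Le_LamM: "LamM N Le"
proof (intro LamM.intro Lam_axioms bimod.intro bimod_axioms.intro central_L)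
  show "abelian_group Le" by (rule abelian_group_like_L) simp_all
  show "x \<in> carrier Le \<Longrightarrow> \<kappa> c \<odot>\<^bsub>Le\<^esub> x = rsmult Le x (\<kappa> c)" for x c
    using L.kappa_central[of x c] by (simp add: coef_Nil_one)
qed (auto simp: L.l_distr L.r_distr L.m_assoc coef_add coef_Nil_mult coef_Nil_one
    kappa_add kappa_mult kappa_1 simp del: pr_one)

sublocale Q: LamM N K Le
  by (rule Le_LamM)

lemma coef_lw: "w \<in> basis_words \<Longrightarrow> v \<in> basis_words \<Longrightarrow> coef (lw w) v = (if v = w then 1 else 0)"
  by (simp add: lw_def coef_pr cf_sg)

lemma Q_W: "Q.W u x v = lw u \<otimes>\<^bsub>L\<^esub> x \<otimes>\<^bsub>L\<^esub> \<kappa> (coef (lw v) [])"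
  by (simp add: Q.W_def bact_def)

lemma altw_basis_words: "n < 2 * N \<Longrightarrow> altw s n \<in> basis_words"
  by (simp add: basis_words_def)

text \<open>A nonempty word acts by zero from the right on \<open>Le\<close>, so only the left
  multiplication remains of the commutator.\<close>

lemma Q_commut: "w \<in> basis_words \<Longrightarrow> w \<noteq> [] \<Longrightarrow> Q.commut w \<one>\<^bsub>L\<^esub> = lw w"
  unfolding Q.commut_def
  by (simp add: Q_W coef_lw kappa_0 kappa_1 coef_Nil_one del: pr_one pr_zero)

text \<open>Only a summand with empty right word survives; this is the second half at
  \<open>k = N - 1\<close>.\<close>

lemma Q_norm_sum: "Q.norm_sum s \<one>\<^bsub>L\<^esub> = lw (altw s (2 * N - 1))"
  unfolding Q.norm_sum_def
proof (rule Q.finsum_at[of _ "N - 1"])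
  fix k assume k: "k < N"
  let ?j = "N - 1 - k"
  have c: "coef (lw (altw s n)) [] = (if n = 0 then 1 else 0)" if "n < 2 * N" for s n
    using coef_lw[OF altw_basis_words[OF that, of s] basis_words_Nil] by (cases n) auto
  have 1: "Q.W (altw (flip s) (2 * k)) \<one>\<^bsub>L\<^esub> (altw s (Suc (2 * ?j))) = \<zero>\<^bsub>L\<^esub>"
    unfolding Q_W using k by (subst c) (auto simp: kappa_0 simp del: pr_zero pr_one)
  have 2: "Q.W (altw s (Suc (2 * k))) \<one>\<^bsub>L\<^esub> (altw s (2 * ?j)) = (if k = N - 1 then lw (altw s (2 * N - 1)) else \<zero>\<^bsub>L\<^esub>)"
  proof -
    have "Suc (2 * (N - 1)) = 2 * N - 1" using N1 by simp
    then show ?thesis unfolding Q_W using k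
      by (subst c) (auto simp: kappa_0 kappa_1 simp del: pr_zero pr_one altw.simps(2))
  qed
  show "Q.W (altw (flip s) (2 * k)) \<one>\<^bsub>L\<^esub> (altw s (Suc (2 * ?j))) \<oplus>\<^bsub>Le\<^esub>
      Q.W (altw s (Suc (2 * k))) \<one>\<^bsub>L\<^esub> (altw s (2 * ?j)) = (if k = N - 1 then lw (altw s (2 * N - 1)) else \<zero>\<^bsub>Le\<^esub>)"
    unfolding 1 2 by auto
qed (use N1 in auto)

text \<open>Sending generator \<open>s\<close> to the unit and the others to zero isolates the
  entries into component \<open>s\<close>. A commutator with the long word and a norm sum both
  become that long word, which is why \<open>wl\<close> and \<open>wr\<close> distinguish only two
  cases.\<close>

lemma Q_diff_val:
  "Q.diff_val n (int r) (\<lambda>i. if i = int s then \<one>\<^bsub>L\<^esub> else \<zero>\<^bsub>L\<^esub>) =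
    (if r = s then lw (wl n s) else if r = Suc s then lw (wr n s) else \<zero>\<^bsub>L\<^esub>)"
proof -
  have top: "altw Arr_a (2 * N - 1) = topw Arr_abar" "altw Arr_abar (2 * N - 1) = topw Arr_a"
    by (simp_all add: topw_def)
  have letter: "[t] \<in> basis_words" for t using N1 by (simp add: basis_words_def)
  note z = Q.commut_zero[simplified, folded pr_zero] Q.norm_sum_zero[simplified, folded pr_zero]
  note c = Q_commut[OF letter] Q_commut[OF topw_props(3)] Q_norm_sum
  have i: "int r - 1 = int s \<longleftrightarrow> r = Suc s" "int r = int s \<longleftrightarrow> r = s" by auto
  show ?thesis
    unfolding Q.diff_val_def top i
    by (auto simp: c z top top[simplified] wl_def wr_def simp del: pr_one pr_zero)
qed

text \<open>Taking the constant coefficient of the right factor is multiplicative, so it turns the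
  right action into the twisted one of \<open>Le\<close>. Along this map the differential is
  compared with the one-sided complex.\<close>

lemma cv_hom:
  assumes s: "s \<le> m"
  shows "(\<lambda>x\<in>carrier (P m). cv [] s x) \<in> bimod_hom L (P m) Le"
proof (rule bimod_homI)
  fix x y assume "x \<in> carrier (P m)" "y \<in> carrier (P m)"
  then show "(\<lambda>x\<in>carrier (P m). cv [] s x) (x \<oplus>\<^bsub>P m\<^esub> y) =
      (\<lambda>x\<in>carrier (P m). cv [] s x) x \<oplus>\<^bsub>Le\<^esub> (\<lambda>x\<in>carrier (P m). cv [] s x) y"
    using s by (simp add: cv_add[of _ _ m])
next
  fix u x assume u: "u \<in> carrier L" and x: "x \<in> carrier (P m)"
  have b: "cv [] s (bact (P m) u x v) = u \<otimes>\<^bsub>L\<^esub> cv [] s x \<otimes>\<^bsub>L\<^esub> \<kappa> (coef v [])"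
    if u: "u \<in> carrier L" and v: "v \<in> carrier L" for u v
    using x
  proof (induction rule: P_induct)
    case zero
    have "bact (P m) u \<zero>\<^bsub>P m\<^esub> v = \<zero>\<^bsub>P m\<^esub>" using u v by (simp add: bact_def)
    then show ?case using u v s cv_zero[of "[]" s m] by (simp del: pr_zero)
  next
    case (tensor r x y)
    then show ?case using u v s
      by (simp add: res_tensor_bact_bact cv_tensor coef_Nil_mult kappa_mult L.m_assoc del: pr_zero)
  next
    case (add x y)
    then show ?case using u v s
      by (simp add: bact_add cv_add[of _ _ m] L.r_distr L.l_distr del: pr_zero)
  qed
  have "u \<odot>\<^bsub>P m\<^esub> x = bact (P m) u x \<one>\<^bsub>L\<^esub>" "rsmult (P m) x u = bact (P m) \<one>\<^bsub>L\<^esub> x u"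
    using u x by (simp_all add: bact_def del: pr_one)
  then show "(\<lambda>x\<in>carrier (P m). cv [] s x) (u \<odot>\<^bsub>P m\<^esub> x) = u \<odot>\<^bsub>Le\<^esub> (\<lambda>x\<in>carrier (P m). cv [] s x) x"
    "(\<lambda>x\<in>carrier (P m). cv [] s x) (rsmult (P m) x u) = rsmult Le ((\<lambda>x\<in>carrier (P m). cv [] s x) x) u"
    using b[OF L.one_closed u] b[OF u L.one_closed] u x s
    by (simp_all add: coef_Nil_one kappa_1 cv_closed[of _ _ m] del: pr_one)
qed (use s in auto)

lemma cv_gn: "s \<le> m \<Longrightarrow> cv [] s (gn m i) = (if i = int s then \<one>\<^bsub>L\<^esub> else \<zero>\<^bsub>L\<^esub>)"
proof (cases "0 \<le> i \<and> i \<le> int m")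
  case True
  moreover assume "s \<le> m"
  ultimately show ?thesis
    using cv_tensor[of "[]" s m "\<one>\<^bsub>L\<^esub>" "\<one>\<^bsub>L\<^esub>" "nat i"]
    by (auto simp: gn_def coef_Nil_one kappa_1 simp del: pr_one pr_zero)
next
  case False
  moreover assume "s \<le> m"
  ultimately show ?thesis using gn_zero[of i m] cv_zero[of "[]" s m] by auto
qed

lemma cv_d_gn:
  assumes s: "s \<le> m"
  shows "cv [] s (res_diff N (Suc m) (gn (Suc m) (int r))) =
    (if r = s then lw (wl (Suc m) s) else if r = Suc s then lw (wr (Suc m) s) else \<zero>\<^bsub>L\<^esub>)"
proof -
  have "cv [] s (P.diff_val m (Suc m) (int r) (gn m)) = (\<lambda>x\<in>carrier (P m). cv [] s x) (P.diff_val m (Suc m) (int r) (gn m))"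
    by (simp add: P.diff_val_closed)
  also have "\<dots> = Q.diff_val (Suc m) (int r) (\<lambda>i. (\<lambda>x\<in>carrier (P m). cv [] s x) (gn m i))"
    by (rule hom_diff_val[OF LamM_res Le_LamM cv_hom[OF s]]) auto
  also have "(\<lambda>i. (\<lambda>x\<in>carrier (P m). cv [] s x) (gn m i)) = (\<lambda>i. if i = int s then \<one>\<^bsub>L\<^esub> else \<zero>\<^bsub>L\<^esub>)"
    using cv_gn[OF s] by auto
  finally show ?thesis unfolding Q_diff_val d_gn .
qed

section \<open>Descent along the filtration\<close>

definition filtered :: "nat \<Rightarrow> nat \<Rightarrow> 'k res_elem \<Rightarrow> bool" where
  "filtered m i x \<longleftrightarrow> (\<forall>s\<le>m. \<forall>w\<in>basis_words. length w < i \<longrightarrow> cv w s x = \<zero>\<^bsub>L\<^esub>)"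

lemma finsum_pick:
  assumes M: "abelian_group M" and "finite J" "j \<in> J" "c \<in> carrier M"
    "\<And>i. i \<in> J \<Longrightarrow> f i = (if i = j then c else \<zero>\<^bsub>M\<^esub>)"
  shows "finsum M f J = c"
proof -
  interpret M: abelian_group M by (rule M)
  have "finsum M f J = finsum M (\<lambda>i. if j = i then c else \<zero>\<^bsub>M\<^esub>) J"
    by (rule M.finsum_cong') (use assms in auto)
  then show ?thesis using M.finsum_singleton[of j J "\<lambda>_. c"] assms by simp
qed

text \<open>Expand \<open>x\<close> in the basis words \<open>v\<close> of the right factor. Those
  shorter than \<open>i\<close> do not occur; any other contributes to the coordinate at
  \<open>w\<close> only if \<open>v = w\<close>, and then through the constant coefficient of the
  differential of a generator, which is a one-sided entry \<open>wl\<close> or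
  \<open>wr\<close>.\<close>

lemma d_leading:
  assumes x: "x \<in> carrier (P (Suc m))" and F: "filtered (Suc m) i x" and w: "w \<in> basis_words" and le: "length w \<le> i" and s: "s \<le> m"
  shows "cv w s (res_diff N (Suc m) x) =
    cv w s x \<otimes>\<^bsub>L\<^esub> lw (wl (Suc m) s) \<oplus>\<^bsub>L\<^esub> cv w (Suc s) x \<otimes>\<^bsub>L\<^esub> lw (wr (Suc m) s)"
proof -
  let ?\<Phi> = "\<lambda>x. cv w s (res_diff N (Suc m) x)"
  let ?G = "\<lambda>r. cv [] s (res_diff N (Suc m) (gn (Suc m) (int r)))"
  have dc: "res_diff N (Suc m) y \<in> carrier (P m)" if "y \<in> carrier (P (Suc m))" for y
    by (rule bimod_homD(1)[OF d_hom that])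
  have \<Phi>c: "?\<Phi> y \<in> carrier L" if "y \<in> carrier (P (Suc m))" for y
    by (rule cv_closed[OF w s dc[OF that]])
  have \<Phi>a: "?\<Phi> (y \<oplus>\<^bsub>P (Suc m)\<^esub> z) = ?\<Phi> y \<oplus>\<^bsub>L\<^esub> ?\<Phi> z" if "y \<in> carrier (P (Suc m))" "z \<in> carrier (P (Suc m))" for y z
    unfolding bimod_homD(2)[OF d_hom that] by (rule cv_add[OF w s dc[OF that(1)] dc[OF that(2)]])
  note Pg = P.M.M.abelian_group_axioms and Lg = L.abelian_group_axioms
  have cvc: "cv v r x \<in> carrier L" if "v \<in> basis_words" "r \<le> Suc m" for v r using cv_closed[OF that x] .
  have Gc: "?G r \<in> carrier L" for r by (rule cv_closed[OF basis_words_Nil s dc]) auto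
  have t: "?\<Phi> (res_tensor N (Suc m) (int r) (cv v r x) (lw v)) = (if v = w then cv w r x \<otimes>\<^bsub>L\<^esub> ?G r else \<zero>\<^bsub>L\<^esub>)"
    if v: "v \<in> basis_words" and r: "r \<le> Suc m" for v r
  proof (cases "length v < i")
    case True
    then have z: "cv v r x = \<zero>\<^bsub>L\<^esub>" using F v r by (simp add: filtered_def)
    have "?\<Phi> (res_tensor N (Suc m) (int r) (cv v r x) (lw v)) = cv w s \<zero>\<^bsub>P m\<^esub>"
      unfolding z res_tensor_zero[OF lw_closed] hom_zero_bimod[OF LamM_res LamM_res d_hom] ..
    also have "\<dots> = \<zero>\<^bsub>L\<^esub>" by (rule cv_zero[OF w s])
    finally show ?thesis using z Gc[of r] by (auto simp del: pr_zero)
  next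
    case False
    have "res_diff N (Suc m) (res_tensor N (Suc m) (int r) (cv v r x) (lw v)) =
        bact (P m) (cv v r x) (res_diff N (Suc m) (gn (Suc m) (int r))) (lw v)"
      using cvc[OF v r] by (simp add: res_tensor_bact bact_def bimod_homD(3)[OF d_hom] bimod_homD(4)[OF d_hom])
    moreover have "cv w s (bact (P m) (cv v r x) (res_diff N (Suc m) (gn (Suc m) (int r))) (lw v)) =
        (if w = v then cv v r x \<otimes>\<^bsub>L\<^esub> ?G r else \<zero>\<^bsub>L\<^esub>)"
      by (rule cv_bact_lw[OF w v _ s cvc[OF v r] dc]) (use False le in auto)
    ultimately show ?thesis by auto
  qed
  let ?i = "\<lambda>r. finsum (P (Suc m)) (\<lambda>v. res_tensor N (Suc m) (int r) (cv v r x) (lw v)) basis_words"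
  have ic: "?i r \<in> carrier (P (Suc m))" if "r \<le> Suc m" for r
    using cvc[OF _ that] by (intro P.M.M.finsum_closed) auto
  have \<Phi>i: "?\<Phi> (?i r) = cv w r x \<otimes>\<^bsub>L\<^esub> ?G r" if r: "r \<le> Suc m" for r
  proof -
    have "?\<Phi> (?i r) = finsum L (\<lambda>v. ?\<Phi> (res_tensor N (Suc m) (int r) (cv v r x) (lw v))) basis_words"
      by (rule finsum_additive[where f="?\<Phi>", OF Pg Lg \<Phi>c \<Phi>a]) (use cvc[OF _ r] in auto)
    also have "\<dots> = cv w r x \<otimes>\<^bsub>L\<^esub> ?G r"
      by (rule finsum_pick[OF Lg finite_basis_words w]) (use t[OF _ r] cvc[OF w r] Gc in auto)
    finally show ?thesis .
  qed
  have "?\<Phi> x = ?\<Phi> (finsum (P (Suc m)) ?i {..Suc m})"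
    by (rule arg_cong[OF P_expand[OF x]])
  also have "\<dots> = finsum L (\<lambda>r. ?\<Phi> (?i r)) {..Suc m}"
    by (rule finsum_additive[where f="?\<Phi>", OF Pg Lg \<Phi>c \<Phi>a]) (use ic in auto)
  also have "\<dots> = finsum L (\<lambda>r. (if r = s then cv w s x \<otimes>\<^bsub>L\<^esub> lw (wl (Suc m) s) else \<zero>\<^bsub>L\<^esub>) \<oplus>\<^bsub>L\<^esub>
      (if r = Suc s then cv w (Suc s) x \<otimes>\<^bsub>L\<^esub> lw (wr (Suc m) s) else \<zero>\<^bsub>L\<^esub>)) {..Suc m}"
  proof (rule L.finsum_cong')
    fix r assume r: "r \<in> {..Suc m}"
    then show "?\<Phi> (?i r) = (if r = s then cv w s x \<otimes>\<^bsub>L\<^esub> lw (wl (Suc m) s) else \<zero>\<^bsub>L\<^esub>) \<oplus>\<^bsub>L\<^esub>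
      (if r = Suc s then cv w (Suc s) x \<otimes>\<^bsub>L\<^esub> lw (wr (Suc m) s) else \<zero>\<^bsub>L\<^esub>)"
      using \<Phi>i[of r] cvc[OF w, of r] cv_d_gn[OF s, of r] by (auto simp del: pr_zero)
  qed (use cvc[OF w] s in auto)
  also have "\<dots> = finsum L (\<lambda>r. if r = s then cv w s x \<otimes>\<^bsub>L\<^esub> lw (wl (Suc m) s) else \<zero>\<^bsub>L\<^esub>) {..Suc m} \<oplus>\<^bsub>L\<^esub>
      finsum L (\<lambda>r. if r = Suc s then cv w (Suc s) x \<otimes>\<^bsub>L\<^esub> lw (wr (Suc m) s) else \<zero>\<^bsub>L\<^esub>) {..Suc m}"
    by (rule L.finsum_addf) (use cvc[OF w] s in auto)
  also have "finsum L (\<lambda>r. if r = s then cv w s x \<otimes>\<^bsub>L\<^esub> lw (wl (Suc m) s) else \<zero>\<^bsub>L\<^esub>) {..Suc m} = cv w s x \<otimes>\<^bsub>L\<^esub> lw (wl (Suc m) s)"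
    by (rule finsum_pick[OF Lg]) (use cvc[OF w] s in auto)
  also have "finsum L (\<lambda>r. if r = Suc s then cv w (Suc s) x \<otimes>\<^bsub>L\<^esub> lw (wr (Suc m) s) else \<zero>\<^bsub>L\<^esub>) {..Suc m} = cv w (Suc s) x \<otimes>\<^bsub>L\<^esub> lw (wr (Suc m) s)"
    by (rule finsum_pick[OF Lg]) (use cvc[OF w] s in auto)
  finally show ?thesis .
qed

lemma coef_finsum:
  assumes w: "w \<in> basis_words" and "finite J" and "\<And>j. j \<in> J \<Longrightarrow> f j \<in> carrier L"
  shows "coef (finsum L f J) w = (\<Sum>j\<in>J. coef (f j) w)"
  using assms(2,3)
proof (induction J rule: finite_induct)
  case empty
  then show ?case using coef_zero_elem[OF w] by simp
next
  case (insert j J)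
  then have "finsum L f (insert j J) = f j \<oplus>\<^bsub>L\<^esub> finsum L f J"
    by (intro L.finsum_insert) auto
  moreover have "finsum L f J \<in> carrier L" using insert by (intro L.finsum_closed) auto
  ultimately show ?case using insert w by (simp add: coef_add)
qed

text \<open>The same leading-term argument for the multiplication map; it provides the extra
  hypothesis of \<open>Q_exact\<close> in degree zero.\<close>

lemma eps_leading:
  assumes x: "x \<in> carrier (P 0)" and F: "filtered 0 i x" and w: "w \<in> basis_words" and le: "length w \<le> i"
    and e: "res_aug N x = \<zero>\<^bsub>L\<^esub>"
  shows "coef (cv w 0 x) [] = 0"
proof -
  note Pg = P.M.M.abelian_group_axioms and Lg = L.abelian_group_axioms
  have cvc: "cv v 0 x \<in> carrier L" if "v \<in> basis_words" for v using cv_closed[OF that le0 x] .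
  have "x = finsum (P 0) (\<lambda>r. finsum (P 0) (\<lambda>v. res_tensor N 0 (int r) (cv v r x) (lw v)) basis_words) {..0}"
    by (rule P_expand[OF x])
  also have "\<dots> = finsum (P 0) (\<lambda>v. res_tensor N 0 0 (cv v 0 x) (lw v)) basis_words"
    using cvc by (intro finsum_pick[OF Pg, of _ 0]) (auto intro!: P.M.M.finsum_closed)
  finally have "res_aug N x = res_aug N (finsum (P 0) (\<lambda>v. res_tensor N 0 0 (cv v 0 x) (lw v)) basis_words)"
    by (rule arg_cong)
  also have "\<dots> = finsum Reg (\<lambda>v. res_aug N (res_tensor N 0 0 (cv v 0 x) (lw v))) basis_words"
    by (rule finsum_additive[where f="res_aug N", OF Pg R.M.M.abelian_group_axioms bimod_homD(1)[OF eps_hom] bimod_homD(2)[OF eps_hom]])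
      (use cvc in auto)
  also have "\<dots> = finsum Reg (\<lambda>v. cv v 0 x \<otimes>\<^bsub>L\<^esub> lw v) basis_words"
    by (rule R.M.M.finsum_cong') (use cvc in \<open>auto simp: eps_ex(2)\<close>)
  also have "\<dots> = finsum L (\<lambda>v. cv v 0 x \<otimes>\<^bsub>L\<^esub> lw v) basis_words"
    by (rule finsum_additive[of Reg L "\<lambda>x. x", OF R.M.M.abelian_group_axioms Lg]) (use cvc in auto)
  finally have "coef (res_aug N x) w = (\<Sum>v\<in>basis_words. coef (cv v 0 x \<otimes>\<^bsub>L\<^esub> lw v) w)"
    using coef_finsum[OF w finite_basis_words, of "\<lambda>v. cv v 0 x \<otimes>\<^bsub>L\<^esub> lw v"] cvc by simp
  also have "\<dots> = (\<Sum>v\<in>basis_words. if v = w then coef (cv w 0 x) [] else 0)"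
  proof (rule sum.cong)
    fix v assume v: "v \<in> basis_words"
    show "coef (cv v 0 x \<otimes>\<^bsub>L\<^esub> lw v) w = (if v = w then coef (cv w 0 x) [] else 0)"
    proof (cases "length v < i")
      case True
      then have "cv v 0 x = \<zero>\<^bsub>L\<^esub>" using F v by (simp add: filtered_def)
      then show ?thesis using coef_zero_elem[OF w] coef_zero_elem[OF basis_words_Nil] by (auto simp del: pr_zero)
    next
      case False
      have "length w \<le> length v" using False le by simp
      from coef_mult_lw[OF cvc[OF v] w v this] show ?thesis by auto
    qed
  qed simp
  also have "\<dots> = coef (cv w 0 x) []" using w finite_basis_words by simp
  finally show ?thesis using e coef_zero_elem[OF w] by simp
qed

text \<open>Solve the leading layer, formed by the words of length \<open>i\<close>, with
  \<open>Q_exact\<close> and subtract the differential of the solution; the rest lies one step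
  deeper. Once \<open>i\<close> exceeds \<open>2 * N\<close> there are no coordinates left.\<close>

lemma exact_filtered:
  assumes "x \<in> carrier (P m)" "filtered m i x"
    and "m = 0 \<Longrightarrow> res_aug N x = \<zero>\<^bsub>L\<^esub>"
    and "\<And>k. m = Suc k \<Longrightarrow> res_diff N (Suc k) x = \<zero>\<^bsub>P k\<^esub>"
  shows "\<exists>y\<in>carrier (P (Suc m)). res_diff N (Suc m) y = x"
  using assms
proof (induction "2 * N + 1 - i" arbitrary: i x)
  case 0
  note Pg = P.M.M.abelian_group_axioms
  have z: "cv v r x = \<zero>\<^bsub>L\<^esub>" if "v \<in> basis_words" "r \<le> m" for v r
    using 0(1) 0(3) that basis_words_props(2)[OF that(1)] by (simp add: filtered_def)
  have "finsum (P m) (\<lambda>r. finsum (P m) (\<lambda>v. res_tensor N m (int r) (cv v r x) (lw v)) basis_words) {..m} = \<zero>\<^bsub>P m\<^esub>"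
    by (intro P.M.M.add.finprod_one_eqI)
      (auto simp: z res_tensor_zero simp del: pr_zero intro!: P.M.M.add.finprod_one_eqI)
  then have "x = \<zero>\<^bsub>P m\<^esub>" using P_expand[OF 0(2)] by (rule trans[rotated])
  then show ?case using hom_zero_bimod[OF LamM_res LamM_res d_hom] by (intro bexI[of _ "\<zero>\<^bsub>P (Suc m)\<^esub>"]) auto
next
  case (Suc j)
  note x = Suc.prems(1) and F = Suc.prems(2)
  note Pg = P.M.M.abelian_group_axioms and Lg = L.abelian_group_axioms
  have cvc: "cv v r x \<in> carrier L" if "v \<in> basis_words" "r \<le> m" for v r using cv_closed[OF that x] .
  let ?J = "{w \<in> basis_words. length w = i}"
  have "\<forall>w\<in>?J. \<exists>y. (\<forall>s. y s \<in> carrier L) \<and>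
      (\<forall>s\<le>m. cv w s x = y s \<otimes>\<^bsub>L\<^esub> lw (wl (Suc m) s) \<oplus>\<^bsub>L\<^esub> y (Suc s) \<otimes>\<^bsub>L\<^esub> lw (wr (Suc m) s))"
  proof
    fix w assume w: "w \<in> ?J"
    show "\<exists>y. (\<forall>s. y s \<in> carrier L) \<and>
      (\<forall>s\<le>m. cv w s x = y s \<otimes>\<^bsub>L\<^esub> lw (wl (Suc m) s) \<oplus>\<^bsub>L\<^esub> y (Suc s) \<otimes>\<^bsub>L\<^esub> lw (wr (Suc m) s))"
    proof (rule Q_exact)
      show "cv w s x \<in> carrier L" if "s \<le> m" for s using cvc w that by auto
      assume "m = 0"
      then show "coef (cv w 0 x) [] = 0" using eps_leading[of x i w] x F w Suc.prems(3) by auto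
    next
      fix s assume "s < m"
      then obtain k where k: "m = Suc k" "s \<le> k" by (cases m) auto
      have "cv w s (res_diff N (Suc k) x) = \<zero>\<^bsub>L\<^esub>"
        unfolding Suc.prems(4)[OF k(1)] using w k by (intro cv_zero) auto
      then show "cv w s x \<otimes>\<^bsub>L\<^esub> lw (wl m s) \<oplus>\<^bsub>L\<^esub> cv w (Suc s) x \<otimes>\<^bsub>L\<^esub> lw (wr m s) = \<zero>\<^bsub>L\<^esub>"
        using d_leading[of x k i w s] x F w k by simp
    qed
  qed
  then obtain Y where Yc: "\<And>w s. w \<in> ?J \<Longrightarrow> Y w s \<in> carrier L"
    and Y: "\<And>w s. w \<in> ?J \<Longrightarrow> s \<le> m \<Longrightarrow>
      cv w s x = Y w s \<otimes>\<^bsub>L\<^esub> lw (wl (Suc m) s) \<oplus>\<^bsub>L\<^esub> Y w (Suc s) \<otimes>\<^bsub>L\<^esub> lw (wr (Suc m) s)"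
    unfolding bchoice_iff by blast
  let ?t = "\<lambda>r w. res_tensor N (Suc m) (int r) (Y w r) (lw w)"
  let ?i = "\<lambda>r. finsum (P (Suc m)) (?t r) ?J"
  define y0 where "y0 = finsum (P (Suc m)) ?i {..Suc m}"
  have finJ: "finite ?J" using finite_basis_words by simp
  have ic: "?i r \<in> carrier (P (Suc m))" for r using Yc by (intro P.M.M.finsum_closed) auto
  have y0c: "y0 \<in> carrier (P (Suc m))" unfolding y0_def using ic by (intro P.M.M.finsum_closed) auto
  have cvy: "cv v s y0 = (if length v = i then Y v s else \<zero>\<^bsub>L\<^esub>)" if v: "v \<in> basis_words" and s: "s \<le> Suc m" for v s
  proof -
    have t: "cv v s (?t r w) = (if r = s then (if w = v then Y v s else \<zero>\<^bsub>L\<^esub>) else \<zero>\<^bsub>L\<^esub>)" if w: "w \<in> ?J" for r w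
      using w v s Yc[OF w] by (auto simp: cv_tensor coef_lw kappa_0 kappa_1 simp del: pr_zero pr_one)
    have "cv v s (?i r) = finsum L (\<lambda>w. cv v s (?t r w)) ?J" for r
      by (rule finsum_additive[where f="cv v s", OF Pg Lg cv_closed[OF v s] cv_add[OF v s]]) (use Yc in auto)
    also have "finsum L (\<lambda>w. cv v s (?t r w)) ?J = (if r = s then (if length v = i then Y v s else \<zero>\<^bsub>L\<^esub>) else \<zero>\<^bsub>L\<^esub>)" for r
    proof (cases "r = s \<and> length v = i")
      case True
      then have "finsum L (\<lambda>w. cv v s (?t r w)) ?J = Y v s"
        using v Yc by (intro finsum_pick[OF Lg finJ, of v]) (auto simp: t)
      then show ?thesis using True by simp
    next
      case False
      then have "finsum L (\<lambda>w. cv v s (?t r w)) ?J = \<zero>\<^bsub>L\<^esub>"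
        by (intro L.add.finprod_one_eqI) (auto simp: t)
      then show ?thesis using False by auto
    qed
    finally have in_eq: "cv v s (?i r) = (if r = s then (if length v = i then Y v s else \<zero>\<^bsub>L\<^esub>) else \<zero>\<^bsub>L\<^esub>)" for r .
    have "cv v s y0 = finsum L (\<lambda>r. cv v s (?i r)) {..Suc m}"
      unfolding y0_def
      by (rule finsum_additive[where f="cv v s", OF Pg Lg cv_closed[OF v s] cv_add[OF v s]]) (use ic in auto)
    also have "\<dots> = (if length v = i then Y v s else \<zero>\<^bsub>L\<^esub>)"
      by (rule finsum_pick[OF Lg, of _ s]) (use s v Yc in \<open>auto simp: in_eq\<close>)
    finally show ?thesis .
  qed
  have Fy: "filtered (Suc m) i y0" using cvy by (simp add: filtered_def)
  have cvdy: "cv w s (res_diff N (Suc m) y0) = (if length w = i then cv w s x else \<zero>\<^bsub>L\<^esub>)"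
    if w: "w \<in> basis_words" "length w \<le> i" and s: "s \<le> m" for w s
    using d_leading[OF y0c Fy w s] cvy[OF w(1)] s Y[of w s] w by (auto simp del: pr_zero)
  have dyc: "res_diff N (Suc m) y0 \<in> carrier (P m)" by (rule bimod_homD(1)[OF d_hom y0c])
  \<comment> \<open>Adding is subtracting here, so the layer of length \<open>i\<close>
    cancels.\<close>
  let ?x = "x \<oplus>\<^bsub>P m\<^esub> res_diff N (Suc m) y0"
  have xc: "?x \<in> carrier (P m)" using x dyc by simp
  have "filtered m (Suc i) ?x"
    unfolding filtered_def
  proof (intro allI ballI impI)
    fix s w assume s: "s \<le> m" and w: "w \<in> basis_words" "length w < Suc i"
    have "cv w s ?x = cv w s x \<oplus>\<^bsub>L\<^esub> (if length w = i then cv w s x else \<zero>\<^bsub>L\<^esub>)"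
      using cv_add[OF w(1) s x dyc] cvdy[of w s] s w by simp
    then show "cv w s ?x = \<zero>\<^bsub>L\<^esub>"
      using F s w cvc[of w s] by (cases "length w = i") (auto simp: filtered_def simp del: pr_zero)
  qed
  moreover have "res_aug N ?x = \<zero>\<^bsub>L\<^esub>" if "m = 0"
    using Suc.prems(3)[OF that] eps_d[of y0] y0c x dyc bimod_homD(2)[OF eps_hom, of x "res_diff N (Suc m) y0"] that by simp
  moreover have "res_diff N (Suc k) ?x = \<zero>\<^bsub>P k\<^esub>" if k: "m = Suc k" for k
    using Suc.prems(4)[OF k] dd[of y0 k] y0c x dyc bimod_homD(2)[OF d_hom[of k], of x "res_diff N (Suc m) y0"] k by simp
  moreover have "j = 2 * N + 1 - Suc i" using Suc(2) by simp
  ultimately obtain y' where y': "y' \<in> carrier (P (Suc m))" "res_diff N (Suc m) y' = ?x"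
    using Suc.hyps(1)[OF _ xc] by blast
  have "res_diff N (Suc m) (y0 \<oplus>\<^bsub>P (Suc m)\<^esub> y') = res_diff N (Suc m) y0 \<oplus>\<^bsub>P m\<^esub> ?x"
    unfolding bimod_homD(2)[OF d_hom y0c y'(1)] y'(2) ..
  also have "\<dots> = x" using x dyc by (simp add: P.M.M.a_ac)
  finally show ?case using y0c y' by (intro bexI[of _ "y0 \<oplus>\<^bsub>P (Suc m)\<^esub> y'"]) auto
qed

lemma filtered_0: "filtered m 0 x"
  by (simp add: filtered_def)

text \<open>A map out of \<open>P n\<close> can be given arbitrary values on the generators, so
  preimages of the images of the generators extend to a lift; \<open>exact_filtered\<close> at
  filtration zero supplies these preimages, and for the augmentation they are evident.\<close>

lemma ext_res: "ext_res L \<kappa> P (res_diff N) (res_aug N) Reg"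
proof (rule ext_res.intro)
  show "bimod L \<kappa> (P n)" for n by (rule LamM.axioms(2)[OF LamM_res])
  show "bimod L \<kappa> Reg" by (rule LamM.axioms(2)[OF Reg_LamM])
  show "res_diff N (Suc n) \<in> bimod_hom L (P (Suc n)) (P n)" for n by (rule d_hom)
  show "res_aug N \<in> bimod_hom L (P 0) Reg" by (rule eps_hom)
  show "x \<in> carrier (P (Suc (Suc n))) \<Longrightarrow> res_diff N (Suc n) (res_diff N (Suc (Suc n)) x) = \<zero>\<^bsub>P n\<^esub>" for x n
    by (rule dd)
  show "x \<in> carrier (P (Suc 0)) \<Longrightarrow> res_aug N (res_diff N (Suc 0) x) = \<zero>\<^bsub>Reg\<^esub>" for x by (rule eps_d)
next
  have lift: "\<exists>\<psi>\<in>bimod_hom L (P n) (P (Suc i)). \<forall>x\<in>carrier (P n). res_diff N (Suc i) (\<psi> x) = \<phi> x"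
    if \<phi>: "\<phi> \<in> bimod_hom L (P n) (P i)"
      and ex: "\<And>x. x \<in> carrier (P n) \<Longrightarrow> \<exists>y\<in>carrier (P (Suc i)). res_diff N (Suc i) y = \<phi> x" for \<phi> n i
  proof -
    have "\<forall>r. \<exists>y. y \<in> carrier (P (Suc i)) \<and> res_diff N (Suc i) y = \<phi> (gn n (int r))"
      using ex by blast
    then obtain v where v: "\<And>r. v r \<in> carrier (P (Suc i))" "\<And>r. res_diff N (Suc i) (v r) = \<phi> (gn n (int r))"
      by metis
    obtain \<psi> where \<psi>: "\<psi> \<in> bimod_hom L (P n) (P (Suc i))" "\<And>r. r \<le> n \<Longrightarrow> \<psi> (gn n (int r)) = v r"
      using P_hom_ex[OF LamM_res[of "Suc i"], of n v] v by blast
    have eq: "compose (carrier (P n)) (res_diff N (Suc i)) \<psi> = \<phi>"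
      by (rule P_hom_eqI[OF LamM_res P_comp[OF \<psi>(1) d_hom] \<phi>]) (simp add: compose_apply \<psi>(2) v(2))
    have "res_diff N (Suc i) (\<psi> x) = \<phi> x" if "x \<in> carrier (P n)" for x
      by (rule trans[OF compose_apply[OF that, symmetric] fun_cong[OF eq]])
    then show ?thesis using \<psi> by blast
  qed
  show "\<exists>\<psi>\<in>bimod_hom L (P n) (P (Suc (Suc i))). \<forall>x\<in>carrier (P n). res_diff N (Suc (Suc i)) (\<psi> x) = \<phi> x"
    if \<phi>: "\<phi> \<in> bimod_hom L (P n) (P (Suc i))"
      and z: "\<And>x. x \<in> carrier (P n) \<Longrightarrow> res_diff N (Suc i) (\<phi> x) = \<zero>\<^bsub>P i\<^esub>" for \<phi> n i
    by (rule lift[OF \<phi>], rule exact_filtered[OF bimod_homD(1)[OF \<phi>] filtered_0]) (use z in auto)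
  show "\<exists>\<psi>\<in>bimod_hom L (P n) (P (Suc 0)). \<forall>x\<in>carrier (P n). res_diff N (Suc 0) (\<psi> x) = \<phi> x"
    if \<phi>: "\<phi> \<in> bimod_hom L (P n) (P 0)"
      and z: "\<And>x. x \<in> carrier (P n) \<Longrightarrow> res_aug N (\<phi> x) = \<zero>\<^bsub>Reg\<^esub>" for \<phi> n
    by (rule lift[OF \<phi>], rule exact_filtered[OF bimod_homD(1)[OF \<phi>] filtered_0]) (use z in auto)
  show "\<exists>\<psi>\<in>bimod_hom L (P n) (P 0). \<forall>x\<in>carrier (P n). res_aug N (\<psi> x) = f x"
    if f: "f \<in> bimod_hom L (P n) Reg" for f n
  proof -
    let ?v = "\<lambda>r. res_tensor N 0 0 (f (gn n (int r))) \<one>\<^bsub>L\<^esub>"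
    have fc: "f (gn n r) \<in> carrier L" for r using bimod_homD(1)[OF f gn_closed] by simp
    obtain \<psi> where \<psi>: "\<psi> \<in> bimod_hom L (P n) (P 0)" "\<And>r. r \<le> n \<Longrightarrow> \<psi> (gn n (int r)) = ?v r"
      using P_hom_ex[OF LamM_res[of 0], of n ?v] fc by blast
    have eq: "compose (carrier (P n)) (res_aug N) \<psi> = f"
      by (rule P_hom_eqI[OF Reg_LamM P_comp[OF \<psi>(1) eps_hom] f])
        (simp add: compose_apply \<psi>(2) eps_ex(2) fc del: pr_one)
    have "res_aug N (\<psi> x) = f x" if "x \<in> carrier (P n)" for x
      by (rule trans[OF compose_apply[OF that, symmetric] fun_cong[OF eq]])
    then show ?thesis using \<psi> by blast
  qed
qed

end

section \<open>Cocycles and products\<close>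

context Lam
begin

sublocale H: ext_res "Lambda N" "Lambda_scalar N :: 'k \<Rightarrow> 'k lam" "res_module N" "res_diff N" "res_aug N" "regular_bimodule (Lambda N)"
  by (rule ext_res)

section \<open>Long commutators and norm sums on the algebra itself\<close>

lemma L_induct [consumes 1, case_names word add]:
  assumes x: "x \<in> carrier L"
    and word: "\<And>c w. w \<in> basis_words \<Longrightarrow> Q (\<kappa> c \<otimes>\<^bsub>L\<^esub> lw w)"
    and add: "\<And>x y. x \<in> carrier L \<Longrightarrow> y \<in> carrier L \<Longrightarrow> Q x \<Longrightarrow> Q y \<Longrightarrow> Q (x \<oplus>\<^bsub>L\<^esub> y)"
  shows "Q x"
proof -
  have zero: "Q \<zero>\<^bsub>L\<^esub>" using word[of "[]" 0] by (simp add: kappa_0 del: pr_zero)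
  have "finite J \<Longrightarrow> J \<subseteq> basis_words \<Longrightarrow> Q (finsum L (\<lambda>w. \<kappa> (coef x w) \<otimes>\<^bsub>L\<^esub> lw w) J)" for J
  proof (induction J rule: finite_induct)
    case empty
    then show ?case using zero by (simp del: pr_zero)
  next
    case (insert w J)
    then have "finsum L (\<lambda>w. \<kappa> (coef x w) \<otimes>\<^bsub>L\<^esub> lw w) (insert w J) =
        \<kappa> (coef x w) \<otimes>\<^bsub>L\<^esub> lw w \<oplus>\<^bsub>L\<^esub> finsum L (\<lambda>w. \<kappa> (coef x w) \<otimes>\<^bsub>L\<^esub> lw w) J"
      by (intro L.finsum_insert) auto
    then show ?case using insert word by (auto intro!: add L.finsum_closed)
  qed
  from this[OF finite_basis_words] show ?thesis by (subst L_expand[OF x]) simp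
qed

lemma R_commut: "R.commut w x = lw w \<otimes>\<^bsub>L\<^esub> x \<oplus>\<^bsub>L\<^esub> x \<otimes>\<^bsub>L\<^esub> lw w" if "x \<in> carrier L"
  using that unfolding R.commut_def by (simp add: Reg_W del: pr_one)

lemma kappa_move: "x \<in> carrier L \<Longrightarrow> y \<in> carrier L \<Longrightarrow> x \<otimes>\<^bsub>L\<^esub> (\<kappa> c \<otimes>\<^bsub>L\<^esub> y) = \<kappa> c \<otimes>\<^bsub>L\<^esub> (x \<otimes>\<^bsub>L\<^esub> y)"
  by (simp add: L.kappa_central[of x c, symmetric] flip: L.m_assoc)

lemma basis_words_length_cases:
  assumes "w \<in> basis_words"
  obtains "w = []" | t where "w = [t]" | "2 \<le> length w"
proof -
  consider "length w = 0" | "length w = 1" | "2 \<le> length w" by linarith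
  then show ?thesis using that by cases (auto simp: length_Suc_conv)
qed

text \<open>The long word is central: with a letter it gives zero in both orders or the two equal
  words of length \<open>2 * N\<close>, and with a longer word the product is zero by
  length.\<close>

lemma commut_top_zero:
  assumes x: "x \<in> carrier L" shows "R.commut (altw s (2 * N - 1)) x = \<zero>\<^bsub>L\<^esub>"
  using x
proof (induction rule: L_induct)
  case (word c w)
  let ?A = "altw s (2 * N - 1)"
  have "lw ?A \<otimes>\<^bsub>L\<^esub> lw w = lw w \<otimes>\<^bsub>L\<^esub> lw ?A"
    using word
  proof (cases rule: basis_words_length_cases)
    case (2 t)
    show ?thesis
    proof (cases "t = s")
      case True
      have "\<not> distinct_adj (altw s (2 * N - 1) @ altw s 1)" "\<not> distinct_adj (altw s 1 @ altw s (2 * N - 1))"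
        using N1 by (intro R.alt_append_same; simp)+
      then show ?thesis using True 2 by (simp del: pr_zero)
    next
      case False
      then have t: "t = flip s" by (simp add: neq_iff_flip)
      show ?thesis using top_words[of t] lw_top[of t] unfolding 2 t topw_def by simp
    qed
  next
    case 3
    then show ?thesis by (simp add: lw_long del: pr_zero)
  qed (simp del: lw_Nil)
  then show ?case by (simp add: R_commut kappa_move L.m_assoc del: lw_mult pr_zero)
next
  case (add x y)
  then show ?case using R.commut_add[of x y "altw s (2 * N - 1)"] by (simp del: pr_zero)
qed

text \<open>For the empty word only the equal terms at \<open>k = 0\<close> and
  \<open>k = N - 1\<close> survive, and they cancel. For \<open>[flip s]\<close> the two halves of
  each summand are the two equal words of length \<open>2 * N\<close>. For \<open>[s]\<close> a
  letter is repeated, and longer words vanish by length.\<close>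

lemma norm_sum_zero_L:
  assumes x: "x \<in> carrier L" shows "R.norm_sum s x = \<zero>\<^bsub>L\<^esub>"
  using x
proof (induction rule: L_induct)
  case (word c w)
  let ?x = "\<kappa> c \<otimes>\<^bsub>L\<^esub> lw w"
  let ?f = "\<lambda>k. R.W (altw (flip s) (2 * k)) ?x (altw s (Suc (2 * (N - 1 - k))))
      \<oplus>\<^bsub>Reg\<^esub> R.W (altw s (Suc (2 * k))) ?x (altw s (2 * (N - 1 - k)))"
  have W: "R.W u ?x v = \<kappa> c \<otimes>\<^bsub>L\<^esub> lw (u @ w @ v)" for u v
    by (simp add: Reg_W kappa_move L.m_assoc)
  have al: "altw s (2 * k) @ [s] = altw s (Suc (2 * k))" for s k
    by (simp add: altw_Suc del: altw.simps(2))
  have "finsum Reg ?f {..<N} = \<zero>\<^bsub>Reg\<^esub>"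
    using word
  proof (cases rule: basis_words_length_cases)
    case 1
    let ?A = "\<kappa> c \<otimes>\<^bsub>L\<^esub> lw (altw s (2 * N - 1))"
    let ?l = "\<lambda>k. if k = 0 then ?A else \<zero>\<^bsub>L\<^esub>"
    let ?r = "\<lambda>k. if k = N - 1 then ?A else \<zero>\<^bsub>L\<^esub>"
    have A: "2 * N - 1 = Suc (2 * (N - 1))" using N1 by simp
    have "finsum Reg ?f {..<N} = finsum Reg (\<lambda>k. ?l k \<oplus>\<^bsub>Reg\<^esub> ?r k) {..<N}"
    proof (rule R.M.M.finsum_cong')
      fix k assume k: "k \<in> {..<N}"
      have "R.W (altw (flip s) (2 * k)) ?x (altw s (Suc (2 * (N - 1 - k)))) = ?l k"
      proof (cases "k = 0")
        case True
        then show ?thesis unfolding W unfolding A 1 by simp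
      next
        case False
        then have "\<not> distinct_adj (altw (flip s) (2 * k) @ altw s (Suc (2 * (N - 1 - k))))"
          by (intro R.alt_append_same) auto
        then show ?thesis using False unfolding W unfolding 1 by (simp del: pr_zero altw.simps(2))
      qed
      moreover have "R.W (altw s (Suc (2 * k))) ?x (altw s (2 * (N - 1 - k))) = ?r k"
      proof (cases "k = N - 1")
        case True
        then show ?thesis unfolding W unfolding A 1 by simp
      next
        case False
        then have "\<not> distinct_adj (altw s (Suc (2 * k)) @ altw s (2 * (N - 1 - k)))"
          using k by (intro R.alt_append_same) auto
        then show ?thesis using False unfolding W unfolding 1 by (simp del: pr_zero altw.simps(2))
      qed
      ultimately show "?f k = ?l k \<oplus>\<^bsub>Reg\<^esub> ?r k" by simp
    qed auto
    also have "\<dots> = finsum Reg ?l {..<N} \<oplus>\<^bsub>Reg\<^esub> finsum Reg ?r {..<N}"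
      by (rule R.M.M.finsum_addf) auto
    also have "finsum Reg ?l {..<N} = ?A"
      by (rule finsum_pick[OF R.M.M.abelian_group_axioms, of _ 0]) (use N1 in auto)
    also have "finsum Reg ?r {..<N} = ?A"
      by (rule finsum_pick[OF R.M.M.abelian_group_axioms, of _ "N - 1"]) (use N1 in auto)
    finally show ?thesis by simp
  next
    case (2 t)
    have "?f k = \<zero>\<^bsub>Reg\<^esub>" if k: "k < N" for k
    proof (cases "t = s")
      case True
      have "\<not> distinct_adj (altw (flip s) (2 * k) @ [s] @ altw s (Suc (2 * (N - 1 - k))))"
        by (auto simp: distinct_adj_append_iff)
      moreover have "\<not> distinct_adj ((altw s (2 * k) @ [s]) @ [s] @ altw s (2 * (N - 1 - k)))"
        by (auto simp: distinct_adj_append_iff)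
      then have "\<not> distinct_adj (altw s (Suc (2 * k)) @ [s] @ altw s (2 * (N - 1 - k)))"
        unfolding al .
      ultimately have "lw (altw (flip s) (2 * k) @ [s] @ altw s (Suc (2 * (N - 1 - k)))) = \<zero>\<^bsub>L\<^esub>"
        "lw (altw s (Suc (2 * k)) @ [s] @ altw s (2 * (N - 1 - k))) = \<zero>\<^bsub>L\<^esub>" by (metis lw_nonalt)+
      then show ?thesis unfolding W unfolding 2 True by (simp del: pr_zero altw.simps(2)) simp
    next
      case False
      then have t: "t = flip s" by (simp add: neq_iff_flip)
      let ?j = "N - 1 - k"
      have "altw (flip s) (2 * k) @ [flip s] @ altw s (Suc (2 * ?j)) = altw (flip s) (2 * N)"
      proof -
        have "2 * N = 2 * k + Suc (Suc (2 * ?j))" using k by simp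
        then show ?thesis using altw_add[of "flip s" "2 * k" "Suc (Suc (2 * ?j))"] by simp
      qed
      moreover have "altw s (Suc (2 * k)) @ [flip s] @ altw s (2 * ?j) = altw s (2 * N)"
      proof -
        have "2 * N = Suc (2 * k) + Suc (2 * ?j)" using k by simp
        then show ?thesis using altw_add[of s "Suc (2 * k)" "Suc (2 * ?j)"] by simp
      qed
      ultimately show ?thesis unfolding W unfolding 2 t by (simp add: lw_top del: altw.simps(2))
    qed
    then show ?thesis by (intro R.M.M.add.finprod_one_eqI) auto
  next
    case 3
    have "lw (altw (flip s) (2 * k) @ w @ altw s (Suc (2 * (N - 1 - k)))) = \<zero>\<^bsub>L\<^esub>"
      "lw (altw s (Suc (2 * k)) @ w @ altw s (2 * (N - 1 - k))) = \<zero>\<^bsub>L\<^esub>" if "k < N" for k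
      using that 3 by (intro lw_long; simp)+
    then have "?f k = \<zero>\<^bsub>Reg\<^esub>" if "k < N" for k
      using that unfolding W by (simp del: pr_zero altw.simps(2)) simp
    then show ?thesis by (intro R.M.M.add.finprod_one_eqI) auto
  qed
  then show ?case unfolding R.norm_sum_def by simp
next
  case (add x y)
  then show ?case using R.norm_sum_add[of x y s] by (simp del: pr_zero)
qed

text \<open>The values that a cocycle of degree \<open>n\<close> may take at \<open>1 \<otimes>\<^sub>r 1\<close>.\<close>

definition cocycle_val :: "nat \<Rightarrow> nat \<Rightarrow> 'k lam \<Rightarrow> bool" where
  "cocycle_val n r x \<longleftrightarrow> x \<in> carrier L \<and> (2 * r \<le> n \<longrightarrow> R.commut [Arr_a] x = \<zero>\<^bsub>L\<^esub>) \<and> (n \<le> 2 * r \<longrightarrow> R.commut [Arr_abar] x = \<zero>\<^bsub>L\<^esub>)"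

lemma R_diff_val:
  assumes v: "\<And>s. v s \<in> carrier L"
  shows "R.diff_val n r v = (if 2 * r < int n then R.commut [Arr_a] (v r)
    else if int n < 2 * r then R.commut [Arr_abar] (v (r - 1)) else \<zero>\<^bsub>L\<^esub>)"
proof -
  have c: "R.commut w (v r) \<in> carrier L" for w r using R.commut_closed[of "v r" w] v by simp
  show ?thesis
    unfolding R.diff_val_def using v c by (simp add: commut_top_zero norm_sum_zero_L commut_top_zero[simplified] del: pr_zero) simp
qed

lemma hom_gn_zero: "f \<in> bimod_hom L (P n) Reg \<Longrightarrow> s < 0 \<or> int n < s \<Longrightarrow> f (gn n s) = \<zero>\<^bsub>L\<^esub>"
  using gn_zero[of s n] hom_zero_bimod[OF LamM_res Reg_LamM, of f n] by auto

text \<open>Each generator of degree \<open>Suc n\<close> constrains at most one value: its index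
  \<open>r\<close> gives the condition with \<open>Arr_a\<close> at \<open>r\<close>, its index
  \<open>r + 1\<close> the one with \<open>Arr_abar\<close> at \<open>r\<close>. Comparing with
  \<open>Suc n\<close> turns the strict inequalities of \<open>diff_val\<close> into the weak ones
  of \<open>cocycle_val\<close>. So the values at different indices are independent.\<close>

lemma Z_iff:
  "f \<in> H.Z n \<longleftrightarrow> f \<in> bimod_hom L (P n) Reg \<and> (\<forall>r\<le>n. cocycle_val n r (f (gn n (int r))))"
proof (cases "f \<in> bimod_hom L (P n) Reg")
  case f: True
  have fc: "f (gn n r) \<in> carrier L" for r using bimod_homD(1)[OF f gn_closed] by simp
  have fd: "f (res_diff N (Suc n) (gn (Suc n) r)) = R.diff_val (Suc n) r (\<lambda>s. f (gn n s))" for r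
    unfolding d_gn by (rule hom_diff_val[OF LamM_res Reg_LamM f gn_closed])
  show ?thesis
  proof
    assume Z: "f \<in> H.Z n"
    have d: "R.diff_val (Suc n) r (\<lambda>s. f (gn n s)) = \<zero>\<^bsub>L\<^esub>" for r
      using H.Z_d[OF Z gn_closed[of "Suc n" r]] unfolding fd by simp
    have "cocycle_val n r (f (gn n (int r)))" if "r \<le> n" for r
      using d[of "int r"] d[of "int r + 1"] fc unfolding cocycle_val_def R_diff_val[OF fc] by (auto split: if_splits)
    then show "f \<in> bimod_hom L (P n) Reg \<and> (\<forall>r\<le>n. cocycle_val n r (f (gn n (int r))))" using f by blast
  next
    assume r: "f \<in> bimod_hom L (P n) Reg \<and> (\<forall>r\<le>n. cocycle_val n r (f (gn n (int r))))"
    let ?c = "compose (carrier (P (Suc n))) f (res_diff N (Suc n))"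
    let ?z = "\<lambda>x\<in>carrier (P (Suc n)). \<zero>\<^bsub>Reg\<^esub>"
    have eq: "?c = ?z"
    proof (rule P_hom_eqI[OF Reg_LamM P_comp[OF d_hom f]])
      show "?z \<in> bimod_hom L (P (Suc n)) Reg"
        by (rule bimod2.hom_zero_closed[OF H.PM])
      fix s assume s: "s \<le> Suc n"
      have "R.diff_val (Suc n) (int s) (\<lambda>s. f (gn n s)) = \<zero>\<^bsub>L\<^esub>"
      proof -
        consider "2 * s < Suc n" | "Suc n = 2 * s" | k where "s = Suc k" "Suc n < 2 * s" by (cases s) (auto, linarith)
        then show ?thesis
        proof cases
          case 1
          then show ?thesis using r s unfolding R_diff_val[OF fc] by (auto simp: cocycle_val_def)
        next
          case 2
          then show ?thesis unfolding R_diff_val[OF fc] by auto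
        next
          case (3 k)
          then have "cocycle_val n k (f (gn n (int k)))" using r s by auto
          then show ?thesis using 3 unfolding R_diff_val[OF fc] by (auto simp: cocycle_val_def)
        qed
      qed
      then show "?c (gn (Suc n) (int s)) = ?z (gn (Suc n) (int s))"
        by (simp add: compose_apply fd)
    qed
    show "f \<in> H.Z n"
    proof (rule H.ZI[OF f])
      fix x assume x: "x \<in> carrier (P (Suc n))"
      from fun_cong[OF eq, of x] show "f (res_diff N (Suc n) x) = \<zero>\<^bsub>Reg\<^esub>"
        using x by (simp add: compose_apply)
    qed
  qed
qed (use H.Z_hom in blast)

section \<open>Cochains with a single value and their products\<close>

definition cochain :: "nat \<Rightarrow> nat \<Rightarrow> 'k lam \<Rightarrow> 'k res_elem \<Rightarrow> 'k lam" where
  "cochain n r x = free_bimod_map \<kappa> L n Reg (\<lambda>i. if i = r then x else \<zero>\<^bsub>L\<^esub>)"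

abbreviation HC :: "nat \<Rightarrow> nat \<Rightarrow> 'k lam \<Rightarrow> 'k hh_elem" where
  "HC n r x \<equiv> HH_class N n r x"

lemma HC_eq: "HC n r x = H.hm n (cochain n r x)"
  by (simp add: HH_class_def cochain_def)

lemma HH_eq: "HH N = H.ER"
  by (simp add: HH_def)

lemma cochain_hom: "x \<in> carrier L \<Longrightarrow> cochain n r x \<in> bimod_hom L (P n) Reg"
  unfolding cochain_def res_module_def
  by (rule bimod.free_bimod_map(1)[OF LamM.axioms(2)[OF Reg_LamM]]) auto

lemma cochain_gn_nat: "x \<in> carrier L \<Longrightarrow> i \<le> n \<Longrightarrow> cochain n r x (gn n (int i)) = (if i = r then x else \<zero>\<^bsub>L\<^esub>)"
  unfolding cochain_def gn_def res_tensor_def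
  by (rule bimod.free_bimod_map(2)[OF LamM.axioms(2)[OF Reg_LamM]]) auto

lemma cochain_gn:
  assumes x: "x \<in> carrier L" and r: "r \<le> n"
  shows "cochain n r x (gn n s) = (if s = int r then x else \<zero>\<^bsub>L\<^esub>)"
proof (cases "0 \<le> s \<and> s \<le> int n")
  case True
  then obtain i where "s = int i" "i \<le> n" by (metis nonneg_int_cases of_nat_le_iff)
  then show ?thesis using cochain_gn_nat[OF x, of i n r] by simp
next
  case False
  then show ?thesis using hom_gn_zero[OF cochain_hom[OF x], of s n r] r by auto
qed

lemma cocycle_val_zero [simp]: "cocycle_val n r \<zero>\<^bsub>L\<^esub>"
  using R.commut_zero by (simp add: cocycle_val_def)

lemma cochain_Z: "r \<le> n \<Longrightarrow> cocycle_val n r x \<Longrightarrow> cochain n r x \<in> H.Z n"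
  unfolding Z_iff using cochain_hom[of x] by (auto simp: cochain_gn cocycle_val_def[of n r x] simp del: pr_zero)

lemma cochain_eqI:
  assumes f: "f \<in> bimod_hom L (P n) Reg" and x: "x \<in> carrier L"
    and eq: "\<And>i. i \<le> n \<Longrightarrow> f (gn n (int i)) = (if i = r then x else \<zero>\<^bsub>L\<^esub>)"
  shows "f = cochain n r x"
  by (rule P_hom_eqI[OF Reg_LamM f cochain_hom[OF x]]) (simp add: eq cochain_gn_nat[OF x] del: pr_zero)

lemma commut_zero_commute:
  assumes c: "c \<in> carrier L" and "R.commut [t] c = \<zero>\<^bsub>L\<^esub>"
  shows "lw [t] \<otimes>\<^bsub>L\<^esub> c = c \<otimes>\<^bsub>L\<^esub> lw [t]"
proof -
  have "(lw [t] \<otimes>\<^bsub>L\<^esub> c \<oplus>\<^bsub>L\<^esub> c \<otimes>\<^bsub>L\<^esub> lw [t]) \<oplus>\<^bsub>L\<^esub> c \<otimes>\<^bsub>L\<^esub> lw [t] = c \<otimes>\<^bsub>L\<^esub> lw [t]"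
    using assms by (simp add: R_commut)
  then show ?thesis using c by (simp add: L.a_assoc del: pr_zero)
qed

text \<open>In degree zero both conditions of \<open>cocycle_val\<close> apply, so \<open>c\<close>
  commutes with both arrows and hence with every word.\<close>

lemma central_mult:
  assumes "cocycle_val 0 0 c" "x \<in> carrier L" shows "c \<otimes>\<^bsub>L\<^esub> x = x \<otimes>\<^bsub>L\<^esub> c"
proof -
  have c: "c \<in> carrier L" using assms(1) by (simp add: cocycle_val_def)
  have letter: "lw [t] \<otimes>\<^bsub>L\<^esub> c = c \<otimes>\<^bsub>L\<^esub> lw [t]" for t
    using assms(1) by (intro commut_zero_commute[OF c]) (cases t; auto simp: cocycle_val_def)
  have word: "lw w \<otimes>\<^bsub>L\<^esub> c = c \<otimes>\<^bsub>L\<^esub> lw w" for w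
  proof (induction w)
    case Nil
    then show ?case using c by (simp del: pr_one)
  next
    case (Cons t w)
    have "lw (t # w) = lw [t] \<otimes>\<^bsub>L\<^esub> lw w" by simp
    then show ?case using c Cons
      by (simp add: L.m_assoc del: lw_mult) (simp add: letter flip: L.m_assoc del: lw_mult)
  qed
  show ?thesis using assms(2)
  proof (induction rule: L_induct)
    case (word a w)
    then show ?case using c \<open>\<And>w. lw w \<otimes>\<^bsub>L\<^esub> c = c \<otimes>\<^bsub>L\<^esub> lw w\<close> by (simp add: kappa_move L.m_assoc)
  next
    case (add x y)
    then show ?case using c by (simp add: L.l_distr L.r_distr)
  qed
qed

lemma cocycle_val_mult_central:
  assumes c: "cocycle_val 0 0 c" and x: "cocycle_val n r x" shows "cocycle_val n r (c \<otimes>\<^bsub>L\<^esub> x)"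
proof -
  have cc: "c \<in> carrier L" "x \<in> carrier L" using c x by (simp_all add: cocycle_val_def)
  have "R.commut [t] (c \<otimes>\<^bsub>L\<^esub> x) = c \<otimes>\<^bsub>L\<^esub> R.commut [t] x" for t
    using cc central_mult[OF c, of "lw [t]"]
    by (simp add: R_commut L.r_distr flip: L.m_assoc)
  then show ?thesis using x cc by (auto simp: cocycle_val_def simp del: pr_zero)
qed

text \<open>On the left a class of degree zero sees only the component \<open>F 0\<close>, and its
  cochain is \<open>c\<close> times the augmentation. The augmentation of \<open>F 0\<close> is the
  lifted cochain, so the product is known for any lift.\<close>

lemma HC_central_mult:
  assumes c: "cocycle_val 0 0 c" and x: "cocycle_val n r x" and r: "r \<le> n"
  shows "HC 0 0 c \<otimes>\<^bsub>HH N\<^esub> HC n r x = HC n r (c \<otimes>\<^bsub>L\<^esub> x)"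
proof -
  have cc: "c \<in> carrier L" and xc: "x \<in> carrier L" using c x by (simp_all add: cocycle_val_def)
  note gZ = cochain_Z[OF le0 c] and fZ = cochain_Z[OF r x]
  obtain F where F: "H.lifts n (cochain n r x) F" using H.lifts_ex[OF fZ] by blast
  have F0: "F 0 \<in> bimod_hom L (P n) (P 0)" using H.liftsD(1)[OF F, of 0] by simp
  have g: "cochain 0 0 c = (\<lambda>y\<in>carrier (P 0). c \<otimes>\<^bsub>L\<^esub> res_aug N y)"
  proof (rule cochain_eqI[symmetric])
    show "(\<lambda>y\<in>carrier (P 0). c \<otimes>\<^bsub>L\<^esub> res_aug N y) \<in> bimod_hom L (P 0) Reg"
    proof (rule bimod_homI)
      fix u x assume u: "u \<in> carrier L" and x: "x \<in> carrier (P 0)"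
      have e: "res_aug N x \<in> carrier L" using bimod_homD(1)[OF eps_hom x] by simp
      have "c \<otimes>\<^bsub>L\<^esub> (u \<otimes>\<^bsub>L\<^esub> res_aug N x) = u \<otimes>\<^bsub>L\<^esub> (c \<otimes>\<^bsub>L\<^esub> res_aug N x)"
        using u e cc central_mult[OF c u] by (simp flip: L.m_assoc)
      then show "(\<lambda>y\<in>carrier (P 0). c \<otimes>\<^bsub>L\<^esub> res_aug N y) (u \<odot>\<^bsub>P 0\<^esub> x) = u \<odot>\<^bsub>Reg\<^esub> (\<lambda>y\<in>carrier (P 0). c \<otimes>\<^bsub>L\<^esub> res_aug N y) x"
        "(\<lambda>y\<in>carrier (P 0). c \<otimes>\<^bsub>L\<^esub> res_aug N y) (rsmult (P 0) x u) = rsmult Reg ((\<lambda>y\<in>carrier (P 0). c \<otimes>\<^bsub>L\<^esub> res_aug N y) x) u"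
        using u x e cc by (simp_all add: bimod_homD[OF eps_hom] L.m_assoc)
    qed (use bimod_homD(1)[OF eps_hom] cc in \<open>auto simp: bimod_homD(2)[OF eps_hom] L.r_distr\<close>)
  qed (use cc in \<open>auto simp: eps_gn simp del: pr_one\<close>)
  have "compose (carrier (P (n + 0))) (cochain 0 0 c) (F 0) = cochain n r (c \<otimes>\<^bsub>L\<^esub> x)"
  proof (rule cochain_eqI)
    show "compose (carrier (P (n + 0))) (cochain 0 0 c) (F 0) \<in> bimod_hom L (P n) Reg"
      using P_comp[OF F0 cochain_hom[OF cc]] by simp
    fix i assume i: "i \<le> n"
    have "res_aug N (F 0 (gn n (int i))) = (if i = r then x else \<zero>\<^bsub>L\<^esub>)"
      using H.liftsD(2)[OF F gn_closed] cochain_gn_nat[OF xc i] by simp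
    then show "compose (carrier (P (n + 0))) (cochain 0 0 c) (F 0) (gn n (int i)) = (if i = r then c \<otimes>\<^bsub>L\<^esub> x else \<zero>\<^bsub>L\<^esub>)"
      using bimod_homD(1)[OF F0 gn_closed] cc by (simp add: compose_def g del: pr_zero)
  qed (use cc xc in auto)
  then show ?thesis
    using H.hm_mult[OF fZ gZ F] by (simp add: HC_eq HH_eq)
qed

lemma HC_add:
  assumes x: "cocycle_val n r x" and y: "cocycle_val n r y" and r: "r \<le> n"
  shows "HC n r x \<oplus>\<^bsub>HH N\<^esub> HC n r y = HC n r (x \<oplus>\<^bsub>L\<^esub> y)"
proof -
  have xc: "x \<in> carrier L" "y \<in> carrier L" using x y by (simp_all add: cocycle_val_def)
  have "H.hadd n (cochain n r x) (cochain n r y) = cochain n r (x \<oplus>\<^bsub>L\<^esub> y)"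
  proof (rule cochain_eqI)
    show "H.hadd n (cochain n r x) (cochain n r y) \<in> bimod_hom L (P n) Reg"
      by (rule bimod2.hom_add_closed[OF H.PM cochain_hom[OF xc(1)] cochain_hom[OF xc(2)]])
  qed (use xc in \<open>auto simp: cochain_gn_nat simp del: pr_zero\<close>)
  then show ?thesis using H.hm_add[OF cochain_Z[OF r x] cochain_Z[OF r y]] by (simp add: HC_eq HH_eq)
qed

text \<open>A lift of \<open>\<chi>\<^bsub>2,1\<^esub>\<close> is the shift of the resolution by two degrees and one index.\<close>

lemma HC_shift:
  assumes x: "cocycle_val n r x" and r: "r \<le> n"
  shows "HC n r x \<otimes>\<^bsub>HH N\<^esub> HC 2 1 \<one>\<^bsub>L\<^esub> = HC (n + 2) (Suc r) x"
proof -
  have xc: "x \<in> carrier L" using x by (simp add: cocycle_val_def)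
  have one: "cocycle_val 2 1 \<one>\<^bsub>L\<^esub>" using Reg_commut_one by (simp add: cocycle_val_def del: pr_one)
  have "\<forall>i. \<exists>f. f \<in> bimod_hom L (P (2 + i)) (P i) \<and> (\<forall>s\<le>2 + i. f (gn (2 + i) (int s)) = gn i (int s - 1))"
    using P_hom_ex[OF LamM_res, of "2 + i" "\<lambda>s. gn i (int s - 1)" i for i] by blast
  then obtain F where F: "\<And>i. F i \<in> bimod_hom L (P (2 + i)) (P i)"
    and Fn: "\<And>i s. s \<le> 2 + i \<Longrightarrow> F i (gn (2 + i) (int s)) = gn i (int s - 1)"
    by metis
  have Fg: "F i (gn (2 + i) s) = gn i (s - 1)" for i s
  proof (cases "0 \<le> s \<and> s \<le> int (2 + i)")
    case True
    then obtain k where "s = int k" "k \<le> 2 + i" by (metis nonneg_int_cases of_nat_le_iff)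
    then show ?thesis using Fn by simp
  next
    case False
    then have "gn (2 + i) s = \<zero>\<^bsub>P (2 + i)\<^esub>" "gn i (s - 1) = \<zero>\<^bsub>P i\<^esub>" by (auto intro!: gn_zero)
    then show ?thesis using hom_zero_bimod[OF LamM_res LamM_res F] by simp
  qed
  have lift: "H.lifts 2 (cochain 2 1 \<one>\<^bsub>L\<^esub>) F"
    unfolding chain_lift_def
  proof (intro conjI allI ballI)
    fix i show "F i \<in> bimod_hom L (P (2 + i)) (P i)" by (rule F)
  next
    fix y assume y: "y \<in> carrier (P 2)"
    have F0: "F 0 \<in> bimod_hom L (P 2) (P 0)" using F[of 0] by simp
    have eq: "compose (carrier (P 2)) (res_aug N) (F 0) = cochain 2 1 \<one>\<^bsub>L\<^esub>"
      by (rule cochain_eqI[OF P_comp[OF F0 eps_hom]]) (use Fg[of 0] in \<open>auto simp: compose_apply eps_gn simp del: pr_one\<close>)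
    show "res_aug N (F 0 y) = cochain 2 1 \<one>\<^bsub>L\<^esub> y"
      by (rule trans[OF compose_apply[OF y, symmetric] fun_cong[OF eq]])
  next
    fix i y assume y: "y \<in> carrier (P (2 + Suc i))"
    have d: "res_diff N (2 + Suc i) \<in> bimod_hom L (P (2 + Suc i)) (P (2 + i))" using d_hom[of "2 + i"] by simp
    have eq: "compose (carrier (P (2 + Suc i))) (res_diff N (Suc i)) (F (Suc i)) =
        compose (carrier (P (2 + Suc i))) (F i) (res_diff N (2 + Suc i))"
    proof (rule P_hom_eqI[OF LamM_res P_comp[OF F d_hom] P_comp[OF d F]])
      fix s
      have "F i (res_diff N (2 + Suc i) (gn (2 + Suc i) (int s))) = P.diff_val i (2 + Suc i) (int s) (\<lambda>t. gn i (t - 1))"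
      proof -
        have "F i (P.diff_val (2 + i) (2 + Suc i) (int s) (gn (2 + i))) = P.diff_val i (2 + Suc i) (int s) (\<lambda>t. F i (gn (2 + i) t))"
          by (rule hom_diff_val[OF LamM_res LamM_res F gn_closed])
        then show ?thesis using d_gn[of "2 + i" "int s"] by (simp add: Fg[simplified] Fg)
      qed
      \<comment> \<open>Lowering the degree by two and the index by one keeps the sign of degree
        minus twice the index, so the same case of \<open>diff_val\<close> applies.\<close>
      also have "\<dots> = P.diff_val i (Suc i) (int s - 1) (gn i)"
        unfolding P.diff_val_def by auto
      finally have "F i (res_diff N (2 + Suc i) (gn (2 + Suc i) (int s))) = \<dots>" .
      moreover have "F (Suc i) (gn (2 + Suc i) (int s)) = gn (Suc i) (int s - 1)" by (rule Fg)
      ultimately show "compose (carrier (P (2 + Suc i))) (res_diff N (Suc i)) (F (Suc i)) (gn (2 + Suc i) (int s)) =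
        compose (carrier (P (2 + Suc i))) (F i) (res_diff N (2 + Suc i)) (gn (2 + Suc i) (int s))"
        using compose_apply[OF gn_closed] by (simp only: compose_apply[OF gn_closed] d_gn)
    qed
    show "res_diff N (Suc i) (F (Suc i) y) = F i (res_diff N (2 + Suc i) y)"
      by (rule trans[OF compose_apply[OF y, symmetric] trans[OF fun_cong[OF eq] compose_apply[OF y]]])
  qed
  have "compose (carrier (P (2 + n))) (cochain n r x) (F n) = cochain (2 + n) (Suc r) x"
    by (rule cochain_eqI[OF P_comp[OF F cochain_hom[OF xc]] xc])
      (auto simp: compose_apply Fg Fg[simplified] cochain_gn[OF xc r] simp del: pr_zero)
  then show ?thesis
    using H.hm_mult[OF cochain_Z[OF _ one] cochain_Z[OF r x] lift] by (simp add: HC_eq HH_eq add.commute[of n 2])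
qed

end

section \<open>Products with a class of degree one\<close>

context Lam
begin

text \<open>The lift of the class with value \<open>1\<close> at \<open>s0\<close> is explicit in homological degree one except at
  the indices \<open>s0\<close> and \<open>s0 + 1\<close>. Below, one of these is \<open>t0\<close> and the other one is interior.\<close>

lemma leading_product:
  assumes s0: "s0 \<le> m" "cocycle_val m s0 \<one>\<^bsub>L\<^esub>" and j: "j \<le> 1" "cocycle_val 1 j y" and t0: "t0 \<le> Suc m"
    and eq: "P.diff_val 0 (Suc 0) (int j) (gn 0) =
      P.diff_val 0 (Suc m) (int t0) (\<lambda>s. if s = int s0 then gn 0 0 else \<zero>\<^bsub>P 0\<^esub>)"
  shows "\<exists>f\<in>H.Z (Suc m). H.hm (Suc m) f = HC 1 j y \<otimes>\<^bsub>HH N\<^esub> HC m s0 \<one>\<^bsub>L\<^esub> \<and>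
    f (gn (Suc m) (int t0)) = y \<and>
    (\<forall>r\<le>Suc m. r \<noteq> t0 \<longrightarrow> r \<noteq> s0 \<longrightarrow> r \<noteq> Suc s0 \<longrightarrow> f (gn (Suc m) (int r)) = \<zero>\<^bsub>L\<^esub>)"
proof -
  have yc: "y \<in> carrier L" using j(2) by (simp add: cocycle_val_def)
  let ?v = "\<lambda>s. if s = int s0 then gn 0 0 else \<zero>\<^bsub>P 0\<^esub>"
  note fZ = cochain_Z[OF s0] and gZ = cochain_Z[OF j]
  obtain F0 where F0: "F0 \<in> bimod_hom L (P m) (P 0)"
    and F0n: "\<And>r. r \<le> m \<Longrightarrow> F0 (gn m (int r)) = ?v (int r)"
  proof -
    have "\<exists>f\<in>bimod_hom L (P m) (P 0). \<forall>r\<le>m. f (gn m (int r)) = ?v (int r)"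
      by (rule P_hom_ex[OF LamM_res]) auto
    then show ?thesis using that by blast
  qed
  have F0g: "F0 (gn m s) = ?v s" for s
  proof (cases "0 \<le> s \<and> s \<le> int m")
    case True
    then obtain k where "s = int k" "k \<le> m" by (metis nonneg_int_cases of_nat_le_iff)
    then show ?thesis using F0n by simp
  next
    case False
    then have "gn m s = \<zero>\<^bsub>P m\<^esub>" by (auto intro!: gn_zero)
    then show ?thesis using hom_zero_bimod[OF LamM_res LamM_res F0] False s0(1) by auto
  qed
  have F0d: "F0 (res_diff N (Suc m) (gn (Suc m) r)) = P.diff_val 0 (Suc m) r ?v" for r
  proof -
    have "F0 (P.diff_val m (Suc m) r (gn m)) = P.diff_val 0 (Suc m) r (\<lambda>s. F0 (gn m s))"
      by (rule hom_diff_val[OF LamM_res LamM_res F0 gn_closed])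
    then show ?thesis unfolding d_gn F0g .
  qed
  have comp: "compose (carrier (P m)) (res_aug N) F0 = cochain m s0 \<one>\<^bsub>L\<^esub>"
  proof (rule cochain_eqI[OF P_comp[OF F0 eps_hom]])
    have "res_aug N \<zero>\<^bsub>P 0\<^esub> = \<zero>\<^bsub>L\<^esub>" using hom_zero_bimod[OF LamM_res Reg_LamM eps_hom] by simp
    then show "compose (carrier (P m)) (res_aug N) F0 (gn m (int i)) = (if i = s0 then \<one>\<^bsub>L\<^esub> else \<zero>\<^bsub>L\<^esub>)" for i
      by (simp add: compose_apply F0g eps_gn del: pr_one pr_zero)
  qed simp
  have aug: "res_aug N (F0 x) = cochain m s0 \<one>\<^bsub>L\<^esub> x" if "x \<in> carrier (P m)" for x
    by (rule trans[OF compose_apply[OF that, symmetric] fun_cong[OF comp]])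
  \<comment> \<open>Requirements on the image of generator \<open>r\<close> in homological degree
    one: prescribed at \<open>t0\<close>, zero away from \<open>t0\<close>, \<open>s0\<close> and
    \<open>Suc s0\<close>, and otherwise only compatible with the differential.\<close>
  let ?Q = "\<lambda>r z. z \<in> carrier (P 1) \<and> res_diff N 1 z = F0 (res_diff N (Suc m) (gn (Suc m) (int r))) \<and>
      (r = t0 \<longrightarrow> z = gn 1 (int j)) \<and> (r \<noteq> t0 \<and> r \<noteq> s0 \<and> r \<noteq> Suc s0 \<longrightarrow> z = \<zero>\<^bsub>P 1\<^esub>)"
  have ex: "\<exists>z. ?Q r z" for r
  proof -
    consider "r = t0" | "r \<noteq> t0" "r = s0 \<or> r = Suc s0" | "r \<noteq> t0" "r \<noteq> s0" "r \<noteq> Suc s0" by blast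
    then show ?thesis
    proof cases
      case 1
      have "res_diff N (Suc 0) (gn (Suc 0) (int j)) = F0 (res_diff N (Suc m) (gn (Suc m) (int r)))"
        unfolding 1 unfolding F0d unfolding d_gn by (rule eq)
      then show ?thesis using 1 by (intro exI[of _ "gn 1 (int j)"]) simp
    next
      case 2
      let ?x = "F0 (res_diff N (Suc m) (gn (Suc m) (int r)))"
      have "?x \<in> carrier (P 0)" by (rule bimod_homD(1)[OF F0 H.d_closed[OF gn_closed]])
      \<comment> \<open>The cocycle condition for the lifted cochain makes \<open>?x\<close> a
        cycle, so some preimage exists; nothing else about it is known.\<close>
      moreover have "res_aug N ?x = \<zero>\<^bsub>L\<^esub>"
        using aug[OF H.d_closed[OF gn_closed]] H.Z_d[OF fZ gn_closed[of "Suc m" "int r"]] by simp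
      ultimately show ?thesis using exact_filtered[of ?x 0 0] filtered_0 2 by auto
    next
      case 3
      have "P.diff_val 0 (Suc m) (int r) ?v = \<zero>\<^bsub>P 0\<^esub>"
        using 3 by (intro diff_val_zero[OF LamM_res]) auto
      with F0d have F: "F0 (res_diff N (Suc m) (gn (Suc m) (int r))) = \<zero>\<^bsub>P 0\<^esub>" by (rule trans)
      have "res_diff N 1 \<zero>\<^bsub>P 1\<^esub> = \<zero>\<^bsub>P 0\<^esub>"
        using hom_zero_bimod[OF LamM_res LamM_res d_hom[of 0]] by simp
      then show ?thesis unfolding F using 3 by (intro exI[of _ "\<zero>\<^bsub>P 1\<^esub>"]) simp
    qed
  qed
  have "\<exists>z. \<forall>r. ?Q r (z r)" by (intro choice allI ex)
  then obtain z where zQ: "\<forall>r. ?Q r (z r)" by (rule exE)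
  then have z: "z r \<in> carrier (P 1)" and zd: "res_diff N 1 (z r) = F0 (res_diff N (Suc m) (gn (Suc m) (int r)))"
    and zo: "r \<noteq> t0 \<Longrightarrow> r \<noteq> s0 \<Longrightarrow> r \<noteq> Suc s0 \<Longrightarrow> z r = \<zero>\<^bsub>P 1\<^esub>" for r by simp_all
  have zt: "z t0 = gn 1 (int j)" using zQ by simp
  obtain F1 where F1: "F1 \<in> bimod_hom L (P (Suc m)) (P (Suc 0))"
    and F1g: "\<And>r. r \<le> Suc m \<Longrightarrow> F1 (gn (Suc m) (int r)) = z r"
    using P_hom_ex[OF LamM_res[of "Suc 0"], of "Suc m" z] z by auto
  have comm: "res_diff N (Suc 0) (F1 x) = F0 (res_diff N (Suc m) x)" if x: "x \<in> carrier (P (Suc m))" for x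
  proof -
    have "compose (carrier (P (Suc m))) (res_diff N (Suc 0)) F1 = compose (carrier (P (Suc m))) F0 (res_diff N (Suc m))"
    proof (rule P_hom_eqI[OF LamM_res P_comp[OF F1 d_hom] P_comp[OF d_hom F0]])
      fix r assume "r \<le> Suc m"
      then show "compose (carrier (P (Suc m))) (res_diff N (Suc 0)) F1 (gn (Suc m) (int r)) =
          compose (carrier (P (Suc m))) F0 (res_diff N (Suc m)) (gn (Suc m) (int r))"
        using zd[of r] by (simp only: compose_apply[OF gn_closed] F1g One_nat_def)
    qed
    from fun_cong[OF this, of x] show ?thesis by (simp only: compose_apply[OF x])
  qed
  obtain F where F: "H.lifts m (cochain m s0 \<one>\<^bsub>L\<^esub>) F" and "F (Suc 0) = F1"
    using H.lifts_extend[OF F0 F1 aug comm] by blast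
  let ?f = "compose (carrier (P (m + 1))) (cochain 1 j y) (F 1)"
  have fF: "?f (gn (Suc m) (int r)) = cochain 1 j y (z r)" if "r \<le> Suc m" for r
    using that F1g \<open>F (Suc 0) = F1\<close> by (simp add: compose_apply)
  show ?thesis
  proof (intro bexI[of _ ?f] conjI allI impI)
    show "?f \<in> H.Z (Suc m)" using H.comp_lift_Z[OF gZ F] by simp
    show "H.hm (Suc m) ?f = HC 1 j y \<otimes>\<^bsub>HH N\<^esub> HC m s0 \<one>\<^bsub>L\<^esub>"
      using H.hm_mult[OF fZ gZ F] by (simp add: HC_eq HH_eq del: pr_one)
    show "?f (gn (Suc m) (int t0)) = y"
      unfolding fF[OF t0] zt using cochain_gn[OF yc j(1), of "int j"] by simp
    fix r assume "r \<le> Suc m" "r \<noteq> t0" "r \<noteq> s0" "r \<noteq> Suc s0"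
    then show "?f (gn (Suc m) (int r)) = \<zero>\<^bsub>L\<^esub>"
      using fF[of r] zo[of r] hom_zero_bimod[OF LamM_res Reg_LamM cochain_hom[OF yc, of 1 j]] by simp
  qed
qed

section \<open>The centre and the centralisers of the arrows\<close>

lemma coef_letter_mult:
  assumes y: "y \<in> carrier L" and w: "t # v \<in> basis_words" "t # v \<noteq> wa"
  shows "coef (lw [t] \<otimes>\<^bsub>L\<^esub> y) (t # v) = coef y v"
proof -
  obtain p where p: "y = pr p" using pr_surj y by blast
  have l: "length (t # v) < 2 * N" "distinct_adj (t # v)" using w by (auto simp: basis_words_def)
  then have "v \<in> basis_words" "v \<noteq> wa" using distinct_adj_ConsD[of t v] by (auto simp: basis_words_def)
  moreover have "lk (sg [t] * p) (t # v) = lk p v" by (simp add: lk_sg_left)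
  ultimately show ?thesis using w by (simp add: p lw_def coef_pr cf_not_wa)
qed

text \<open>Compare the two products with \<open>t\<close> at words beginning with \<open>t\<close>:
  left multiplication reaches all of them, right multiplication only those that also end in
  \<open>t\<close>, which is a matter of parity. The bound in the first claim leaves out
  \<open>topw t\<close>, whose products with \<open>t\<close> both equal
  \<open>lw wa\<close>.\<close>

lemma centraliser_coef:
  assumes x: "x \<in> carrier L" and commut: "R.commut [t] x = \<zero>\<^bsub>L\<^esub>"
  shows "Suc (Suc (2 * i)) < 2 * N \<Longrightarrow> coef x (altw (flip t) (Suc (2 * i))) = 0"
    and "i < N \<Longrightarrow> coef x (altw (flip t) (2 * i)) = coef x (altw t (2 * i))"
proof -
  have coef: "coef x v = (if last (t # v) = t then coef x (butlast (t # v)) else 0)"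
    if "distinct_adj (t # v)" "length (t # v) < 2 * N" for v
  proof -
    have "t # v \<noteq> wa" using that(2) by (metis len_w(1) less_irrefl)
    with that have w: "t # v \<in> basis_words" "t # v \<noteq> wa" by (auto simp: basis_words_def)
    have "coef (lw [t] \<otimes>\<^bsub>L\<^esub> x) (t # v) = coef (x \<otimes>\<^bsub>L\<^esub> lw [t]) (t # v)"
      using commut_zero_commute[OF x commut] by (rule arg_cong)
    then show ?thesis unfolding coef_letter_mult[OF x w] coef_mult_letter[OF x w(1)] using w by simp
  qed
  have tw: "t # altw (flip t) k = altw t (Suc k)" for k by simp
  show "coef x (altw (flip t) (Suc (2 * i))) = 0" if "Suc (Suc (2 * i)) < 2 * N"
  proof -
    have "last (altw t (Suc (Suc (2 * i)))) = flip t" by (subst last_altw) auto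
    then show ?thesis using coef[of "altw (flip t) (Suc (2 * i))"] that unfolding tw by (simp del: altw.simps(2))
  qed
  show "coef x (altw (flip t) (2 * i)) = coef x (altw t (2 * i))" if "i < N"
  proof (cases "i = 0")
    case False
    have "last (altw t (Suc (2 * i))) = t" by (subst last_altw) auto
    moreover have "butlast (altw t (Suc (2 * i))) = altw t (2 * i)"
      unfolding altw_Suc by (rule butlast_snoc)
    ultimately show ?thesis using coef[of "altw (flip t) (2 * i)"] that unfolding tw by (simp del: altw.simps(2))
  qed simp
qed

text \<open>The powers of \<open>c_pow 1\<close>, the sum of the two alternating words of length
  two: mixed products contain a repeated letter. At \<open>i = 0\<close> both words are empty and
  would cancel, so the unit is put in by hand; at \<open>i = N\<close> they do cancel, so expansions
  stop before \<open>N\<close>.\<close>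

definition c_pow :: "nat \<Rightarrow> 'k lam" where
  "c_pow i = (if i = 0 then \<one>\<^bsub>L\<^esub> else lw (altw Arr_a (2 * i)) \<oplus>\<^bsub>L\<^esub> lw (altw Arr_abar (2 * i)))"

lemma c_pow_closed [simp, intro]: "c_pow i \<in> carrier L"
  by (simp add: c_pow_def del: pr_one)

lemma c_pow_alt: "i \<noteq> 0 \<Longrightarrow> c_pow i = lw (altw t (2 * i)) \<oplus>\<^bsub>L\<^esub> lw (altw (flip t) (2 * i))"
  by (cases t) (simp_all add: c_pow_def L.a_comm)

lemma coef_c_pow:
  assumes "i < N" "w \<in> basis_words"
  shows "coef (c_pow i) w = (if length w = 2 * i then 1 else 0)"
proof (cases "i = 0")
  case True
  then show ?thesis using coef_lw[of "[]" w] assms by (simp add: c_pow_def)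
next
  case False
  have "w = altw Arr_a (2 * i) \<or> w = altw Arr_abar (2 * i)" if "length w = 2 * i"
    using distinct_adj_cases[OF basis_words_props(1)[OF assms(2)]] that by auto
  moreover have "altw Arr_a (2 * i) \<noteq> altw Arr_abar (2 * i)" using False by (simp add: altw_inj)
  ultimately show ?thesis
    using False assms by (auto simp: c_pow_def coef_add coef_lw altw_basis_words)
qed

text \<open>For \<open>i > 0\<close> only one of the two words in \<open>c_pow i\<close> can be
  continued by \<open>t\<close>. This exhibits the odd words of the centraliser as multiples of the
  arrow.\<close>

lemma c_pow_letter: "c_pow i \<otimes>\<^bsub>L\<^esub> lw [t] = lw (altw t (Suc (2 * i)))"
proof (cases "i = 0")
  case False
  have "\<not> distinct_adj (altw (flip t) (2 * i) @ altw t 1)"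
    using False by (intro R.alt_append_same) auto
  then have "lw (altw (flip t) (2 * i)) \<otimes>\<^bsub>L\<^esub> lw [t] = \<zero>\<^bsub>L\<^esub>" by (simp del: pr_zero)
  moreover have "lw (altw t (2 * i)) \<otimes>\<^bsub>L\<^esub> lw [t] = lw (altw t (Suc (2 * i)))"
    by (simp add: altw_Suc del: altw.simps(2))
  ultimately show ?thesis using False
    by (simp add: c_pow_alt[of i t] L.l_distr del: lw_mult pr_zero altw.simps(2))
qed (simp add: c_pow_def del: pr_one)

lemma c_pow_Suc: "i \<noteq> 0 \<Longrightarrow> c_pow (Suc i) = c_pow 1 \<otimes>\<^bsub>L\<^esub> c_pow i"
proof -
  assume i: "i \<noteq> 0"
  have z: "lw (altw (flip t) 2) \<otimes>\<^bsub>L\<^esub> lw (altw t (2 * i)) = \<zero>\<^bsub>L\<^esub>" for t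
  proof -
    have "\<not> distinct_adj (altw (flip t) 2 @ altw t (2 * i))"
      using i by (intro R.alt_append_same) auto
    then show ?thesis by (simp del: pr_zero)
  qed
  have y: "lw (altw t 2) \<otimes>\<^bsub>L\<^esub> lw (altw t (2 * i)) = lw (altw t (2 * Suc i))" for t
    using altw_add[of t 2 "2 * i"] by (simp del: altw.simps(2))
  show "c_pow (Suc i) = c_pow 1 \<otimes>\<^bsub>L\<^esub> c_pow i"
    using i z[of Arr_a] z[of Arr_abar] y[of Arr_a] y[of Arr_abar]
    by (simp add: c_pow_def L.l_distr L.r_distr del: lw_mult pr_zero altw.simps(2))
qed

text \<open>By \<open>centraliser_coef\<close> the coordinates at short words of even length depend
  only on the length, which yields the elements \<open>c_pow i\<close>. Of the odd words beginning
  with \<open>flip t\<close> only \<open>topw t\<close> can occur. The odd words beginning with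
  \<open>t\<close> and the word \<open>wa\<close> are unconstrained.\<close>

lemma centraliser_expand:
  assumes x: "x \<in> carrier L" and commut: "R.commut [t] x = \<zero>\<^bsub>L\<^esub>"
  shows "x = (finsum L (\<lambda>i. \<kappa> (coef x (altw t (2 * i))) \<otimes>\<^bsub>L\<^esub> c_pow i) {..<N} \<oplus>\<^bsub>L\<^esub>
        (\<kappa> (coef x (topw t)) \<otimes>\<^bsub>L\<^esub> lw (topw t) \<oplus>\<^bsub>L\<^esub> \<kappa> (coef x wa) \<otimes>\<^bsub>L\<^esub> lw wa)) \<oplus>\<^bsub>L\<^esub>
      finsum L (\<lambda>i. \<kappa> (coef x (altw t (Suc (2 * i)))) \<otimes>\<^bsub>L\<^esub> lw (altw t (Suc (2 * i)))) {..<N}"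
    (is "x = (finsum L ?e _ \<oplus>\<^bsub>L\<^esub> (?u \<oplus>\<^bsub>L\<^esub> ?z)) \<oplus>\<^bsub>L\<^esub> finsum L ?o _")
proof (rule coef_eqI[OF x])
  fix w assume w: "w \<in> basis_words"
  have c: "finsum L ?e {..<N} \<in> carrier L" "finsum L ?o {..<N} \<in> carrier L"
    by (auto intro!: L.finsum_closed)
  have wa: "wa \<in> basis_words" by (simp add: basis_words_def)
  have o: "coef (?o i) w = (if w = altw t (Suc (2 * i)) then coef x w else 0)" if "i < N" for i
    using that w by (simp add: coef_kappa coef_lw altw_basis_words del: altw.simps(2))
  have so: "(\<Sum>i<N. coef (?o i) w) = (if (\<exists>i<N. w = altw t (Suc (2 * i))) then coef x w else 0)"
  proof (cases "\<exists>i<N. w = altw t (Suc (2 * i))")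
    case True
    then obtain k where k: "k < N" "w = altw t (Suc (2 * k))" by blast
    have "(\<Sum>i<N. coef (?o i) w) = (\<Sum>i<N. if i = k then coef x w else 0)"
      by (rule sum.cong) (use o k in \<open>auto simp: altw_inj simp del: altw.simps(2)\<close>)
    then show ?thesis using k True by simp
  next
    case False
    then have "(\<Sum>i<N. coef (?o i) w) = 0" by (intro sum.neutral) (use o in auto)
    then show ?thesis unfolding if_not_P[OF False] .
  qed
  have e: "coef (?e i) w = (if length w = 2 * i then coef x (altw t (2 * i)) else 0)" if "i < N" for i
    using that w by (simp add: coef_kappa coef_c_pow)
  have se: "(\<Sum>i<N. coef (?e i) w) = (if even (length w) \<and> length w < 2 * N then coef x (altw t (length w)) else 0)"
  proof (cases "even (length w) \<and> length w < 2 * N")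
    case True
    then obtain k where k: "k < N" "length w = 2 * k" by (auto elim!: evenE)
    have "(\<Sum>i<N. coef (?e i) w) = (\<Sum>i<N. if i = k then coef x (altw t (length w)) else 0)"
      by (rule sum.cong) (use e k in auto)
    then show ?thesis using k True by simp
  next
    case False
    then have "(\<Sum>i<N. coef (?e i) w) = 0" by (intro sum.neutral) (use e in auto)
    then show ?thesis unfolding if_not_P[OF False] .
  qed
  have "coef x w = (if even (length w) \<and> length w < 2 * N then coef x (altw t (length w)) else 0)
      + ((if w = topw t then coef x w else 0) + (if w = wa then coef x w else 0))
      + (if \<exists>i<N. w = altw t (Suc (2 * i)) then coef x w else 0)"
  proof (cases "w = wa")
    case True
    have "wa \<noteq> altw t (Suc (2 * i))" for i
    proof
      assume "wa = altw t (Suc (2 * i))"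
      then have "2 * N = Suc (2 * i)" by (metis len_w(1) length_altw)
      then show False by presburger
    qed
    then have "\<not> (\<exists>i<N. wa = altw t (Suc (2 * i)))" by blast
    moreover have "wa \<noteq> topw t" using topw_props(4)[of t] by (rule not_sym)
    ultimately show ?thesis unfolding True by (auto simp del: altw.simps(2))
  next
    case False
    then have l: "length w < 2 * N" "distinct_adj w" using w by (auto simp: basis_words_def)
    then consider "w = altw t (length w)" | "w = altw (flip t) (length w)" using alt_len_cases by blast
    then show ?thesis
    proof cases
      case 1
      show ?thesis
      proof (cases "even (length w)")
        case True
        then have "w \<noteq> altw t (Suc (2 * i))" "w \<noteq> topw t" for i
          using N1 by (auto dest!: arg_cong[of _ _ length] simp del: altw.simps(2))
        then show ?thesis using True False l by (simp add: 1[symmetric] del: altw.simps(2))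
      next
        case odd: False
        then obtain i where i: "length w = Suc (2 * i)" by (metis oddE Suc_eq_plus1)
        then have "w = altw t (Suc (2 * i))" using 1 by metis
        moreover have "i < N" using i l by simp
        ultimately have "\<exists>i<N. w = altw t (Suc (2 * i))" by blast
        moreover have "w \<noteq> topw t"
        proof
          assume "w = topw t"
          then have "altw t (2 * N - 1) = altw (flip t) (2 * N - 1)" using 1 by (metis topw_def topw_props(2))
          then show False using N1 unfolding altw_inj by simp
        qed
        ultimately show ?thesis using odd False by simp
      qed
    next
      case 2
      show ?thesis
      proof (cases "even (length w)")
        case True
        then obtain i where i: "length w = 2 * i" "i < N" using l by (auto elim!: evenE)
        have "coef x w = coef x (altw t (length w))"
          using centraliser_coef(2)[OF x commut i(2)] 2 i(1) by metis
        moreover have "w \<noteq> altw t (Suc (2 * i))" "w \<noteq> topw t" for i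
          using True N1 by (auto dest!: arg_cong[of _ _ length] simp del: altw.simps(2))
        ultimately show ?thesis using True False l by (simp del: altw.simps(2))
      next
        case odd: False
        then obtain i where i: "length w = Suc (2 * i)" by (metis oddE Suc_eq_plus1)
        have w: "w = altw (flip t) (Suc (2 * i))" using 2 i by metis
        have "w \<noteq> altw t (Suc (2 * j))" for j unfolding w altw_inj by simp
        then have ne: "\<not> (\<exists>j<N. w = altw t (Suc (2 * j)))" by blast
        show ?thesis
        proof (cases "Suc (Suc (2 * i)) < 2 * N")
          case True
          then have c0: "coef x w = 0" using centraliser_coef(1)[OF x commut True] w by metis
          show ?thesis unfolding c0 using odd by simp
        next
          case F: False
          then have "Suc (2 * i) = 2 * N - 1" using i l(1) by linarith
          then have "w = topw t" unfolding w topw_def by simp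
          then show ?thesis unfolding if_not_P[OF ne] using odd False by (simp del: altw.simps(2))
        qed
      qed
    qed
  qed
  also have "\<dots> = coef ((finsum L ?e {..<N} \<oplus>\<^bsub>L\<^esub> (?u \<oplus>\<^bsub>L\<^esub> ?z)) \<oplus>\<^bsub>L\<^esub> finsum L ?o {..<N}) w"
  proof -
    have "coef ?u w = (if w = topw t then coef x w else 0)" "coef ?z w = (if w = wa then coef x w else 0)"
      using w wa by (simp_all add: coef_kappa coef_lw)
    moreover have "coef ((finsum L ?e {..<N} \<oplus>\<^bsub>L\<^esub> (?u \<oplus>\<^bsub>L\<^esub> ?z)) \<oplus>\<^bsub>L\<^esub> finsum L ?o {..<N}) w =
        (\<Sum>i<N. coef (?e i) w) + (coef ?u w + coef ?z w) + (\<Sum>i<N. coef (?o i) w)"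
      using w c by (simp add: coef_add coef_finsum del: altw.simps(2))
    ultimately show ?thesis unfolding so se by (simp only:)
  qed
  finally show "coef x w = \<dots>" .
qed (auto intro!: L.a_closed L.finsum_closed)

section \<open>Generation\<close>

definition gens :: "'k hh_elem set" where
  "gens = {HC 0 0 \<one>\<^bsub>L\<^esub>, HC 0 0 (c_pow 1), HC 0 0 (lw (altw Arr_a (2 * N - 1))), HC 0 0 (lw (altw Arr_abar (2 * N - 1))), HC 0 0 (lw wa),
    HC 1 0 \<one>\<^bsub>L\<^esub>, HC 1 1 \<one>\<^bsub>L\<^esub>, HC 1 0 (lw [Arr_a]), HC 1 1 (lw [Arr_abar]),
    HC 2 1 \<one>\<^bsub>L\<^esub>, HC 2 2 (lw [Arr_abar])}"

definition S :: "'k hh_elem set" where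
  "S = HH_subalgebra N gens"

lemma S_gens: "x \<in> gens \<Longrightarrow> x \<in> S"
  and S_scalar: "HH_scalar N c \<in> S"
  and S_add: "x \<in> S \<Longrightarrow> y \<in> S \<Longrightarrow> x \<oplus>\<^bsub>HH N\<^esub> y \<in> S"
  and S_mult: "x \<in> S \<Longrightarrow> y \<in> S \<Longrightarrow> x \<otimes>\<^bsub>HH N\<^esub> y \<in> S"
  unfolding S_def HH_subalgebra_def by (auto intro: generate_ring.intros)

section \<open>Admissible values and the part of degree zero\<close>

lemma cocycle_val_one [simp]: "cocycle_val n r \<one>\<^bsub>L\<^esub>"
  using Reg_commut_one by (simp add: cocycle_val_def del: pr_one)

lemma cocycle_val_central: "x \<in> carrier L \<Longrightarrow> (\<And>t. R.commut [t] x = \<zero>\<^bsub>L\<^esub>) \<Longrightarrow> cocycle_val n r x"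
  by (simp add: cocycle_val_def del: pr_zero)

lemma cocycle_val_add: "cocycle_val n r x \<Longrightarrow> cocycle_val n r y \<Longrightarrow> cocycle_val n r (x \<oplus>\<^bsub>L\<^esub> y)"
  unfolding cocycle_val_def using R.commut_add[of x y] by (auto simp del: pr_zero)

lemma cocycle_val_letter: "2 * r < n \<Longrightarrow> cocycle_val n r (lw [Arr_a])" "n < 2 * r \<Longrightarrow> cocycle_val n r (lw [Arr_abar])"
  unfolding cocycle_val_def by (auto simp: R_commut simp del: pr_zero)

lemma cocycle_val_kappa: "cocycle_val 0 0 (\<kappa> c)"
proof (rule cocycle_val_central)
  show "R.commut [t] (\<kappa> c) = \<zero>\<^bsub>L\<^esub>" for t
    unfolding R_commut[OF L.kappa_closed] L.kappa_central[OF lw_closed] by (rule L_double) auto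
qed simp

lemma cocycle_val_c_pow_1: "cocycle_val 0 0 (c_pow 1)"
proof (rule cocycle_val_central)
  fix t
  have 1: "c_pow 1 = lw [t, flip t] \<oplus>\<^bsub>L\<^esub> lw [flip t, t]"
    using c_pow_alt[of 1 t] by (simp add: numeral_2_eq_2)
  show "R.commut [t] (c_pow 1) = \<zero>\<^bsub>L\<^esub>"
    unfolding 1 by (simp add: R_commut L.l_distr L.r_distr del: pr_zero)
qed simp

lemma cocycle_val_top: "cocycle_val 0 0 (lw (altw s (2 * N - 1)))"
proof (rule cocycle_val_central)
  show "R.commut [t] (lw (altw s (2 * N - 1))) = \<zero>\<^bsub>L\<^esub>" for t
    using commut_top_zero[OF lw_closed[of "[t]"], of s] L.a_comm[of "lw [t] \<otimes>\<^bsub>L\<^esub> lw (altw s (2 * N - 1))"]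
    by (simp only: R_commut[OF lw_closed] L.m_closed lw_closed)
qed simp

lemma cocycle_val_wa: "cocycle_val 0 0 (lw wa)"
proof (rule cocycle_val_central)
  have "lw (t # wa) = \<zero>\<^bsub>L\<^esub>" "lw (wa @ [t]) = \<zero>\<^bsub>L\<^esub>" for t by (rule lw_long; simp)+
  then show "R.commut [t] (lw wa) = \<zero>\<^bsub>L\<^esub>" for t by (simp add: R_commut del: pr_zero)
qed simp

text \<open>Centrality and membership are carried together because the product formula
  \<open>HC_central_mult\<close> asks for a central left factor.\<close>

definition central_gen :: "'k lam \<Rightarrow> bool" where
  "central_gen x \<longleftrightarrow> cocycle_val 0 0 x \<and> HC 0 0 x \<in> S"

lemma central_gen_closed: "central_gen x \<Longrightarrow> x \<in> carrier L"
  by (simp add: central_gen_def cocycle_val_def)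

lemma central_gen_add: "central_gen x \<Longrightarrow> central_gen y \<Longrightarrow> central_gen (x \<oplus>\<^bsub>L\<^esub> y)"
  using HC_add[of 0 0 x y] S_add[of "HC 0 0 x" "HC 0 0 y"] cocycle_val_add[of 0 0 x y] by (simp add: central_gen_def)

lemma central_gen_mult: "central_gen x \<Longrightarrow> central_gen y \<Longrightarrow> central_gen (x \<otimes>\<^bsub>L\<^esub> y)"
  using HC_central_mult[of x 0 0 y] S_mult[of "HC 0 0 x" "HC 0 0 y"] cocycle_val_mult_central[of x 0 0 y] by (simp add: central_gen_def)

lemma central_gen_kappa: "central_gen (\<kappa> c)"
  using cocycle_val_kappa S_scalar[of c] by (simp add: central_gen_def HH_scalar_def)

lemma central_gen_c_pow: "central_gen (c_pow i)"
proof (induction i)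
  case 0
  then show ?case using central_gen_kappa[of 1] by (simp add: c_pow_def kappa_1 del: pr_one)
next
  case (Suc i)
  have 1: "central_gen (c_pow 1)" using cocycle_val_c_pow_1 by (simp add: central_gen_def S_gens gens_def)
  then show ?case using Suc c_pow_Suc[of i] central_gen_mult by (cases "i = 0") auto
qed

lemma central_gen_top: "central_gen (lw (altw s (2 * N - 1)))"
  using cocycle_val_top[of s] by (cases s) (auto simp only: central_gen_def gens_def intro!: S_gens)

lemma central_gen_wa: "central_gen (lw wa)"
  using cocycle_val_wa by (simp add: central_gen_def S_gens gens_def)

lemma central_gen_finsum:
  assumes "finite J" and "\<And>j. j \<in> J \<Longrightarrow> central_gen (f j)"
  shows "central_gen (finsum L f J)"
  using assms
proof (induction J rule: finite_induct)
  case empty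
  then show ?case using central_gen_kappa[of 0] by (simp add: kappa_0 del: pr_zero)
next
  case (insert j J)
  then have "finsum L f (insert j J) = f j \<oplus>\<^bsub>L\<^esub> finsum L f J"
    by (intro L.finsum_insert) (auto intro: central_gen_closed)
  then show ?case using insert central_gen_add by simp
qed

text \<open>In \<open>centraliser_expand\<close> everything but the last sum is built from generated
  central elements, and \<open>c_pow_letter\<close> factors the arrow out of the last sum on the
  right.\<close>

lemma centraliser_decomp:
  assumes x: "x \<in> carrier L" and commut: "R.commut [t] x = \<zero>\<^bsub>L\<^esub>"
  obtains y z where "central_gen y" "central_gen z" "x = y \<oplus>\<^bsub>L\<^esub> z \<otimes>\<^bsub>L\<^esub> lw [t]"
proof
  let ?z = "finsum L (\<lambda>i. \<kappa> (coef x (altw t (Suc (2 * i)))) \<otimes>\<^bsub>L\<^esub> c_pow i) {..<N}"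
  let ?y = "finsum L (\<lambda>i. \<kappa> (coef x (altw t (2 * i))) \<otimes>\<^bsub>L\<^esub> c_pow i) {..<N} \<oplus>\<^bsub>L\<^esub>
        (\<kappa> (coef x (topw t)) \<otimes>\<^bsub>L\<^esub> lw (topw t) \<oplus>\<^bsub>L\<^esub> \<kappa> (coef x wa) \<otimes>\<^bsub>L\<^esub> lw wa)"
  show "central_gen ?y" unfolding topw_def
    by (intro central_gen_add central_gen_mult central_gen_finsum central_gen_kappa central_gen_c_pow central_gen_top central_gen_wa) simp
  show "central_gen ?z" by (intro central_gen_mult central_gen_finsum central_gen_kappa central_gen_c_pow) simp
  have "?z \<otimes>\<^bsub>L\<^esub> lw [t] = finsum L (\<lambda>i. \<kappa> (coef x (altw t (Suc (2 * i)))) \<otimes>\<^bsub>L\<^esub> c_pow i \<otimes>\<^bsub>L\<^esub> lw [t]) {..<N}"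
    by (rule L.finsum_ldistr) auto
  also have "\<dots> = finsum L (\<lambda>i. \<kappa> (coef x (altw t (Suc (2 * i)))) \<otimes>\<^bsub>L\<^esub> lw (altw t (Suc (2 * i)))) {..<N}"
    by (rule L.finsum_cong') (auto simp: L.m_assoc c_pow_letter simp del: altw.simps(2))
  finally have e: "?z \<otimes>\<^bsub>L\<^esub> lw [t] = \<dots>" .
  show "x = ?y \<oplus>\<^bsub>L\<^esub> ?z \<otimes>\<^bsub>L\<^esub> lw [t]" unfolding e by (rule centraliser_expand[OF x commut])
qed

text \<open>Commuting with \<open>Arr_abar\<close> as well kills the coordinates at odd words
  beginning with \<open>Arr_a\<close>, except at the long one, and that one is itself among the
  generators.\<close>

lemma central_gen_iff_cocycle_val: "central_gen x \<longleftrightarrow> cocycle_val 0 0 x"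
proof
  assume cocycle_val: "cocycle_val 0 0 x"
  then have x: "x \<in> carrier L" and commut: "R.commut [t] x = \<zero>\<^bsub>L\<^esub>" for t
    by (auto simp: cocycle_val_def intro: arrow.exhaust[of t])
  have "central_gen (\<kappa> (coef x (altw Arr_a (Suc (2 * i)))) \<otimes>\<^bsub>L\<^esub> lw (altw Arr_a (Suc (2 * i))))" if "i < N" for i
  proof (cases "Suc (Suc (2 * i)) < 2 * N")
    case True
    then have "coef x (altw Arr_a (Suc (2 * i))) = 0"
      using centraliser_coef(1)[OF x commut, of i Arr_abar] by simp
    then show ?thesis using central_gen_kappa[of 0] by (simp add: kappa_0 del: pr_zero altw.simps(2))
  next
    case False
    then have "Suc (2 * i) = 2 * N - 1" using that by linarith
    then show ?thesis using central_gen_mult[OF central_gen_kappa central_gen_top] by simp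
  qed
  then have "central_gen (finsum L (\<lambda>i. \<kappa> (coef x (altw Arr_a (Suc (2 * i)))) \<otimes>\<^bsub>L\<^esub> lw (altw Arr_a (Suc (2 * i)))) {..<N})"
    by (intro central_gen_finsum) auto
  moreover have "central_gen (finsum L (\<lambda>i. \<kappa> (coef x (altw Arr_a (2 * i))) \<otimes>\<^bsub>L\<^esub> c_pow i) {..<N})"
    by (intro central_gen_finsum central_gen_mult central_gen_kappa central_gen_c_pow) simp
  moreover have "central_gen (\<kappa> (coef x (topw Arr_a)) \<otimes>\<^bsub>L\<^esub> lw (topw Arr_a))" "central_gen (\<kappa> (coef x wa) \<otimes>\<^bsub>L\<^esub> lw wa)"
    unfolding topw_def by (intro central_gen_mult central_gen_kappa central_gen_top central_gen_wa)+
  ultimately show "central_gen x"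
    by (subst centraliser_expand[OF x commut[of Arr_a]]) (intro central_gen_add)
qed (simp add: central_gen_def)

text \<open>The product from \<open>leading_product\<close> takes the value \<open>y\<close> at the
  edge index \<open>t0\<close> and an unknown value at one interior index at most. Adding the
  interior class with that same value cancels it.\<close>

lemma leading_product_S:
  fixes j :: nat
  assumes n: "2 \<le> n" and t0: "t0 = 0 \<and> s0 = 0 \<and> j = 0 \<or> t0 = n \<and> s0 = n - 1 \<and> j = 1"
    and y: "y = \<one>\<^bsub>L\<^esub> \<or> j = 0 \<and> y = lw [Arr_a] \<or> j = 1 \<and> y = lw [Arr_abar]"
    and IH: "HC (n - 1) s0 \<one>\<^bsub>L\<^esub> \<in> S"
    and interior: "\<And>r x. 0 < r \<Longrightarrow> r < n \<Longrightarrow> cocycle_val n r x \<Longrightarrow> HC n r x \<in> S"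
  shows "HC n t0 y \<in> S"
proof -
  obtain m where m: "n = Suc m" "1 \<le> m" using n by (cases n) auto
  \<comment> \<open>The interior one of the indices \<open>s0\<close> and
    \<open>Suc s0\<close>.\<close>
  let ?i = "if j = 0 then 1 else m"
  have i: "0 < ?i" "?i < n" using n m by auto
  have okj: "cocycle_val 1 j y" using y t0 n by (auto intro: cocycle_val_letter simp del: pr_one)
  have yc: "y \<in> carrier L" using okj by (simp add: cocycle_val_def)
  have "HC 1 j y \<in> gens" using y t0 by (auto simp: gens_def simp del: pr_one)
  then have Sj: "HC 1 j y \<in> S" by (rule S_gens)
  \<comment> \<open>At an edge index only the commutator with a letter survives the substitution,
    and the letter is the same as in degree one.\<close>
  have "P.diff_val 0 (Suc 0) (int j) (gn 0) = P.diff_val 0 (Suc m) (int t0) (\<lambda>s. if s = int s0 then gn 0 0 else \<zero>\<^bsub>P 0\<^esub>)"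
    using t0 m gn_zero[of _ 0] by (auto simp: P.diff_val_def)
  then obtain f where fZ: "f \<in> H.Z (Suc m)" and f: "H.hm (Suc m) f = HC 1 j y \<otimes>\<^bsub>HH N\<^esub> HC m s0 \<one>\<^bsub>L\<^esub>"
    and ft: "f (gn (Suc m) (int t0)) = y"
    and fr: "\<And>r. r \<le> Suc m \<Longrightarrow> r \<noteq> t0 \<Longrightarrow> r \<noteq> s0 \<Longrightarrow> r \<noteq> Suc s0 \<Longrightarrow> f (gn (Suc m) (int r)) = \<zero>\<^bsub>L\<^esub>"
  proof -
    assume eq: "P.diff_val 0 (Suc 0) (int j) (gn 0) = P.diff_val 0 (Suc m) (int t0) (\<lambda>s. if s = int s0 then gn 0 0 else \<zero>\<^bsub>P 0\<^esub>)"
    have "s0 \<le> m" "j \<le> 1" "t0 \<le> Suc m" using t0 m by auto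
    from leading_product[OF this(1) cocycle_val_one this(2) okj this(3) eq] show ?thesis using that by blast
  qed
  have fH: "f \<in> bimod_hom L (P n) Reg" and okf: "\<And>r. r \<le> n \<Longrightarrow> cocycle_val n r (f (gn n (int r)))"
    using fZ m Z_iff[of f n] by auto
  let ?u = "f (gn n (int ?i))"
  have ou: "cocycle_val n ?i ?u" using okf i by simp
  have uc: "?u \<in> carrier L" using ou by (simp add: cocycle_val_def)
  have "H.hadd n f (cochain n ?i ?u) = cochain n t0 y"
  proof (rule cochain_eqI)
    show "H.hadd n f (cochain n ?i ?u) \<in> bimod_hom L (P n) Reg"
      by (rule bimod2.hom_add_closed[OF H.PM fH cochain_hom[OF uc]])
    fix r assume r: "r \<le> n"
    have h: "H.hadd n f (cochain n ?i ?u) (gn n (int r)) = f (gn n (int r)) \<oplus>\<^bsub>L\<^esub> (if r = ?i then ?u else \<zero>\<^bsub>L\<^esub>)"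
      using cochain_gn_nat[OF uc r] by (simp del: pr_zero)
    consider "r = t0" "r \<noteq> ?i" | "r \<noteq> t0" "r = ?i" | "r \<noteq> t0" "r \<noteq> ?i" "r \<noteq> s0" "r \<noteq> Suc s0"
      using t0 m by (cases "j = 0") auto
    then show "H.hadd n f (cochain n ?i ?u) (gn n (int r)) = (if r = t0 then y else \<zero>\<^bsub>L\<^esub>)"
    proof cases
      case 1
      then show ?thesis unfolding h using ft m yc by (simp del: pr_zero)
    next
      case 2
      then show ?thesis unfolding h using L_double[OF uc] by (simp del: pr_zero)
    next
      case 3
      then show ?thesis unfolding h using fr[of r] m r by (simp del: pr_zero)
    qed
  qed (rule yc)
  moreover have "cochain n ?i ?u \<in> H.Z n" using cochain_Z ou i by simp
  ultimately have "HC n t0 y = H.hm n f \<oplus>\<^bsub>HH N\<^esub> HC n ?i ?u"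
    using H.hm_add[of f n "cochain n ?i ?u"] fZ m by (simp add: HC_eq HH_eq)
  moreover have "H.hm n f \<in> S" using f S_mult[OF Sj IH] m by simp
  moreover have "HC n ?i ?u \<in> S" using interior[OF i ou] .
  ultimately show ?thesis using S_add by simp
qed

lemma HC_in_S: "r \<le> n \<Longrightarrow> cocycle_val n r x \<Longrightarrow> HC n r x \<in> S"
proof (induction n arbitrary: r x rule: less_induct)
  case (less n)
  have int: "HC n r x \<in> S" if "0 < r" "r < n" "cocycle_val n r x" for r x
  proof -
    obtain m where m: "n = m + 2" using \<open>0 < r\<close> \<open>r < n\<close> by (metis add.commute le_Suc_ex Suc_leI Suc_1 le_less_trans less_eq_Suc_le numeral_2_eq_2)
    obtain k where k: "r = Suc k" using \<open>0 < r\<close> gr0_implies_Suc by blast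
    \<comment> \<open>\<open>2 * k\<close> compares with \<open>m\<close> as \<open>2 * r\<close>
      does with \<open>n\<close>, so the condition on the value is unchanged.\<close>
    have "cocycle_val m k x" using that unfolding cocycle_val_def m k by auto
    moreover have "k \<le> m" using that m k by simp
    ultimately have "HC n r x = HC m k x \<otimes>\<^bsub>HH N\<^esub> HC 2 1 \<one>\<^bsub>L\<^esub>" "HC m k x \<in> S"
      using HC_shift[of m k x] less.IH[of m k x] m k by simp_all
    moreover have "HC 2 1 \<one>\<^bsub>L\<^esub> \<in> S" by (rule S_gens) (simp add: gens_def)
    ultimately show ?thesis using S_mult by simp
  qed
  \<comment> \<open>At an edge only one arrow has to commute with the value, so it is a combination
    of the unit and \<open>lw [t]\<close> with central coefficients, and membership of two classes
    suffices.\<close>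
  have edge: "HC n r x \<in> S" if r: "r \<le> n" and x: "x \<in> carrier L" and commut: "R.commut [t] x = \<zero>\<^bsub>L\<^esub>"
    and cocycle_val: "cocycle_val n r (lw [t])" and S: "HC n r \<one>\<^bsub>L\<^esub> \<in> S" "HC n r (lw [t]) \<in> S" for t
  proof -
    obtain y z where y: "central_gen y" and z: "central_gen z" and e: "x = y \<oplus>\<^bsub>L\<^esub> z \<otimes>\<^bsub>L\<^esub> lw [t]"
      using centraliser_decomp[OF x commut] by blast
    have oy: "cocycle_val 0 0 y" "cocycle_val 0 0 z" and S0: "HC 0 0 y \<in> S" "HC 0 0 z \<in> S" using y z by (simp_all add: central_gen_def)
    have "HC n r y = HC 0 0 y \<otimes>\<^bsub>HH N\<^esub> HC n r \<one>\<^bsub>L\<^esub>"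
      using HC_central_mult[OF oy(1) cocycle_val_one r] central_gen_closed[OF y] by (simp del: pr_one)
    moreover have "cocycle_val n r y" using cocycle_val_mult_central[OF oy(1) cocycle_val_one] central_gen_closed[OF y] by (simp del: pr_one)
    moreover have "HC n r (z \<otimes>\<^bsub>L\<^esub> lw [t]) = HC 0 0 z \<otimes>\<^bsub>HH N\<^esub> HC n r (lw [t])"
      using HC_central_mult[OF oy(2) cocycle_val r] by simp
    ultimately show ?thesis
      using HC_add[of n r y "z \<otimes>\<^bsub>L\<^esub> lw [t]"] cocycle_val_mult_central[OF oy(2) cocycle_val] r
        S_add[OF S_mult[OF S0(1) S(1)] S_mult[OF S0(2) S(2)]] unfolding e by (simp del: pr_one)
  qed
  consider "n = 0" | "0 < r" "r < n" | "0 < n" "r = 0" | "0 < n" "r = n" using less.prems by linarith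
  then show ?case
  proof cases
    case 1
    then show ?thesis using less.prems central_gen_iff_cocycle_val[of x] by (simp add: central_gen_def)
  next
    case 2
    then show ?thesis using int less.prems by blast
  next
    case 3
    have S: "HC n r y \<in> S" if y: "y = \<one>\<^bsub>L\<^esub> \<or> y = lw [Arr_a]" for y
    proof (cases "n = 1")
      case True
      then show ?thesis using y 3 by (auto simp: gens_def intro!: S_gens simp del: pr_one)
    next
      case False
      have IH: "HC (n - 1) (0) \<one>\<^bsub>L\<^esub> \<in> S" by (rule less.IH[OF _ _ cocycle_val_one]) (use 3 in auto)
      have n: "2 \<le> n" using False 3 by simp
      show ?thesis
        by (rule leading_product_S[of n r "0" 0, OF n _ _ IH int]) (use 3 y in auto)
    qed
    have "x \<in> carrier L" "R.commut [Arr_a] x = \<zero>\<^bsub>L\<^esub>" using less.prems 3 by (simp_all add: cocycle_val_def del: pr_zero)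
    then show ?thesis
      by (rule edge[OF less.prems(1) _ _ cocycle_val_letter(1) S S]) (use 3 in auto)
  next
    case 4
    have S: "HC n r y \<in> S" if y: "y = \<one>\<^bsub>L\<^esub> \<or> y = lw [Arr_abar]" for y
    proof (cases "n = 1")
      case True
      then show ?thesis using y 4 by (auto simp: gens_def intro!: S_gens simp del: pr_one)
    next
      case False
      have IH: "HC (n - 1) (n - 1) \<one>\<^bsub>L\<^esub> \<in> S" by (rule less.IH[OF _ _ cocycle_val_one]) (use 4 in auto)
      have n: "2 \<le> n" using False 4 by simp
      show ?thesis
        by (rule leading_product_S[of n r "n - 1" 1, OF n _ _ IH int]) (use 4 y in auto)
    qed
    have "x \<in> carrier L" "R.commut [Arr_abar] x = \<zero>\<^bsub>L\<^esub>" using less.prems 4 by (simp_all add: cocycle_val_def del: pr_zero)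
    then show ?thesis
      by (rule edge[OF less.prems(1) _ _ cocycle_val_letter(2) S S]) (use 4 in auto)
  qed
qed

text \<open>A cocycle is the sum of its single-value cochains, each of which is again a cocycle
  because the conditions in \<open>Z_iff\<close> are separate. The induction removes the value at
  the largest index where it may be nonzero.\<close>

lemma hm_in_S:
  assumes "f \<in> H.Z n"
  shows "H.hm n f \<in> S"
proof -
  have "f \<in> H.Z n \<Longrightarrow> (\<And>r. k \<le> r \<Longrightarrow> r \<le> n \<Longrightarrow> f (gn n (int r)) = \<zero>\<^bsub>L\<^esub>) \<Longrightarrow> k \<le> Suc n \<Longrightarrow> H.hm n f \<in> S" for k f
  proof (induction k arbitrary: f)
    case 0
    have "f = cochain n 0 \<zero>\<^bsub>L\<^esub>"
      by (rule cochain_eqI) (use 0 in \<open>auto simp: Z_iff\<close>)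
    then show ?case using HC_in_S[of 0 n "\<zero>\<^bsub>L\<^esub>"] by (simp add: HC_eq del: pr_zero)
  next
    case (Suc k)
    let ?u = "f (gn n (int k))"
    let ?g = "cochain n k ?u"
    have k: "k \<le> n" using Suc.prems by simp
    have ou: "cocycle_val n k ?u" using Suc.prems(1) k by (simp add: Z_iff)
    have uc: "?u \<in> carrier L" using ou by (simp add: cocycle_val_def)
    have gZ: "?g \<in> H.Z n" by (rule cochain_Z[OF k ou])
    have fg: "H.hadd n f ?g \<in> H.Z n" by (rule H.Z_add[OF Suc.prems(1) gZ])
    have "H.hm n (H.hadd n f ?g) \<in> S"
    proof (rule Suc.IH[OF fg])
      fix r assume r: "k \<le> r" "r \<le> n"
      then show "H.hadd n f ?g (gn n (int r)) = \<zero>\<^bsub>L\<^esub>"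
        using Suc.prems(2)[of r] cochain_gn_nat[OF uc r(2)] L_double[OF uc] by (cases "r = k") (simp_all del: pr_zero)
    qed (use k in simp)
    moreover have "H.hm n f = H.hm n (H.hadd n f ?g) \<oplus>\<^bsub>HH N\<^esub> H.hm n ?g"
    proof -
      have "f = H.hadd n (H.hadd n f ?g) ?g"
      proof (rule P_hom_eqI[OF Reg_LamM])
        show "f \<in> bimod_hom L (P n) Reg" "H.hadd n (H.hadd n f ?g) ?g \<in> bimod_hom L (P n) Reg"
          using Suc.prems(1) H.Z_add[OF fg gZ] by (simp_all add: Z_iff)
        fix r assume r: "r \<le> n"
        have "f (gn n (int r)) \<in> carrier L" using Suc.prems(1) r by (simp add: Z_iff cocycle_val_def)
        then show "f (gn n (int r)) = H.hadd n (H.hadd n f ?g) ?g (gn n (int r))"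
          using cochain_gn_nat[OF uc r] uc by (simp add: L.a_assoc del: pr_zero)
      qed
      then show ?thesis using H.hm_add[OF fg gZ] by (simp add: HH_eq)
    qed
    moreover have "H.hm n ?g \<in> S" using HC_in_S[OF k ou] by (simp add: HC_eq)
    ultimately show ?case using S_add by simp
  qed
  from this[OF assms, of "Suc n"] show ?thesis by simp
qed

lemma S_eq: "S = carrier (HH N)"
proof
  show "carrier (HH N) \<subseteq> S"
    unfolding HH_eq by (rule H.ER_subset[OF hm_in_S S_add[unfolded HH_eq]])
  have HC: "HC n r x \<in> carrier H.ER" if "r \<le> n" "cocycle_val n r x" for n r x
    unfolding HC_eq by (rule H.hm_closed[OF cochain_Z[OF that]])
  have "gens \<subseteq> carrier H.ER"
    unfolding gens_def insert_subset
    by (intro conjI HC empty_subsetI cocycle_val_one cocycle_val_c_pow_1 cocycle_val_top cocycle_val_wa cocycle_val_letter) simp_all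
  moreover have "range (HH_scalar N) \<subseteq> carrier H.ER"
    unfolding HH_scalar_def using HC[OF le0 cocycle_val_kappa] by blast
  ultimately have "range (HH_scalar N) \<union> gens \<subseteq> carrier H.ER" by (rule Un_least[rotated])
  then show "S \<subseteq> carrier (HH N)"
    unfolding S_def HH_subalgebra_def HH_eq by (rule H.generate_ER_subset)
qed

end

theorem theorem7p10:
  fixes N :: nat
  assumes "N > 1" and "CHAR('k::field) = 2"
  shows
    "let A = (Lambda N :: 'k lam ring);
         a = Lambda_arrow N Arr_a;
         b = Lambda_arrow N Arr_abar
     in HH_subalgebra N
          ({HH_class N 0 0 \<one>\<^bsub>A\<^esub>,
            HH_class N 0 0 (a \<otimes>\<^bsub>A\<^esub> b \<oplus>\<^bsub>A\<^esub> b \<otimes>\<^bsub>A\<^esub> a),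
            HH_class N 0 0 ((a \<otimes>\<^bsub>A\<^esub> b) [^]\<^bsub>A\<^esub> (N - 1) \<otimes>\<^bsub>A\<^esub> a),
            HH_class N 0 0 ((b \<otimes>\<^bsub>A\<^esub> a) [^]\<^bsub>A\<^esub> (N - 1) \<otimes>\<^bsub>A\<^esub> b),
            HH_class N 0 0 ((a \<otimes>\<^bsub>A\<^esub> b) [^]\<^bsub>A\<^esub> N)} \<union>
           {HH_class N 1 0 \<one>\<^bsub>A\<^esub>,
            HH_class N 1 1 \<one>\<^bsub>A\<^esub>,
            HH_class N 1 0 a,
            HH_class N 1 1 b} \<union>
           {HH_class N 2 1 \<one>\<^bsub>A\<^esub>,
            HH_class N 2 2 b})
        = carrier (HH N)"
proof -
  interpret Lam N "TYPE('k)" using assms by unfold_locales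
  \<comment> \<open>The central elements of the statement are products of powers of arrows; they are
    rewritten as alternating words to match \<open>gens\<close>.\<close>
  have top: "(lw [s] \<otimes>\<^bsub>L\<^esub> lw [flip s]) [^]\<^bsub>L\<^esub> (N - 1) \<otimes>\<^bsub>L\<^esub> lw [s] = lw (altw s (2 * N - 1))" for s
  proof -
    have e: "2 * N - 1 = Suc (2 * (N - 1))" using N1 by simp
    show ?thesis unfolding lw_pow e altw_Suc by simp
  qed
  have 2: "lw [Arr_a] \<otimes>\<^bsub>L\<^esub> lw [Arr_abar] \<oplus>\<^bsub>L\<^esub> lw [Arr_abar] \<otimes>\<^bsub>L\<^esub> lw [Arr_a] = c_pow 1"
    by (simp add: c_pow_def numeral_2_eq_2)
  have pw: "(lw [Arr_a] \<otimes>\<^bsub>L\<^esub> lw [Arr_abar]) [^]\<^bsub>L\<^esub> N = lw wa"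
    using lw_pow[of Arr_a N] by (simp add: wa_def del: lw_mult)
  show ?thesis
    using S_eq top[of Arr_a] top[of Arr_abar]
    unfolding S_def gens_def Let_def arrow_lw 2 pw by (simp only: flip.simps Un_insert_left Un_empty_left)
qed

end
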